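(* Let $w>-H-\theta$ be a given initial wealth. Let $\Lambda<0$ be the constant $$\Lambda=\frac{1}{a_0\gamma+\gamma-1}\left(\frac{(1+a_0)(\gamma-1)}{(\tilde\eta/\eta)^{\beta\hat\gamma}-1}-a_0\right),\qquad \hat\gamma=\frac{1-\gamma}{\gamma},$$ where $-a_0<0$ is the negative root of $\tfrac12\kappa^2x(x-1)+(\hat\delta-\mu_R)x-\hat\delta=0$. Define the threshold $w^*=\Lambda\theta-H$ and let $z^*=z(w^* )$. Then, for the problem $$F(w)=\sup_{(a,x,s,\tau)\in\mathcal A(w)}\mathbb{E}\Big[\int_0^\tau e^{-\hat\delta t}U(x_t,s_t)\,\mathrm{d}t+e^{-\hat\delta\tau}G(W_\tau)\ \Big|\ W_0=w\Big],$$ the following holds. (i) Suppose $\theta\ge0$ or $w\ge w^*$. Then $F(w)=G(w)$, and $\tau^*(w)=0$ is optimal. The optimal allocation and consumption strategies are $$\tilde a^*_t=\frac{\kappa}{\gamma\sigma_S}\frac{\tilde Z_t}{\tilde W_t},\quad \tilde x^*_t=\underline{x}+(1-\beta)\varphi\tilde Z_t,\quad \tilde s^*_t=\underline{s}+\beta\varphi\frac{\tilde Z_t}{P/\tilde\eta},$$ where $\tilde W$ is the post-investment wealth controlled by these strategies with $\tilde W_0=w$, and $\tilde Z_t=\tilde W_t+\tilde H$. (ii) Suppose $\theta<0$ and $w<w^*$. Then $$F(w)=\inf_{\hat z>0}\big[\hat f(\hat z)+\hat z\,z(w)\big],$$ where $$\hat f(\hat z)=\begin{cases}\Gamma^{-1}\hat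 u(\hat z)+\theta\hat z,&\hat z\le\hat z^*,\\ \Phi^{-1}\hat u(\hat z)+A_0(\hat z/\hat z^* )^{-a_0},&\hat z\ge\hat z^*,\end{cases}\qquad \hat u(\hat z)=\frac{\hat z^{-\hat\gamma}}{\hat\gamma},$$ $$A_0=\left(-\frac{(a_0\gamma+\gamma-1)(\Gamma-\Phi)^{\frac{\gamma}{\gamma-1}}\big((a_0+1)(\gamma-1)\Gamma\Phi\big)^{\frac{\gamma}{1-\gamma}}}{\theta}\right)^{\gamma-1},\qquad \hat z^*=\left(-\frac{(a_0\gamma+\gamma-1)(\Gamma-\Phi)}{(a_0+1)(\gamma-1)\Gamma\theta\Phi}\right)^{\gamma}.$$ The first hitting time $\tau^*(w)=\inf\{t\ge0\mid W_t\ge w^*\}$ (with $W_0=w$, $W$ the optimally controlled pre-investment wealth) is optimal. The remaining optimal strategies are $$a^*_t=\begin{cases}-\dfrac{\kappa}{\sigma_S}\dfrac{\partial_wF(W_t)}{W_t\,\partial_w^2F(W_t)},&t<\tau^*,\\[2mm] \dfrac{\kappa}{\gamma\sigma_S}\dfrac{\tilde Z_t^{z^*+\theta}}{\tilde W_t^{w^*}},&t\ge\tau^*,\end{cases}$$ $$x^*_t=\begin{cases}b_0\big(\partial_wF(W_t),(P/\eta)\partial_wF(W_t)\big),&t<\tau^*,\\ \underline{x}+(1-\beta)\varphi\tilde Z_t^{z^*+\theta},&t\ge\tau^*,\end{cases}\qquad s^*_t=\begin{cases}b_1\big(\partial_wF(W_t),(P/\eta)\partial_wF(W_t)\big),&t<\tau^*,\\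 \underline{s}+\beta\varphi\dfrac{\tilde Z_t^{z^*+\theta}}{P/\tilde\eta},&t\ge\tau^*,\end{cases}$$ where $$b_0(\pi,\xi)=\underline{x}+\Big(\frac{\pi}{1-\beta}\Big)^{-1}q(\pi,\xi)^{-\hat\gamma},\quad b_1(\pi,\xi)=\underline{s}+\Big(\frac{\xi}{\beta}\Big)^{-1}q(\pi,\xi)^{-\hat\gamma},\quad q(\pi,\xi)=\Big(\frac{\pi}{1-\beta}\Big)^{1-\beta}\Big(\frac{\xi}{\beta}\Big)^{\beta}.$$
   Context: Let $B$ be a standard Brownian motion. Parameters: $\mu_S>\mu_R>0$, $\sigma_S>0$, $\kappa=(\mu_S-\mu_R)/\sigma_S$; energy price $P>0$, labour income $Y>0$, retrofit cost $K>0$, borrowing rate $\rho\ge\mu_R$, efficiencies $\tilde\eta>\eta>0$ (post- and pre-retrofit); subsistence levels $\underline{x}>0$, $\underline{s}>0$; $\beta\in(0,1)$, $\gamma>1$; $\delta,\lambda>0$, $\hat\delta=\delta+\lambda$. Standing assumption (patience condition): $\hat\delta<(\kappa^2+2\mu_R)/2$. Utility: $$U(x,s)=\frac{\big((x-\underline{x})^{1-\beta}(s-\underline{s})^{\beta}\big)^{1-\gamma}}{1-\gamma}.$$ Consumption controls satisfy $x_t>\underline{x}$, $s_t>\underline{s}$. Pre-investment wealth ($t<\tau$): $\mathrm{d}W_t=\big(a_t\mu_SW_t+(1-a_t)\mu_RW_t+Y-x_t-(s_t/\eta)P\big)\mathrm{d}t+a_t\sigma_SW_t\,\mathrm{d}B_t$,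 $W_0=w$. Post-investment wealth: with $\tilde Y=Y-\rho K$, $\mathrm{d}\tilde W_t=\big(\tilde a_t\mu_S\tilde W_t+(1-\tilde a_t)\mu_R\tilde W_t+\tilde Y-\tilde x_t-(\tilde s_t/\tilde\eta)P\big)\mathrm{d}t+\tilde a_t\sigma_S\tilde W_t\,\mathrm{d}B_t$. At the investment time wealth is continuous (the retrofit is financed by a loan with perpetual payment flow $\rho K$). Human capital: $H=\frac1{\mu_R}(Y-\underline{x}-(\underline{s}/\eta)P)$, $\tilde H=\frac1{\mu_R}(\tilde Y-\underline{x}-(\underline{s}/\tilde\eta)P)$; $z(w)=w+H$, $\tilde z(w)=w+\tilde H$; $\theta=\tilde H-H=\frac1{\mu_R}\big((\underline{s}/\eta-\underline{s}/\tilde\eta)P-\rho K\big)$. $G(w)=\sup\mathbb{E}\big[\int_0^\infty e^{-\hat\delta t}U(\tilde x_t,\tilde s_t)\mathrm{d}t\mid\tilde W_0=w\big]$ for $w>-\tilde H$, the supremum being over adapted $(\tilde a,\tilde x,\tilde s)$ with $\tilde z(\tilde W_t)>0$ for all $t\ge0$. $\mathcal A(w)$ is the set of $(a,x,s,\tau)$ with $(a,x,s)$ adapted and $\tau$ a $[0,\infty]$-valued stopping time, such that $z(W_t)>0$ for $0\le t<\tau$ and $\tilde z(W_\tau)>0$ on $\{\tau<\infty\}$; $e^{-\hat\delta\tau}G(W_\tau)=0$ on $\{\tau=\infty\}$. The function $F$ is defined by the displayed supremum at any wealth level for which $\mathcal A$ is nonempty. Constants: $\varphi=\dfrac{\gamma(\kappa^2+2\hat\delta+2(\gamma-1)\mu_R)-\kappa^2}{2\gamma^2}>0$,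 $\ \Gamma=\left(\dfrac{(P/\tilde\eta)^\beta}{(1-\beta)^{1-\beta}\beta^\beta}\right)^{\hat\gamma}\varphi$, $\ \Phi=\left(\dfrac{(P/\eta)^\beta}{(1-\beta)^{1-\beta}\beta^\beta}\right)^{\hat\gamma}\varphi$, with $\hat\gamma=(1-\gamma)/\gamma$. In (ii), $\tilde W_t^{w^*}$, $t\ge\tau^*$, denotes the post-investment wealth under the stated controls started from the value $w^*$ at time $\tau^*$, and $\tilde Z_t^{z^*+\theta}=\tilde W_t^{w^*}+\tilde H$ (whose value at $\tau^*$ is $z^*+\theta$). *)

theory Defs
  imports "HOL-Probability.Probability"
begin

section \<open>Brownian motion and the stochastic integral\<close>

text \<open>
  Filtrations are indexed by real times; only times \<open>t \<ge> 0\<close> matter.  No usual conditions are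
  imposed, so the raw and the augmented Brownian filtration are both covered.  As the filtration
  need not be complete, every path of the Brownian motion is required to be continuous.
\<close>

definition brownian_motion ::
    "'a measure \<Rightarrow> (real \<Rightarrow> 'a measure) \<Rightarrow> (real \<Rightarrow> 'a \<Rightarrow> real) \<Rightarrow> bool" where
  "brownian_motion M F B \<longleftrightarrow>
     prob_space M \<and> filtration (space M) F \<and> (\<forall>t\<ge>0. subalgebra M (F t)) \<and>
     (\<forall>t\<ge>0. B t \<in> borel_measurable (F t)) \<and>
     (\<forall>\<omega>\<in>space M. continuous_on {0..} (\<lambda>t. B t \<omega>)) \<and>
     (AE \<omega> in M. B 0 \<omega> = 0) \<and>
     (\<forall>s t. 0 \<le> s \<and> s < t \<longrightarrow>
        distributed M lborel (\<lambda>\<omega>. B t \<omega> - B s \<omega>) (normal_density 0 (sqrt (t - s))) \<and>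
        prob_space.indep_set M (sets (F s))
          (sets (vimage_algebra (space M) (\<lambda>\<omega>. B t \<omega> - B s \<omega>) borel)))"

definition progressive :: "(real \<Rightarrow> 'a measure) \<Rightarrow> (real \<Rightarrow> 'a \<Rightarrow> real) \<Rightarrow> bool" where
  "progressive F X \<longleftrightarrow>
     (\<forall>t\<ge>0. (\<lambda>(s, \<omega>). X s \<omega>) \<in> borel_measurable (restrict_space borel {0..t} \<Otimes>\<^sub>M F t))"

text \<open>
  Stopping times may take the value \<open>\<infinity>\<close>, whereas the library's \<^const>\<open>stopping_time\<close> takes values
  in the index set of the filtration.
\<close>

definition ext_stopping_time :: "(real \<Rightarrow> 'a measure) \<Rightarrow> ('a \<Rightarrow> ennreal) \<Rightarrow> bool" where
  "ext_stopping_time F \<tau> \<longleftrightarrow> (\<forall>t\<ge>0. Measurable.pred (F t) (\<lambda>\<omega>. \<tau> \<omega> \<le> ennreal t))"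

text \<open>
  The triple \<open>(n, t, \<xi>)\<close> encodes the elementary integrand
  \<open>\<Sum>i<n. \<xi>\<^sub>i \<cdot> 1\<close> on \<open>(t\<^sub>i, t\<^sub>i\<^sub>+\<^sub>1]\<close>.
\<close>

type_synonym 'a elementary = "nat \<times> (nat \<Rightarrow> real) \<times> (nat \<Rightarrow> 'a \<Rightarrow> real)"

definition is_elementary :: "(real \<Rightarrow> 'a measure) \<Rightarrow> 'a elementary \<Rightarrow> bool" where
  "is_elementary F = (\<lambda>(n, t, \<xi>).
     0 \<le> t 0 \<and> (\<forall>i<n. t i \<le> t (Suc i) \<and> \<xi> i \<in> borel_measurable (F (t i)) \<and>
       (\<exists>C. \<forall>\<omega>\<in>space (F (t i)). \<bar>\<xi> i \<omega>\<bar> \<le> C)))"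

definition elementary_process :: "'a elementary \<Rightarrow> real \<Rightarrow> 'a \<Rightarrow> real" where
  "elementary_process = (\<lambda>(n, t, \<xi>) u \<omega>. \<Sum>i<n. \<xi> i \<omega> * indicator {t i<..t (Suc i)} u)"

definition elementary_integral ::
    "(real \<Rightarrow> 'a \<Rightarrow> real) \<Rightarrow> 'a elementary \<Rightarrow> real \<Rightarrow> 'a \<Rightarrow> real" where
  "elementary_integral B = (\<lambda>(n, t, \<xi>) u \<omega>.
     \<Sum>i<n. \<xi> i \<omega> * (B (min u (t (Suc i))) \<omega> - B (min u (t i)) \<omega>))"

text \<open>
  \<open>ito_integral M F B H I\<close>: the process \<open>I\<close> is a continuous version of \<open>\<integral> H dB\<close>.  Here \<open>H\<close> is
  progressive with almost surely locally square-integrable paths, and the integral is the limit in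
  probability of elementary integrals along any approximation of \<open>H\<close> by elementary processes in
  the sense of \<open>\<integral>\<^sub>0\<^sup>T (H\<^sub>k - H)\<^sup>2 ds \<rightarrow> 0\<close> in probability; the limit does not depend on the
  approximation, so that the existence of one is required.
\<close>

definition ito_integral ::
    "'a measure \<Rightarrow> (real \<Rightarrow> 'a measure) \<Rightarrow> (real \<Rightarrow> 'a \<Rightarrow> real) \<Rightarrow>
     (real \<Rightarrow> 'a \<Rightarrow> real) \<Rightarrow> (real \<Rightarrow> 'a \<Rightarrow> real) \<Rightarrow> bool" where
  "ito_integral M F B H I \<longleftrightarrow>
     progressive F H \<and>
     (AE \<omega> in M. \<forall>T\<ge>0. (\<integral>\<^sup>+ s\<in>{0..T}. ennreal ((H s \<omega>)\<^sup>2) \<partial>lborel) < \<infinity>) \<and>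
     (\<forall>t\<ge>0. I t \<in> borel_measurable M) \<and>
     (AE \<omega> in M. continuous_on {0..} (\<lambda>t. I t \<omega>)) \<and>
     (\<exists>E. (\<forall>k. is_elementary F (E k)) \<and>
        (\<forall>T\<ge>0. \<forall>\<epsilon>>0.
           (\<lambda>k. measure M {\<omega>\<in>space M. ennreal \<epsilon> <
              (\<integral>\<^sup>+ s\<in>{0..T}. ennreal ((elementary_process (E k) s \<omega> - H s \<omega>)\<^sup>2) \<partial>lborel)})
           \<longlonglongrightarrow> 0) \<and>
        (\<forall>t\<ge>0. \<forall>\<epsilon>>0.
           (\<lambda>k. measure M {\<omega>\<in>space M. \<epsilon> < \<bar>elementary_integral B (E k) t \<omega> - I t \<omega>\<bar>})
           \<longlonglongrightarrow> 0))"

text \<open>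
  Lebesgue integral with values in \<open>[-\<infinity>, \<infinity>]\<close>.  All integrands below are nonpositive (as
  \<open>\<gamma> > 1\<close>), so the integral is always meaningful and possibly \<open>-\<infinity>\<close>.
\<close>

definition ereal_integral :: "'a measure \<Rightarrow> ('a \<Rightarrow> ereal) \<Rightarrow> ereal" where
  "ereal_integral M f =
     enn2ereal (\<integral>\<^sup>+ x. e2ennreal (f x) \<partial>M) - enn2ereal (\<integral>\<^sup>+ x. e2ennreal (- f x) \<partial>M)"


section \<open>Parameters\<close>

text \<open>
  \<open>eff_pre\<close> and \<open>eff_post\<close> are \<open>\<eta>\<close> and \<open>\<eta>\<close>-tilde; \<open>x_min\<close> and \<open>s_min\<close> are the subsistence levels;
  \<open>gam\<close> is \<open>\<gamma>\<close>, and \<open>gam_hat\<close> below is \<open>\<gamma>\<close>-hat.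
\<close>

record params =
  mu_S :: real
  mu_R :: real
  sigma_S :: real
  price :: real
  income :: real
  retrofit_cost :: real
  loan_rate :: real
  eff_pre :: real
  eff_post :: real
  x_min :: real
  s_min :: real
  beta :: real
  gam :: real
  delta :: real
  lam :: real

definition kappa :: "params \<Rightarrow> real" where
  "kappa p = (mu_S p - mu_R p) / sigma_S p"

definition delta_hat :: "params \<Rightarrow> real" where
  "delta_hat p = delta p + lam p"

definition gam_hat :: "params \<Rightarrow> real" where
  "gam_hat p = (1 - gam p) / gam p"

definition valid_params :: "params \<Rightarrow> bool" where
  "valid_params p \<longleftrightarrow>
     0 < mu_R p \<and> mu_R p < mu_S p \<and> 0 < sigma_S p \<and>
     0 < price p \<and> 0 < income p \<and> 0 < retrofit_cost p \<and> mu_R p \<le> loan_rate p \<and>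
     0 < eff_pre p \<and> eff_pre p < eff_post p \<and> 0 < x_min p \<and> 0 < s_min p \<and>
     0 < beta p \<and> beta p < 1 \<and> 1 < gam p \<and> 0 < delta p \<and> 0 < lam p \<and>
     delta_hat p < ((kappa p)\<^sup>2 + 2 * mu_R p) / 2"

definition utility :: "params \<Rightarrow> real \<Rightarrow> real \<Rightarrow> real" where
  "utility p x s =
     ((x - x_min p) powr (1 - beta p) * (s - s_min p) powr beta p) powr (1 - gam p) / (1 - gam p)"

definition income_post :: "params \<Rightarrow> real" where
  "income_post p = income p - loan_rate p * retrofit_cost p"

definition H_pre :: "params \<Rightarrow> real" where
  "H_pre p = 1 / mu_R p * (income p - x_min p - s_min p / eff_pre p * price p)"

definition H_post :: "params \<Rightarrow> real" where
  "H_post p = 1 / mu_R p * (income_post p - x_min p - s_min p / eff_post p * price p)"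

definition z_pre :: "params \<Rightarrow> real \<Rightarrow> real" where
  "z_pre p w = w + H_pre p"

definition z_post :: "params \<Rightarrow> real \<Rightarrow> real" where
  "z_post p w = w + H_post p"

definition theta :: "params \<Rightarrow> real" where
  "theta p = H_post p - H_pre p"

definition phi :: "params \<Rightarrow> real" where
  "phi p = (gam p * ((kappa p)\<^sup>2 + 2 * delta_hat p + 2 * (gam p - 1) * mu_R p) - (kappa p)\<^sup>2)
           / (2 * (gam p)\<^sup>2)"

definition Gamma_post :: "params \<Rightarrow> real" where
  "Gamma_post p =
     ((price p / eff_post p) powr beta p / ((1 - beta p) powr (1 - beta p) * beta p powr beta p))
       powr gam_hat p * phi p"

definition Phi_pre :: "params \<Rightarrow> real" where
  "Phi_pre p =
     ((price p / eff_pre p) powr beta p / ((1 - beta p) powr (1 - beta p) * beta p powr beta p))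
       powr gam_hat p * phi p"

definition is_negative_root :: "params \<Rightarrow> real \<Rightarrow> bool" where
  "is_negative_root p r \<longleftrightarrow>
     r < 0 \<and> 1 / 2 * (kappa p)\<^sup>2 * r * (r - 1) + (delta_hat p - mu_R p) * r - delta_hat p = 0"

definition a0 :: "params \<Rightarrow> real" where
  "a0 p = - (THE r. is_negative_root p r)"

lemma ex1_negative_root:
  assumes "valid_params p"
  shows "\<exists>!r. is_negative_root p r"
proof -
  define A where "A = (kappa p)\<^sup>2 / 2"
  define D where "D = delta_hat p"
  define C where "C = D - mu_R p - A"
  have "kappa p > 0" "D > 0"
    using assms by (auto simp: valid_params_def kappa_def D_def delta_hat_def)
  then have A: "A > 0" and D: "D > 0" by (auto simp: A_def)
  have root: "is_negative_root p r \<longleftrightarrow> r < 0 \<and> A * r\<^sup>2 + C * r - D = 0" for r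
    by (simp add: is_negative_root_def A_def C_def D_def field_simps power2_eq_square)
  define S where "S = sqrt (C\<^sup>2 + 4 * A * D)"
  have S2: "S\<^sup>2 = C\<^sup>2 + 4 * A * D"
    using A D by (simp add: S_def)
  have "sqrt (C\<^sup>2) < S"
    unfolding S_def using A D by (intro real_sqrt_less_mono) simp
  then have S: "\<bar>C\<bar> < S" by simp
  have "is_negative_root p ((- C - S) / (2 * A))"
  proof -
    have "A * ((- C - S) / (2 * A))\<^sup>2 + C * ((- C - S) / (2 * A)) - D
          = (S\<^sup>2 - C\<^sup>2 - 4 * A * D) / (4 * A)"
      using A by (simp add: field_simps power2_eq_square)
    moreover have "(- C - S) / (2 * A) < 0"
      using S A by (simp add: divide_neg_pos)
    ultimately show ?thesis using S2 by (simp add: root)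
  qed
  moreover have "r = s" if "is_negative_root p r" "is_negative_root p s" for r s
  proof (rule ccontr)
    assume "r \<noteq> s"
    have e: "A * r\<^sup>2 + C * r = D" "A * s\<^sup>2 + C * s = D" and neg: "r < 0" "s < 0"
      using that by (auto simp: root)
    have "(r - s) * (A * (r + s) + C) = (A * r\<^sup>2 + C * r) - (A * s\<^sup>2 + C * s)"
      by (simp add: algebra_simps power2_eq_square)
    then have "A * (r + s) + C = 0" using e \<open>r \<noteq> s\<close> by simp
    then have C: "C = - A * (r + s)" by simp
    have "A * r\<^sup>2 + (- A * (r + s)) * r = - (A * (r * s))"
      by (simp add: algebra_simps power2_eq_square)
    then have "- (A * (r * s)) = D" using e(1) unfolding C by linarith
    moreover have "A * (r * s) > 0" using A neg by (simp add: mult_neg_neg)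
    ultimately show False using D by simp
  qed
  ultimately show ?thesis by blast
qed

definition Lambda :: "params \<Rightarrow> real" where
  "Lambda p = 1 / (a0 p * gam p + gam p - 1) *
     ((1 + a0 p) * (gam p - 1) / ((eff_post p / eff_pre p) powr (beta p * gam_hat p) - 1) - a0 p)"

definition w_star :: "params \<Rightarrow> real" where
  "w_star p = Lambda p * theta p - H_pre p"


section \<open>The control problem\<close>

text \<open>
  \<open>wealth_sde M F B p Y \<eta> \<tau>\<^sub>0 w \<tau>\<^sub>1 a x s W\<close>: on the stochastic interval \<open>[\<tau>\<^sub>0, \<tau>\<^sub>1]\<close> (without \<open>\<infinity>\<close>) the
  process \<open>W\<close> satisfies the wealth equation with income \<open>Y\<close> and efficiency \<open>\<eta>\<close>, starting from \<open>w\<close> at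
  time \<open>\<tau>\<^sub>0\<close>.  Outside the interval \<open>W\<close> is unconstrained; inside, its paths are almost surely
  continuous because the right-hand side is.
\<close>

definition active :: "('a \<Rightarrow> ennreal) \<Rightarrow> ('a \<Rightarrow> ennreal) \<Rightarrow> real \<Rightarrow> 'a \<Rightarrow> real" where
  "active \<tau>\<^sub>0 \<tau>\<^sub>1 t \<omega> = of_bool (0 \<le> t \<and> \<tau>\<^sub>0 \<omega> \<le> ennreal t \<and> ennreal t < \<tau>\<^sub>1 \<omega>)"

definition wealth_drift ::
    "params \<Rightarrow> real \<Rightarrow> real \<Rightarrow> real \<Rightarrow> real \<Rightarrow> real \<Rightarrow> real \<Rightarrow> real" where
  "wealth_drift p Y \<eta> a x s W =
     a * mu_S p * W + (1 - a) * mu_R p * W + Y - x - s / \<eta> * price p"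

definition wealth_sde ::
    "'a measure \<Rightarrow> (real \<Rightarrow> 'a measure) \<Rightarrow> (real \<Rightarrow> 'a \<Rightarrow> real) \<Rightarrow> params \<Rightarrow> real \<Rightarrow> real \<Rightarrow>
     ('a \<Rightarrow> ennreal) \<Rightarrow> real \<Rightarrow> ('a \<Rightarrow> ennreal) \<Rightarrow>
     (real \<Rightarrow> 'a \<Rightarrow> real) \<Rightarrow> (real \<Rightarrow> 'a \<Rightarrow> real) \<Rightarrow> (real \<Rightarrow> 'a \<Rightarrow> real) \<Rightarrow>
     (real \<Rightarrow> 'a \<Rightarrow> real) \<Rightarrow> bool" where
  "wealth_sde M F B p Y \<eta> \<tau>\<^sub>0 w \<tau>\<^sub>1 a x s W \<longleftrightarrow>
     (let b = (\<lambda>t \<omega>. active \<tau>\<^sub>0 \<tau>\<^sub>1 t \<omega> * wealth_drift p Y \<eta> (a t \<omega>) (x t \<omega>) (s t \<omega>) (W t \<omega>));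
          v = (\<lambda>t \<omega>. active \<tau>\<^sub>0 \<tau>\<^sub>1 t \<omega> * (a t \<omega> * sigma_S p * W t \<omega>))
      in progressive F W \<and>
         (AE \<omega> in M. \<forall>t\<ge>0. set_integrable lborel {0..t} (\<lambda>u. b u \<omega>)) \<and>
         (\<exists>I. ito_integral M F B v I \<and>
            (AE \<omega> in M. \<forall>t\<ge>0. \<tau>\<^sub>0 \<omega> \<le> ennreal t \<and> ennreal t \<le> \<tau>\<^sub>1 \<omega> \<longrightarrow>
               W t \<omega> = w + (LINT u:{0..t}|lborel. b u \<omega>) + I t \<omega>)))"

text \<open>The pathwise integral of \<open>e\<^sup>-\<^sup>\<delta>\<^sup>t U(x\<^sub>t, s\<^sub>t)\<close>, with \<open>\<delta>\<close>-hat for \<open>\<delta>\<close>, over \<open>[\<tau>\<^sub>0, \<tau>\<^sub>1)\<close>.\<close>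

definition discounted_utility ::
    "params \<Rightarrow> (real \<Rightarrow> 'a \<Rightarrow> real) \<Rightarrow> (real \<Rightarrow> 'a \<Rightarrow> real) \<Rightarrow>
     ('a \<Rightarrow> ennreal) \<Rightarrow> ('a \<Rightarrow> ennreal) \<Rightarrow> 'a \<Rightarrow> ereal" where
  "discounted_utility p x s \<tau>\<^sub>0 \<tau>\<^sub>1 \<omega> =
     ereal_integral lborel
       (\<lambda>t. ereal (active \<tau>\<^sub>0 \<tau>\<^sub>1 t \<omega> * (exp (- delta_hat p * t) * utility p (x t \<omega>) (s t \<omega>))))"

definition admissible_post ::
    "'a measure \<Rightarrow> (real \<Rightarrow> 'a measure) \<Rightarrow> (real \<Rightarrow> 'a \<Rightarrow> real) \<Rightarrow> params \<Rightarrow>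
     ('a \<Rightarrow> ennreal) \<Rightarrow> real \<Rightarrow>
     (real \<Rightarrow> 'a \<Rightarrow> real) \<Rightarrow> (real \<Rightarrow> 'a \<Rightarrow> real) \<Rightarrow> (real \<Rightarrow> 'a \<Rightarrow> real) \<Rightarrow>
     (real \<Rightarrow> 'a \<Rightarrow> real) \<Rightarrow> bool" where
  "admissible_post M F B p \<tau>\<^sub>0 w a x s W \<longleftrightarrow>
     progressive F a \<and> progressive F x \<and> progressive F s \<and>
     (AE \<omega> in M. \<forall>t\<ge>0. \<tau>\<^sub>0 \<omega> \<le> ennreal t \<longrightarrow>
        x_min p < x t \<omega> \<and> s_min p < s t \<omega> \<and> 0 < z_post p (W t \<omega>)) \<and>
     wealth_sde M F B p (income_post p) (eff_post p) \<tau>\<^sub>0 w (\<lambda>_. \<infinity>) a x s W"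

text \<open>
  Since \<open>a\<close> is a fraction of wealth and wealth may vanish (making \<open>a\<close> unbounded), the linear wealth
  equation need not determine \<open>W\<close> from the controls.  The wealth process is therefore carried along
  as part of the control in both suprema.
\<close>

definition post_payoff ::
    "'a measure \<Rightarrow> params \<Rightarrow> (real \<Rightarrow> 'a \<Rightarrow> real) \<Rightarrow> (real \<Rightarrow> 'a \<Rightarrow> real) \<Rightarrow> ereal" where
  "post_payoff M p x s = ereal_integral M (discounted_utility p x s (\<lambda>_. 0) (\<lambda>_. \<infinity>))"

definition value_G ::
    "'a measure \<Rightarrow> (real \<Rightarrow> 'a measure) \<Rightarrow> (real \<Rightarrow> 'a \<Rightarrow> real) \<Rightarrow> params \<Rightarrow> real \<Rightarrow> ereal" where
  "value_G M F B p w =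
     (SUP (a, x, s, W) \<in> {(a, x, s, W). admissible_post M F B p (\<lambda>_. 0) w a x s W}.
        post_payoff M p x s)"

definition admissible ::
    "'a measure \<Rightarrow> (real \<Rightarrow> 'a measure) \<Rightarrow> (real \<Rightarrow> 'a \<Rightarrow> real) \<Rightarrow> params \<Rightarrow> real \<Rightarrow>
     (real \<Rightarrow> 'a \<Rightarrow> real) \<Rightarrow> (real \<Rightarrow> 'a \<Rightarrow> real) \<Rightarrow> (real \<Rightarrow> 'a \<Rightarrow> real) \<Rightarrow>
     ('a \<Rightarrow> ennreal) \<Rightarrow> (real \<Rightarrow> 'a \<Rightarrow> real) \<Rightarrow> bool" where
  "admissible M F B p w a x s \<tau> W \<longleftrightarrow>
     progressive F a \<and> progressive F x \<and> progressive F s \<and> ext_stopping_time F \<tau> \<and>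
     (AE \<omega> in M. \<forall>t\<ge>0. ennreal t < \<tau> \<omega> \<longrightarrow>
        x_min p < x t \<omega> \<and> s_min p < s t \<omega> \<and> 0 < z_pre p (W t \<omega>)) \<and>
     (AE \<omega> in M. \<tau> \<omega> < \<infinity> \<longrightarrow> 0 < z_post p (W (enn2real (\<tau> \<omega>)) \<omega>)) \<and>
     wealth_sde M F B p (income p) (eff_pre p) (\<lambda>_. 0) w \<tau> a x s W"

definition payoff ::
    "'a measure \<Rightarrow> (real \<Rightarrow> 'a measure) \<Rightarrow> (real \<Rightarrow> 'a \<Rightarrow> real) \<Rightarrow> params \<Rightarrow>
     (real \<Rightarrow> 'a \<Rightarrow> real) \<Rightarrow> (real \<Rightarrow> 'a \<Rightarrow> real) \<Rightarrow> ('a \<Rightarrow> ennreal) \<Rightarrow>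
     (real \<Rightarrow> 'a \<Rightarrow> real) \<Rightarrow> ereal" where
  "payoff M F B p x s \<tau> W =
     ereal_integral M (\<lambda>\<omega>. discounted_utility p x s (\<lambda>_. 0) \<tau> \<omega> +
       (if \<tau> \<omega> = \<infinity> then 0
        else ereal (exp (- delta_hat p * enn2real (\<tau> \<omega>))) *
             value_G M F B p (W (enn2real (\<tau> \<omega>)) \<omega>)))"

definition value_F ::
    "'a measure \<Rightarrow> (real \<Rightarrow> 'a measure) \<Rightarrow> (real \<Rightarrow> 'a \<Rightarrow> real) \<Rightarrow> params \<Rightarrow> real \<Rightarrow> ereal" where
  "value_F M F B p w =
     (SUP (a, x, s, \<tau>, W) \<in> {(a, x, s, \<tau>, W). admissible M F B p w a x s \<tau> W}.
        payoff M F B p x s \<tau> W)"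

definition dF ::
    "'a measure \<Rightarrow> (real \<Rightarrow> 'a measure) \<Rightarrow> (real \<Rightarrow> 'a \<Rightarrow> real) \<Rightarrow> params \<Rightarrow> real \<Rightarrow> real" where
  "dF M F B p = deriv (\<lambda>w. real_of_ereal (value_F M F B p w))"

definition d2F ::
    "'a measure \<Rightarrow> (real \<Rightarrow> 'a measure) \<Rightarrow> (real \<Rightarrow> 'a \<Rightarrow> real) \<Rightarrow> params \<Rightarrow> real \<Rightarrow> real" where
  "d2F M F B p = deriv (dF M F B p)"


section \<open>The explicit solution\<close>

definition u_hat :: "params \<Rightarrow> real \<Rightarrow> real" where
  "u_hat p y = y powr (- gam_hat p) / gam_hat p"

definition A0 :: "params \<Rightarrow> real" where
  "A0 p =
     (- ((a0 p * gam p + gam p - 1) * (Gamma_post p - Phi_pre p) powr (gam p / (gam p - 1)) *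
         ((a0 p + 1) * (gam p - 1) * Gamma_post p * Phi_pre p) powr (gam p / (1 - gam p)))
       / theta p) powr (gam p - 1)"

definition zhat_star :: "params \<Rightarrow> real" where
  "zhat_star p =
     (- ((a0 p * gam p + gam p - 1) * (Gamma_post p - Phi_pre p)) /
        ((a0 p + 1) * (gam p - 1) * Gamma_post p * theta p * Phi_pre p)) powr gam p"

definition f_hat :: "params \<Rightarrow> real \<Rightarrow> real" where
  "f_hat p y =
     (if y \<le> zhat_star p then inverse (Gamma_post p) * u_hat p y + theta p * y
      else inverse (Phi_pre p) * u_hat p y + A0 p * (y / zhat_star p) powr (- a0 p))"

definition q :: "params \<Rightarrow> real \<Rightarrow> real \<Rightarrow> real" where
  "q p \<pi> \<xi> = (\<pi> / (1 - beta p)) powr (1 - beta p) * (\<xi> / beta p) powr beta p"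

definition b0 :: "params \<Rightarrow> real \<Rightarrow> real \<Rightarrow> real" where
  "b0 p \<pi> \<xi> = x_min p + inverse (\<pi> / (1 - beta p)) * q p \<pi> \<xi> powr (- gam_hat p)"

definition b1 :: "params \<Rightarrow> real \<Rightarrow> real \<Rightarrow> real" where
  "b1 p \<pi> \<xi> = s_min p + inverse (\<xi> / beta p) * q p \<pi> \<xi> powr (- gam_hat p)"

definition a_post :: "params \<Rightarrow> real \<Rightarrow> real" where
  "a_post p W = kappa p / (gam p * sigma_S p) * (z_post p W / W)"

definition x_post :: "params \<Rightarrow> real \<Rightarrow> real" where
  "x_post p W = x_min p + (1 - beta p) * phi p * z_post p W"

definition s_post :: "params \<Rightarrow> real \<Rightarrow> real" where
  "s_post p W = s_min p + beta p * phi p * (z_post p W / (price p / eff_post p))"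

definition a_pre ::
    "'a measure \<Rightarrow> (real \<Rightarrow> 'a measure) \<Rightarrow> (real \<Rightarrow> 'a \<Rightarrow> real) \<Rightarrow> params \<Rightarrow> real \<Rightarrow> real" where
  "a_pre M F B p W = - (kappa p / sigma_S p) * (dF M F B p W / (W * d2F M F B p W))"

definition x_pre ::
    "'a measure \<Rightarrow> (real \<Rightarrow> 'a measure) \<Rightarrow> (real \<Rightarrow> 'a \<Rightarrow> real) \<Rightarrow> params \<Rightarrow> real \<Rightarrow> real" where
  "x_pre M F B p W = b0 p (dF M F B p W) (price p / eff_pre p * dF M F B p W)"

definition s_pre ::
    "'a measure \<Rightarrow> (real \<Rightarrow> 'a measure) \<Rightarrow> (real \<Rightarrow> 'a \<Rightarrow> real) \<Rightarrow> params \<Rightarrow> real \<Rightarrow> real" where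
  "s_pre M F B p W = b1 p (dF M F B p W) (price p / eff_pre p * dF M F B p W)"

end

theory Submission imports Defs "HOL-Real_Asymp.Real_Asymp" begin

text \<open>
 Upper bound: under the density \<open>emart (- kappa p)\<close>, discounted wealth plus accumulated consumption is a
 nonnegative local martingale, which yields the budget inequality. Pairing it with the convex conjugate of the
 utility at a multiplier \<open>y\<close> bounds every payoff by \<open>f_hat p y + y * z_pre p w\<close>, since waiting is an optimal
 stopping problem for the state price \<open>y * zeta\<close>, solved by the smooth-fit function \<open>kfun\<close>. Attainment: for
 the optimal \<open>y\<close>, wealth is a combination of powers of \<open>zeta\<close>, whose Ito integrals are limits of explicit
 Riemann sums, and the resulting payoff equals the bound. As an infimum of affine functions, the value function
 has the optimal multiplier as its derivative.
\<close>

section \<open>Gaussian increments and Girsanov transform\<close>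

text \<open>As \<gamma> > 1, utilities are nonpositive, so payoffs are negatives of costs in
  \<open>ennreal\<close>, where infinite values and Fubini raise no integrability questions. The
  price is that each inequality must be arranged with nonnegative terms on both sides. An Ito
  integral comes only with convergence in probability of some elementary approximants. For an
  arbitrary admissible wealth these are truncated to bounded second moments; in the limit the mean
  is bounded from one side, which suits a nonnegative process. The exponents behind the constants
  come from \<open>phq\<close>: the discounted power \<open>zeta powr e\<close> decays in mean at
  rate \<open>phq e\<close>, with \<open>phq 1 = mu_R p\<close>, \<open>phq (eps p) = phi p\<close>
  and \<open>phq (- a0 p) = 0\<close>. \<open>zhat_star\<close> and \<open>A0\<close> are the free
  boundary and the coefficient of the power \<open>- a0 p\<close> for which value and slope of the
  gain from waiting vanish together. For the candidate strategy only a lower bound on the mean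
  discount factor at the investment time is computed; the upper bound on the value function then
  forces equality.\<close>

abbreviation (input) "NI \<equiv> nn_integral"
abbreviation (input) "NS M A f \<equiv> nn_integral M (%x. f x * indicator A x)"
abbreviation (input) "en \<equiv> ennreal"
abbreviation (input) "Ind \<equiv> indicator"
abbreviation (input) "prog \<equiv> progressive"
abbreviation (input) "Stop \<equiv> ext_stopping_time"
abbreviation (input) "EP \<equiv> elementary_process"
abbreviation (input) "EI \<equiv> elementary_integral"
abbreviation (input) "LI A f \<equiv> set_lebesgue_integral lborel A f"
abbreviation (input) "RB T \<equiv> restrict_space borel {0..T::real}"
abbreviation (input) "on ta t v \<equiv> indicator {v. ta v <= ennreal t} v"
abbreviation (input) "disc p ta v \<equiv> (if ta v = \<top> then 0 else ennreal (exp (- delta_hat p * enn2real (ta v))))"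
abbreviation (input) "du p x s t v \<equiv> exp (- delta_hat p * t) * - utility p (x t v) (s t v)"
abbreviation (input) "er \<equiv> enn2real"
abbreviation (input) "Con \<equiv> continuous_on"
abbreviation (input) "SI \<equiv> set_integrable lborel"
abbreviation (input) "Gp \<equiv> Gamma_post"
abbreviation (input) "Pp \<equiv> Phi_pre"
abbreviation (input) "dh \<equiv> delta_hat"
abbreviation (input) "nd d x \<equiv> normal_density 0 (sqrt d) x"
abbreviation (input) "NL T f \<equiv> nn_integral lborel (%x. f x * indicator {0..T::real} x)"
abbreviation (input) PM (infixr "><" 80) where "A >< B \<equiv> A \<Otimes>\<^sub>M B"
abbreviation (input) "qv s h m v \<equiv> (\<Sum>i<m. (h i v)^2 * (s (Suc i) - s i :: real) :: real)"
abbreviation (input) "pgt M d f \<equiv> measure M {v\<in>space M. ennreal d < f v}"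
abbreviation (input) "dev M S e X Y \<equiv> {v\<in>space M. \<exists>t\<in>S. e \<le> \<bar>X t v - Y t v :: real\<bar>}"
abbreviation (input) "Bm \<equiv> borel_measurable"
abbreviation (input) tends (infixr "---->" 60) where "X ----> L \<equiv> X \<longlonglongrightarrow> L"


text \<open>Independence of the past and normality of an increment are packed into
  \<open>freeze\<close>: the increment may be integrated out with the past held fixed. The index set
  is a parameter because the shifted motion is treated only up to the horizon of the density, while
  the original one lives on \<open>{0..}\<close>.\<close>

locale gauss_incr = prob_space M for M :: "'a measure" +
 fixes F :: "real => 'a measure" and bt :: "real => 'a => real" and I :: "real set"
 assumes filt: "filtration (space M) F"
 and times_nonneg: "t : I ==> 0 <= t"
 and times_down: "t : I ==> 0 <= s ==> s <= t ==> s : I"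
 and sub: "t : I ==> subalgebra M (F t)"
 and adapted: "t : I ==> bt t : Bm (F t)"
 and continuous: "v : space M ==> Con I (%t. bt t v)"
 and freeze: "s : I ==> t : I ==> s < t ==> h : Bm (F s >< borel) ==>
 NI M (%v. h (v, bt t v - bt s v)) =
 NI M (%v. NI lborel (%x. h (v, x) * en (nd (t - s) x)))"
begin

lemma space_F [simp]: "space (F t) = space M"
 using filt by (simp add: filtration.space_F)

lemma F_mono: "s <= t ==> f : measurable (F s) N ==> f : measurable (F t) N"
 using filtration.sets_F_mono[OF filt, of s t] by (auto simp: measurable_def)

lemma F_M: "t : I ==> f : measurable (F t) N ==> f : measurable M N"
 using sub[of t] by (auto simp: measurable_def subalgebra_def)

lemma F_M_prod: "t : I ==> f : measurable (N' >< F t) N ==> f : measurable (N' >< M) N"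
proof -
 assume t: "t : I" and f: "f : measurable (N' >< F t) N"
 have "(%x. f (fst x, snd x)) : measurable (N' >< M) N"
 proof (rule measurable_compose[OF _ f])
 have "(%x. x) : measurable M (F t)" by (rule F_M[OF t]) simp
 thus "(%x. (fst x, snd x)) : measurable (N' >< M) (N' >< F t)"
 by (intro measurable_Pair measurable_compose[OF measurable_snd]) auto
 qed
 thus ?thesis by simp
qed

lemma F_sets: "t : I ==> A : sets (F t) ==> A : sets M"
 using sub[of t] by (auto simp: subalgebra_def)

lemma bt_measurable: "t : I ==> bt t : Bm M"
 using F_M adapted by blast

lemma bt_adapted: "s <= t ==> s : I ==> bt s : Bm (F t)"
 using F_mono adapted by blast

end

section \<open>Exponential martingale and change of drift\<close>

lemma nn_integral_normal_density: "sx > 0 ==> NI lborel (%x. en (normal_density \<mu> sx x)) = 1"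
 by (subst nn_integral_eq_integral) auto

text \<open>Completing the square: exponential tilting shifts the mean of a normal density.\<close>

lemma normal_density_exp:
 fixes c d x :: real
 assumes d: "0 < d"
 shows "exp (c * x) * nd d x = exp (c^2 * d / 2) * normal_density (c * d) (sqrt d) x"
proof -
 have "c * x + - x\<^sup>2 / (2 * d) = c^2 * d / 2 + - (x - c * d)\<^sup>2 / (2 * d)"
 using d by (simp add: field_simps power2_eq_square)
 hence "exp (c * x) * exp (- x\<^sup>2 / (2 * d)) = exp (c^2 * d / 2) * exp (- (x - c * d)\<^sup>2 / (2 * d))"
 unfolding exp_add[symmetric] by simp
 thus ?thesis using d by (simp add: normal_density_def)
qed

lemma nn_integral_normal_exp:
 fixes c d :: real
 assumes d: "0 < d"
 shows "NI lborel (%x. en (exp (c * x)) * en (nd d x)) = en (exp (c^2 * d / 2))"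
proof -
 have "NI lborel (%x. en (exp (c * x)) * en (nd d x))
 = NI lborel (%x. en (exp (c^2 * d / 2)) * en (normal_density (c * d) (sqrt d) x))"
 by (intro nn_integral_cong) (simp add: ennreal_mult'[symmetric] normal_density_exp[OF d])
 also have "... = en (exp (c^2 * d / 2))"
 using d by (subst nn_integral_cmult) (auto simp: nn_integral_normal_density)
 finally show ?thesis .
qed

context gauss_incr
begin

text \<open>The increment from time 0 is used because the starting value need not vanish on every
  path; this makes the process exactly 1 at time 0.\<close>

definition emart :: "real => real => 'a => real" where
 "emart c t v = exp (c * (bt t v - bt 0 v) - c^2 * t / 2)"

lemma emart_pos: "emart c t v > 0" by (simp add: emart_def)

lemma emart_adapted: "s <= t ==> s : I ==> emart c s : Bm (F t)"
proof -
 assume "s <= t" "s : I"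
 hence [measurable]: "bt s : Bm (F t)" "bt 0 : Bm (F t)"
 using bt_adapted[of s t] bt_adapted[of 0 t] times_nonneg[of s] times_down[of s 0] by auto
 show ?thesis unfolding emart_def by measurable
qed

lemma emart_M: "s : I ==> emart c s : Bm M"
 using F_M emart_adapted by blast

lemma emart_step: "emart c t v = emart c s v * exp (c * (bt t v - bt s v) - c^2 * (t - s) / 2)"
 unfolding emart_def exp_add[symmetric] by (rule arg_cong[where f=exp]) (simp add: field_simps)

text \<open>The martingale property, tested against nonnegative \<open>F s\<close>-measurable
  weights that may be infinite. By \<open>freeze\<close> the factor gained between \<open>s\<close>
  and \<open>t\<close> integrates to 1.\<close>

lemma emart_nn_integral:
 assumes st: "s : I" "t : I" "s <= t" and Y: "Y : Bm (F s)"
 shows "NI M (%v. Y v * en (emart c t v)) = NI M (%v. Y v * en (emart c s v))"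
proof (cases "s = t")
 case False
 hence lt: "s < t" using st by simp
 note [measurable] = Y emart_adapted[OF order_refl st(1)]
 let ?h = "%(v, x). Y v * en (emart c s v) * en (exp (c * x - c^2 * (t - s) / 2))"
 have "NI M (%v. Y v * en (emart c t v)) = NI M (%v. ?h (v, bt t v - bt s v))"
 using emart_pos[of c s] by (intro nn_integral_cong)
 (simp only: emart_step[of c t _ s] prod.case mult.assoc ennreal_mult' less_imp_le)
 also have "... = NI M (%v. NI lborel (%x. ?h (v, x) * en (nd (t - s) x)))"
 by (rule freeze[OF st(1,2) lt]) measurable
 also have "... = NI M (%v. Y v * en (emart c s v))"
 proof (rule nn_integral_cong)
 fix v
 have "NI lborel (%x. ?h (v, x) * en (nd (t - s) x))
 = NI lborel (%x. (Y v * en (emart c s v) * en (exp (- c\<^sup>2 * (t - s) / 2))) *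
 (en (exp (c * x)) * en (nd (t - s) x)))"
 proof (rule nn_integral_cong)
 fix x
 have "exp (c * x - c^2 * (t - s) / 2) = exp (- c\<^sup>2 * (t - s) / 2) * exp (c * x)"
 by (simp add: exp_add[symmetric])
 hence "en (exp (c * x - c^2 * (t - s) / 2)) = en (exp (- c\<^sup>2 * (t - s) / 2)) * en (exp (c * x))"
 by (simp only: ennreal_mult' exp_ge_zero)
 thus "?h (v, x) * en (nd (t - s) x) =
 (Y v * en (emart c s v) * en (exp (- c\<^sup>2 * (t - s) / 2))) *
 (en (exp (c * x)) * en (nd (t - s) x))"
 by (simp only: prod.case mult.assoc)
 qed
 also have "... = Y v * en (emart c s v) * (en (exp (- c\<^sup>2 * (t - s) / 2)) * en (exp (c^2 * (t - s) / 2)))"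
 using lt by (subst nn_integral_cmult) (auto simp: nn_integral_normal_exp mult.assoc)
 also have "en (exp (- c\<^sup>2 * (t - s) / 2)) * en (exp (c^2 * (t - s) / 2)) = 1"
 by (simp add: ennreal_mult'[symmetric] exp_add[symmetric])
 finally show "NI lborel (%x. ?h (v, x) * en (nd (t - s) x))
 = Y v * en (emart c s v)" by simp
 qed
 finally show ?thesis .
qed simp

lemma emart_0: "emart c 0 v = 1" by (simp add: emart_def)

lemma emart_expectation: "t : I ==> NI M (%v. en (emart c t v)) = 1"
 using emart_nn_integral[of 0 t "%_. 1" c] times_nonneg[of t] times_down[of t 0]
 by (simp add: emart_0 emeasure_space_1)

text \<open>Cameron-Martin theorem at the level of \<open>freeze\<close>. The martingale property
  lowers the density from \<open>T\<close> to \<open>t\<close>, its last factor turns the normal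
  density of the increment into a shifted one, a translation removes the shift, and the remaining
  \<open>emart (- k) s\<close> is raised to \<open>T\<close> again.\<close>

lemma gauss_incr_girsanov:
 assumes T: "T : I"
 shows "gauss_incr (density M (%v. en (emart (- k) T v))) F (%t v. bt t v + k * t) {0..T}"
proof -
 let ?L = "emart (- k)"
 let ?Q = "density M (%v. en (?L T v))"
 note LM [measurable] = emart_M[OF T, of "-k"]
 have in_I: "t : I" if "t : {0..T}" for t using that times_down[OF T] by auto
 interpret Q: prob_space ?Q
 proof (rule prob_spaceI)
 have "emeasure ?Q (space ?Q) = NI M (%v. en (?L T v) * Ind (space M) v)"
 by (subst emeasure_density) auto
 also have "... = NI M (%v. en (?L T v))"
 by (rule nn_integral_cong) simp
 finally show "emeasure ?Q (space ?Q) = 1" using emart_expectation[OF T] by simp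
 qed
 show ?thesis
 proof (intro gauss_incr.intro gauss_incr_axioms.intro)
 show "prob_space ?Q" by unfold_locales
 show "filtration (space ?Q) F" using filt by simp
 show "Con {0..T} (%t. bt t v + k * t)" if "v : space ?Q" for v
 using that by (intro continuous_intros continuous_on_subset[OF continuous]) (auto intro: in_I)
 next
 fix t assume t: "t : {0..T}"
 show "0 <= t" using t by simp
 show "s : {0..T}" if "0 <= s" "s <= t" for s using that t by auto
 show "subalgebra ?Q (F t)" using sub[OF in_I[OF t]] by (simp add: subalgebra_def)
 show "(%v. bt t v + k * t) : Bm (F t)"
 using adapted[OF in_I[OF t]] by measurable
 next
 fix s t and h :: "'a \<times> real => ennreal"
 assume s: "s : {0..T}" and t: "t : {0..T}" and lt: "s < t"
 and h [measurable]: "h : Bm (F s >< borel)"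
 note [measurable] = adapted[OF in_I[OF t]] adapted[OF in_I[OF s]] bt_adapted[OF less_imp_le[OF lt] in_I[OF s]]
 emart_adapted[OF order_refl in_I[OF s]]
 have h2 [measurable]: "h : Bm (F t >< borel)"
 using h
 proof -
 have "(%x. h (fst x, snd x)) : Bm (F t >< borel)"
 by (rule measurable_compose[OF _ h], rule measurable_Pair,
 rule measurable_compose[OF measurable_fst], rule F_mono[OF less_imp_le[OF lt]], auto)
 thus ?thesis by simp
 qed
 have h3 [measurable]: "h : Bm (M >< borel)"
 proof -
 have "(%x. h (fst x, snd x)) : Bm (M >< borel)"
 by (rule measurable_compose[OF _ h], rule measurable_Pair,
 rule measurable_compose[OF measurable_fst], rule F_M[OF in_I[OF s]], auto)
 thus ?thesis by simp
 qed
 note [measurable] = bt_measurable[OF in_I[OF t]] bt_measurable[OF in_I[OF s]]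
 let ?d = "t - s"
 let ?n = "%x. en (nd (t - s) x)"
 let ?h' = "%(v, x). h (v, x + k * ?d) * en (?L s v) * en (exp (- k * x - k^2 * ?d / 2))"
 have "NI ?Q (%v. h (v, bt t v + k * t - (bt s v + k * s)))
 = NI M (%v. h (v, bt t v + k * t - (bt s v + k * s)) * en (?L T v))"
 by (subst nn_integral_density) (auto simp: mult.commute)
 also have "... = NI M (%v. h (v, bt t v + k * t - (bt s v + k * s)) * en (?L t v))"
 using t by (intro emart_nn_integral) (auto intro: in_I T)
 also have "... = NI M (%v. ?h' (v, bt t v - bt s v))"
 proof (rule nn_integral_cong)
 fix v
 have 1: "bt t v + k * t - (bt s v + k * s) = bt t v - bt s v + k * ?d" by (simp add: algebra_simps)
 have "?L t v = ?L s v * exp (- k * (bt t v - bt s v) - k^2 * ?d / 2)"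
 using emart_step[of "-k" t v s] by simp
 thus "h (v, bt t v + k * t - (bt s v + k * s)) * en (?L t v) = ?h' (v, bt t v - bt s v)"
 unfolding 1 using emart_pos[of "-k" s v] by (simp only: prod.case mult.assoc ennreal_mult' less_imp_le)
 qed
 also have "... = NI M (%v. NI lborel (%x. ?h' (v, x) * ?n x))"
 by (rule freeze[OF in_I[OF s] in_I[OF t] lt]) measurable
 also have "... = NI M (%v. NI lborel (%x. h (v, x) * ?n x) * en (?L s v))"
 proof (rule nn_integral_cong)
 fix v assume w: "v : space M"
 have m: "(%x. h (v, x)) : Bm borel"
 using measurable_compose[OF measurable_Pair1'[OF w] h3] by simp
 have "NI lborel (%x. ?h' (v, x) * ?n x) = NI lborel (%x. (h (v, x + k * ?d) * ?n (x + k * ?d)) * en (?L s v))"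
 proof (rule nn_integral_cong)
 fix x
 \<comment> \<open>The factor of the martingale over one step turns the centred normal density at
   \<open>x\<close> into the one at \<open>x + k * ?d\<close>.\<close>
 have "exp (- k * x - k^2 * ?d / 2) * nd ?d x = exp (- k\<^sup>2 * ?d / 2) * (exp ((- k) * x) * nd ?d x)"
 proof -
 have "exp (- k * x - k^2 * ?d / 2) = exp (- k\<^sup>2 * ?d / 2) * exp ((- k) * x)"
 unfolding exp_add[symmetric] by simp
 thus ?thesis by (simp only: mult.assoc)
 qed
 also have "... = normal_density (- k * ?d) (sqrt ?d) x"
 using lt by (subst normal_density_exp) (auto simp: mult.assoc[symmetric] exp_add[symmetric])
 also have "... = nd ?d (x + k * ?d)"
 by (simp add: normal_density_def)
 finally have e: "exp (- k * x - k^2 * ?d / 2) * nd ?d x = nd ?d (x + k * ?d)" .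
 have "?h' (v, x) * ?n x = h (v, x + k * ?d) * en (?L s v) * en (exp (- k * x - k^2 * ?d / 2) * nd ?d x)"
 by (simp only: prod.case mult.assoc ennreal_mult' exp_ge_zero)
 thus "?h' (v, x) * ?n x = (h (v, x + k * ?d) * ?n (x + k * ?d)) * en (?L s v)"
 unfolding e by (simp only: mult_ac)
 qed
 also have "... = NI lborel (%x. (h (v, x + k * ?d) * ?n (x + k * ?d))) * en (?L s v)"
 proof (rule nn_integral_multc)
 have "(%x. h (v, x + k * ?d)) : Bm borel"
 by (rule measurable_compose[OF _ m]) simp
 thus "(%x. h (v, x + k * ?d) * ?n (x + k * ?d)) : Bm lborel"
 by (intro borel_measurable_times_ennreal) simp_all
 qed
 also have "NI lborel (%x. (h (v, x + k * ?d) * ?n (x + k * ?d))) = NI lborel (%x. h (v, x) * ?n x)"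
 using nn_integral_real_affine[of "%x. h (v, x) * ?n x" 1 "k * ?d"] m by (simp add: add.commute)
 finally show "NI lborel (%x. ?h' (v, x) * ?n x) = NI lborel (%x. h (v, x) * ?n x) * en (?L s v)" .
 qed
 also have "... = NI M (%v. NI lborel (%x. h (v, x) * ?n x) * en (?L T v))"
 using s by (intro emart_nn_integral[symmetric]) (auto intro: in_I T)
 also have "... = NI ?Q (%v. NI lborel (%x. h (v, x) * ?n x))"
 by (subst nn_integral_density) (auto simp: mult.commute)
 finally show "NI ?Q (%v. h (v, bt t v + k * t - (bt s v + k * s))) = NI ?Q (%v. NI lborel (%x. h (v, x) * ?n x))" .
 qed
qed

end

text \<open>Independence says that the joint law of the identity, viewed as a map into
  \<open>F s\<close>, and of the increment is a product measure; Fubini and the normal density of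
  the second factor then give \<open>freeze\<close>.\<close>

lemma gauss_incr_brownian:
 assumes BM: "brownian_motion M F B"
 shows "gauss_incr M F B {0..}"
proof -
 note bm = BM[unfolded brownian_motion_def]
 interpret prob_space M using bm by blast
 have filt: "filtration (space M) F" using bm by blast
 have sub: "subalgebra M (F t)" if "t >= 0" for t using bm that by blast
 have ad: "B t : Bm (F t)" if "t >= 0" for t using bm that by blast
 have FM: "f : measurable (F t) N ==> f : measurable M N" if "t >= 0" for t f N
 using sub[OF that] by (auto simp: measurable_def subalgebra_def)
 show ?thesis
 proof (intro gauss_incr.intro gauss_incr_axioms.intro)
 show "prob_space M" by unfold_locales
 show "filtration (space M) F" by fact
 show "Con {0..} (%t. B t v)" if "v : space M" for v using bm that by blast
 next
 fix s t :: real and h :: "'a \<times> real => ennreal"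
 assume s: "s : {0..}" and t: "t : {0..}" and lt: "s < t"
 and h [measurable]: "h : Bm (F s >< borel)"
 let ?X = "%v. B t v - B s v"
 have X [measurable]: "?X : Bm M" using FM[OF _ ad] s t by auto
 have idm: "(%v. v) : measurable M (F s)" using s by (intro FM[of s]) auto
 have d: "distributed M lborel ?X (normal_density 0 (sqrt (t - s)))"
 and ind: "indep_set (sets (F s)) (sets (vimage_algebra (space M) ?X borel))"
 using bm s lt by auto
 have spF: "space (F s) = space M" using filt by (simp add: filtration.space_F)
 interpret D: prob_space "distr M borel ?X" by (rule prob_space_distr) simp
 interpret E: prob_space "distr M (F s) (%v. v)" by (rule prob_space_distr) (rule idm)
 have eq: "distr M (F s) (%v. v) >< distr M borel ?X = distr M (F s >< borel) (%v. (v, ?X v))"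
 proof (rule pair_measure_eqI)
 show "sets (distr M (F s) (%v. v) >< distr M borel ?X) = sets (distr M (F s >< borel) (%v. (v, ?X v)))"
 by (simp add: sets_pair_measure_cong[of "distr M (F s) (%v. v)" "F s" "distr M borel ?X" borel])
 fix A C assume "A : sets (distr M (F s) (%v. v))" "C : sets (distr M borel ?X)"
 hence A: "A : sets (F s)" and C [measurable]: "C : sets borel" by auto
 have Asp: "A Int space M = A" using sets.sets_into_space[OF A] spF by auto
 have V: "?X -` C Int space M : sets (vimage_algebra (space M) ?X borel)"
 by (rule in_vimage_algebra) (rule C)
 have ind2: "prob (A Int (?X -` C Int space M)) = prob A * prob (?X -` C Int space M)"
 using ind A V unfolding indep_sets2_eq by blast
 have "emeasure (distr M (F s) (%v. v)) A = en (prob A)"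
 using emeasure_distr[OF idm A] Asp by (simp add: emeasure_eq_measure)
 moreover have "emeasure (distr M borel ?X) C = en (prob (?X -` C Int space M))"
 using emeasure_distr[OF X C] by (simp add: emeasure_eq_measure)
 moreover have "emeasure (distr M (F s >< borel) (%v. (v, ?X v))) (A \<times> C)
 = en (prob (A Int (?X -` C Int space M)))"
 proof (subst emeasure_distr)
 show "(%v. (v, ?X v)) : M \<rightarrow>\<^sub>M F s >< borel" using idm by (intro measurable_Pair) auto
 show "A \<times> C : sets (F s >< borel)" using A C by (rule pair_measureI)
 have "(%v. (v, ?X v)) -` (A \<times> C) Int space M = A Int (?X -` C Int space M)" using Asp by auto
 thus "emeasure M ((%v. (v, ?X v)) -` (A \<times> C) Int space M) = en (prob (A Int (?X -` C Int space M)))"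
 by (simp add: emeasure_eq_measure)
 qed
 ultimately show "emeasure (distr M (F s) (%v. v)) A * emeasure (distr M borel ?X) C =
 emeasure (distr M (F s >< borel) (%v. (v, ?X v))) (A \<times> C)"
 unfolding ind2 by (simp add: ennreal_mult')
 qed unfold_locales
 have dd: "distr M borel ?X = density lborel (%x. en (nd (t - s) x))"
 using distributed_distr_eq_density[OF d]
 by (metis (lifting) distr_cong sets_lborel)
 have hs: "h : Bm (distr M (F s) (%v. v) >< distr M borel ?X)"
 proof -
 have "sets (distr M (F s) (%v. v) >< distr M borel ?X) = sets (F s >< borel)"
 by (rule sets_pair_measure_cong) auto
 thus ?thesis using h measurable_cong_sets by blast
 qed
 have "NI M (%v. h (v, ?X v)) = (NI (distr M (F s >< borel) (%v. (v, ?X v))) (%y. h y))"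
 using idm by (subst nn_integral_distr) auto
 also have "... = (NI (distr M (F s) (%v. v)) (%v. NI (distr M borel ?X) (%x. h (v, x))))"
 unfolding eq[symmetric] using D.nn_integral_fst[OF hs] by simp
 also have "... = NI M (%v. NI (distr M borel ?X) (%x. h (v, x)))"
 proof (subst nn_integral_distr[OF idm])
 have "h : Bm (F s >< distr M borel ?X)"
 using h measurable_cong_sets[OF sets_pair_measure_cong[OF refl sets_distr[of M borel ?X]] refl] by blast
 from D.borel_measurable_nn_integral_fst[OF this]
 show "(%v. NI (distr M borel ?X) (%x. h (v, x))) : Bm (distr M (F s) (%v. v))"
 by simp
 qed simp
 also have "... = NI M (%v. NI lborel (%x. h (v, x) * en (nd (t - s) x)))"
 proof (rule nn_integral_cong)
 fix v assume "v : space M"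
 hence w: "v : space (F s)" using spF by simp
 have "(%x. h (v, x)) : Bm borel"
 using measurable_compose[OF measurable_Pair1'[OF w] h] by simp
 thus "NI (distr M borel ?X) (%x. h (v, x)) = NI lborel (%x. h (v, x) * en (nd (t - s) x))"
 unfolding dd by (subst nn_integral_density) (auto simp: mult.commute)
 qed
 finally show "NI M (%v. h (v, ?X v)) = NI M (%v. NI lborel (%x. h (v, x) * en (nd (t - s) x)))" .
 qed (use sub ad in auto)
qed

text \<open>Rounding the time down to a grid makes the process a countable patchwork of measurable
  maps; path continuity lets the mesh tend to 0.\<close>

lemma joint_measurable_continuous:
 fixes X :: "real => 'b => real"
 assumes T: "0 <= T"
 and X: "!!t. 0 <= t ==> t <= T ==> X t : Bm N"
 and cont: "!!v. v : space N ==> Con {0..T} (%t. X t v)"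
 shows "(%(s, v). X s v) : Bm (RB T >< N)"
proof -
 let ?R = "RB T >< N"
 \<comment> \<open>\<open>min T\<close> keeps every one of the countably many grid times inside the
   interval on which \<open>X\<close> is known to be measurable.\<close>
 define a :: "nat => real => real" where "a n s = min T (real (nat \<lfloor>real (Suc n) * s\<rfloor>) / real (Suc n))" for n s
 have a_le: "0 <= a n s & a n s <= s & s - 1 / real (Suc n) <= a n s" if "0 <= s" "s <= T" for n s
 proof -
 have 1: "real (nat \<lfloor>real (Suc n) * s\<rfloor>) <= real (Suc n) * s" using that by simp
 have 2: "real (Suc n) * s - 1 <= real (nat \<lfloor>real (Suc n) * s\<rfloor>)" using that by linarith
 have "real (nat \<lfloor>real (Suc n) * s\<rfloor>) / real (Suc n) <= s" using 1 by (simp add: divide_le_eq mult.commute del: of_nat_Suc)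
 moreover have "s - 1 / real (Suc n) = (real (Suc n) * s - 1) / real (Suc n)" by (simp add: diff_divide_distrib del: of_nat_Suc)
 ultimately show ?thesis unfolding a_def
 using that 2 by (simp add: divide_right_mono del: of_nat_Suc)
 qed
 have lim: "(%n. a n s) ----> s" if "0 <= s" "s <= T" for s
 proof (rule real_tendsto_sandwich[where h="%_. s"])
 show "(%n. s - 1 / real (Suc n)) ----> s"
 using tendsto_diff[OF tendsto_const[of s] LIMSEQ_inverse_real_of_nat] by (simp add: divide_inverse)
 qed (use a_le[OF that] in \<open>auto intro!: always_eventually\<close>)
 show ?thesis
 proof (rule borel_measurable_LIMSEQ_real[where u="%n (s, v). X (a n s) v"])
 fix n :: nat
 have "(%x. (%i x. X (min T (real i / real (Suc n))) (snd x)) (nat \<lfloor>real (Suc n) * fst x\<rfloor>) x) : Bm ?R"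
 proof (rule measurable_compose_countable[where f="%i x. X (min T (real i / real (Suc n))) (snd x)" and g="%x. nat \<lfloor>real (Suc n) * fst x\<rfloor>"])
 fix i :: nat
 show "(%x. X (min T (real i / real (Suc n))) (snd x)) : Bm ?R"
 by (rule measurable_compose[OF measurable_snd]) (use T in \<open>auto intro!: X\<close>)
 have "(%s. nat \<lfloor>real (Suc n) * s\<rfloor>) : measurable borel (count_space UNIV)" by measurable
 hence "(%s. nat \<lfloor>real (Suc n) * s\<rfloor>) : measurable (RB T) (count_space UNIV)"
 by (rule measurable_restrict_space1)
 thus "(%x. nat \<lfloor>real (Suc n) * fst x\<rfloor>) : measurable ?R (count_space UNIV)"
 by (rule measurable_compose[OF measurable_fst])
 qed
 thus "(%(s, v). X (a n s) v) : Bm ?R"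
 unfolding a_def by (simp only: case_prod_beta')
 next
 fix x :: "real \<times> 'b" assume "x : space ?R"
 hence x: "0 <= fst x" "fst x <= T" "snd x : space N"
 by (auto simp: space_pair_measure space_restrict_space)
 have "(%n. X (a n (fst x)) (snd x)) ----> X (fst x) (snd x)"
 proof (rule continuous_on_tendsto_compose[OF cont[OF x(3)] lim[OF x(1,2)]])
 show "fst x : {0..T}" using x by simp
 show "\<forall>\<^sub>F n in sequentially. a n (fst x) : {0..T}"
 proof (rule always_eventually, rule allI)
 fix n show "a n (fst x) : {0..T}" using a_le[OF x(1,2), of n] x(2) by simp
 qed
 qed
 thus "(%n. (%(s, v). X (a n s) v) x) ----> (%(s, v). X s v) x"
 by (simp only: case_prod_beta')
 qed
qed

section \<open>Discrete stochastic integrals: isometry and maximal inequality\<close>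

context gauss_incr
begin

text \<open>\<open>f\<close> is centred with second moment \<open>c\<close> under the law of the
  increment, so the cross term vanishes. The identity as \<open>f\<close> gives the isometry of
  elementary integrals, and \<open>psi\<close> gives the error estimate for exponential
  martingales.\<close>

lemma increment_square_gen:
 assumes st: "s : I" "t : I" "s < t" and d: "d : Bm (F s)" and g: "g : Bm (F s)"
 and [measurable]: "f : Bm borel"
 and f1: "has_bochner_integral lborel (%x. nd (t - s) x * f x) 0"
 and f2: "has_bochner_integral lborel (%x. nd (t - s) x * (f x)^2) c"
 shows "NI M (%v. en ((d v + g v * f (bt t v - bt s v))^2)) =
 NI M (%v. en ((d v)^2 + (g v)^2 * c))"
proof -
 note [measurable] = d g
 let ?h = "%(v, x). en ((d v + g v * f x)^2)"
 let ?n = "normal_density 0 (sqrt (t - s))"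
 have "NI M (%v. en ((d v + g v * f (bt t v - bt s v))^2)) = NI M (%v. NI lborel (%x. ?h (v, x) * en (?n x)))"
 using freeze[OF st, of ?h] by simp
 also have "... = NI M (%v. en ((d v)^2 + (g v)^2 * c))"
 proof (rule nn_integral_cong)
 fix v
 have n0: "has_bochner_integral lborel ?n 1"
 using normal_moment_even[of "sqrt (t - s)" 0 0] st by simp
 have b: "has_bochner_integral lborel (%x. (d v)^2 * ?n x + 2 * d v * g v * (?n x * f x) + (g v)^2 * (?n x * (f x)^2))
 ((d v)^2 * 1 + 2 * d v * g v * 0 + (g v)^2 * c)"
 by (intro has_bochner_integral_add has_bochner_integral_mult_right n0 f1 f2)
 have e: "(d v)^2 * ?n x + 2 * d v * g v * (?n x * f x) + (g v)^2 * (?n x * (f x)^2) = (d v + g v * f x)^2 * ?n x" for x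
 by (simp add: power2_eq_square algebra_simps)
 have "NI lborel (%x. ?h (v, x) * en (?n x)) = NI lborel (%x. en ((d v + g v * f x)^2 * ?n x))"
 by (simp add: ennreal_mult')
 also have "... = en ((d v)^2 + (g v)^2 * c)"
 using b[unfolded e] by (subst nn_integral_eq_integral) (auto simp: has_bochner_integral_iff)
 finally show "NI lborel (%x. ?h (v, x) * en (?n x)) = en ((d v)^2 + (g v)^2 * c)" .
 qed
 finally show ?thesis .
qed

lemma increment_square:
 assumes st: "s : I" "t : I" "s <= t" and d: "d : Bm (F s)" and g: "g : Bm (F s)"
 shows "NI M (%v. en ((d v + g v * (bt t v - bt s v))^2)) =
 NI M (%v. en ((d v)^2 + (g v)^2 * (t - s)))"
proof (cases "s = t")
 case False
 hence lt: "s < t" "0 < sqrt (t - s)" using st by auto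
 show ?thesis
 using normal_moment_odd[OF lt(2), of 0 0] normal_moment_even[OF lt(2), of 0 1] lt(1)
 by (intro increment_square_gen[OF st(1,2) lt(1) d g, where f="%x. x"]) (auto simp: fact_numeral diff_divide_distrib)
qed simp

text \<open>Integrability comes from the second moment; the mean vanishes because the reflection of
  \<open>x\<close> to \<open>- x\<close> interchanges positive and negative parts under the
  symmetric normal density.\<close>

lemma increment_mean:
 assumes st: "s : I" "t : I" "s <= t" and g: "g : Bm (F s)"
 and b: "!!v. v : space M ==> abs (g v) <= C"
 shows "integrable M (%v. g v * (bt t v - bt s v))" "(\<integral>v. g v * (bt t v - bt s v) \<partial>M) = 0"
proof -
 note [measurable] = g F_M[OF st(1) g] bt_measurable[OF st(1)] bt_measurable[OF st(2)]
 let ?X = "%v. g v * (bt t v - bt s v)"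
 have "NI M (%v. en (((%_. 0) v + ?X v)^2)) = NI M (%v. en (((%_. 0) v)^2 + (g v)^2 * (t - s)))"
 by (rule increment_square[OF st _ g]) simp
 also have "... <= NI M (%v. en (C^2 * (t - s)))"
 proof (intro nn_integral_mono ennreal_leI)
 fix v assume "v : space M"
 hence "(g v)^2 <= C^2" using b power2_le_iff_abs_le[of C "g v"] by force
 thus "0^2 + (g v)^2 * (t - s) <= C^2 * (t - s)" using st by (simp add: mult_right_mono)
 qed
 also have "... < \<infinity>" by (simp add: emeasure_space_1 ennreal_mult_less_top)
 finally have "NI M (%v. en ((?X v)^2)) < \<infinity>" by simp
 hence "integrable M (%v. (?X v)^2)"
 by (intro integrableI_bounded) auto
 thus int: "integrable M ?X"
 by (rule square_integrable_imp_integrable[rotated]) measurable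
 show "integral\<^sup>L M ?X = 0"
 proof (cases "s = t")
 case False
 hence lt: "s < t" using st by simp
 let ?n = "normal_density 0 (sqrt (t - s))"
 have p: "NI M (%v. en (?X v)) = NI M (%v. NI lborel (%x. en (g v * x) * en (?n x)))"
 using freeze[OF st(1,2) lt, of "%(v, x). en (g v * x)"] by simp
 have q: "NI M (%v. en (- ?X v)) = NI M (%v. NI lborel (%x. en (- (g v * x)) * en (?n x)))"
 using freeze[OF st(1,2) lt, of "%(v, x). en (- (g v * x))"] by simp
 have e: "NI lborel (%x. en (g v * x) * en (?n x)) = NI lborel (%x. en (- (g v * x)) * en (?n x))" for v
 using nn_integral_real_affine[of "%x. en (g v * x) * en (?n x)" "-1" 0]
 by (simp add: normal_density_def)
 show ?thesis
 by (subst real_lebesgue_integral_def[OF int]) (simp add: p q e)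
 qed simp
qed

definition dsum :: "(nat => real) => (nat => 'a => real) => nat => 'a => real" where
 "dsum s h l v = (SUM i<l. h i v * (bt (s (Suc i)) v - bt (s i) v))"

definition grid :: "(nat => real) => nat => bool" where
 "grid s m \<longleftrightarrow> (ALL i<=m. s i : I) & (ALL i<m. s i <= s (Suc i))"

lemma grid_mono: "grid s m ==> i <= j ==> j <= m ==> s i <= s j"
proof (induction j)
 case (Suc j)
 thus ?case
 by (cases "i = Suc j") (auto simp: grid_def intro: order_trans)
qed auto

lemma dsum_measurable:
 assumes g: "grid s m" and h: "!!i. i < m ==> h i : Bm (F (s i))" and l: "l <= m"
 shows "dsum s h l : Bm (F (s l))"
 unfolding dsum_def
proof (rule borel_measurable_sum)
 fix i assume "i : {..<l}"
 hence i: "i < l" by simp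
 have "s i <= s l" "s (Suc i) <= s l" using grid_mono[OF g] i l by auto
 moreover have "s i : I" "s (Suc i) : I" using g i l by (auto simp: grid_def)
 ultimately have [measurable]: "bt (s i) : Bm (F (s l))" "bt (s (Suc i)) : Bm (F (s l))"
 "h i : Bm (F (s l))"
 using bt_adapted F_mono[OF _ h] i l by auto
 show "(%v. h i v * (bt (s (Suc i)) v - bt (s i) v)) : Bm (F (s l))" by measurable
qed

text \<open>Discrete Ito isometry: the sum grows by one orthogonal increment at a time.\<close>

lemma dsum_square:
 assumes g: "grid s m" and h: "!!i. i < m ==> h i : Bm (F (s i))"
 shows "NI M (%v. en ((dsum s h m v)^2)) = NI M (%v. en (qv s h m v))"
 using assms
proof (induction m)
 case (Suc m)
 have g: "grid s m" using Suc.prems(1) by (simp add: grid_def)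
 have I: "s m : I" "s (Suc m) : I" "s m <= s (Suc m)" using Suc.prems(1) by (auto simp: grid_def)
 have hm: "h i : Bm (F (s i))" if "i < m" for i using Suc.prems(2) that by simp
 have dm: "dsum s h m : Bm (F (s m))" using dsum_measurable[OF g hm, of m] by simp
 have h: "h m : Bm (F (s m))" using Suc.prems(2) by simp
 have hM [measurable]: "h i : Bm M" if "i <= m" for i
 using F_M[OF _ Suc.prems(2)] Suc.prems(1) that by (auto simp: grid_def)
 have dM [measurable]: "dsum s h m : Bm M" using F_M[OF I(1) dm] .
 let ?S = "%v. SUM i<m. (h i v)^2 * (s (Suc i) - s i)"
 have S0: "0 <= ?S v" for v using g by (intro sum_nonneg) (auto simp: grid_def)
 have [measurable]: "?S : Bm M" by (rule borel_measurable_sum) (use hM in auto)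
 have [measurable]: "h m : Bm M" using hM by simp
 have "NI M (%v. en ((dsum s h (Suc m) v)^2)) = NI M (%v. en ((dsum s h m v + h m v * (bt (s (Suc m)) v - bt (s m) v))^2))"
 by (simp add: dsum_def)
 also have "... = NI M (%v. en ((dsum s h m v)^2 + (h m v)^2 * (s (Suc m) - s m)))"
 by (rule increment_square[OF I dm h])
 also have "... = NI M (%v. en ((dsum s h m v)^2)) + NI M (%v. en ((h m v)^2 * (s (Suc m) - s m)))"
 using I by (subst nn_integral_add[symmetric]) auto
 also have "... = NI M (%v. en (?S v)) + NI M (%v. en ((h m v)^2 * (s (Suc m) - s m)))"
 using Suc.IH[OF g hm] by simp
 also have "... = NI M (%v. en (SUM i<Suc m. (h i v)^2 * (s (Suc i) - s i)))"
 using I S0 by (subst nn_integral_add[symmetric]) (auto intro!: nn_integral_cong)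
 finally show ?case .
qed (simp add: dsum_def)

text \<open>
 Stopping the weights as soon as the accumulated variance exceeds \<open>de\<close> or the sum leaves
 \<open>(-ee, ee)\<close> keeps them predictable and turns the second moment identity into a maximal inequality.
\<close>

lemma dsum_maximal:
 assumes g: "grid s m" and h: "!!i. i < m ==> h i : Bm (F (s i))"
 and e: "0 < ee" and d: "0 <= de"
 shows "\<P>(v in M. EX l<=m. ee <= abs (dsum s h l v)) <=
 de / ee^2 + \<P>(v in M. de < (qv s h m v))"
proof -
 define A where "A l v = (qv s h l v)" for l v
 define k where "k i v = (if A (Suc i) v <= de & (ALL l<=i. abs (dsum s h l v) < ee) then h i v else 0)" for i v
 have inI: "s i : I" if "i <= m" for i using g that by (auto simp: grid_def)
 have hF: "h i : Bm (F (s j))" if "i < m" "i <= j" "j <= m" for i j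
 using F_mono[OF grid_mono[OF g that(2,3)] h[OF that(1)]] .
 have hM: "h i : Bm M" if "i < m" for i
 using F_M[OF inI h] that by simp
 have AF: "A (Suc i) : Bm (F (s i))" if "i < m" for i
 unfolding A_def using hF that by (intro borel_measurable_sum) auto
 have AM [measurable]: "A i : Bm M" if "i <= m" for i
 unfolding A_def using hM that by (intro borel_measurable_sum) auto
 have dF: "dsum s h l : Bm (F (s i))" if "l <= i" "i <= m" for i l
 using F_mono[OF grid_mono[OF g that] dsum_measurable[OF g h]] that by auto
 have dM: "dsum s h l : Bm M" if "l <= m" for l
 using F_M[OF inI dF] that by blast
 have kF: "k i : Bm (F (s i))" if i: "i < m" for i
 proof -
 have p1: "Measurable.pred (F (s i)) (%v. A (Suc i) v <= de)"
 using AF[OF i] by measurable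
 have p2: "Measurable.pred (F (s i)) (%v. ALL l<=i. abs (dsum s h l v) < ee)"
 proof -
 have "Measurable.pred (F (s i)) (%v. ALL l:{..i}. abs (dsum s h l v) < ee)"
 proof (rule pred_intros_finite)
 fix l assume "l : {..i}"
 hence [measurable]: "dsum s h l : Bm (F (s i))" using dF i by simp
 show "Measurable.pred (F (s i)) (%v. abs (dsum s h l v) < ee)" by measurable
 qed simp
 thus ?thesis by (simp only: Ball_def atMost_iff)
 qed
 show ?thesis unfolding k_def
 using pred_intros_logic(3)[OF p1 p2] h[OF i] by (intro measurable_If) (simp_all only: pred_def borel_measurable_const)
 qed
 have ds: "0 <= s (Suc i) - s i" if "i < m" for i using g that by (simp add: grid_def)
 have A_mono: "A i v <= A j v" if "i <= j" "j <= m" for i j v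
 unfolding A_def using that ds by (intro sum_mono2) auto
 have kA: "(qv s k l v) <= de" if "l <= m" for l v
 using that
 proof (induction l)
 case (Suc l)
 show ?case
 proof (cases "A (Suc l) v <= de")
 case True
 have "(SUM i<Suc l. (k i v)^2 * (s (Suc i) - s i)) <= A (Suc l) v"
 unfolding A_def using Suc.prems ds by (intro sum_mono mult_right_mono) (auto simp: k_def)
 thus ?thesis using True by simp
 next
 case False
 hence "k l v = 0" by (simp add: k_def)
 thus ?thesis using Suc by simp
 qed
 qed (use d in simp)
 have stop: "ee <= abs (dsum s k m v)" if A: "A m v <= de" and ex: "EX l<=m. ee <= abs (dsum s h l v)" for v
 proof -
 define L where "L = (LEAST l. ee <= abs (dsum s h l v))"
 have L: "ee <= abs (dsum s h L v)" and Lm: "L <= m"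
 proof -
 obtain l where l: "l <= m" "ee <= abs (dsum s h l v)" using ex by blast
 show "ee <= abs (dsum s h L v)" unfolding L_def by (rule LeastI[of _ l]) (rule l)
 show "L <= m" unfolding L_def by (rule order_trans[OF Least_le[of _ l]]) (rule l)+
 qed
 have before: "abs (dsum s h l v) < ee" if "l < L" for l
 using not_less_Least[of l "%l. ee <= abs (dsum s h l v)"] that unfolding L_def[symmetric] by auto
 have "dsum s k m v = (SUM i<L. k i v * (bt (s (Suc i)) v - bt (s i) v))"
 unfolding dsum_def using Lm L by (intro sum.mono_neutral_right) (auto simp: k_def)
 also have "... = dsum s h L v"
 unfolding dsum_def
 proof (intro sum.cong refl)
 fix i assume "i : {..<L}"
 hence i: "i < L" by simp
 have "A (Suc i) v <= de" using A A_mono[of "Suc i" m v] i Lm by simp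
 thus "k i v * (bt (s (Suc i)) v - bt (s i) v) = h i v * (bt (s (Suc i)) v - bt (s i) v)"
 using before i by (simp add: k_def)
 qed
 finally show ?thesis using L by simp
 qed
 have kM [measurable]: "dsum s k m : Bm M"
 using F_M[OF inI dsum_measurable[OF g kF]] by blast
 have "emeasure M {v:space M. ee <= abs (dsum s k m v)} <= en (1 / ee^2) * NI M (%v. en ((dsum s k m v)^2) * Ind (space M) v)"
 proof (rule order_trans[OF emeasure_mono nn_integral_Markov_inequality])
 show "{v : space M. ee <= abs (dsum s k m v)} <= {v : space M. 1 <= en (1 / ee^2) * en ((dsum s k m v)^2)}"
 proof safe
 fix v assume "ee <= abs (dsum s k m v)"
 hence "ee^2 <= (dsum s k m v)^2" using e power_mono[of ee "abs (dsum s k m v)" 2] by simp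
 thus "1 <= en (1 / ee^2) * en ((dsum s k m v)^2)"
 using e by (simp add: ennreal_mult'[symmetric] field_simps)
 qed
 qed auto
 also have "... = en (1 / ee^2) * NI M (%v. en (qv s k m v))"
 proof -
 have "NI M (%v. en ((dsum s k m v)^2) * Ind (space M) v) = NI M (%v. en ((dsum s k m v)^2))"
 by (rule nn_integral_cong) simp
 thus ?thesis by (simp only: dsum_square[OF g kF])
 qed
 also have "... <= en (1 / ee^2) * NI M (%v. en de)"
 using kA by (intro mult_left_mono nn_integral_mono ennreal_leI) auto
 also have "... = en (de / ee^2)" using d by (simp add: emeasure_space_1 ennreal_mult'[symmetric])
 finally have markov: "\<P>(v in M. ee <= abs (dsum s k m v)) <= de / ee^2"
 using d by (simp add: emeasure_eq_measure)
 have "\<P>(v in M. EX l<=m. ee <= abs (dsum s h l v)) <= prob ({v:space M. ee <= abs (dsum s k m v)} Un {v:space M. de < A m v})"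
 proof (rule finite_measure_mono)
 show "{v:space M. EX l<=m. ee <= abs (dsum s h l v)} <= {v:space M. ee <= abs (dsum s k m v)} Un {v:space M. de < A m v}"
 proof
 fix v assume "v : {v:space M. EX l<=m. ee <= abs (dsum s h l v)}"
 thus "v : {v:space M. ee <= abs (dsum s k m v)} Un {v:space M. de < A m v}"
 using stop[of v] by (cases "A m v <= de") auto
 qed
 qed auto
 also have "... <= \<P>(v in M. ee <= abs (dsum s k m v)) + \<P>(v in M. de < A m v)"
 by (rule measure_Un_le) auto
 finally show ?thesis using markov unfolding A_def by simp
qed

end

section \<open>Grids and elementary processes\<close>

lemma grid_exists:
 fixes S :: "real set"
 assumes S: "finite S" "S <= {0..T}" and T: "0 <= T"
 shows "EX s m. s 0 = 0 & s m = T & (ALL i<m. s i <= s (Suc i)) & (ALL i<=m. 0 <= s i & s i <= T) & S <= s ` {..m} &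
 (ALL x:S. ALL i<m. x <= s i | s (Suc i) <= (x :: real))"
proof -
 define A where "A = insert 0 (insert T S)"
 define xs where "xs = sorted_list_of_set A"
 define m where "m = length xs - 1"
 have fA: "finite A" using S by (simp add: A_def)
 have set: "set xs = A" and st: "sorted_wrt (<) xs" using fA by (auto simp: xs_def)
 have len: "length xs = Suc m"
 using set by (cases xs) (auto simp: m_def A_def)
 have less: "xs ! i < xs ! j" if "i < j" "j <= m" for i j
 using sorted_wrt_nth_less[OF st, of i j] that len by simp
 have le: "xs ! i <= xs ! j" if "i <= j" "j <= m" for i j
 using less[of i j] that by (cases "i = j") auto
 have idx: "EX l<=m. x = xs ! l" if "x : A" for x
 using that set len by (metis in_set_conv_nth less_Suc_eq_le)
 have mem: "xs ! i : A" if "i <= m" for i using that set len by (metis less_Suc_eq_le nth_mem)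
 have AT: "0 <= x & x <= T" if "x : A" for x using that S T by (auto simp: A_def)
 obtain l where l: "l <= m" "0 = xs ! l" using idx[of 0] unfolding A_def by blast
 have z: "xs ! 0 = 0" using le[of 0 l] l AT[OF mem[of 0]] by simp
 obtain k where k: "k <= m" "T = xs ! k" using idx[of T] unfolding A_def by blast
 have t: "xs ! m = T" using le[of k m] k AT[OF mem[of m]] by simp
 show ?thesis
 proof (intro exI[of _ "%i. xs ! i"] exI[of _ m] conjI ballI allI impI)
 show "S <= (%i. xs ! i) ` {..m}"
 proof
 fix x assume "x : S"
 then obtain l where "l <= m" "x = xs ! l" using idx[of x] unfolding A_def by blast
 thus "x : (%i. xs ! i) ` {..m}" by simp
 qed
 show "xs ! 0 = 0" "xs ! m = T" by fact+
 show "xs ! i <= xs ! Suc i" if "i < m" for i using le[of i "Suc i"] that by simp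
 show "0 <= xs ! i" "xs ! i <= T" if "i <= m" for i using AT[OF mem[OF that]] by simp_all
 fix x i assume x: "x : S" and i: "i < m"
 obtain l where l: "l <= m" "x = xs ! l" using idx[of x] x unfolding A_def by blast
 show "x <= xs ! i | xs ! Suc i <= x"
 proof (cases "l <= i")
 case True
 hence "xs ! l <= xs ! i" using le[of l i] i by simp
 thus ?thesis using l(2) by simp
 next
 case False
 hence "xs ! Suc i <= xs ! l" using le[of "Suc i" l] l(1) by simp
 thus ?thesis using l(2) by simp
 qed
 qed
qed

text \<open>The cells are left-open, so the value on a cell is read off at its right endpoint; the
  single point 0 is a null set.\<close>

lemma nn_integral_step:
 fixes f :: "real => real"
 assumes f [measurable]: "f : Bm borel" and s0: "s 0 = 0"
 and s: "!!i. i < m ==> s i <= s (Suc i)"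
 and const: "!!i x. i < m ==> s i < x ==> x <= s (Suc i) ==> f x = f (s (Suc i))"
 shows "NL (s m) (%x. en ((f x)^2)) = en (SUM i<m. (f (s (Suc i)))^2 * (s (Suc i) - s i))"
 using s const
proof (induction m)
 case 0
 have "NL (s 0) (%x. en ((f x)^2)) = NI (lborel :: real measure) (%x. 0)"
 proof (rule nn_integral_cong_AE)
 show "AE x in lborel. en ((f x)^2) * Ind {0..s 0} x = 0"
 using AE_lborel_singleton[of 0] by eventually_elim (simp add: s0)
 qed
 thus ?case by simp
next
 case (Suc m)
 have le0: "0 <= s i" if "i <= m" for i
 using that
 proof (induction i)
 case (Suc i) thus ?case using Suc.prems \<open>!!i. i < Suc m ==> s i <= s (Suc i)\<close>[of i] by simp
 qed (simp add: s0)
 have le: "s m <= s (Suc m)" using Suc.prems(1) by simp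
 have "NL (s (Suc m)) (%x. en ((f x)^2)) =
 NI lborel (%x. en ((f x)^2) * Ind {0..s m} x + en ((f (s (Suc m)))^2) * Ind {s m<..s (Suc m)} x)"
 proof (rule nn_integral_cong)
 fix x
 show "en ((f x)^2) * Ind {0..s (Suc m)} x =
 en ((f x)^2) * Ind {0..s m} x + en ((f (s (Suc m)))^2) * Ind {s m<..s (Suc m)} x"
 proof (cases "x : {s m<..s (Suc m)}")
 case True
 hence "f x = f (s (Suc m))" using Suc.prems(2)[of m x] by simp
 thus ?thesis using True le0[of m] by (simp add: indicator_def)
 next
 case False
 thus ?thesis using le by (auto simp: indicator_def)
 qed
 qed
 also have "... = NL (s m) (%x. en ((f x)^2)) + en ((f (s (Suc m)))^2) * en (s (Suc m) - s m)"
 using le by (subst nn_integral_add) (auto simp: nn_integral_cmult_indicator)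
 also have "... = en (SUM i<Suc m. (f (s (Suc i)))^2 * (s (Suc i) - s i))"
 proof -
 have n: "0 <= (SUM i<m. (f (s (Suc i)))^2 * (s (Suc i) - s i))"
 proof (rule sum_nonneg)
 fix i assume "i : {..<m}"
 hence "s i <= s (Suc i)" using Suc.prems(1)[of i] by simp
 thus "0 <= (f (s (Suc i)))^2 * (s (Suc i) - s i)" by simp
 qed
 have IH: "NL (s m) (%x. en ((f x)^2)) = en (SUM i<m. (f (s (Suc i)))^2 * (s (Suc i) - s i))"
 proof (rule Suc.IH)
 show "s i <= s (Suc i)" if "i < m" for i using Suc.prems(1)[of i] that by simp
 show "f x = f (s (Suc i))" if "i < m" "s i < x" "x <= s (Suc i)" for i x
 using Suc.prems(2)[OF _ that(2,3)] that(1) by simp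
 qed
 show ?thesis unfolding IH using le n by (simp add: ennreal_mult'[symmetric] flip: ennreal_plus)
 qed
 finally show ?case .
qed

text \<open>This is what makes the process constant on each left-open cell, with a value that is
  known at the left endpoint of the cell.\<close>

definition compat :: "'a elementary => (nat => real) => nat => bool" where
 "compat E s m \<longleftrightarrow> (ALL j<=fst E. ALL i<m. fst (snd E) j <= s i | s (Suc i) <= fst (snd E) j)"

lemma elementary_mono:
 assumes "is_elementary F (n, t, xx)" "i <= j" "j <= n" shows "0 <= t i & t i <= t j"
proof -
 have m: "t i <= t j" if "i <= j" "j <= n" for i j
 using that
 proof (induction j)
 case (Suc j)
 have "t j <= t (Suc j)" using assms(1) Suc.prems by (auto simp: is_elementary_def)
 thus ?case using Suc by (cases "i = Suc j") auto
 qed simp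
 have "0 <= t 0" using assms(1) by (auto simp: is_elementary_def)
 thus ?thesis using m[of 0 i] m[of i j] assms by auto
qed

text \<open>Differences of half-line indicators replace interval indicators, so that changes of grid
  telescope.\<close>

lemma elementary_process_eq:
 assumes el: "is_elementary F (n, t, xx)"
 shows "EP (n, t, xx) x v = (SUM j<n. xx j v * (of_bool (x <= t (Suc j)) - of_bool (x <= t j)))"
 unfolding elementary_process_def prod.case
proof (intro sum.cong refl arg_cong2[where f="(*)"])
 fix j assume "j : {..<n}"
 hence "t j <= t (Suc j)" using elementary_mono[OF el, of j "Suc j"] by simp
 thus "Ind {t j<..t (Suc j)} x = (of_bool (x <= t (Suc j)) - of_bool (x <= t j) :: real)"
 by (auto simp: indicator_def)
qed

lemma elementary_process_const:
 assumes el: "is_elementary F E" and c: "compat E s m" and i: "i < m" and x: "s i < x" "x <= s (Suc i)"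
 shows "EP E x v = EP E (s (Suc i)) v"
proof -
 obtain n t xx where E: "E = (n, t, xx)" by (cases E)
 have "(x <= t j) = (s (Suc i) <= t j)" if "j <= n" for j
 using c[unfolded compat_def E, rule_format, of j i] that i x by auto
 thus ?thesis unfolding E elementary_process_eq[OF el[unfolded E]] by (intro sum.cong) auto
qed

lemma elementary_process_borel [measurable]: "(%x. EP E x v) : Bm borel"
proof -
 obtain n t xx where E: "E = (n, t, xx)" by (cases E)
 show ?thesis unfolding E elementary_process_def prod.case by measurable
qed

lemma grid_telescope:
 fixes f :: "real => real"
 assumes "!!i. i < l ==> s i <= s (Suc i)" "!!i. i < l ==> a <= s i | s (Suc i) <= a"
 shows "(SUM i<l. of_bool (s (Suc i) <= a) * (f (min u (s (Suc i))) - f (min u (s i)))) = f (min u (max (s 0) (min a (s l)))) - f (min u (s 0))"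
 using assms
proof (induction l)
 case (Suc l)
 have mono: "s 0 <= s l" using Suc.prems(1)
 proof (induction l)
 case (Suc l) thus ?case by (meson less_Suc_eq less_SucI order_trans order_refl)
 qed simp
 have IH: "(SUM i<l. of_bool (s (Suc i) <= a) * (f (min u (s (Suc i))) - f (min u (s i)))) = f (min u (max (s 0) (min a (s l)))) - f (min u (s 0))"
 using Suc by simp
 have step: "s l <= s (Suc l)" "a <= s l | s (Suc l) <= a" using Suc.prems by auto
 show ?case
 proof (cases "s (Suc l) <= a")
 case True
 hence "max (s 0) (min a (s l)) = s l" "max (s 0) (min a (s (Suc l))) = s (Suc l)" using step mono by auto
 thus ?thesis using True IH by simp
 next
 case False
 hence "min a (s l) = a" "min a (s (Suc l)) = a" using step by auto
 thus ?thesis using False IH by simp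
 qed
qed simp

context gauss_incr
begin

definition gint :: "(nat => real) => (nat => 'a => real) => nat => real => 'a => real" where
 "gint s g m u v = (SUM i<m. g i v * (bt (min u (s (Suc i))) v - bt (min u (s i)) v))"

lemma gint_grid:
 assumes g: "grid s m" and l: "l <= m"
 shows "gint s h m (s l) v = dsum s h l v"
proof -
 have "gint s h m (s l) v = (SUM i<l. h i v * (bt (min (s l) (s (Suc i))) v - bt (min (s l) (s i)) v))"
 unfolding gint_def using l grid_mono[OF g]
 by (intro sum.mono_neutral_right) (auto simp: min_def not_less)
 also have "... = dsum s h l v"
 unfolding dsum_def
 proof (intro sum.cong refl)
 fix i assume "i : {..<l}"
 hence "s i <= s l" "s (Suc i) <= s l" using grid_mono[OF g] l by auto
 thus "h i v * (bt (min (s l) (s (Suc i))) v - bt (min (s l) (s i)) v) = h i v * (bt (s (Suc i)) v - bt (s i) v)"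
 by (simp add: min_absorb2)
 qed
 finally show ?thesis .
qed

text \<open>Increments telescope under refinement, so an elementary integral can be rewritten on any
  compatible grid. Two of them can then be compared cell by cell on a common grid.\<close>

lemma elementary_integral_grid:
 assumes el: "is_elementary F E" and g: "grid s m" and s0: "s 0 = 0" and c: "compat E s m"
 and u: "0 <= u" "u <= s m"
 shows "EI bt E u v = gint s (%i. EP E (s (Suc i))) m u v"
proof -
 obtain n t xx where E: "E = (n, t, xx)" by (cases E)
 note el = el[unfolded E]
 have tel: "bt (min u (t j)) v - bt 0 v = (SUM i<m. of_bool (s (Suc i) <= t j) * (bt (min u (s (Suc i))) v - bt (min u (s i)) v))"
 if j: "j <= n" for j
 proof -
 have "0 <= t j" using elementary_mono[OF el, of j j] j by simp
 hence "min u (max (s 0) (min (t j) (s m))) = min u (t j)" "min u (s 0) = 0" using u s0 by auto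
 thus ?thesis
 using grid_telescope[of m s "t j" "%x. bt x v" u] g c[unfolded compat_def E] j by (auto simp: grid_def)
 qed
 have "EI bt E u v = (SUM j<n. xx j v * ((bt (min u (t (Suc j))) v - bt 0 v) - (bt (min u (t j)) v - bt 0 v)))"
 by (simp add: E elementary_integral_def)
 also have "... = (SUM j<n. xx j v * (SUM i<m. (of_bool (s (Suc i) <= t (Suc j)) - of_bool (s (Suc i) <= t j)) * (bt (min u (s (Suc i))) v - bt (min u (s i)) v)))"
 proof (intro sum.cong refl arg_cong2[where f="(*)"])
 fix j assume "j : {..<n}"
 hence j: "j <= n" "Suc j <= n" by auto
 show "bt (min u (t (Suc j))) v - bt 0 v - (bt (min u (t j)) v - bt 0 v) =
 (SUM i<m. (of_bool (s (Suc i) <= t (Suc j)) - of_bool (s (Suc i) <= t j)) * (bt (min u (s (Suc i))) v - bt (min u (s i)) v))"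
 unfolding tel[OF j(1)] tel[OF j(2)] left_diff_distrib sum_subtractf ..
 qed
 also have "... = (SUM i<m. (SUM j<n. xx j v * (of_bool (s (Suc i) <= t (Suc j)) - of_bool (s (Suc i) <= t j))) * (bt (min u (s (Suc i))) v - bt (min u (s i)) v))"
 by (simp add: sum_distrib_left sum_distrib_right mult.assoc sum.swap[of _ "{..<n}"])
 also have "... = gint s (%i. EP E (s (Suc i))) m u v"
 by (simp add: gint_def E elementary_process_eq[OF el])
 finally show ?thesis .
qed

text \<open>A jump time below the right end of a cell is at most its left end, so its coefficient is
  already known there.\<close>

lemma elementary_process_predictable:
 assumes el: "is_elementary F E" and g: "grid s m" and c: "compat E s m" and i: "i < m"
 shows "EP E (s (Suc i)) : Bm (F (s i))"
proof -
 obtain n t xx where E: "E = (n, t, xx)" by (cases E)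
 have "EP (n, t, xx) (s (Suc i)) : Bm (F (s i))"
 unfolding elementary_process_def prod.case
 proof (rule borel_measurable_sum)
 fix j assume "j : {..<n}"
 hence j: "j < n" by simp
 show "(%v. xx j v * Ind {t j<..t (Suc j)} (s (Suc i))) : Bm (F (s i))"
 proof (cases "t j < s (Suc i)")
 case True
 hence "t j <= s i" using c[unfolded compat_def E, rule_format, of j i] i j by auto
 hence "xx j : Bm (F (s i))"
 using el[unfolded E is_elementary_def] j F_mono[of "t j" "s i"] by auto
 thus ?thesis by measurable
 qed simp
 qed
 thus ?thesis by (simp add: E)
qed

lemma elementary_process_bounded:
 assumes el: "is_elementary F E" shows "EX C. ALL u. ALL v:space M. abs (EP E u v) <= C"
proof -
 obtain n t xx where E: "E = (n, t, xx)" by (cases E)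
 have "ALL j. EX C. j < n --> (ALL v:space M. abs (xx j v) <= C)"
 using el unfolding E is_elementary_def by auto
 then obtain C where C: "!!j v. j < n ==> v : space M ==> abs (xx j v) <= C j" by metis
 have "abs (EP E u v) <= (SUM j<n. C j)" if w: "v : space M" for u v
 proof -
 have "abs (EP E u v) <= (SUM j<n. abs (xx j v * Ind {t j<..t (Suc j)} u))"
 unfolding E elementary_process_def prod.case by (rule sum_abs)
 also have "... <= (SUM j<n. C j)"
 proof (rule sum_mono)
 fix j assume "j : {..<n}"
 hence "abs (xx j v) <= C j" using C[OF _ w] by simp
 thus "abs (xx j v * Ind {t j<..t (Suc j)} u) <= C j" by (auto simp: indicator_def)
 qed
 finally show ?thesis .
 qed
 thus ?thesis by blast
qed

lemma elementary_process_joint: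
 assumes el: "is_elementary F E" and I: "{0..T} <= I"
 shows "(%(s, v). EP E s v) : Bm (RB T >< M)"
proof -
 obtain n t xx where E: "E = (n, t, xx)" by (cases E)
 have "(%x. SUM j<n. xx j (snd x) * Ind {t j<..t (Suc j)} (fst x)) : Bm (RB T >< M)"
 proof (rule borel_measurable_sum)
 fix j assume "j : {..<n}"
 hence j: "j < n" by simp
 have t0: "0 <= t j" using elementary_mono[OF el[unfolded E], of j j] j by simp
 show "(%x. xx j (snd x) * Ind {t j<..t (Suc j)} (fst x)) : Bm (RB T >< M)"
 proof (cases "t j <= T")
 case True
 hence "t j : I" using t0 I by auto
 hence "xx j : Bm M"
 using el[unfolded E is_elementary_def] j F_M[of "t j"] by auto
 hence 1: "(%x. xx j (snd x)) : Bm (RB T >< M)"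
 by (rule measurable_compose[OF measurable_snd])
 have "(%s. Ind {t j<..t (Suc j)} s :: real) : Bm (RB T)"
 by (intro measurable_restrict_space1) measurable
 hence "(%x. Ind {t j<..t (Suc j)} (fst x) :: real) : Bm (RB T >< M)"
 by (rule measurable_compose[OF measurable_fst])
 thus ?thesis using 1 by (rule borel_measurable_times[rotated])
 next
 case False
 have "(%x. xx j (snd x) * Ind {t j<..t (Suc j)} (fst x)) : Bm (RB T >< M) \<longleftrightarrow>
 (%x. 0 :: real) : Bm (RB T >< M)"
 using False by (intro measurable_cong) (auto simp: space_pair_measure space_restrict_space)
 thus ?thesis by simp
 qed
 qed
 thus ?thesis by (simp only: E elementary_process_def prod.case case_prod_beta' fst_conv snd_conv)
qed

lemma elementary_integral_measurable:
 assumes el: "is_elementary F E" and t: "t : I"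
 shows "EI bt E t : Bm M"
proof -
 obtain n t' xx where E: "E = (n, t', xx)" by (cases E)
 show ?thesis unfolding E elementary_integral_def prod.case
 proof (rule borel_measurable_sum)
 fix i assume "i : {..<n}"
 hence i: "i < n" by simp
 have t0: "0 <= t' i" "t' i <= t' (Suc i)" using elementary_mono[OF el[unfolded E], of i "Suc i"] i by auto
 have [measurable]: "bt (min t (t' i)) : Bm M" "bt (min t (t' (Suc i))) : Bm M"
 using t0 times_nonneg[OF t] by (auto intro!: bt_measurable times_down[OF t])
 show "(%v. xx i v * (bt (min t (t' (Suc i))) v - bt (min t (t' i)) v)) : Bm M"
 proof (cases "t' i <= t")
 case True
 hence [measurable]: "xx i : Bm M"
 using el[unfolded E is_elementary_def] i F_M[of "t' i"] times_down[OF t t0(1)] t0 by auto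
 show ?thesis by measurable
 next
 case False
 hence "min t (t' (Suc i)) = min t (t' i)" using t0 by auto
 thus ?thesis by simp
 qed
 qed
qed

end

section \<open>Ito integrals as limits of elementary integrals\<close>

lemma dense_rationals_Icc:
 fixes T :: real assumes T: "0 <= T" shows "{0..T} <= closure ({0..T} Int Rats)"
proof (cases "T = 0")
 case False
 hence "{0..T} = closure {0<..<T}" using T by (simp add: closure_greaterThanLessThan)
 also have "... = closure ({0<..<T} Int Rats)"
 using closure_open_Int_superset[of "{0<..<T}" "Rats"] by (simp add: Rats_closure_real)
 also have "... <= closure ({0..T} Int Rats)" by (intro closure_mono) auto
 finally show ?thesis .
next
 case True
 hence "{0..T} <= {0..T} Int Rats" by auto
 thus ?thesis using closure_subset by blast
qed

lemma section_measurable: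
 assumes f: "(%(s, vo). f s vo) : Bm (RB T >< N)" and w: "vo : space N"
 shows "(%s. f s vo) : Bm (RB T)"
 using measurable_compose[OF measurable_Pair2'[OF w] f] by simp

lemma set_nn_integral_restrict:
 fixes f :: "real => ennreal"
 assumes "A : sets borel"
 shows "NS lborel A (%s. f s) = NI (restrict_space lborel A) (%s. f s)"
 using assms by (subst nn_integral_restrict_space) auto

lemma sigma_finite_restrict_lborel: "A : sets borel ==> sigma_finite_measure (restrict_space lborel (A :: real set))"
 by (rule sigma_finite_measure_restrict_space[OF sigma_finite_lborel]) auto

lemma set_nn_integral_measurable:
 fixes f :: "real => 'b => ennreal"
 assumes f: "(%(s, vo). f s vo) : Bm (RB T >< N)"
 shows "(%vo. NL T (%s. f s vo)) : Bm N"
proof -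
 interpret sigma_finite_measure "restrict_space lborel {0..T}" by (rule sigma_finite_restrict_lborel) simp
 have "(%(s, vo). f s vo) : Bm (restrict_space lborel {0..T} >< N)"
 using f measurable_cong_sets[OF sets_pair_measure_cong[OF sets_restrict_space_cong[OF sets_lborel] refl] refl] by blast
 hence "(%(vo, s). f s vo) : Bm (N >< restrict_space lborel {0..T})"
 by (subst measurable_pair_swap_iff) (simp add: case_prod_beta')
 hence "(%vo. NI (restrict_space lborel {0..T}) (%s. f s vo)) : Bm N"
 by (rule borel_measurable_nn_integral)
 thus ?thesis by (simp add: set_nn_integral_restrict)
qed

text \<open>The properties of an Ito integral on \<open>[0,T]\<close> that survive a change of
  measure: all convergence is in probability, and \<open>bt\<close> can be the Brownian motion with
  added drift under the new density.\<close>

locale approx = gauss_incr M F bt "{0..T}" for M :: "'a measure" and F bt and T :: real +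
 fixes E :: "nat => 'a elementary" and v J :: "real => 'a => real"
 assumes T: "0 <= T"
 and el: "is_elementary F (E k)"
 and v_joint: "(%(s, vo). v s vo) : Bm (RB T >< M)"
 and v_finite: "AE vo in M. NL T (%s. en ((v s vo)^2)) < \<infinity>"
 and J_measurable: "t : {0..T} ==> J t : Bm M"
 and J_continuous: "AE vo in M. Con {0..T} (%t. J t vo)"
 and v_lim: "0 < ee ==> (%k. \<P>(vo in M. en ee <
 NL T (%s. en ((EP (E k) s vo - v s vo)^2)))) ----> 0"
 and J_lim: "t : {0..T} ==> 0 < ee ==>
 (%k. \<P>(vo in M. ee < abs (EI bt (E k) t vo - J t vo))) ----> 0"
begin

abbreviation "V k s \<equiv> EP (E k) s"
abbreviation "JE k t \<equiv> EI bt (E k) t"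

lemma JE_measurable: "t : {0..T} ==> JE k t : Bm M"
 by (rule elementary_integral_measurable[OF el])

lemma V_joint: "(%(s, vo). V k s vo) : Bm (RB T >< M)"
 by (rule elementary_process_joint[OF el subset_refl])

lemma diff_joint: "(%(s, vo). en ((V k s vo - v s vo)^2)) : Bm (RB T >< M)"
proof -
 have "(%x. en (((%(s, vo). V k s vo) x - (%(s, vo). v s vo) x)^2)) : Bm (RB T >< M)"
 using V_joint[of k] v_joint by measurable
 thus ?thesis by (simp only: case_prod_beta')
qed

lemma V_diff_joint: "(%(s, vo). en ((V k s vo - V j s vo)^2)) : Bm (RB T >< M)"
proof -
 have "(%x. en (((%(s, vo). V k s vo) x - (%(s, vo). V j s vo) x)^2)) : Bm (RB T >< M)"
 using V_joint[of k] V_joint[of j] by measurable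
 thus ?thesis by (simp only: case_prod_beta')
qed

definition "err k vo = NL T (%s. en ((V k s vo - v s vo)^2))"
definition "err2 k j vo = NL T (%s. en ((V k s vo - V j s vo)^2))"

lemma err_measurable [measurable]: "err k : Bm M"
 unfolding err_def by (rule set_nn_integral_measurable[OF diff_joint])

lemma err2_measurable [measurable]: "err2 k j : Bm M"
 unfolding err2_def by (rule set_nn_integral_measurable[OF V_diff_joint])

lemma err_lim: "0 < ee ==> (%k. pgt M ee (err k)) ----> 0"
 using v_lim unfolding err_def .

lemma sq_split:
 assumes a: "a : Bm (RB T)" and b: "b : Bm (RB T)"
 and c: "!!s. s : {0..T} ==> (c s)^2 <= 2 * (a s)^2 + 2 * (b s :: real)^2"
 shows "NL T (%s. en ((c s)^2)) <=
 2 * NL T (%s. en ((a s)^2)) + 2 * NL T (%s. en ((b s)^2))"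
proof -
 let ?R = "restrict_space lborel {0..T}"
 have ab [measurable]: "a : Bm ?R" "b : Bm ?R"
 using a b measurable_cong_sets[OF sets_restrict_space_cong[OF sets_lborel, of "{0..T}"] refl] by blast+
 have "NI ?R (%s. en ((c s)^2)) <= NI ?R (%s. 2 * en ((a s)^2) + 2 * en ((b s)^2))"
 proof (rule nn_integral_mono)
 fix s assume "s : space ?R"
 hence "s : {0..T}" by (simp add: space_restrict_space)
 from c[OF this] have "en ((c s)^2) <= en (2 * (a s)^2 + 2 * (b s)^2)" by (rule ennreal_leI)
 also have "... = 2 * en ((a s)^2) + 2 * en ((b s)^2)"
 by (simp add: ennreal_mult')
 finally show "en ((c s)^2) <= 2 * en ((a s)^2) + 2 * en ((b s)^2)" .
 qed
 also have "... = 2 * NI ?R (%s. en ((a s)^2)) + 2 * NI ?R (%s. en ((b s)^2))"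
 by (subst nn_integral_add) (auto simp: nn_integral_cmult)
 finally show ?thesis by (simp add: set_nn_integral_restrict)
qed

lemma sq_le: "(x - y)^2 <= 2 * (x - z)^2 + 2 * (y - z :: real)^2"
proof -
 have "0 <= ((x - z) + (y - z))^2" by simp
 thus ?thesis by (simp add: power2_eq_square algebra_simps)
qed

lemma ennreal_split4: "en de < x ==> x <= 2 * a + 2 * b ==> 0 <= de ==> ennreal (de / 4) < a | en (de / 4) < b"
proof (rule ccontr)
 assume *: "en de < x" "x <= 2 * a + 2 * b" "0 <= de" "~  (en (de / 4) < a | en (de / 4) < b)"
 hence "a <= en (de / 4)" "b <= en (de / 4)" by auto
 hence "2 * a + 2 * b <= 2 * en (de / 4) + 2 * en (de / 4)"
 by (intro add_mono mult_left_mono) auto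
 also have "... = en (2 * (de / 4) + 2 * (de / 4))"
 proof -
 have "2 * en (de / 4) = en (2 * (de / 4))" using ennreal_mult'[of 2 "de / 4"] by simp
 thus ?thesis using *(3) by (simp only: ennreal_plus)
 qed
 also have "... = en de" by (rule arg_cong[where f=ennreal]) simp
 finally show False using * by (auto dest: order.strict_trans1 order_trans)
qed

lemma err2_le: "vo : space M ==> err2 k j vo <= 2 * err k vo + 2 * err j vo"
 unfolding err2_def err_def
proof (rule sq_split)
 assume w: "vo : space M"
 note 1 = section_measurable[OF V_joint w] and 2 = section_measurable[OF v_joint w]
 show "(%s. V k s vo - v s vo) : Bm (RB T)"
 "(%s. V j s vo - v s vo) : Bm (RB T)"
 using 1 2 by (auto intro!: borel_measurable_diff)
qed (rule sq_le)

lemma prob_err2: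
 assumes d: "0 <= de"
 shows "\<P>(vo in M. en de < err2 k j vo) <=
 pgt M (de / 4) (err k) + pgt M (de / 4) (err j)"
proof -
 have "\<P>(vo in M. en de < err2 k j vo) <=
 prob ({vo:space M. en (de / 4) < err k vo} Un {vo:space M. en (de / 4) < err j vo})"
 proof (rule finite_measure_mono)
 show "{vo:space M. en de < err2 k j vo} <= {vo:space M. en (de / 4) < err k vo} Un {vo:space M. en (de / 4) < err j vo}"
 using ennreal_split4[OF _ err2_le d] by blast
 qed measurable
 also have "... <= pgt M (de / 4) (err k) + pgt M (de / 4) (err j)"
 by (rule measure_Un_le) auto
 finally show ?thesis .
qed

lemma common_grid:
 assumes S: "finite S" "S <= {0..T}" and K: "finite K"
 obtains s m where "s 0 = 0" "s m = T" "grid s m" "S <= s ` {..m}" "!!k. k : K ==> compat (E k) s m"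
proof -
 let ?P = "S Un ((UN k:K. (fst (snd (E k))) ` {..fst (E k)}) Int {0..T})"
 have "finite ?P" "?P <= {0..T}" using S K by auto
 from grid_exists[OF this T] obtain s m where s: "s 0 = 0" "s m = T" "ALL i<m. s i <= s (Suc i)"
 "ALL i<=m. 0 <= s i & s i <= T" "?P <= s ` {..m}" "ALL x:?P. ALL i<m. x <= s i | s (Suc i) <= x" by blast
 have "compat (E k) s m" if k: "k : K" for k
 unfolding compat_def
 proof (intro allI impI)
 fix j i assume j: "j <= fst (E k)" and i: "i < m"
 obtain n t xx where E: "E k = (n, t, xx)" by (cases "E k")
 have t0: "0 <= t j" using elementary_mono[OF el[of k, unfolded E], of j j] j E by simp
 show "fst (snd (E k)) j <= s i | s (Suc i) <= fst (snd (E k)) j"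
 proof (cases "t j <= T")
 case True
 hence "t j : ?P" using t0 j k E by force
 thus ?thesis using s(6) i E by simp
 next
 \<comment> \<open>Jump times beyond \<open>T\<close> lie to the right of every cell.\<close>
 case False
 thus ?thesis using s(4)[rule_format, of "Suc i"] i E by simp
 qed
 qed
 moreover have "grid s m" using s by (auto simp: grid_def)
 ultimately show ?thesis using s by (intro that[of s m]) auto
qed

text \<open>On a common grid the difference of two elementary integrals is one discrete sum whose
  quadratic variation is exactly \<open>err2\<close>, so \<open>dsum_maximal\<close>
  applies.\<close>

lemma max_pair:
 assumes S: "finite S" "S <= {0..T}" and e: "0 < ee" and d: "0 <= de"
 shows "prob (dev M S ee (JE k) (JE j)) <= de / ee^2 + \<P>(vo in M. en de < err2 k j vo)"
proof -
 obtain s m where s: "s 0 = 0" "s m = T" and g: "grid s m" and Ss: "S <= s ` {..m}" and c: "compat (E k) s m" "compat (E j) s m"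
 using common_grid[OF S, of "{k, j}"] by (metis finite.emptyI finite.insertI insertCI)
 define h where "h i vo = V k (s (Suc i)) vo - V j (s (Suc i)) vo" for i vo
 have hF: "h i : Bm (F (s i))" if "i < m" for i
 unfolding h_def using elementary_process_predictable[OF el g] c that by (intro borel_measurable_diff) auto
 have sT: "0 <= s l & s l <= s m" if "l <= m" for l using g that s by (auto simp: grid_def)
 have diff: "JE k (s l) vo - JE j (s l) vo = dsum s h l vo" if l: "l <= m" for l vo
 proof -
 have "JE k (s l) vo - JE j (s l) vo = gint s h m (s l) vo"
 using elementary_integral_grid[OF el g s(1) _ , of _ "s l" vo] c sT[OF l]
 by (simp add: gint_def h_def left_diff_distrib sum_subtractf)
 thus ?thesis using gint_grid[OF g l] by simp
 qed
 have e2: "err2 k j vo = en (qv s h m vo)" for vo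
 proof -
 have "NL (s m) (%x. en ((V k x vo - V j x vo)^2)) =
 en (SUM i<m. (V k (s (Suc i)) vo - V j (s (Suc i)) vo)^2 * (s (Suc i) - s i))"
 proof (rule nn_integral_step[where f="%x. V k x vo - V j x vo"])
 show "s i <= s (Suc i)" if "i < m" for i using g that by (simp add: grid_def)
 show "V k x vo - V j x vo = V k (s (Suc i)) vo - V j (s (Suc i)) vo" if "i < m" "s i < x" "x <= s (Suc i)" for i x
 using elementary_process_const[OF el c(1) that, of vo] elementary_process_const[OF el c(2) that, of vo] by simp
 qed (use s in auto)
 thus ?thesis unfolding err2_def h_def s(2) .
 qed
 have "prob (dev M S ee (JE k) (JE j)) <= \<P>(vo in M. EX l<=m. ee <= abs (dsum s h l vo))"
 proof (rule finite_measure_mono)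
 show "(dev M S ee (JE k) (JE j)) <= {vo:space M. EX l<=m. ee <= abs (dsum s h l vo)}"
 proof safe
 fix vo t assume t: "t : S" "ee <= abs (JE k t vo - JE j t vo)"
 then obtain l where "l <= m" "t = s l" using Ss by auto
 thus "EX l<=m. ee <= abs (dsum s h l vo)" using t diff by auto
 qed
 have dM: "dsum s h l : Bm M" if "l <= m" for l
 using F_M[OF _ dsum_measurable[OF g hF that]] g that by (auto simp: grid_def)
 have "{vo:space M. EX l<=m. ee <= abs (dsum s h l vo)} = (UN l:{..m}. {vo:space M. ee <= abs (dsum s h l vo)})" by auto
 also have "... : sets M"
 proof (rule sets.finite_UN)
 fix l assume "l : {..m}"
 hence [measurable]: "dsum s h l : Bm M" using dM by simp
 show "{vo:space M. ee <= abs (dsum s h l vo)} : sets M" by measurable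
 qed simp
 finally show "{vo:space M. EX l<=m. ee <= abs (dsum s h l vo)} : sets M" .
 qed
 also have "... <= de / ee^2 + \<P>(vo in M. de < (qv s h m vo))"
 by (rule dsum_maximal[OF g hF e d])
 also have "{vo:space M. de < (qv s h m vo)} = {vo:space M. en de < err2 k j vo}"
 unfolding e2 using d by (simp add: ennreal_less_iff)
 finally show ?thesis .
qed

lemma dev_sets: "S <= {0..T} ==> countable S ==> (dev M S ee (JE k) J) : sets M"
proof -
 assume S: "S <= {0..T}" "countable S"
 have "(dev M S ee (JE k) J) = (UN t:S. {vo:space M. ee <= abs (JE k t vo - J t vo)})" by auto
 also have "... : sets M"
 proof (rule sets.countable_UN'[OF S(2)])
 show "(%t. {vo : space M. ee <= abs (JE k t vo - J t vo)}) ` S <= sets M"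
 proof safe
 fix t assume "t : S"
 hence [measurable]: "JE k t : Bm M" "J t : Bm M"
 using JE_measurable J_measurable S by auto
 show "{vo : space M. ee <= abs (JE k t vo - J t vo)} : sets M" by measurable
 qed
 qed
 finally show ?thesis .
qed

text \<open>In \<open>max_pair\<close> the second integral is sent to its limit \<open>J\<close>; at
  finitely many times convergence in probability at each single time is enough for this.\<close>

lemma max_finite:
 assumes S: "finite S" "S <= {0..T}" and e: "0 < ee" and d: "0 < de"
 shows "prob (dev M S (2 * ee) (JE k) J) <= de / ee^2 + pgt M (de / 4) (err k)"
proof -
 let ?p = "prob (dev M S (2 * ee) (JE k) J)"
 let ?q = "%j. de / ee^2 + pgt M (de / 4) (err k) + pgt M (de / 4) (err j) +
 (SUM t:S. \<P>(vo in M. ee / 2 < abs (JE j t vo - J t vo)))"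
 have "?p <= ?q j" for j
 proof -
 have m1: "{vo:space M. ee / 2 < abs (JE j t vo - J t vo)} : sets M" if "t : S" for t
 proof -
 have [measurable]: "JE j t : Bm M" "J t : Bm M" using that JE_measurable J_measurable S by auto
 show ?thesis by measurable
 qed
 have m2: "{vo:space M. ee <= abs (JE k t vo - JE j t vo)} : sets M" if "t : S" for t
 proof -
 have [measurable]: "JE j t : Bm M" "JE k t : Bm M" using that JE_measurable S by auto
 show ?thesis by measurable
 qed
 have "(dev M S ee (JE k) (JE j)) = (UN t:S. {vo:space M. ee <= abs (JE k t vo - JE j t vo)})" by auto
 also have "... : sets M" using S m2 by (intro sets.finite_UN) auto
 finally have m3: "(dev M S ee (JE k) (JE j)) : sets M" .
 have m4: "(UN t:S. {vo:space M. ee / 2 < abs (JE j t vo - J t vo)}) : sets M" using S m1 by (intro sets.finite_UN) auto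
 have "?p <= prob ((dev M S ee (JE k) (JE j)) Un (UN t:S. {vo:space M. ee / 2 < abs (JE j t vo - J t vo)}))"
 proof (rule finite_measure_mono)
 show "(dev M S (2 * ee) (JE k) J) <=
 (dev M S ee (JE k) (JE j)) Un (UN t:S. {vo:space M. ee / 2 < abs (JE j t vo - J t vo)})"
 proof
 fix vo assume "vo : (dev M S (2 * ee) (JE k) J)"
 then obtain t where w: "vo : space M" and t: "t : S" "2 * ee <= abs (JE k t vo - J t vo)" by blast
 have "ee <= abs (JE k t vo - JE j t vo) | ee / 2 < abs (JE j t vo - J t vo)" using t(2) e by linarith
 thus "vo : (dev M S ee (JE k) (JE j)) Un (UN t:S. {vo:space M. ee / 2 < abs (JE j t vo - J t vo)})"
 using w t(1) by blast
 qed
 qed (intro sets.Un m3 m4)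
 also have "... <= prob (dev M S ee (JE k) (JE j)) + prob (UN t:S. {vo:space M. ee / 2 < abs (JE j t vo - J t vo)})"
 by (rule measure_Un_le[OF m3 m4])
 also have "prob (UN t:S. {vo:space M. ee / 2 < abs (JE j t vo - J t vo)}) <= (SUM t:S. \<P>(vo in M. ee / 2 < abs (JE j t vo - J t vo)))"
 by (rule measure_UNION_le[OF S(1) m1])
 also have "prob (dev M S ee (JE k) (JE j)) <= de / ee^2 + \<P>(vo in M. en de < err2 k j vo)"
 using d by (intro max_pair[OF S e]) simp
 also have "\<P>(vo in M. en de < err2 k j vo) <=
 pgt M (de / 4) (err k) + pgt M (de / 4) (err j)"
 using d by (intro prob_err2) simp
 finally show ?thesis by simp
 qed
 moreover have "?q ----> de / ee^2 + pgt M (de / 4) (err k) + 0 + (SUM t:S. 0)"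
 using S d e by (intro tendsto_add tendsto_const tendsto_sum err_lim J_lim) auto
 ultimately show ?thesis
 by (intro LIMSEQ_le_const[of ?q]) auto
qed

text \<open>The bound for finite sets of times does not depend on the set, so it passes to all
  rationals by continuity of measure along an enumeration.\<close>

lemma uniform_approx:
 assumes e: "0 < ee" and h: "0 < et"
 shows "eventually (%k. prob (dev M ({0..T} Int Rats) ee (JE k) J) <= et) sequentially"
proof -
 \<comment> \<open>Half of the tolerance \<open>et\<close> goes to the maximal inequality;
   \<open>ee / 2\<close> accounts for the factor 2 lost in \<open>max_finite\<close>.\<close>
 define de where "de = et / 2 * (ee / 2)^2"
 have d: "0 < de" "de / (ee / 2)^2 = et / 2" using e h by (auto simp: de_def)
 have "eventually (%k. pgt M (de / 4) (err k) < et / 2) sequentially"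
 using order_tendstoD(2)[OF err_lim[of "de / 4"], of "et / 2"] d h by simp
 thus ?thesis
 proof eventually_elim
 case (elim k)
 define r where "r = from_nat_into (insert 0 ({0..T} Int Rats))"
 have cnt: "countable (insert 0 ({0..T} Int Rats))" using countable_rat by (auto intro: countable_Int2)
 have rng: "range r = {0..T} Int Rats"
 unfolding r_def using T cnt by (subst range_from_nat_into) auto
 let ?A = "%n. (dev M (r ` {..n}) ee (JE k) J)"
 have sub: "r ` {..n} <= {0..T}" for n using rng by blast
 have "?A n : sets M" for n using sub by (intro dev_sets) auto
 hence "(%n. prob (?A n)) ----> prob (UN n. ?A n)"
 proof (intro finite_Lim_measure_incseq)
 show "incseq ?A" unfolding incseq_def by (intro allI impI) (auto intro: order_trans)
 qed auto
 moreover have "(UN n. ?A n) = (dev M ({0..T} Int Rats) ee (JE k) J)"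
 unfolding rng[symmetric] by auto
 moreover have "prob (?A n) <= et" for n
 using max_finite[of "r ` {..n}" "ee / 2" de k] sub e d elim by simp
 ultimately show ?case by (intro LIMSEQ_le_const2[of "%n. prob (?A n)"]) auto
 qed
qed

lemma JE_continuous: "vo : space M ==> Con {0..T} (%t. JE k t vo)"
proof -
 assume w: "vo : space M"
 obtain n t xx where E: "E k = (n, t, xx)" by (cases "E k")
 have c: "Con {0..T} (%u. bt (min u (t j)) vo)" if "j <= n" for j
 proof (rule continuous_on_compose2[OF continuous[OF w]])
 show "Con {0..T} (%u. min u (t j))" by (intro continuous_intros)
 show "(%u. min u (t j)) ` {0..T} <= {0..T}"
 using elementary_mono[OF el[of k, unfolded E], of j j] that by auto
 qed
 show ?thesis unfolding E elementary_integral_def prod.case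
 by (intro continuous_on_sum continuous_on_mult continuous_on_const continuous_on_diff c) auto
qed

lemma uniform_from_rationals:
 assumes w: "vo : space M" and c: "Con {0..T} (%t. J t vo)"
 and r: "!!t. t : {0..T} Int Rats ==> abs (JE k t vo - J t vo) <= ee" and t: "t : {0..T}"
 shows "abs (JE k t vo - J t vo) <= ee"
proof -
 have cl: "closure ({0..T} Int Rats) = {0..T}"
 using dense_rationals_Icc[OF T] closure_mono[of "{0..T} Int Rats" "{0..T}"] by (simp add: subset_antisym)
 have "norm (JE k t vo - J t vo) <= ee"
 proof (rule continuous_on_closure_norm_le[where s="{0..T} Int Rats" and f="%t. JE k t vo - J t vo"])
 show "Con (closure ({0..T} Int Rats)) (%t. JE k t vo - J t vo)"
 unfolding cl by (intro continuous_on_diff JE_continuous[OF w] c)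
 qed (use r t cl in auto)
 thus ?thesis by simp
qed

end

text \<open>For \<open>j 0 = 0\<close> this is \<open>z\<close> plus the integral of
  \<open>exp (- r * s)\<close> against \<open>j\<close>, integrated by parts: a discounted integral
  that makes sense path by path and depends continuously on the path.\<close>

definition damped :: "real => real => (real => real) => real => real" where
 "damped r z j t = z + exp (- r * t) * j t + LI {0..t} (%s. r * exp (- r * s) * j s)"

lemma damped_kernel_integral:
 fixes a b r :: real
 assumes "0 <= a" "a <= b"
 shows "LI {a..b} (%s. r * exp (- r * s)) = exp (- r * a) - exp (- r * b)"
proof -
 have "LI {a..b} (%s. r * exp (- r * s)) = (- exp (- r * b)) - (- exp (- r * a))"
 proof -
 have "(\<integral>s. (r * exp (- r * s)) * Ind {a..b} s \<partial>lborel) = (- exp (- r * b)) - (- exp (- r * a))"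
 by (rule integral_FTC_Icc_real[where F="%s. - exp (- r * s)"])
 (auto intro!: derivative_eq_intros continuous_intros assms)
 moreover have "(%s. indicat_real {a..b} s *\<^sub>R (r * exp (- r * s))) = (%s. (r * exp (- r * s)) * Ind {a..b} s)"
 by (simp add: fun_eq_iff)
 ultimately show ?thesis unfolding set_lebesgue_integral_def by simp
 qed
 thus ?thesis by simp
qed

lemma set_integrable_continuous_Icc:
 fixes f :: "real => real"
 assumes "Con {a..b} f" shows "SI {a..b} f"
 using borel_integrable_atLeastAtMost'[OF assms] .

text \<open>An integral against \<open>j\<close> gains nothing once the path is frozen.\<close>

lemma damped_stop:
 assumes c: "Con {0..T} j" and s: "0 <= sx" "sx <= T"
 shows "damped r z (%u. j (min u sx)) T = damped r z j sx"
proof -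
 have ck: "Con A (%s. r * exp (- r * s))" for A by (intro continuous_intros)
 have c1: "Con {0..sx} j" using c s by (auto intro: continuous_on_subset)
 have i1: "SI {0..sx} (%s. r * exp (- r * s) * j s)"
 by (intro set_integrable_continuous_Icc continuous_intros c1)
 have i2: "SI {sx<..T} (%s. r * exp (- r * s) * j sx)"
 by (rule set_integrable_subset[OF set_integrable_continuous_Icc[of sx T]]) (auto intro!: continuous_intros)
 have "LI {0..T} (%s. r * exp (- r * s) * j (min s sx)) =
 (LI (({0..sx} Un {sx<..T})) (%s. r * exp (- r * s) * j (min s sx)))"
 using s by (intro arg_cong[where f="%A. set_lebesgue_integral lborel A _"]) auto
 also have "... = LI {0..sx} (%s. r * exp (- r * s) * j (min s sx)) + LI {sx<..T} (%s. r * exp (- r * s) * j (min s sx))"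
 proof (rule set_integral_Un)
 show "SI {0..sx} (%s. r * exp (- r * s) * j (min s sx))"
 proof -
 have "SI {0..sx} (%s. r * exp (- r * s) * j (min s sx)) \<longleftrightarrow> SI {0..sx} (%s. r * exp (- r * s) * j s)"
 by (rule set_integrable_cong) auto
 thus ?thesis using i1 by simp
 qed
 show "SI {sx<..T} (%s. r * exp (- r * s) * j (min s sx))"
 proof -
 have "SI {sx<..T} (%s. r * exp (- r * s) * j (min s sx)) \<longleftrightarrow> SI {sx<..T} (%s. r * exp (- r * s) * j sx)"
 by (rule set_integrable_cong) auto
 thus ?thesis using i2 by simp
 qed
 qed auto
 also have "LI {0..sx} (%s. r * exp (- r * s) * j (min s sx)) = LI {0..sx} (%s. r * exp (- r * s) * j s)"
 by (rule set_lebesgue_integral_cong) auto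
 also have "LI {sx<..T} (%s. r * exp (- r * s) * j (min s sx)) = LI {sx<..T} (%s. r * exp (- r * s) * j sx)"
 by (rule set_lebesgue_integral_cong) auto
 also have "... = LI {sx..T} (%s. r * exp (- r * s) * j sx)"
 unfolding set_lebesgue_integral_def
 proof (rule integral_cong_AE)
 show "AE x in lborel. Ind {sx<..T} x *\<^sub>R (r * exp (- r * x) * j sx) = Ind {sx..T} x *\<^sub>R (r * exp (- r * x) * j sx)"
 using AE_lborel_singleton[of sx] by eventually_elim (auto simp: indicator_def)
 qed auto
 also have "... = (exp (- r * sx) - exp (- r * T)) * j sx"
 using damped_kernel_integral[OF s] by simp
 finally show ?thesis using s by (simp add: damped_def algebra_simps)
qed

text \<open>The weight \<open>exp (- r * t)\<close> and the mass of \<open>r * exp (- r * s)\<close>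
  over \<open>[0,t]\<close> add up to 1, so uniform distances do not grow.\<close>

lemma damped_dist:
 assumes c: "Con {0..t} j" "Con {0..t} j'" and t: "0 <= t" and r: "0 <= r"
 and d: "!!s. s : {0..t} ==> abs (j s - j' s) <= ee"
 shows "abs (damped r z j t - damped r z j' t) <= ee"
proof -
 have ck: "Con A (%s. r * exp (- r * s))" for A by (intro continuous_intros)
 note int = set_integrable_continuous_Icc[OF continuous_on_mult[OF ck]]
 have "abs (LI {0..t} (%s. r * exp (- r * s) * (j s - j' s))) <= LI {0..t} (%s. abs (r * exp (- r * s) * (j s - j' s)))"
 using set_integral_norm_bound[OF int[OF continuous_on_diff[OF c]]] by simp
 also have "... <= LI {0..t} (%s. r * exp (- r * s) * ee)"
 proof (rule set_integral_mono)
 show "SI {0..t} (%s. abs (r * exp (- r * s) * (j s - j' s)))"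
 by (intro set_integrable_continuous_Icc continuous_intros c)
 show "SI {0..t} (%s. r * exp (- r * s) * ee)"
 by (intro int continuous_intros)
 show "abs (r * exp (- r * s) * (j s - j' s)) <= r * exp (- r * s) * ee" if "s : {0..t}" for s
 unfolding abs_mult using d[OF that] r by (simp add: mult_left_mono)
 qed
 also have "... = (1 - exp (- r * t)) * ee"
 using damped_kernel_integral[of 0 t r] t by simp
 finally have 1: "abs (LI {0..t} (%s. r * exp (- r * s) * (j s - j' s))) <= (1 - exp (- r * t)) * ee" .
 have 2: "abs (exp (- r * t) * (j t - j' t)) <= exp (- r * t) * ee"
 unfolding abs_mult using d[of t] t by (simp add: mult_left_mono)
 have "damped r z j t - damped r z j' t = exp (- r * t) * (j t - j' t) + LI {0..t} (%s. r * exp (- r * s) * (j s - j' s))"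
 unfolding damped_def right_diff_distrib by (subst set_integral_diff(2)[OF int[OF c(1)] int[OF c(2)]]) simp
 moreover have "(1 - exp (- r * t)) * ee + exp (- r * t) * ee = ee" by (simp add: algebra_simps)
 ultimately show ?thesis using 1 2 by linarith
qed

section \<open>Locality of the integral\<close>

context approx
begin

lemma grid_point_cases:
 assumes "grid s m" "t : s ` {..m}" "i < m" shows "t <= s i | s (Suc i) <= t"
proof -
 obtain l where l: "l <= m" "t = s l" using assms by auto
 show ?thesis
 proof (cases "l <= i")
 case True thus ?thesis using grid_mono[OF assms(1), of l i] assms(3) l by simp
 next
 case False thus ?thesis using grid_mono[OF assms(1), of "Suc i" l] l by simp
 qed
qed

text \<open>Restricted to \<open>A\<close> and to the interval from \<open>r\<close> to
  \<open>t\<close>, the elementary integrand stays predictable because \<open>A\<close> is known at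
  \<open>r\<close>. Its sum is the increment of the approximating integral on \<open>A\<close>, and
  since \<open>v\<close> vanishes there, its quadratic variation is at most
  \<open>err\<close>.\<close>

lemma locality_bound:
 assumes A: "A : sets (F r)" and rt: "0 <= r" "r <= t" "t <= T"
 and v0: "AE y in M. y : A --> (ALL s:{r<..t}. v s y = 0)" and e: "0 < ee" and d: "0 < de"
 shows "\<P>(y in M. y : A & ee <= abs (JE k t y - JE k r y)) <= de / ee^2 + pgt M de (err k)"
proof -
 have S: "{r, t} <= {0..T}" using rt by auto
 obtain s m where s: "s 0 = 0" "s m = T" and g: "grid s m" and Ss: "{r, t} <= s ` {..m}" and c: "compat (E k) s m"
 using common_grid[OF _ S, of "{k}"] by (metis finite.emptyI finite.insertI insertCI)
 have gr: "r <= s i | s (Suc i) <= r" "t <= s i | s (Suc i) <= t" if "i < m" for i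
 using grid_point_cases[OF g _ that] Ss by auto
 have si: "s i <= s (Suc i)" if "i < m" for i using g that by (simp add: grid_def)
 define f where "f y x = Ind A y * (of_bool (x <= t) - of_bool (x <= r)) * V k x y" for y x
 define h where "h i y = f y (s (Suc i))" for i y
 have AM: "A : sets M" using F_sets[OF _ A] rt by auto
 have hF: "h i : Bm (F (s i))" if i: "i < m" for i
 proof (cases "r < s (Suc i)")
 case True
 hence "r <= s i" using gr(1)[OF i] by auto
 hence "A : sets (F (s i))" using A filtration.sets_F_mono[OF filt] by blast
 thus ?thesis
 unfolding h_def f_def using elementary_process_predictable[OF el g c i] by measurable
 next
 case False
 hence "h i = (%_. 0)" using rt by (auto simp: h_def f_def fun_eq_iff)
 thus ?thesis by simp
 qed
 have JE: "JE k u y = (SUM i<m. of_bool (s (Suc i) <= u) * (V k (s (Suc i)) y * (bt (s (Suc i)) y - bt (s i) y)))"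
 if u: "u : {r, t}" for u y
 proof -
 have "JE k u y = gint s (%i. V k (s (Suc i))) m u y"
 using u rt s by (intro elementary_integral_grid[OF el g s(1) c]) auto
 also have "... = (SUM i<m. of_bool (s (Suc i) <= u) * (V k (s (Suc i)) y * (bt (s (Suc i)) y - bt (s i) y)))"
 unfolding gint_def
 proof (intro sum.cong refl)
 fix i assume "i : {..<m}"
 hence i: "i < m" by simp
 show "V k (s (Suc i)) y * (bt (min u (s (Suc i))) y - bt (min u (s i)) y) =
 of_bool (s (Suc i) <= u) * (V k (s (Suc i)) y * (bt (s (Suc i)) y - bt (s i) y))"
 proof (cases "s (Suc i) <= u")
 case True thus ?thesis using si[OF i] by (simp add: min_absorb2)
 next
 case False
 hence "u <= s i" using gr[OF i] u by auto
 thus ?thesis using False by (simp add: min_absorb1)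
 qed
 qed
 finally show ?thesis .
 qed
 have dsum: "dsum s h m y = Ind A y * (JE k t y - JE k r y)" for y
 unfolding dsum_def h_def f_def
 by (simp only: JE insert_iff simp_thms sum_subtractf[symmetric] sum_distrib_left) (auto intro!: sum.cong simp: algebra_simps)
 have Am: "NL T (%x. en ((f y x)^2)) = en (qv s h m y)" for y
 proof -
 have "NL (s m) (%x. en ((f y x)^2)) = en (SUM i<m. (f y (s (Suc i)))^2 * (s (Suc i) - s i))"
 proof (rule nn_integral_step[where f="f y"])
 show "f y : Bm borel" unfolding f_def by measurable
 fix i x assume i: "i < m" and x: "s i < x" "x <= s (Suc i)"
 have "(x <= t) = (s (Suc i) <= t)" "(x <= r) = (s (Suc i) <= r)" using gr[OF i] x by auto
 thus "f y x = f y (s (Suc i))"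
 unfolding f_def using elementary_process_const[OF el c i x, of y] by simp
 qed (use si s in auto)
 thus ?thesis unfolding h_def s(2) .
 qed
 have "\<P>(y in M. y : A & ee <= abs (JE k t y - JE k r y)) <= \<P>(y in M. EX l<=m. ee <= abs (dsum s h l y))"
 proof (rule finite_measure_mono)
 show "{y:space M. y : A & ee <= abs (JE k t y - JE k r y)} <= {y:space M. EX l<=m. ee <= abs (dsum s h l y)}"
 using dsum by (auto intro!: exI[of _ m])
 have dM: "dsum s h l : Bm M" if "l <= m" for l
 using F_M[OF _ dsum_measurable[OF g hF that]] g that by (auto simp: grid_def)
 have "{y:space M. EX l<=m. ee <= abs (dsum s h l y)} = (UN l:{..m}. {y:space M. ee <= abs (dsum s h l y)})" by auto
 also have "... : sets M"
 proof (rule sets.finite_UN)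
 fix l assume "l : {..m}"
 hence [measurable]: "dsum s h l : Bm M" using dM by simp
 show "{y:space M. ee <= abs (dsum s h l y)} : sets M" by measurable
 qed simp
 finally show "{y:space M. EX l<=m. ee <= abs (dsum s h l y)} : sets M" .
 qed
 also have "... <= de / ee^2 + \<P>(y in M. de < (qv s h m y))"
 using d by (intro dsum_maximal[OF g hF e]) auto
 also have "\<P>(y in M. de < (qv s h m y)) <= pgt M de (err k)"
 proof (rule finite_measure_mono_AE)
 show "AE y in M. y : {y:space M. de < (qv s h m y)} --> y : {y:space M. en de < err k y}"
 using v0
 proof eventually_elim
 case (elim y)
 have "NL T (%x. en ((f y x)^2)) <= err k y"
 unfolding err_def
 proof (rule nn_integral_mono)
 fix x
 have "(f y x)^2 <= (V k x y - v x y)^2"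
 proof (cases "y : A & r < x & x <= t")
 case True thus ?thesis using elim by (simp add: f_def)
 next
 case False hence "f y x = 0" using rt by (auto simp: f_def)
 thus ?thesis by simp
 qed
 thus "en ((f y x)^2) * Ind {0..T} x <= en ((V k x y - v x y)^2) * Ind {0..T} x"
 by (intro mult_right_mono ennreal_leI) auto
 qed
 thus ?case unfolding Am using d
 by (auto simp: ennreal_less_iff intro: order.strict_trans2[OF iffD2[OF ennreal_less_iff]])
 qed
 qed measurable
 finally show ?thesis by simp
qed

text \<open>Serves to freeze the integral after a stopping time, where the integrand vanishes. The
  bound is passed to the limit in \<open>k\<close>, after which \<open>de\<close> tends to
  0.\<close>

lemma locality:
 assumes A: "A : sets (F r)" and rt: "0 <= r" "r <= t" "t <= T"
 and v0: "AE y in M. y : A --> (ALL s:{r<..t}. v s y = 0)"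
 shows "AE y in M. y : A --> J t y = J r y"
proof -
 have AM [measurable]: "A : sets M" using F_sets[OF _ A] rt by auto
 have rT: "r : {0..T}" "t : {0..T}" using rt by auto
 note [measurable] = J_measurable[OF rT(1)] J_measurable[OF rT(2)] JE_measurable[OF rT(1)] JE_measurable[OF rT(2)]
 have z: "\<P>(y in M. y : A & 2 * ee <= abs (J t y - J r y)) <= de / ee^2" if e: "0 < ee" and d: "0 < de" for ee de
 proof -
 let ?q = "%k. de / ee^2 + pgt M de (err k) + \<P>(y in M. ee / 3 < abs (JE k t y - J t y)) + \<P>(y in M. ee / 3 < abs (JE k r y - J r y))"
 have "\<P>(y in M. y : A & 2 * ee <= abs (J t y - J r y)) <= ?q k" for k
 proof -
 let ?B = "{y:space M. y : A & ee <= abs (JE k t y - JE k r y)}"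
 let ?C = "{y:space M. ee / 3 < abs (JE k t y - J t y)}"
 let ?D = "{y:space M. ee / 3 < abs (JE k r y - J r y)}"
 have "\<P>(y in M. y : A & 2 * ee <= abs (J t y - J r y)) <= prob ((?B Un ?C) Un ?D)"
 proof (rule finite_measure_mono)
 show "{y:space M. y : A & 2 * ee <= abs (J t y - J r y)} <= (?B Un ?C) Un ?D"
 proof
 fix y assume w: "y : {y:space M. y : A & 2 * ee <= abs (J t y - J r y)}"
 hence "ee <= abs (JE k t y - JE k r y) | ee / 3 < abs (JE k t y - J t y) | ee / 3 < abs (JE k r y - J r y)"
 using e by - (simp only: mem_Collect_eq, linarith)
 thus "y : (?B Un ?C) Un ?D" using w by blast
 qed
 qed measurable
 also have "... <= prob (?B Un ?C) + prob ?D" by (rule measure_Un_le) measurable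
 also have "prob (?B Un ?C) <= prob ?B + prob ?C" by (rule measure_Un_le) measurable
 also have "prob ?B <= de / ee^2 + pgt M de (err k)"
 by (rule locality_bound[OF A rt v0 e d])
 finally show ?thesis by simp
 qed
 moreover have "?q ----> de / ee^2 + 0 + 0 + 0"
 using e d rT by (intro tendsto_add tendsto_const err_lim J_lim) auto
 ultimately show ?thesis by (intro LIMSEQ_le_const[of ?q]) auto
 qed
 have z2: "AE y in M. ~  (y : A & 2 * (1 / real (Suc n)) <= abs (J t y - J r y))" for n
 proof -
 let ?S = "{y:space M. y : A & 2 * (1 / real (Suc n)) <= abs (J t y - J r y)}"
 have "prob ?S <= 0"
 proof (rule field_le_epsilon)
 fix x :: real assume x: "0 < x"
 show "prob ?S <= 0 + x"
 using z[of "1 / real (Suc n)" "x * (1 / real (Suc n))^2"] x by simp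
 qed
 hence "prob ?S = 0" by (simp add: antisym)
 hence "?S : null_sets M" by (simp add: null_sets_def emeasure_eq_measure)
 thus ?thesis by (rule AE_I') auto
 qed
 have "AE y in M. ALL n. ~  (y : A & 2 * (1 / real (Suc n)) <= abs (J t y - J r y))"
 unfolding AE_all_countable using z2 by blast
 thus ?thesis
 proof eventually_elim
 case (elim y)
 show ?case
 proof (rule impI, rule ccontr)
 assume A: "y : A" and ne: "J t y ~= J r y"
 then obtain n where "inverse (real (Suc n)) < abs (J t y - J r y) / 2" using reals_Archimedean[of "abs (J t y - J r y) / 2"] by auto
 thus False using elim A by (auto simp: inverse_eq_divide dest!: spec[of _ n])
 qed
 qed
qed

end

section \<open>Moments of truncated integrals\<close>

context approx
begin

text \<open>Evaluation at an intermediate time is a discrete sum over the grid cut off at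
  \<open>u\<close>, so isometry and zero mean apply to it.\<close>

lemma stopped_integral_moments:
 assumes g: "grid s m" and s: "s 0 = 0" "s m = T" and hF: "!!i. i < m ==> h i : Bm (F (s i))"
 and hb: "!!i e. i < m ==> e : space M ==> abs (h i e) <= C"
 and hA: "!!e. (qv s h m e) <= c" and u: "u : {0..T}"
 shows "gint s h m u : Bm M" "integrable M (gint s h m u)" "(\<integral>e. gint s h m u e \<partial>M) = 0"
 "NI M (%e. en ((gint s h m u e)^2)) <= en c"
proof -
 define s' where "s' i = min u (s i)" for i
 \<comment> \<open>Cells starting at or after \<open>u\<close> get weight 0: their cut-off left
   endpoint is \<open>u\<close>, where the original weight need not be known.\<close>
 define h' where "h' i e = (if s i < u then h i e else 0)" for i e
 have sT: "0 <= s i" if "i <= m" for i using grid_mono[OF g, of 0 i] that s by simp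
 have si: "s i <= s (Suc i)" if "i < m" for i using g that by (simp add: grid_def)
 have g': "grid s' m"
 unfolding grid_def s'_def using u sT si by (auto intro: min.coboundedI2 min.coboundedI1)
 have h'F: "h' i : Bm (F (s' i))" if "i < m" for i
 proof (cases "s i < u")
 case True
 hence "s' i = s i" "h' i = h i" by (auto simp: s'_def h'_def fun_eq_iff)
 thus ?thesis using hF[OF that] by simp
 next
 case False
 hence "h' i = (%_. 0)" by (auto simp: h'_def fun_eq_iff)
 thus ?thesis by simp
 qed
 have eq: "gint s h m u = dsum s' h' m"
 unfolding gint_def dsum_def
 proof (intro ext sum.cong refl)
 fix e i assume "i : {..<m}"
 hence "s i <= s (Suc i)" using si by simp
 thus "h i e * (bt (min u (s (Suc i))) e - bt (min u (s i)) e) = h' i e * (bt (s' (Suc i)) e - bt (s' i) e)"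
 by (auto simp: s'_def h'_def)
 qed
 have I: "s' i : {0..T}" if "i <= m" for i using g' that by (simp add: grid_def)
 show "gint s h m u : Bm M"
 unfolding eq using dsum_measurable[OF g' h'F, of m] F_M[OF I[of m]] by simp
 have h'b: "abs (h' i e) <= abs C" if "i < m" "e : space M" for i e
 using hb[OF that] by (auto simp: h'_def)
 have summand: "integrable M (%e. h' i e * (bt (s' (Suc i)) e - bt (s' i) e)) & (\<integral>e. h' i e * (bt (s' (Suc i)) e - bt (s' i) e) \<partial>M) = 0"
 if i: "i < m" for i
 proof -
 have "s' i <= s' (Suc i)" using si[OF i] by (auto simp: s'_def)
 thus ?thesis
 using increment_mean[OF I[of i] I[of "Suc i"] _ h'F[OF i] h'b[OF i]] i by simp
 qed
 show "integrable M (gint s h m u)" unfolding eq dsum_def[abs_def] using summand by (intro Bochner_Integration.integrable_sum) auto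
 show "(\<integral>e. gint s h m u e \<partial>M) = 0"
 unfolding eq dsum_def[abs_def] using summand by (subst Bochner_Integration.integral_sum) auto
 have "NI M (%e. en ((gint s h m u e)^2)) = NI M (%e. en (qv s' h' m e))"
 unfolding eq by (rule dsum_square[OF g' h'F])
 also have "... <= NI M (%e. en c)"
 proof (intro nn_integral_mono ennreal_leI)
 fix e
 have "(qv s' h' m e) <= (qv s h m e)"
 proof (rule sum_mono)
 fix i assume "i : {..<m}"
 thus "(h' i e)^2 * (s' (Suc i) - s' i) <= (h i e)^2 * (s (Suc i) - s i)"
 using si[of i] by (auto simp: h'_def s'_def intro!: mult_left_mono)
 qed
 thus "(qv s' h' m e) <= c" using hA[of e] by simp
 qed
 also have "... = en c" by (simp add: emeasure_space_1)
 finally show "NI M (%e. en ((gint s h m u e)^2)) <= en c" .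
qed

lemma gint_continuous:
 assumes g: "grid s m" and w: "e : space M"
 shows "Con {0..T} (%u. gint s h m u e)"
proof -
 have c: "Con {0..T} (%u. bt (min u (s j)) e)" if "j <= m" for j
 proof (rule continuous_on_compose2[OF continuous[OF w]])
 show "Con {0..T} (%u. min u (s j))" by (intro continuous_intros)
 show "(%u. min u (s j)) ` {0..T} <= {0..T}" using g that by (auto simp: grid_def)
 qed
 show ?thesis unfolding gint_def
 by (intro continuous_on_sum continuous_on_mult continuous_on_const continuous_on_diff c) auto
qed

text \<open>
 The damped transform of a martingale is a martingale; only the first moment and a truncated
 absolute moment are needed.
\<close>

lemma damped_moments:
 assumes N: "!!u. u : {0..T} ==> N u : Bm M" and Nc: "!!e. e : space M ==> Con {0..T} (%u. N u e)"
 and Ni: "!!u. u : {0..T} ==> integrable M (N u)" and N0: "!!u. u : {0..T} ==> (\<integral>e. N u e \<partial>M) = 0"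
 and N2: "!!u. u : {0..T} ==> NI M (%e. en ((N u e)^2)) <= en c" and c: "0 <= c" and r: "0 <= r"
 shows "integrable M (%e. damped r z (%u. N u e) T)" "(\<integral>e. damped r z (%u. N u e) T \<partial>M) = z"
 "!!A K. A : sets M ==> 0 < K ==> (\<integral>e. abs (damped r z (%u. N u e) T) * Ind A e \<partial>M) <= abs z * prob A + (1 + r * T) * (c / K + K * prob A)"
proof -
 let ?R = "restrict_space lborel {0..T}"
 interpret R: finite_measure ?R
 by (rule finite_measureI) (use T in \<open>simp add: emeasure_restrict_space space_restrict_space\<close>)
 interpret P: pair_sigma_finite ?R M ..
 have spR: "space ?R = {0..T}" by (simp add: space_restrict_space)
 have joint: "(%(s, e). N s e) : Bm (?R >< M)"
 proof -
 have "(%(s, e). N s e) : Bm (RB T >< M)"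
 using N Nc T by (intro joint_measurable_continuous) auto
 thus ?thesis
 using measurable_cong_sets[OF sets_pair_measure_cong[OF sets_restrict_space_cong[OF sets_lborel] refl] refl] by blast
 qed
 define f where "f = (%(s, e). r * exp (- r * s) * N s e)"
 have ex: "(%s. r * exp (- r * s)) : Bm ?R"
 by (intro measurable_restrict_space1) simp
 have f [measurable]: "f : Bm (?R >< M)"
 proof -
 have "(%x. (%s. r * exp (- r * s)) (fst x) * (%(s, e). N s e) x) : Bm (?R >< M)"
 by (intro borel_measurable_times joint measurable_compose[OF measurable_fst ex])
 thus ?thesis by (simp add: f_def case_prod_beta')
 qed
 have D: "damped r z (%u. N u e) T = z + exp (- r * T) * N T e + (\<integral>s. f (s, e) \<partial>?R)" for e
 unfolding damped_def f_def by (simp add: integral_restrict_space set_lebesgue_integral_def)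
 have absb: "en (abs x) * Ind A e <= en (1 / K) * en (x^2) + en K * Ind A e"
 if "0 < K" for x K :: real and A and e :: 'a
 proof -
 have "abs x <= 1 / K * x^2 + K"
 proof (cases "abs x <= K")
 case True thus ?thesis using that by (simp add: add_increasing)
 next
 case False
 hence "abs x * K <= abs x * abs x" by (intro mult_left_mono) auto
 hence "abs x * K <= x^2" by (simp add: power2_eq_square)
 hence "abs x <= x^2 / K" using that by (simp add: pos_le_divide_eq)
 thus ?thesis using that by simp
 qed
 hence "en (abs x) <= en (1 / K * x^2 + K)" by (rule ennreal_leI)
 also have "... = en (1 / K) * en (x^2) + en K"
 proof -
 have "en (1 / K * x^2) = en (1 / K) * en (x^2)" using that by (intro ennreal_mult) auto
 thus ?thesis using that by (subst ennreal_plus) auto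
 qed
 finally show ?thesis by (auto simp: indicator_def)
 qed
 have NA: "NI M (%e. en (abs (N u e)) * Ind A e) <= en (c / K + K * prob A)"
 if A [measurable]: "A : sets M" and K: "0 < K" and u: "u : {0..T}" for A K u
 proof -
 note [measurable] = N[OF u]
 have "NI M (%e. en (abs (N u e)) * Ind A e) <= NI M (%e. en (1 / K) * en ((N u e)^2) + en K * Ind A e)"
 by (intro nn_integral_mono absb K)
 also have "... = en (1 / K) * NI M (%e. en ((N u e)^2)) + en K * emeasure M A"
 by (subst nn_integral_add) (auto simp: nn_integral_cmult nn_integral_cmult_indicator)
 also have "... <= en (1 / K) * en c + en K * en (prob A)"
 using N2[OF u] by (intro add_mono mult_left_mono) (auto simp: emeasure_eq_measure)
 also have "... = en (c / K + K * prob A)"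
 using K c by (subst ennreal_plus) (auto simp: ennreal_mult'[symmetric])
 finally show ?thesis .
 qed
 have fA: "NI M (%e. NI ?R (%s. en (abs (f (s, e)))) * Ind A e) <= en (r * T * (c / K + K * prob A))"
 if A [measurable]: "A : sets M" and K: "0 < K" for A K
 proof -
 have m: "(%(s, e). en (abs (f (s, e))) * Ind A e) : Bm (?R >< M)"
 proof -
 have "(%x. en (abs (f x)) * Ind A (snd x)) : Bm (?R >< M)" by measurable
 thus ?thesis by (simp add: case_prod_beta')
 qed
 have "NI M (%e. NI ?R (%s. en (abs (f (s, e)))) * Ind A e) = NI M (%e. NI ?R (%s. en (abs (f (s, e))) * Ind A e))"
 proof (rule nn_integral_cong)
 fix e assume "e : space M"
 hence "(%s. en (abs (f (s, e)))) : Bm ?R"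
 using measurable_compose[OF measurable_Pair2' f] by measurable
 thus "NI ?R (%s. en (abs (f (s, e)))) * Ind A e = NI ?R (%s. en (abs (f (s, e))) * Ind A e)"
 by (rule nn_integral_multc[symmetric])
 qed
 also have "... = NI ?R (%s. NI M (%e. en (abs (f (s, e))) * Ind A e))"
 using P.Fubini[of "%x. en (abs (f x)) * Ind A (snd x)"] m by (simp add: case_prod_beta')
 also have "... <= NI ?R (%s. en (r * (c / K + K * prob A)))"
 proof (rule nn_integral_mono)
 fix s assume "s : space ?R"
 hence s: "s : {0..T}" using spR by simp
 note [measurable] = N[OF s]
 have "NI M (%e. en (abs (f (s, e))) * Ind A e) <= NI M (%e. en r * (en (abs (N s e)) * Ind A e))"
 proof (rule nn_integral_mono)
 fix e
 have "abs (f (s, e)) <= r * abs (N s e)"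
 unfolding f_def using r s by (simp add: abs_mult mult_left_le_one_le mult_left_mono mult.assoc)
 hence "en (abs (f (s, e))) <= en r * en (abs (N s e))"
 using r by (simp add: ennreal_mult'[symmetric] ennreal_leI)
 thus "en (abs (f (s, e))) * Ind A e <= en r * (en (abs (N s e)) * Ind A e)"
 by (auto simp: indicator_def)
 qed
 also have "... = en r * NI M (%e. en (abs (N s e)) * Ind A e)"
 by (rule nn_integral_cmult) measurable
 also have "... <= en r * en (c / K + K * prob A)" by (intro mult_left_mono NA[OF A K s]) auto
 also have "... = en (r * (c / K + K * prob A))" using r by (simp add: ennreal_mult')
 finally show "NI M (%e. en (abs (f (s, e))) * Ind A e) <= en (r * (c / K + K * prob A))" .
 qed
 also have "... = en (r * T * (c / K + K * prob A))"
 using r T c K by (simp add: emeasure_restrict_space spR ennreal_mult'[symmetric] mult_ac)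
 finally show ?thesis .
 qed
 have fint: "integrable (?R >< M) f"
 proof (rule integrableI_bounded)
 have "NI (?R >< M) (%x. en (norm (f x))) = NI M (%e. NI ?R (%s. en (abs (f (s, e)))))"
 using P.nn_integral_snd[of "%x. en (abs (f x))"] by simp
 also have "... = NI M (%e. NI ?R (%s. en (abs (f (s, e)))) * Ind (space M) e)"
 by (rule nn_integral_cong) simp
 also have "... < \<infinity>" using fA[of "space M" 1] by (simp add: order.strict_trans1)
 finally show "NI (?R >< M) (%x. en (norm (f x))) < \<infinity>" .
 qed simp
 have fi2: "integrable M (%e. \<integral>s. f (s, e) \<partial>?R)" "(\<integral>e. (\<integral>s. f (s, e) \<partial>?R) \<partial>M) = (\<integral>s. (\<integral>e. f (s, e) \<partial>M) \<partial>?R)"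
 using P.integrable_snd[of "%s e. f (s, e)"] P.Fubini_integral[of "%s e. f (s, e)"] fint by (simp_all add: case_prod_beta')
 have Ti: "T : {0..T}" using T by simp
 show int: "integrable M (%e. damped r z (%u. N u e) T)"
 unfolding D using fi2(1) Ni[OF Ti] by (intro Bochner_Integration.integrable_add integrable_mult_right) auto
 have "(\<integral>s. (\<integral>e. f (s, e) \<partial>M) \<partial>?R) = (\<integral>s. 0 \<partial>?R)"
 proof (rule Bochner_Integration.integral_cong[OF refl])
 fix s assume "s : space ?R"
 hence "s : {0..T}" using spR by simp
 from N0[OF this] show "(\<integral>e. f (s, e) \<partial>M) = 0" by (simp add: f_def)
 qed
 thus "(\<integral>e. damped r z (%u. N u e) T \<partial>M) = z"
 unfolding D using fi2 Ni[OF Ti] N0[OF Ti] by (simp add: prob_space)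
 fix A :: "'a set" and K :: real assume A [measurable]: "A : sets M" and K: "0 < K"
 note [measurable] = N[OF Ti]
 have "NI M (%e. en (abs (damped r z (%u. N u e) T) * Ind A e)) <=
 NI M (%e. en (abs z) * Ind A e + (en (abs (N T e)) * Ind A e + NI ?R (%s. en (abs (f (s, e)))) * Ind A e))"
 proof (rule nn_integral_mono)
 fix e
 have "en (abs (damped r z (%u. N u e) T)) <= en (abs z + (abs (N T e) + abs (\<integral>s. f (s, e) \<partial>?R)))"
 proof (rule ennreal_leI)
 have "exp (- r * T) * abs (N T e) <= abs (N T e)" using r T by (simp add: mult_left_le_one_le)
 hence "abs (exp (- r * T) * N T e) <= abs (N T e)" by (simp add: abs_mult)
 thus "abs (damped r z (%u. N u e) T) <= abs z + (abs (N T e) + abs (\<integral>s. f (s, e) \<partial>?R))"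
 unfolding D by linarith
 qed
 also have "... = en (abs z) + (en (abs (N T e)) + en (abs (\<integral>s. f (s, e) \<partial>?R)))"
 by (simp add: ennreal_plus)
 also have "en (abs (\<integral>s. f (s, e) \<partial>?R)) <= NI ?R (%s. en (abs (f (s, e))))"
 proof (cases "integrable ?R (%s. f (s, e))")
 case True
 thus ?thesis using integral_norm_bound_ennreal[OF True] by simp
 next
 case False
 thus ?thesis by (simp add: not_integrable_integral_eq)
 qed
 finally show "en (abs (damped r z (%u. N u e) T) * Ind A e) <=
 en (abs z) * Ind A e + (en (abs (N T e)) * Ind A e + NI ?R (%s. en (abs (f (s, e)))) * Ind A e)"
 by (auto simp: indicator_def)
 qed
 also have "... = en (abs z) * emeasure M A + (NI M (%e. en (abs (N T e)) * Ind A e) + NI M (%e. NI ?R (%s. en (abs (f (s, e)))) * Ind A e))"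
 proof -
 have [measurable]: "(%e. NI ?R (%s. en (abs (f (s, e))))) : Bm M"
 using R.borel_measurable_nn_integral[of "%e s. en (abs (f (s, e)))" M] f measurable_pair_swap_iff[of "%x. en (abs (f x))" ?R M] by (simp add: case_prod_beta')
 show ?thesis by (subst nn_integral_add, simp, simp, subst nn_integral_add) (auto simp: nn_integral_cmult_indicator)
 qed
 also have "... <= en (abs z) * en (prob A) + (en (c / K + K * prob A) + en (r * T * (c / K + K * prob A)))"
 by (intro add_mono NA[OF A K Ti] fA[OF A K]) (simp add: emeasure_eq_measure)
 also have "... = en (abs z * prob A + (1 + r * T) * (c / K + K * prob A))"
 proof -
 have "0 <= c / K + K * prob A" "0 <= r * T * (c / K + K * prob A)" using c K r T by auto
 thus ?thesis by (simp add: ennreal_mult'[symmetric] distrib_right flip: ennreal_plus)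
 qed
 finally have le: "NI M (%e. en (abs (damped r z (%u. N u e) T) * Ind A e)) <= en (abs z * prob A + (1 + r * T) * (c / K + K * prob A))" .
 have "integrable M (%e. abs (damped r z (%u. N u e) T) * Ind A e)"
 using int by (intro integrable_real_mult_indicator) auto
 hence "en (\<integral>e. abs (damped r z (%u. N u e) T) * Ind A e \<partial>M) = NI M (%e. en (abs (damped r z (%u. N u e) T) * Ind A e))"
 by (subst nn_integral_eq_integral) auto
 with le have "en (\<integral>e. abs (damped r z (%u. N u e) T) * Ind A e \<partial>M) <= en (abs z * prob A + (1 + r * T) * (c / K + K * prob A))" by simp
 thus "(\<integral>e. abs (damped r z (%u. N u e) T) * Ind A e \<partial>M) <= abs z * prob A + (1 + r * T) * (c / K + K * prob A)"
 using c K r T by (subst (asm) ennreal_le_iff) auto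
qed

end

lemma damped_cong:
 assumes "!!s. s : {0..t} ==> j s = j' s" "0 <= t"
 shows "damped r z j t = damped r z j' t"
proof -
 have "LI {0..t} (%s. r * exp (- r * s) * j s) = LI {0..t} (%s. r * exp (- r * s) * j' s)"
 using assms(1) by (intro set_lebesgue_integral_cong) auto
 thus ?thesis using assms unfolding damped_def by simp
qed

section \<open>Truncation and the supermartingale inequality\<close>

context approx
begin

text \<open>Dropping the cells from which on the accumulated variance would exceed \<open>c\<close>
  stops the integral at a random grid point. The stopped process has zero means and second moments
  at most \<open>c\<close>, and it agrees with the original wherever the total variance is at most
  \<open>c\<close>.\<close>

lemma truncation:
 assumes c: "0 <= c"
 obtains N where "!!u. u : {0..T} ==> N u : Bm M" "!!y. y : space M ==> Con {0..T} (%u. N u y)"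
 "!!u. u : {0..T} ==> integrable M (N u)" "!!u. u : {0..T} ==> (\<integral>y. N u y \<partial>M) = 0"
 "!!u. u : {0..T} ==> NI M (%y. en ((N u y)^2)) <= en c"
 "!!y. EX sx:{0..T}. ALL u:{0..T}. N u y = JE k (min u sx) y"
 "!!y u. NL T (%s. en ((V k s y)^2)) <= en c ==> u : {0..T} ==> N u y = JE k u y"
proof -
 obtain s m where s: "s 0 = 0" "s m = T" and g: "grid s m" and co: "compat (E k) s m"
 using common_grid[of "{}" "{k}"] by (metis empty_subsetI finite.emptyI finite.insertI insertCI)
 define h where "h i y = V k (s (Suc i)) y" for i y
 define A where "A l y = (qv s h l y)" for l y
 \<comment> \<open>\<open>A (Suc i)\<close> includes the cell about to be entered and is still known
   at its left endpoint, so the weight stays predictable and the bound \<open>c\<close> is never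
   overshot.\<close>
 define k' where "k' i y = (if A (Suc i) y <= c then h i y else 0)" for i y
 have si: "s i <= s (Suc i)" if "i < m" for i using g that by (simp add: grid_def)
 have sT: "s i : {0..T}" if "i <= m" for i using g that by (simp add: grid_def)
 have hF: "h i : Bm (F (s i))" if "i < m" for i
 using elementary_process_predictable[OF el g co that] by (simp add: h_def[abs_def])
 have AF: "A (Suc i) : Bm (F (s i))" if i: "i < m" for i
 unfolding A_def
 proof (rule borel_measurable_sum)
 fix j assume "j : {..<Suc i}"
 hence "j <= i" by simp
 hence [measurable]: "h j : Bm (F (s i))"
 using F_mono[OF grid_mono[OF g, of j i] hF[of j]] i by simp
 show "(%y. (h j y)^2 * (s (Suc j) - s j)) : Bm (F (s i))" by measurable
 qed
 have kF: "k' i : Bm (F (s i))" if i: "i < m" for i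
 proof -
 note [measurable] = AF[OF i] hF[OF i]
 show ?thesis unfolding k'_def by measurable
 qed
 obtain C where C: "!!u y. y : space M ==> abs (V k u y) <= C" using elementary_process_bounded[OF el] by blast
 have kb: "abs (k' i y) <= abs C" if "y : space M" for i y
 using C[OF that, of "s (Suc i)"] by (auto simp: k'_def h_def)
 have A_mono: "A i y <= A j y" if "i <= j" "j <= m" for i j y
 unfolding A_def using that si by (intro sum_mono2) auto
 have kA: "(qv s k' l y) <= c" if "l <= m" for l y
 using that
 proof (induction l)
 case (Suc l)
 show ?case
 proof (cases "A (Suc l) y <= c")
 case True
 have "(SUM i<Suc l. (k' i y)^2 * (s (Suc i) - s i)) <= A (Suc l) y"
 unfolding A_def
 proof (rule sum_mono)
 fix i assume "i : {..<Suc l}"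
 hence "0 <= s (Suc i) - s i" using si[of i] Suc.prems by simp
 thus "(k' i y)^2 * (s (Suc i) - s i) <= (h i y)^2 * (s (Suc i) - s i)"
 by (intro mult_right_mono) (auto simp: k'_def)
 qed
 thus ?thesis using True by simp
 next
 case False
 hence "k' l y = 0" by (simp add: k'_def)
 thus ?thesis using Suc by simp
 qed
 qed (use c in simp)
 note mom = stopped_integral_moments[OF g s kF kb kA[OF order_refl]]
 have JE: "JE k u y = gint s h m u y" if "u : {0..T}" for u y
 using elementary_integral_grid[OF el g s(1) co, of u y] that s by (simp add: h_def[abs_def])
 show ?thesis
 proof (rule that[of "gint s k' m"])
 show "Con {0..T} (%u. gint s k' m u y)" if "y : space M" for y by (rule gint_continuous[OF g that])
 fix y
 \<comment> \<open>The first dropped cell; as \<open>A\<close> is monotone, all later cells are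
   dropped as well.\<close>
 define L where "L = (LEAST l. l = m | c < A (Suc l) y)"
 have Lm: "L <= m" unfolding L_def by (rule Least_le) simp
 have L: "L = m | c < A (Suc L) y" unfolding L_def by (rule LeastI[of _ m]) simp
 have before: "A (Suc i) y <= c" if "i < L" for i
 using not_less_Least[of i "%l. l = m | c < A (Suc l) y"] that unfolding L_def[symmetric] by simp
 have after: "~  A (Suc i) y <= c" if "L <= i" "i < m" for i
 proof -
 have "A (Suc L) y <= A (Suc i) y" using that by (intro A_mono) auto
 thus ?thesis using L that by auto
 qed
 have "gint s k' m u y = JE k (min u (s L)) y" if u: "u : {0..T}" for u
 proof -
 have "min u (s L) : {0..T}" using u sT[OF Lm] by auto
 hence "JE k (min u (s L)) y = gint s h m (min u (s L)) y" by (rule JE)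
 also have "... = gint s k' m u y"
 unfolding gint_def
 proof (intro sum.cong refl)
 fix i assume "i : {..<m}"
 hence i: "i < m" by simp
 show "h i y * (bt (min (min u (s L)) (s (Suc i))) y - bt (min (min u (s L)) (s i)) y) =
 k' i y * (bt (min u (s (Suc i))) y - bt (min u (s i)) y)"
 proof (cases "i < L")
 case True
 have "s i <= s L" "s (Suc i) <= s L" using grid_mono[OF g] True Lm by auto
 hence "min (min u (s L)) (s (Suc i)) = min u (s (Suc i))" "min (min u (s L)) (s i) = min u (s i)" by auto
 thus ?thesis using before[OF True] by (simp add: k'_def)
 next
 case False
 have "s L <= s i" "s L <= s (Suc i)" using grid_mono[OF g] False i by auto
 hence "min (min u (s L)) (s (Suc i)) = min u (s L)" "min (min u (s L)) (s i) = min u (s L)" by auto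
 thus ?thesis using after[of i] False i by (simp add: k'_def)
 qed
 qed
 finally show ?thesis by simp
 qed
 thus "EX sx:{0..T}. ALL u:{0..T}. gint s k' m u y = JE k (min u sx) y" using sT[OF Lm] by blast
 next
 fix y u assume le: "NL T (%s. en ((V k s y)^2)) <= en c" and u: "u : {0..T}"
 have "NL (s m) (%x. en ((V k x y)^2)) = en (SUM i<m. (V k (s (Suc i)) y)^2 * (s (Suc i) - s i))"
 proof (rule nn_integral_step)
 show "V k x y = V k (s (Suc i)) y" if "i < m" "s i < x" "x <= s (Suc i)" for i x
 by (rule elementary_process_const[OF el co that])
 qed (use si s in auto)
 hence "en (A m y) <= en c" using le s by (simp add: A_def h_def)
 hence "A m y <= c" using c by (simp add: ennreal_le_iff)
 hence "A (Suc i) y <= c" if "i < m" for i using A_mono[of "Suc i" m y] that by simp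
 hence "gint s k' m u y = gint s h m u y"
 unfolding gint_def by (intro sum.cong) (auto simp: k'_def)
 thus "gint s k' m u y = JE k u y" using JE[OF u] by simp
 qed (use mom in auto)
qed

definition "vv y = NL T (%s. en ((v s y)^2))"

lemma vv_measurable [measurable]: "vv : Bm M"
proof -
 have "(%x. en (((%(s, y). v s y) x)^2)) : Bm (RB T >< M)"
 using v_joint by measurable
 thus ?thesis unfolding vv_def by (intro set_nn_integral_measurable) (simp only: case_prod_beta')
qed

lemma V_sq_measurable: "(%y. NL T (%s. en ((V k s y)^2))) : Bm M"
proof -
 have "(%x. en (((%(s, y). V k s y) x)^2)) : Bm (RB T >< M)"
 using V_joint[of k] by measurable
 thus ?thesis by (intro set_nn_integral_measurable) (simp only: case_prod_beta')
qed

lemma vv_tail: "(%n. pgt M (real n) vv) ----> 0"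
proof -
 let ?A = "%n. {y:space M. en (real n) < vv y}"
 have "(%n. prob (?A n)) ----> prob (INT n. ?A n)"
 proof (rule finite_Lim_measure_decseq)
 show "decseq ?A"
 unfolding decseq_def
 proof (intro allI impI subsetI)
 fix m n y assume mn: "m <= n" and w: "y : ?A n"
 have "en (real m) <= en (real n)" using mn by (intro ennreal_leI) simp
 thus "y : ?A m" using w using order.strict_trans1 by blast
 qed
 qed auto
 moreover have "prob (INT n. ?A n) = 0"
 proof -
 have "AE y in M. y \<notin> (INT n. ?A n)"
 using v_finite
 proof eventually_elim
 case (elim y)
 then obtain n where "vv y < of_nat n" unfolding vv_def[symmetric]
 using ennreal_Ex_less_of_nat by auto
 hence "~  en (real n) < vv y" by (simp add: ennreal_of_nat_eq_real_of_nat)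
 thus ?case by blast
 qed
 moreover have "(INT n. ?A n) : sets M" by measurable
 ultimately have "emeasure M (INT n. ?A n) = 0"
 using AE_iff_measurable[of "INT n. ?A n" M "%y. y \<notin> (INT n. ?A n)"] by auto
 thus ?thesis by (simp add: measure_def)
 qed
 ultimately show ?thesis by simp
qed

text \<open>Outside \<open>B1\<close> the approximation is uniform, so \<open>X\<close> is within
  \<open>ee\<close> of the nonnegative transform of \<open>J\<close> at an earlier time and hence at
  least \<open>- ee\<close>. Outside \<open>B2\<close> as well, the truncation is inactive and
  \<open>X\<close> dominates \<open>Y - ee\<close>. On \<open>B2\<close> the loss is at most
  \<open>K\<close>; on \<open>B1\<close> it is controlled by the truncated absolute moment of
  \<open>X\<close>. The mean of \<open>X\<close> is \<open>z\<close>.\<close>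

lemma budget_truncated:
 assumes r: "0 <= r" and Y [measurable]: "Y : Bm M" and Y0: "AE y in M. 0 <= Y y"
 and YJ: "AE y in M. Y y <= damped r z (%t. J t y) T"
 and pos: "AE y in M. ALL t:{0..T}. 0 <= damped r z (%t. J t y) t"
 and e: "0 < ee" and c: "0 <= c" and K: "0 <= K" and L: "0 < L"
 defines "b \<equiv> %k. prob (dev M ({0..T} Int Rats) ee (JE k) J)"
 shows "(\<integral>y. min (Y y) K \<partial>M) <= z + ee + K * (pgt M (c / 4) vv + pgt M (c / 4) (err k))
 + (abs z * b k + (1 + r * T) * (c / L + L * b k)) + K * b k"
proof -
 obtain N where N: "!!u. u : {0..T} ==> N u : Bm M" "!!y. y : space M ==> Con {0..T} (%u. N u y)"
 "!!u. u : {0..T} ==> integrable M (N u)" "!!u. u : {0..T} ==> (\<integral>y. N u y \<partial>M) = 0"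
 "!!u. u : {0..T} ==> NI M (%y. en ((N u y)^2)) <= en c"
 "!!y. EX sx:{0..T}. ALL u:{0..T}. N u y = JE k (min u sx) y"
 "!!y u. NL T (%s. en ((V k s y)^2)) <= en c ==> u : {0..T} ==> N u y = JE k u y"
 using truncation[OF c, of k] by blast
 note mom = damped_moments[OF N(1-5) c r, where z=z]
 define X where "X y = damped r z (%u. N u y) T" for y
 define B1 where "B1 = (dev M ({0..T} Int Rats) ee (JE k) J)"
 define B2 where "B2 = {y:space M. en c < NL T (%s. en ((V k s y)^2))}"
 have B1 [measurable]: "B1 : sets M" unfolding B1_def by (rule dev_sets) (auto simp: countable_rat)
 have B2 [measurable]: "B2 : sets M" unfolding B2_def using V_sq_measurable[of k] by measurable
 have key: "AE y in M. min (Y y) K <= X y + ee + K * Ind B2 y + abs (X y) * Ind B1 y + K * Ind B1 y"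
 using YJ pos J_continuous AE_space
 proof eventually_elim
 case (elim y)
 show ?case
 proof (cases "y : B1")
 case True
 have "min (Y y) K <= K" by simp
 moreover have "0 <= X y + abs (X y)" by simp
 moreover have "0 <= K * Ind B2 y" using K by simp
 ultimately show ?thesis using True e by simp
 next
 case False
 have unif: "abs (JE k t y - J t y) <= ee" if "t : {0..T}" for t
 proof (rule uniform_from_rationals[OF elim(4,3) _ that])
 fix t assume "t : {0..T} Int Rats"
 thus "abs (JE k t y - J t y) <= ee" using False elim(4) unfolding B1_def by force
 qed
 obtain sx where s: "sx : {0..T}" "!!u. u : {0..T} ==> N u y = JE k (min u sx) y" using N(6) by blast
 have Xs: "X y = damped r z (%t. JE k t y) sx"
 proof -
 have "X y = damped r z (%u. JE k (min u sx) y) T"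
 unfolding X_def by (rule damped_cong[OF s(2) T])
 also have "... = damped r z (%t. JE k t y) sx"
 using s(1) JE_continuous[OF elim(4)] by (intro damped_stop) auto
 finally show ?thesis .
 qed
 have dist: "abs (damped r z (%t. JE k t y) t - damped r z (%t. J t y) t) <= ee" if t: "t : {0..T}" for t
 proof (rule damped_dist)
 have st: "{0..t} <= {0..T}" using t by auto
 show "Con {0..t} (%t. JE k t y)" "Con {0..t} (%t. J t y)"
 by (rule continuous_on_subset[OF _ st], rule JE_continuous[OF elim(4)] elim(3))+
 show "abs (JE k s y - J s y) <= ee" if "s : {0..t}" for s using unif that st by blast
 qed (use t r in auto)
 have low: "- ee <= X y" using dist[OF s(1)] elim(2) s(1) unfolding Xs by (smt (verit, best))
 show ?thesis
 proof (cases "y : B2")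
 case True
 thus ?thesis using low False by simp
 next
 case nB2: False
 have "N u y = JE k u y" if "u : {0..T}" for u
 using N(7)[OF _ that] nB2 elim(4) unfolding B2_def by (simp add: not_less)
 hence "X y = damped r z (%t. JE k t y) T"
 unfolding X_def by (intro damped_cong T)
 hence "Y y <= X y + ee" using dist[of T] T elim(1) by auto
 thus ?thesis using nB2 False by simp
 qed
 qed
 qed
 have Xi: "integrable M X" using mom(1) by (simp add: X_def[abs_def])
 have XB: "integrable M (%y. abs (X y) * Ind B1 y)" using Xi by (intro integrable_real_mult_indicator) auto
 have i1: "integrable M (%y. K * Ind B2 y :: real)" "integrable M (%y. K * Ind B1 y :: real)"
 by (auto intro!: integrable_mult_right integrable_real_indicator simp: emeasure_eq_measure)
 have Yi: "integrable M (%y. min (Y y) K)"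
 using Y0 K by (intro integrable_const_bound[where B=K]) auto
 have "(\<integral>y. min (Y y) K \<partial>M) <= (\<integral>y. X y + ee + K * Ind B2 y + abs (X y) * Ind B1 y + K * Ind B1 y \<partial>M)"
 using key Xi XB i1 by (intro integral_mono_AE Yi Bochner_Integration.integrable_add) auto
 also have "... = z + ee + K * prob B2 + (\<integral>y. abs (X y) * Ind B1 y \<partial>M) + K * prob B1"
 using Xi XB i1 mom(2) by (simp add: X_def[abs_def] prob_space)
 also have "(\<integral>y. abs (X y) * Ind B1 y \<partial>M) <= abs z * prob B1 + (1 + r * T) * (c / L + L * prob B1)"
 unfolding X_def by (rule mom(3)) (use B1 L in auto)
 also have "prob B2 <= pgt M (c / 4) vv + pgt M (c / 4) (err k)"
 proof -
 have "prob B2 <= prob ({y:space M. en (c / 4) < vv y} Un {y:space M. en (c / 4) < err k y})"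
 proof (rule finite_measure_mono)
 show "B2 <= {y:space M. en (c / 4) < vv y} Un {y:space M. en (c / 4) < err k y}"
 proof
 fix y assume w: "y : B2"
 hence wM: "y : space M" by (simp add: B2_def)
 have "NL T (%s. en ((V k s y)^2)) <= 2 * vv y + 2 * err k y"
 unfolding vv_def err_def
 proof (rule sq_split)
 show "(V k s y)^2 <= 2 * (v s y)^2 + 2 * (V k s y - v s y)^2" for s
 using sq_le[of "V k s y" 0 "v s y"] by simp
 show "(%s. v s y) : Bm (RB T)" by (rule section_measurable[OF v_joint wM])
 show "(%s. V k s y - v s y) : Bm (RB T)"
 by (intro borel_measurable_diff section_measurable[OF v_joint wM] section_measurable[OF V_joint wM])
 qed
 moreover have "en c < NL T (%s. en ((V k s y)^2))" using w by (simp add: B2_def)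
 ultimately show "y : {y:space M. en (c / 4) < vv y} Un {y:space M. en (c / 4) < err k y}"
 using ennreal_split4[OF _ _ c] wM by blast
 qed
 qed measurable
 also have "... <= pgt M (c / 4) vv + pgt M (c / 4) (err k)"
 by (rule measure_Un_le) auto
 finally show ?thesis .
 qed
 finally show ?thesis
 using K unfolding b_def B1_def[symmetric] by (simp add: mult_left_mono)
qed

text \<open>A nonnegative local martingale is a supermartingale. The order of limits matters:
  \<open>k\<close> tends to infinity at a fixed truncation level, then \<open>L\<close>, then the
  level \<open>n\<close>, then \<open>ee\<close> tends to 0; the cap \<open>K\<close> is removed
  last, by monotone convergence.\<close>

lemma budget:
 assumes r: "0 <= r" and Y [measurable]: "Y : Bm M" and Y0: "AE y in M. 0 <= Y y"
 and YJ: "AE y in M. Y y <= damped r z (%t. J t y) T"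
 and pos: "AE y in M. ALL t:{0..T}. 0 <= damped r z (%t. J t y) t"
 shows "NI M (%y. en (Y y)) <= en z"
proof -
 have min: "(\<integral>y. min (Y y) K \<partial>M) <= z" if K: "0 <= K" for K
 proof -
 have step: "(\<integral>y. min (Y y) K \<partial>M) <= z + ee + K * pgt M (real n) vv + (1 + r * T) * (4 * real n / L)"
 if e: "0 < ee" and L: "0 < L" and n: "0 < n" for ee L n
 proof -
 let ?b = "%k. prob (dev M ({0..T} Int Rats) ee (JE k) J)"
 let ?v = "pgt M (real n) vv"
 have b: "?b ----> 0"
 proof (rule order_tendstoI)
 fix a :: real assume "0 < a"
 thus "\<forall>\<^sub>F k in sequentially. ?b k < a"
 using uniform_approx[OF e, of "a / 2"] by (auto elim!: eventually_mono)
 next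
 fix a :: real assume "a < 0"
 thus "\<forall>\<^sub>F k in sequentially. a < ?b k" by (intro always_eventually) (auto intro: order.strict_trans2)
 qed
 let ?q = "%k. z + ee + K * (?v + pgt M (real n) (err k))
 + (abs z * ?b k + (1 + r * T) * (4 * real n / L + L * ?b k)) + K * ?b k"
 have "(\<integral>y. min (Y y) K \<partial>M) <= ?q k" for k
 using budget_truncated[OF r Y Y0 YJ pos e _ K L, of "4 * real n" k] by simp
 moreover have "?q ----> z + ee + K * (?v + 0) + (abs z * 0 + (1 + r * T) * (4 * real n / L + L * 0)) + K * 0"
 using n by (intro tendsto_intros b err_lim) simp
 ultimately show ?thesis by (intro LIMSEQ_le_const[of ?q]) auto
 qed
 have step2: "(\<integral>y. min (Y y) K \<partial>M) <= z + ee + K * pgt M (real n) vv"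
 if e: "0 < ee" and n: "0 < n" for ee n
 proof (rule field_le_epsilon)
 fix x :: real assume x: "0 < x"
 \<comment> \<open>Taking \<open>L = ?a / x\<close> makes the term from the truncated moment exactly
   \<open>x\<close>.\<close>
 let ?a = "(1 + r * T) * (4 * real n)"
 have a: "0 < ?a" using n r T by (simp add: add_pos_nonneg)
 have "(1 + r * T) * (4 * real n / (?a / x)) = ?a / (?a / x)" by simp
 also have "... = x" using a x by (metis divide_divide_eq_right less_irrefl nonzero_mult_div_cancel_left)
 finally have "(1 + r * T) * (4 * real n / (?a / x)) = x" .
 thus "(\<integral>y. min (Y y) K \<partial>M) <= z + ee + K * pgt M (real n) vv + x"
 using step[OF e, of "?a / x" n] a x n by simp
 qed
 have step3: "(\<integral>y. min (Y y) K \<partial>M) <= z + ee" if e: "0 < ee" for ee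
 proof (rule LIMSEQ_le_const)
 show "(%n. z + ee + K * pgt M (real n) vv) ----> z + ee"
 using tendsto_add[OF tendsto_const tendsto_mult[OF tendsto_const vv_tail], of "z + ee" K] by simp
 show "EX N. ALL n>=N. (\<integral>y. min (Y y) K \<partial>M) <= z + ee + K * pgt M (real n) vv"
 using step2[OF e] by (intro exI[of _ 1]) auto
 qed
 show ?thesis by (rule field_le_epsilon) (rule step3)
 qed
 have "NI M (%y. en (Y y)) = NI M (%y. (SUP n. en (min (Y y) (real n))))"
 proof (rule nn_integral_cong)
 fix y
 show "en (Y y) = (SUP n. en (min (Y y) (real n)))"
 proof (rule antisym)
 obtain n where "Y y <= real n" using real_arch_simple by blast
 hence "en (Y y) = en (min (Y y) (real n))" by simp
 also have "... <= (SUP n. en (min (Y y) (real n)))" by (rule SUP_upper) simp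
 finally show "en (Y y) <= (SUP n. en (min (Y y) (real n)))" .
 show "(SUP n. en (min (Y y) (real n))) <= en (Y y)" by (intro SUP_least ennreal_leI) simp
 qed
 qed
 also have "... = (SUP n. NI M (%y. en (min (Y y) (real n))))"
 proof (rule nn_integral_monotone_convergence_SUP)
 show "incseq (%n y. en (min (Y y) (real n)))"
 unfolding incseq_def le_fun_def by (intro allI impI ennreal_leI) auto
 qed measurable
 also have "... <= en z"
 proof (rule SUP_least)
 fix n
 have "NI M (%y. en (min (Y y) (real n))) = en (\<integral>y. min (Y y) (real n) \<partial>M)"
 proof (rule nn_integral_eq_integral)
 show "integrable M (%y. min (Y y) (real n))"
 using Y0 by (intro integrable_const_bound[where B="real n"]) auto
 show "AE y in M. 0 <= min (Y y) (real n)" using Y0 by eventually_elim simp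
 qed
 also have "... <= en z" by (intro ennreal_leI min) simp
 finally show "NI M (%y. en (min (Y y) (real n))) <= en z" .
 qed
 finally show ?thesis .
qed

end

section \<open>Brownian motion and the budget inequality\<close>

lemma progressive_const: "prog F (%_ _. c)"
 by (simp add: progressive_def case_prod_beta')

lemma progressive_comp2:
 assumes X: "prog F X" and Y: "prog F Y" and f: "(%(x, y). f x y) : Bm (borel >< borel)"
 shows "prog F (%t v. f (X t v) (Y t v))"
 unfolding progressive_def
proof (intro allI impI)
 fix t :: real assume t: "0 <= t"
 let ?R = "RB t >< F t"
 have "(%x. (%(x, y). f x y) ((%(s, v). X s v) x, (%(s, v). Y s v) x)) : Bm ?R"
 using X Y t by (intro measurable_compose[OF _ f] measurable_Pair) (auto simp: progressive_def)
 thus "(%(s, v). f (X s v) (Y s v)) : Bm ?R" by (simp add: case_prod_beta')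
qed

lemma progressive_comp:
 assumes X: "prog F X" and f: "f : Bm borel"
 shows "prog F (%t v. f (X t v))"
 using progressive_comp2[OF X X, of "%x y. f x"] f by (simp add: case_prod_beta' measurable_compose[OF measurable_fst])

lemma progressive_add: "prog F X ==> prog F Y ==> prog F (%t v. X t v + Y t v)"
 by (rule progressive_comp2[where f="(+)"]) (auto simp: case_prod_beta')

lemma progressive_diff: "prog F X ==> prog F Y ==> prog F (%t v. X t v - Y t v)"
 by (rule progressive_comp2[where f="(-)"]) (auto simp: case_prod_beta')

lemma progressive_mult: "prog F X ==> prog F Y ==> prog F (%t v. X t v * Y t v)"
 by (rule progressive_comp2[where f="(*)"]) (auto simp: case_prod_beta')

lemma progressive_cong:
 assumes "!!t v. 0 <= t ==> v : space (F t) ==> X t v = Y t v" and sp: "!!s t. space (F s) = space (F t)"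
 shows "prog F X = prog F Y"
 unfolding progressive_def
proof (intro all_cong1 imp_cong refl measurable_cong)
 fix t :: real and x assume "0 <= t" "x : space (RB t >< F t)"
 hence "0 <= fst x" "snd x : space (F t)" by (auto simp: space_pair_measure space_restrict_space)
 hence "0 <= fst x" "snd x : space (F (fst x))" unfolding sp[of "fst x" t] by auto
 thus "(case x of (s, v) => X s v) = (case x of (s, v) => Y s v)" using assms(1) by (simp add: case_prod_beta')
qed

locale bm =
 fixes M :: "'a measure" and F :: "real => 'a measure" and B :: "real => 'a => real"
 assumes BM: "brownian_motion M F B"

sublocale bm \<subseteq> gauss_incr M F B "{0..}"
 by (rule gauss_incr_brownian[OF BM])

section \<open>Progressive processes and stopping times\<close>

context bm
begin

lemma progressive_adapted: "prog F X ==> 0 <= t ==> X t : Bm (F t)"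
proof -
 assume X: "prog F X" and t: "0 <= t"
 have "(%v. (%(s, v). X s v) (t, v)) : Bm (F t)"
 proof (rule measurable_compose[where f="%v. (t, v)" and g="%(s, v). X s v"])
 show "(%v. (t, v)) : measurable (F t) (RB t >< F t)"
 using t by (intro measurable_Pair1') (simp add: space_restrict_space)
 show "(%(s, v). X s v) : Bm (RB t >< F t)" using X t by (simp add: progressive_def)
 qed
 thus ?thesis by simp
qed

lemma progressive_M: "prog F X ==> 0 <= t ==> X t : Bm M"
 by (rule F_M[OF _ progressive_adapted]) auto

lemma progressive_joint:
 assumes X: "prog F X" and T: "0 <= T"
 shows "(%(s, v). X s v) : Bm (RB T >< M)"
 using X T by (intro F_M_prod[of T]) (auto simp: progressive_def)

lemma progressive_continuous:
 assumes "!!t. 0 <= t ==> X t : Bm (F t)" and "!!v. v : space M ==> Con {0..} (%t. X t v)"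
 shows "prog F X"
 unfolding progressive_def
proof (intro allI impI joint_measurable_continuous)
 fix t u :: real assume u: "0 <= u" "u <= t"
 show "X u : Bm (F t)" using F_mono[OF u(2) assms(1)[OF u(1)]] .
next
 fix t :: real and v assume "v : space (F t)"
 thus "Con {0..t} (%t. X t v)" using assms(2)[of v] by (auto intro: continuous_on_subset)
qed simp

lemma progressive_comp_time:
 assumes X: "prog F X" and f: "(%(s, x). f s x) : Bm (borel >< borel)"
 shows "prog F (%t v. f t (X t v))"
 using progressive_comp2[OF progressive_continuous[of "%t _. t"] X f] by (simp add: continuous_on_id)

lemma pred_le:
 assumes ta: "Stop F ta" and st: "0 <= s" "s <= t"
 shows "Measurable.pred (F t) (%v. ta v <= en s)"
proof -
 have "Measurable.pred (F s) (%v. ta v <= en s)" using ta st by (simp add: ext_stopping_time_def)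
 thus ?thesis by (rule F_mono[OF st(2)])
qed

lemma pred_le_M: "Stop F ta ==> 0 <= t ==> Measurable.pred M (%v. ta v <= en t)"
 using F_M[OF _ pred_le[of ta t t]] by auto

lemma stop_measurable:
 assumes ta: "Stop F ta" and t: "0 <= t"
 shows "(%v. min (ta v) (en t)) : Bm (F t)"
proof (rule borel_measurableI_le)
 fix y :: ennreal
 show "{v : space (F t). min (ta v) (en t) <= y} : sets (F t)"
 proof (cases "en t <= y")
 case True
 hence "{v : space (F t). min (ta v) (en t) <= y} = space (F t)" by (auto simp: min_le_iff_disj)
 thus ?thesis by (simp only: sets.top)
 next
 case False
 hence "y < en t" by simp
 then obtain u where u: "y = en u" "0 <= u" by (cases y) auto
 hence "u <= t" using \<open>y < en t\<close> by (simp add: ennreal_less_iff less_imp_le)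
 hence "Measurable.pred (F t) (%v. ta v <= en u)" by (rule pred_le[OF ta u(2)])
 moreover have "{v : space (F t). min (ta v) (en t) <= y} = {v : space (F t). ta v <= en u}"
 using False u by (auto simp: min_le_iff_disj)
 ultimately show ?thesis by (simp add: pred_def)
 qed
qed

text \<open>Real-valued, so that it can be used as a time argument even where \<open>ta\<close> is
  infinite.\<close>

definition stop_at :: "('a => ennreal) => real => 'a => real" where
 "stop_at ta t v = er (min (ta v) (en t))"

lemma stop_at_measurable: "Stop F ta ==> 0 <= t ==> stop_at ta t : Bm (F t)"
 using stop_measurable unfolding stop_at_def[abs_def] by measurable

lemma stop_at_range: "0 <= t ==> stop_at ta t v : {0..t}"
proof -
 assume t: "0 <= t"
 have "er (min (ta v) (en t)) <= er (en t)" by (rule enn2real_mono) auto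
 thus ?thesis using t by (simp add: stop_at_def)
qed

lemma stop_at_eq: "0 <= t ==> stop_at ta t v = (if ta v <= en t then er (ta v) else t)"
 by (simp add: stop_at_def min_def)

lemma progressive_stopped:
 assumes X: "prog F X" and ta: "Stop F ta" and t: "0 <= t"
 shows "(%v. X (stop_at ta t v) v) : Bm (F t)"
proof -
 have "(%v. (%(s, v). X s v) (stop_at ta t v, v)) : Bm (F t)"
 proof (rule measurable_compose[where f="%v. (stop_at ta t v, v)" and g="%(s, v). X s v"])
 have "stop_at ta t : measurable (F t) (RB t)"
 using stop_at_range[OF t] by (intro measurable_restrict_space2 stop_at_measurable[OF ta t]) auto
 thus "(%v. (stop_at ta t v, v)) : measurable (F t) (RB t >< F t)"
 by (intro measurable_Pair) auto
 show "(%(s, v). X s v) : Bm (RB t >< F t)" using X t by (simp add: progressive_def)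
 qed
 thus ?thesis by simp
qed

lemma progressive_stopping:
 assumes ta: "Stop F ta"
 shows "prog F (%t v. of_bool (ta v <= en t))"
 unfolding progressive_def
proof (intro allI impI)
 fix T :: real assume T: "0 <= T"
 let ?R = "RB T >< F T"
 have 1: "(%x. stop_at ta T (snd x)) : Bm ?R"
 by (rule measurable_compose[OF measurable_snd stop_at_measurable[OF ta T]])
 have "(%s. s) : Bm (RB T)" by (rule measurable_restrict_space1) simp
 hence 2: "(%x. fst x) : Bm ?R" by (rule measurable_compose[OF measurable_fst])
 have 3: "Measurable.pred ?R (%x. ta (snd x) <= en T)"
 by (rule measurable_compose[OF measurable_snd pred_le[OF ta T order_refl]])
 \<comment> \<open>\<open>stop_at ta T\<close> cannot tell \<open>ta = T\<close> from
   \<open>ta > T\<close>, so at the final time the event is tested directly.\<close>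
 have "(%x. of_bool (stop_at ta T (snd x) <= fst x & (fst x < T | ta (snd x) <= en T)) :: real) : Bm ?R"
 using 1 2 3 by measurable
 moreover have "(%x. of_bool (stop_at ta T (snd x) <= fst x & (fst x < T | ta (snd x) <= en T)) :: real) : Bm ?R \<longleftrightarrow>
 (%(t, v). of_bool (ta v <= en t) :: real) : Bm ?R"
 proof (rule measurable_cong)
 fix x assume "x : space ?R"
 hence x: "0 <= fst x" "fst x <= T" by (auto simp: space_pair_measure space_restrict_space)
 have "ta (snd x) <= en (fst x) \<longleftrightarrow> stop_at ta T (snd x) <= fst x & (fst x < T | ta (snd x) <= en T)"
 proof (cases "ta (snd x) <= en T")
 case True
 then obtain u where u: "ta (snd x) = en u" "0 <= u" by (cases "ta (snd x)") (auto simp: top_unique)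
 thus ?thesis using True x T by (simp add: stop_at_eq)
 next
 case False
 have "en (fst x) <= en T" using x by (simp add: ennreal_leI)
 hence "~  ta (snd x) <= en (fst x)" using False order_trans by blast
 thus ?thesis using False x T by (simp add: stop_at_eq)
 qed
 thus "(of_bool (stop_at ta T (snd x) <= fst x & (fst x < T | ta (snd x) <= en T)) :: real) = (case x of (t, v) => of_bool (ta v <= en t))"
 by (simp add: case_prod_beta')
 qed
 ultimately show "(%(t, v). of_bool (ta v <= en t) :: real) : Bm ?R" by simp
qed

lemma progressive_pre: "Stop F ta ==> prog F (%t v. of_bool (en t < ta v))"
proof -
 assume ta: "Stop F ta"
 have "(%t v. of_bool (en t < ta v) :: real) = (%t v. 1 - of_bool (ta v <= en t))"
 by (auto simp: fun_eq_iff not_le)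
 thus ?thesis using progressive_diff[OF progressive_const progressive_stopping[OF ta], of 1] by simp
qed

section \<open>Exponential martingales at stopping times\<close>

lemma emart_continuous: "v : space M ==> Con {0..} (%t. emart c t v)"
 unfolding emart_def by (intro continuous_intros continuous) auto

lemma emart_progressive: "prog F (emart c)"
 using emart_adapted emart_continuous by (intro progressive_continuous) auto

text \<open>Measurability with respect to the past of the stopping time \<open>ta\<close>, expressed
  through its traces on the events \<open>ta <= t\<close>.\<close>

definition pre_F :: "('a => ennreal) => ('a => ennreal) => bool" where
 "pre_F ta R \<longleftrightarrow> (ALL t>=0. (%v. R v * on ta t v) : Bm (F t))"

lemma pre_F_times: "pre_F ta R ==> pre_F ta S ==> pre_F ta (%v. R v * S v)"
 unfolding pre_F_def
proof (intro allI impI)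
 fix t :: real assume *: "ALL t>=0. (%v. R v * on ta t v) : Bm (F t)"
 "ALL t>=0. (%v. S v * on ta t v) : Bm (F t)" "0 <= t"
 have "(%v. (R v * on ta t v) * (S v * on ta t v)) : Bm (F t)"
 by (rule borel_measurable_times_ennreal[OF *(1)[rule_format, OF *(3)] *(2)[rule_format, OF *(3)]])
 also have "(%v. (R v * on ta t v) * (S v * on ta t v)) =
 (%v. R v * S v * on ta t v)" by (auto simp: indicator_def)
 finally show "(%v. R v * S v * on ta t v) : Bm (F t)" .
qed

lemma pre_F_process:
 assumes ta: "Stop F ta" and X: "prog F X"
 shows "pre_F ta (%v. en (X (er (ta v)) v))"
 unfolding pre_F_def
proof (intro allI impI)
 fix t :: real assume t: "0 <= t"
 have "(%v. en (X (stop_at ta t v) v) * (if ta v <= en t then 1 else 0)) : Bm (F t)"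
 using progressive_stopped[OF X ta t] pred_le[OF ta t order_refl] by measurable
 also have "(%v. en (X (stop_at ta t v) v) * (if ta v <= en t then 1 else 0)) =
 (%v. en (X (er (ta v)) v) * on ta t v)"
 using t by (auto simp: stop_at_eq indicator_def fun_eq_iff)
 finally show "(%v. en (X (er (ta v)) v) * on ta t v) : Bm (F t)" .
qed

text \<open>Index of the first point of mesh \<open>T / (n + 1)\<close> that is not before
  \<open>ta\<close>. Rounding up keeps the event that a given point is chosen in the past of that
  point.\<close>

definition round_up :: "('a => ennreal) => real => nat => 'a => nat" where
 "round_up ta T n v = (LEAST i. ta v <= en (T * real i / real (Suc n)))"

lemma round_up:
 assumes ta: "ta v <= en T" and T: "0 < T"
 shows "round_up ta T n v <= Suc n" "ta v <= en (T * real (round_up ta T n v) / real (Suc n))"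
 "!!j. j < round_up ta T n v ==> ~  ta v <= en (T * real j / real (Suc n))"
 "abs (T * real (round_up ta T n v) / real (Suc n) - er (ta v)) <= T / real (Suc n)"
proof -
 let ?i = "round_up ta T n v"
 have ex: "ta v <= en (T * real (Suc n) / real (Suc n))" using ta by simp
 show 1: "?i <= Suc n" unfolding round_up_def by (rule Least_le) (rule ex)
 show 2: "ta v <= en (T * real ?i / real (Suc n))" unfolding round_up_def by (rule LeastI[of _ "Suc n"]) (rule ex)
 show 3: "~  ta v <= en (T * real j / real (Suc n))" if "j < ?i" for j
 using not_less_Least[of j "%i. ta v <= en (T * real i / real (Suc n))"] that unfolding round_up_def[symmetric] by simp
 obtain u where u: "ta v = en u" "0 <= u" using ta by (cases "ta v") (auto simp: top_unique)
 have up: "u <= T * real ?i / real (Suc n)" using 2 u T by (simp add: ennreal_le_iff del: of_nat_Suc)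
 have "T * real ?i / real (Suc n) - T / real (Suc n) <= u"
 proof (cases ?i)
 case 0 thus ?thesis using u T by (simp add: order_trans[of _ 0])
 next
 case (Suc j)
 have "~  u <= T * real j / real (Suc n)" using 3[of j] Suc u T by (simp add: ennreal_le_iff del: of_nat_Suc)
 moreover have "T * real ?i / real (Suc n) - T / real (Suc n) = T * real j / real (Suc n)"
 unfolding Suc by (simp add: diff_divide_distrib[symmetric] algebra_simps)
 ultimately show ?thesis by simp
 qed
 thus "abs (T * real ?i / real (Suc n) - er (ta v)) <= T / real (Suc n)" using up u by simp
qed

lemma round_up_lim:
 assumes ta: "ta v <= en T" and T: "0 < T"
 shows "(%n. T * real (round_up ta T n v) / real (Suc n)) ----> er (ta v)"
proof (rule LIM_zero_cancel, rule Lim_null_comparison)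
 show "\<forall>\<^sub>F n in sequentially. norm (T * real (round_up ta T n v) / real (Suc n) - er (ta v)) <= T / real (Suc n)"
 using round_up(4)[where ta=ta and v=v, OF ta T] by (intro always_eventually) simp
 show "(%n. T / real (Suc n)) ----> 0"
 using tendsto_mult[OF tendsto_const[of T] LIMSEQ_inverse_real_of_nat] by (simp add: divide_inverse)
qed

text \<open>With finitely many values, optional stopping is a finite sum of martingale identities.
  \<open>Q\<close> may depend on the rounded time, which admits the reciprocal of the martingale as
  a weight.\<close>

lemma emart_round_up:
 fixes n :: nat
 assumes ta: "Stop F ta" and T: "0 < T" and Q: "!!t. 0 <= t ==> t <= T ==> (%v. Q t v * on ta t v) : Bm (F t)"
 defines "rh \<equiv> %v. T * real (round_up ta T n v) / real (Suc n)"
 shows "NI M (%v. Q (rh v) v * on ta T v * en (emart c T v)) =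
 NI M (%v. Q (rh v) v * on ta T v * en (emart c (rh v) v))"
proof -
 define t where "t i = T * real i / real (Suc n)" for i
 have t0: "0 <= t i" for i using T by (simp add: t_def)
 have tT: "t i <= T" if "i <= Suc n" for i
 unfolding t_def using that T by (simp add: divide_le_eq mult_left_mono del: of_nat_Suc)
 have tm: "t i <= t j" if "i <= j" for i j
 unfolding t_def using that T by (intro divide_right_mono mult_left_mono) auto
 define A where "A i = {v. ta v <= en (t i) & (ALL j<i. ~  ta v <= en (t j))}" for i
 have split: "f (rh v) * on ta T v = (SUM i<=Suc n. f (t i) * Ind (A i) v)"
 for f :: "real => ennreal" and v
 proof (cases "ta v <= en T")
 case True
 let ?i = "round_up ta T n v"
 note r = round_up[where ta=ta and v=v and n=n, OF True T]
 have "Ind (A i) v = (if i = ?i then 1 else 0 :: ennreal)" for i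
 proof -
 have "v : A i \<longleftrightarrow> i = ?i"
 proof
 assume "v : A i"
 hence "ta v <= en (t i)" "!!j. j < i ==> ~  ta v <= en (t j)" by (auto simp: A_def)
 thus "i = ?i" using r(2,3) unfolding t_def[symmetric] by (metis linorder_neqE_nat)
 qed (use r(2,3) in \<open>auto simp: A_def t_def\<close>)
 thus ?thesis by (simp add: indicator_def)
 qed
 hence "(SUM i<=Suc n. f (t i) * Ind (A i) v) = (SUM i<=Suc n. if i = ?i then f (t i) else 0)"
 by (intro sum.cong) auto
 also have "... = f (t ?i)" using r(1) by (subst sum.delta) auto
 finally show ?thesis using True by (simp add: rh_def t_def)
 next
 case False
 have "v \<notin> A i" if "i <= Suc n" for i
 proof
 assume "v : A i"
 hence "ta v <= en (t i)" by (simp add: A_def)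
 also have "... <= en T" using tT[OF that] by (rule ennreal_leI)
 finally show False using False by simp
 qed
 thus ?thesis using False by simp
 qed
 have AF: "(%v. Q (t i) v * Ind (A i) v) : Bm (F (t i))" if i: "i <= Suc n" for i
 proof -
 have "Measurable.pred (F (t i)) (%v. ALL j:{..<i}. ~  ta v <= en (t j))"
 using pred_le[OF ta t0 tm] by (intro pred_intros_finite pred_intros_logic(2)) auto
 hence "(%v. (Q (t i) v * on ta (t i) v) * (if ALL j:{..<i}. ~  ta v <= en (t j) then 1 else 0)) : Bm (F (t i))"
 using Q[OF t0 tT[OF i]] by measurable
 also have "(%v. (Q (t i) v * on ta (t i) v) * (if ALL j:{..<i}. ~  ta v <= en (t j) then 1 else 0))
 = (%v. Q (t i) v * Ind (A i) v)"
 by (auto simp: A_def indicator_def fun_eq_iff)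
 finally show ?thesis .
 qed
 have QM [measurable]: "(%v. Q (t i) v * Ind (A i) v) : Bm M" if "i <= Suc n" for i
 using F_M[OF _ AF[OF that]] t0 by simp
 have eM: "emart c (t i) : Bm M" "emart c T : Bm M" for i
 using emart_M t0 T by auto
 have "NI M (%v. Q (rh v) v * on ta T v * en (emart c T v)) =
 NI M (%v. (SUM i<=Suc n. Q (t i) v * Ind (A i) v * en (emart c T v)))"
 using split[of "%t. Q t _"] by (simp only: sum_distrib_right)
 also have "... = (SUM i<=Suc n. NI M (%v. Q (t i) v * Ind (A i) v * en (emart c T v)))"
 using QM eM by (intro nn_integral_sum) auto
 also have "... = (SUM i<=Suc n. NI M (%v. Q (t i) v * Ind (A i) v * en (emart c (t i) v)))"
 using t0 tT T by (intro sum.cong refl emart_nn_integral AF) auto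
 also have "... = NI M (%v. (SUM i<=Suc n. Q (t i) v * Ind (A i) v * en (emart c (t i) v)))"
 using QM eM by (intro nn_integral_sum[symmetric]) auto
 also have "... = NI M (%v. Q (rh v) v * on ta T v * en (emart c (rh v) v))"
 proof (rule nn_integral_cong)
 fix v
 show "(SUM i<=Suc n. Q (t i) v * Ind (A i) v * en (emart c (t i) v)) =
 Q (rh v) v * on ta T v * en (emart c (rh v) v)"
 using split[of "%t. Q t v * en (emart c t v)" v] by (simp only: mult_ac)
 qed
 finally show ?thesis .
qed

text \<open>
 Optional stopping without uniform integrability: Fatou's lemma along \<open>rh\<^sub>n \<down> ta\<close> gives one
 inequality when applied to \<open>m(rh\<^sub>n)\<close> and the other when applied to \<open>m(T) / m(rh\<^sub>n)\<close>.
\<close>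

lemma emart_optional_stopping:
 assumes ta: "Stop F ta" and T: "0 <= T" and R: "pre_F ta R"
 shows "NI M (%v. R v * on ta T v * en (emart c T v)) =
 NI M (%v. R v * on ta T v * en (emart c (er (ta v)) v))"
proof (cases "T = 0")
 case True
 show ?thesis unfolding True by (intro nn_integral_cong) (auto simp: indicator_def)
next
 case False
 hence T: "0 < T" using T by simp
 define rh where "rh n v = T * real (round_up ta T n v) / real (Suc n)" for n v
 define mta where "mta v = en (emart c (er (ta v)) v)" for v
 let ?I = "%v. on ta T v :: ennreal"
 have mtaF: "pre_F ta mta" unfolding mta_def[abs_def] by (rule pre_F_process[OF ta emart_progressive])
 have lim: "(%n. emart c (rh n v) v) ----> emart c (er (ta v)) v" if "ta v <= en T" "v : space M" for v
 unfolding rh_def using that T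
 by (intro continuous_on_tendsto_compose[OF emart_continuous[OF that(2)] round_up_lim]) auto
 have RM: "(%v. R v * ?I v) : Bm M"
 using F_M[OF _ R[unfolded pre_F_def, rule_format, of T]] T by simp
 have rM: "(%v. emart c (rh n v) v * (if ta v <= en T then 1 else 0)) : Bm M" for n
 proof -
 have "round_up ta T n : measurable M (count_space UNIV)"
 unfolding round_up_def[abs_def] using T by (intro measurable_Least pred_le_M[OF ta]) auto
 have "(%v. (%i v. emart c (T * real i / real (Suc n)) v) (round_up ta T n v) v) : Bm M"
 proof (rule measurable_compose_countable[where f="%i v. emart c (T * real i / real (Suc n)) v" and g="round_up ta T n"])
 show "emart c (T * real i / real (Suc n)) : Bm M" for i using T by (intro emart_M) simp
 qed fact
 moreover have "Measurable.pred M (%v. ta v <= en T)" using T by (intro pred_le_M[OF ta]) simp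
 ultimately show ?thesis unfolding rh_def by measurable
 qed
 have RrM: "(%v. R v * ?I v * en (emart c (rh n v) v)) : Bm M" for n
 proof -
 have "(%v. (R v * ?I v) * en (emart c (rh n v) v * (if ta v <= en T then 1 else 0))) : Bm M"
 using RM rM by measurable
 also have "(%v. (R v * ?I v) * en (emart c (rh n v) v * (if ta v <= en T then 1 else 0))) = (%v. R v * ?I v * en (emart c (rh n v) v))"
 by (auto simp: fun_eq_iff indicator_def)
 finally show ?thesis .
 qed
 show ?thesis
 proof (rule antisym)
 have "NI M (%v. R v * ?I v * en (emart c (er (ta v)) v)) =
 NI M (%v. liminf (%n. R v * ?I v * en (emart c (rh n v) v)))"
 proof (rule nn_integral_cong)
 fix v assume w: "v : space M"
 show "R v * ?I v * en (emart c (er (ta v)) v) = liminf (%n. R v * ?I v * en (emart c (rh n v) v))"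
 proof (cases "ta v <= en T")
 case True
 have "(%n. R v * ?I v * en (emart c (rh n v) v)) ----> R v * ?I v * en (emart c (er (ta v)) v)"
 using emart_pos[of c "er (ta v)" v] by (intro tendsto_mult_ennreal tendsto_const tendsto_ennrealI lim[OF True w]) (auto simp: ennreal_eq_0_iff not_le)
 thus ?thesis by (rule lim_imp_Liminf[OF sequentially_bot, symmetric])
 qed (simp add: Liminf_const)
 qed
 also have "... <= liminf (%n. NI M (%v. R v * ?I v * en (emart c (rh n v) v)))"
 by (rule nn_integral_liminf[OF RrM])
 also have "(%n. NI M (%v. R v * ?I v * en (emart c (rh n v) v))) = (%n. NI M (%v. R v * ?I v * en (emart c T v)))"
 using emart_round_up[OF ta T, of "%_. R"] R T by (auto simp: pre_F_def rh_def)
 finally show "NI M (%v. R v * ?I v * en (emart c (er (ta v)) v)) <= NI M (%v. R v * ?I v * en (emart c T v))"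
 by (simp add: Liminf_const)
 next
 let ?Q = "%t v. R v * mta v * en (inverse (emart c t v))"
 have QF: "(%v. ?Q t v * on ta t v) : Bm (F t)" if t: "0 <= t" for t
 proof -
 have "(%v. (R v * mta v * on ta t v) * en (inverse (emart c t v))) : Bm (F t)"
 proof (rule borel_measurable_times_ennreal[OF pre_F_times[OF R mtaF, unfolded pre_F_def, rule_format, OF t]])
 have "emart c t : Bm (F t)" using t by (intro emart_adapted) auto
 thus "(%v. en (inverse (emart c t v))) : Bm (F t)" by measurable
 qed
 thus ?thesis by (simp only: mult_ac)
 qed
 have id: "?Q (rh n v) v * ?I v * en (emart c (rh n v) v) = R v * ?I v * mta v" for n v
 proof -
 have "en (inverse (emart c (rh n v) v)) * en (emart c (rh n v) v) = 1"
 using emart_pos[of c "rh n v" v] by (simp add: ennreal_mult'[symmetric])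
 moreover have "a * b * i * I * e = (a * I * b) * (i * e)" for a b i I e :: ennreal by (simp only: mult_ac)
 ultimately show ?thesis by simp
 qed
 have int: "NI M (%v. ?Q (rh n v) v * ?I v * en (emart c T v)) = NI M (%v. R v * ?I v * mta v)" for n
 using emart_round_up[OF ta T, of ?Q n c] QF unfolding rh_def[symmetric] id by auto
 have "NI M (%v. R v * ?I v * en (emart c T v)) = NI M (%v. liminf (%n. ?Q (rh n v) v * ?I v * en (emart c T v)))"
 proof (rule nn_integral_cong)
 fix v assume w: "v : space M"
 show "R v * ?I v * en (emart c T v) = liminf (%n. ?Q (rh n v) v * ?I v * en (emart c T v))"
 proof (cases "ta v <= en T")
 case True
 let ?m = "emart c (er (ta v)) v"
 have m0: "0 < ?m" by (rule emart_pos)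
 have "(%n. R v * ?I v * en (emart c T v) * (mta v * en (inverse (emart c (rh n v) v)))) ---->
 R v * ?I v * en (emart c T v) * (mta v * en (inverse ?m))"
 using m0 by (intro tendsto_mult_ennreal tendsto_const tendsto_ennrealI tendsto_inverse lim[OF True w]) (auto simp: mta_def ennreal_mult'[symmetric] ennreal_eq_0_iff not_le)
 moreover have "mta v * en (inverse ?m) = 1" using m0 by (simp add: mta_def ennreal_mult'[symmetric])
 ultimately have "(%n. ?Q (rh n v) v * ?I v * en (emart c T v)) ----> R v * ?I v * en (emart c T v)"
 by (simp add: mult_ac)
 thus ?thesis by (rule lim_imp_Liminf[OF sequentially_bot, symmetric])
 qed (simp add: Liminf_const)
 qed
 also have "... <= liminf (%n. NI M (%v. ?Q (rh n v) v * ?I v * en (emart c T v)))"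
 proof (rule nn_integral_liminf)
 fix n
 have 1: "(%v. R v * mta v * ?I v) : Bm M"
 using F_M[OF _ pre_F_times[OF R mtaF, unfolded pre_F_def, rule_format, of T]] T by simp
 have "(%v. (R v * mta v * ?I v) * en (inverse (emart c (rh n v) v * (if ta v <= en T then 1 else 0))) * en (emart c T v)) : Bm M"
 proof -
 have "emart c T : Bm M" using T by (intro emart_M) simp
 thus ?thesis using 1 rM by measurable
 qed
 also have "(%v. (R v * mta v * ?I v) * en (inverse (emart c (rh n v) v * (if ta v <= en T then 1 else 0))) * en (emart c T v))
 = (%v. ?Q (rh n v) v * ?I v * en (emart c T v))"
 by (auto simp: fun_eq_iff indicator_def)
 finally show "(%v. ?Q (rh n v) v * ?I v * en (emart c T v)) : Bm M" .
 qed
 also have "... = NI M (%v. R v * ?I v * en (emart c (er (ta v)) v))"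
 unfolding int by (simp add: Liminf_const mta_def)
 finally show "NI M (%v. R v * ?I v * en (emart c T v)) <= NI M (%v. R v * ?I v * en (emart c (er (ta v)) v))" .
 qed
qed

end

section \<open>Pathwise integration by parts and comparison of measures\<close>

lemma iterated_set_integral_swap:
 fixes g k :: "real => real"
 assumes g: "SI {0..u} g" and k: "Con UNIV k"
 shows "LI {0..u} (%s. k s * LI {0..s} (%t. g t)) = LI {0..u} (%t. g t * LI {t..u} (%s. k s))"
proof -
 define g0 where "g0 t = Ind {0..u} t * g t" for t
 have g0: "integrable lborel g0" using g by (simp add: set_integrable_def g0_def[abs_def])
 have km [measurable]: "k : Bm borel" using k by (rule borel_measurable_continuous_onI)
 have g0m [measurable]: "g0 : Bm borel" using borel_measurable_integrable[OF g0] by simp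
 define f where "f s t = Ind {0..u} s * k s * (of_bool (t <= s) * g0 t)" for s t
 have fm [measurable]: "(%(s, t). f s t) : Bm (lborel >< lborel)"
 unfolding f_def by measurable
 have "bounded (k ` {0..u})"
 using k by (intro compact_imp_bounded compact_continuous_image continuous_on_subset[OF k]) auto
 then obtain C where "ALL x:k ` {0..u}. norm x <= C" unfolding bounded_iff by blast
 hence C: "abs (k s) <= C" if "s : {0..u}" for s using that by simp
 have fs: "integrable lborel (%t. f s t)" for s
 proof (rule Bochner_Integration.integrable_bound[OF integrable_mult_right[OF g0, of "Ind {0..u} s * k s"]])
 show "AE t in lborel. norm (f s t) <= norm (Ind {0..u} s * k s * g0 t)"
 by (intro AE_I2) (auto simp: f_def abs_mult)
 qed (simp add: f_def)
 have fi: "integrable (lborel >< lborel) (%(s, t). f s t)"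
 proof (rule lborel_pair.Fubini_integrable)
 show "(%(s, t). f s t) : Bm (lborel >< lborel)" by (rule fm)
 show "AE s in lborel. integrable lborel (%t. case (s, t) of (s, t) => f s t)" using fs by simp
 show "integrable lborel (%s. \<integral>t. norm (case (s, t) of (s, t) => f s t) \<partial>lborel)"
 proof (rule Bochner_Integration.integrable_bound)
 show "integrable lborel (%s. Ind {0..u} s * (abs C * (\<integral>t. abs (g0 t) \<partial>lborel)))"
 by (intro integrable_mult_left integrable_real_indicator) (auto simp: emeasure_lborel_Icc_eq)
 show "(%s. \<integral>t. norm (case (s, t) of (s, t) => f s t) \<partial>lborel) : Bm lborel"
 by (rule lborel.borel_measurable_lebesgue_integral) simp
 show "AE s in lborel. norm (\<integral>t. norm (case (s, t) of (s, t) => f s t) \<partial>lborel) <= norm (Ind {0..u} s * (abs C * (\<integral>t. abs (g0 t) \<partial>lborel)))"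
 proof (intro AE_I2)
 fix s
 show "norm (\<integral>t. norm (case (s, t) of (s, t) => f s t) \<partial>lborel) <= norm (Ind {0..u} s * (abs C * (\<integral>t. abs (g0 t) \<partial>lborel)))"
 proof (cases "s : {0..u}")
 case True
 have "(\<integral>t. abs (f s t) \<partial>lborel) <= (\<integral>t. abs C * abs (g0 t) \<partial>lborel)"
 proof (rule integral_mono)
 show "integrable lborel (%t. abs (f s t))" using fs[of s] by (rule integrable_abs)
 show "integrable lborel (%t. abs C * abs (g0 t))" using g0 by (intro integrable_mult_right integrable_abs)
 show "abs (f s t) <= abs C * abs (g0 t)" for t
 proof -
 have "abs (f s t) <= abs (k s) * abs (g0 t)" using True by (simp add: f_def abs_mult)
 also have "... <= abs C * abs (g0 t)" using C[OF True] by (intro mult_right_mono) auto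
 finally show ?thesis .
 qed
 qed
 thus ?thesis using True by simp
 next
 case False thus ?thesis by (simp add: f_def)
 qed
 qed
 qed
 qed
 have L: "(\<integral>t. f s t \<partial>lborel) = Ind {0..u} s *\<^sub>R (k s * LI {0..s} (%t. g t))" for s
 proof (cases "s : {0..u}")
 case True
 have "f s t = k s * (Ind {0..s} t *\<^sub>R g t)" for t
 using True by (auto simp: f_def g0_def indicator_def)
 thus ?thesis using True by (simp add: set_lebesgue_integral_def)
 qed (simp add: f_def)
 have R: "(\<integral>s. f s t \<partial>lborel) = Ind {0..u} t *\<^sub>R (g t * LI {t..u} (%s. k s))" for t
 proof (cases "t : {0..u}")
 case True
 have "f s t = g t * (Ind {t..u} s *\<^sub>R k s)" for s
 using True by (auto simp: f_def g0_def indicator_def)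
 thus ?thesis using True by (simp add: set_lebesgue_integral_def)
 qed (simp add: f_def g0_def)
 show ?thesis
 using lborel_pair.Fubini_integral[OF fi] unfolding L R by (simp add: set_lebesgue_integral_def)
qed

text \<open>Integration by parts for \<open>exp (- r * t) * Z t\<close>, carried out by Fubini
  because \<open>J\<close> is merely continuous. With \<open>Z\<close> as wealth and
  \<open>c\<close> as consumption, the transform of \<open>J\<close> is discounted wealth plus
  accumulated discounted consumption.\<close>

lemma damped_ode:
 assumes u: "0 <= u" and Z: "Con {0..u} Z" and J: "Con {0..u} J" and c: "SI {0..u} c"
 and eq: "!!t. t : {0..u} ==> Z t = z + LI {0..t} (%s. r * Z s - c s) + J t"
 shows "damped r z J u = exp (- r * u) * Z u + LI {0..u} (%s. exp (- r * s) * c s)"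
proof -
 let ?k = "%s. r * exp (- r * s)"
 define g where "g s = r * Z s - c s" for s
 define G where "G t = LI {0..t} (%s. g s)" for t
 have ck: "Con A ?k" for A by (intro continuous_intros)
 have rZ: "SI {0..u} (%s. r * Z s)" by (intro set_integrable_continuous_Icc continuous_intros Z)
 have g: "SI {0..u} g" unfolding g_def[abs_def] by (rule set_integral_diff(1)[OF rZ c])
 have eG: "G t = Z t - z - J t" if "t : {0..u}" for t using eq[OF that] by (simp add: G_def g_def)
 have kZ: "SI {0..u} (%s. ?k s * Z s)" by (intro set_integrable_continuous_Icc continuous_intros Z)
 have kz: "SI {0..u} (%s. ?k s * z)" by (intro set_integrable_continuous_Icc continuous_intros)
 have kJ: "SI {0..u} (%s. ?k s * J s)" by (intro set_integrable_continuous_Icc continuous_intros J)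
 have ec: "SI {0..u} (%s. exp (- r * s) * c s)"
 proof -
 have "integrable lborel (%s. exp (- r * s) * Ind {0..u} s * (Ind {0..u} s *\<^sub>R c s))"
 proof (rule Bochner_Integration.integrable_bound)
 show "integrable lborel (%s. exp (abs r * abs u) * (Ind {0..u} s *\<^sub>R c s))"
 using c by (intro integrable_mult_right) (simp add: set_integrable_def)
 show "(%s. exp (- r * s) * Ind {0..u} s * (Ind {0..u} s *\<^sub>R c s)) : Bm lborel"
 using borel_measurable_integrable[OF c[unfolded set_integrable_def]] by measurable
 show "AE s in lborel. norm (exp (- r * s) * Ind {0..u} s * (Ind {0..u} s *\<^sub>R c s)) <= norm (exp (abs r * abs u) * (Ind {0..u} s *\<^sub>R c s))"
 proof (intro AE_I2)
 fix s
 show "norm (exp (- r * s) * Ind {0..u} s * (Ind {0..u} s *\<^sub>R c s)) <= norm (exp (abs r * abs u) * (Ind {0..u} s *\<^sub>R c s))"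
 proof (cases "s : {0..u}")
 case True
 have "- r * s <= abs r * abs u"
 proof -
 have "- r * s <= abs r * s" using True by (intro mult_right_mono) auto
 also have "... <= abs r * abs u" using True by (intro mult_left_mono) auto
 finally show ?thesis .
 qed
 thus ?thesis using True by (simp add: abs_mult mult_right_mono)
 qed simp
 qed
 qed
 thus ?thesis unfolding set_integrable_def by (rule Bochner_Integration.integrable_cong[THEN iffD1, rotated 2]) (auto simp: indicator_def)
 qed
 have eg: "SI {0..u} (%s. exp (- r * s) * g s)"
 proof -
 have "SI {0..u} (%s. ?k s * Z s - exp (- r * s) * c s)" by (rule set_integral_diff(1)[OF kZ ec])
 thus ?thesis by (simp add: g_def right_diff_distrib mult_ac)
 qed
 have swap: "LI {0..u} (%s. ?k s * G s) = LI {0..u} (%s. exp (- r * s) * g s) - exp (- r * u) * G u"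
 proof -
 have "LI {0..u} (%s. ?k s * G s) = LI {0..u} (%t. g t * LI {t..u} (%s. ?k s))"
 unfolding G_def by (rule iterated_set_integral_swap[OF g ck])
 also have "... = LI {0..u} (%t. exp (- r * t) * g t - exp (- r * u) * g t)"
 proof (intro set_lebesgue_integral_cong allI impI)
 fix t assume "t : {0..u}"
 hence "LI {t..u} (%s. ?k s) = exp (- r * t) - exp (- r * u)" by (intro damped_kernel_integral) auto
 thus "g t * LI {t..u} (%s. ?k s) = exp (- r * t) * g t - exp (- r * u) * g t"
 by (simp only: right_diff_distrib mult.commute)
 qed simp
 also have "... = LI {0..u} (%s. exp (- r * s) * g s) - exp (- r * u) * G u"
 using g by (subst set_integral_diff(2)[OF eg]) (auto simp: G_def set_integrable_mult_right)
 finally show ?thesis .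
 qed
 have "LI {0..u} (%s. ?k s * G s) = LI {0..u} (%s. ?k s * Z s - ?k s * z - ?k s * J s)"
 using eG by (intro set_lebesgue_integral_cong) (auto simp: right_diff_distrib)
 also have "... = LI {0..u} (%s. ?k s * Z s) - LI {0..u} (%s. ?k s * z) - LI {0..u} (%s. ?k s * J s)"
 using set_integral_diff(2)[OF set_integral_diff(1)[OF kZ kz] kJ] set_integral_diff(2)[OF kZ kz] by simp
 also have "LI {0..u} (%s. ?k s * z) = (1 - exp (- r * u)) * z"
 using damped_kernel_integral[of 0 u r] u by simp
 finally have 1: "LI {0..u} (%s. ?k s * J s) = LI {0..u} (%s. ?k s * Z s) - (1 - exp (- r * u)) * z
 - (LI {0..u} (%s. exp (- r * s) * g s) - exp (- r * u) * G u)" unfolding swap by simp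
 have 2: "LI {0..u} (%s. exp (- r * s) * g s) = LI {0..u} (%s. ?k s * Z s) - LI {0..u} (%s. exp (- r * s) * c s)"
 unfolding set_integral_diff(2)[OF kZ ec, symmetric] by (intro set_lebesgue_integral_cong) (auto simp: g_def algebra_simps)
 have "J u = Z u - z - G u" using eG[of u] u by simp
 hence 3: "exp (- r * u) * J u = exp (- r * u) * Z u - exp (- r * u) * z - exp (- r * u) * G u" by (simp only: right_diff_distrib)
 show ?thesis unfolding damped_def 1 2 3 by (simp add: left_diff_distrib)
qed

text \<open>The elementary integral against time itself is the correction produced by adding a drift
  to the motion.\<close>

lemma elementary_integral_time:
 assumes el: "is_elementary F E" and u: "0 <= u"
 shows "EI (%t _. t) E u v = LI {0..u} (%s. EP E s v)"
 "SI {0..u} (%s. EP E s v)"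
proof -
 obtain n t xx where E: "E = (n, t, xx)" by (cases E)
 have tm: "0 <= t i & t i <= t (Suc i)" if "i < n" for i using elementary_mono[OF el[unfolded E], of i "Suc i"] that by simp
 have ind: "Ind {0..u} s * Ind {t i<..t (Suc i)} s = (Ind {min u (t i)<..min u (t (Suc i))} s :: real)" if "i < n" for i s
 using tm[OF that] by (auto simp: indicator_def)
 have i: "integrable lborel (%s. xx i v * Ind {min u (t i)<..min u (t (Suc i))} s)" for i
 by (intro integrable_mult_right integrable_real_indicator) (auto intro: le_less_trans[OF emeasure_mono[of _ "{min u (t i)..min u (t (Suc i))}"]] simp: emeasure_lborel_Icc_eq)
 have e: "Ind {0..u} s *\<^sub>R EP E s v = (SUM i<n. xx i v * Ind {min u (t i)<..min u (t (Suc i))} s)" for s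
 unfolding E elementary_process_def prod.case real_scaleR_def sum_distrib_left
 using ind by (intro sum.cong) (auto simp: mult.left_commute)
 show "SI {0..u} (%s. EP E s v)"
 unfolding set_integrable_def e using i by (intro Bochner_Integration.integrable_sum)
 have "LI {0..u} (%s. EP E s v) = (SUM i<n. xx i v * (min u (t (Suc i)) - min u (t i)))"
 unfolding set_lebesgue_integral_def e using i tm
 by (subst Bochner_Integration.integral_sum) (auto intro!: sum.cong simp: measure_def min.coboundedI2)
 thus "EI (%t _. t) E u v = LI {0..u} (%s. EP E s v)"
 by (simp add: E elementary_integral_def)
qed

text \<open>Split at the event \<open>n < L\<close>: its mass under the density is small for large
  \<open>n\<close>, and off it the density is at most \<open>n\<close>.\<close>

lemma (in prob_space) density_prob_tendsto_0:
 assumes L [measurable]: "L : Bm M" and L1: "NI M (%v. en (L v)) < \<infinity>" and A: "!!k. A k : sets M"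
 and lim: "(%k. prob (A k)) ----> 0"
 shows "(%k. measure (density M (%v. en (L v))) (A k)) ----> 0"
proof -
 let ?Q = "density M (%v. en (L v))"
 interpret Q: finite_measure ?Q
 using L1 by (intro finite_measureI) (simp add: emeasure_density nn_integral_cong[of M "%v. en (L v) * Ind (space M) v" "%v. en (L v)"] less_top)
 let ?B = "%n. {v:space M. real n < L v}"
 have tail: "(%n. measure ?Q (?B n)) ----> 0"
 proof -
 have "(%n. measure ?Q (?B n)) ----> measure ?Q (INT n. ?B n)"
 by (rule Q.finite_Lim_measure_decseq) (auto simp: decseq_def)
 moreover have "(INT n. ?B n) = {}"
 proof -
 have False if "v : (INT n. ?B n)" for v
 proof -
 obtain n where "L v <= real n" using real_arch_simple by blast
 moreover have "real n < L v" using that by auto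
 ultimately show False by simp
 qed
 thus ?thesis by blast
 qed
 ultimately show ?thesis by simp
 qed
 have bound: "measure ?Q (A k) <= real n * prob (A k) + measure ?Q (?B n)" for k n
 proof -
 note [measurable] = A[of k]
 have "measure ?Q (A k) <= measure ?Q ((A k - ?B n) Un ?B n)" using A by (intro Q.finite_measure_mono) auto
 also have "... <= measure ?Q (A k - ?B n) + measure ?Q (?B n)" by (rule measure_Un_le) auto
 also have "measure ?Q (A k - ?B n) <= real n * prob (A k)"
 proof -
 have "emeasure ?Q (A k - ?B n) = NI M (%v. en (L v) * Ind (A k - ?B n) v)"
 by (subst emeasure_density) auto
 also have "... <= NI M (%v. en (real n) * Ind (A k) v)"
 by (intro nn_integral_mono) (auto simp: indicator_def not_less intro!: ennreal_leI)
 also have "... = en (real n * prob (A k))"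
 by (subst nn_integral_cmult_indicator) (auto simp: emeasure_eq_measure ennreal_mult')
 finally show ?thesis by (simp add: Q.emeasure_eq_measure)
 qed
 finally show ?thesis by simp
 qed
 show ?thesis
 proof (rule LIMSEQ_I)
 fix e :: real assume e: "0 < e"
 have "\<forall>\<^sub>F n in sequentially. measure ?Q (?B n) < e / 2" using order_tendstoD(2)[OF tail, of "e / 2"] e by simp
 then obtain n where n: "measure ?Q (?B n) < e / 2" by (auto simp: eventually_sequentially)
 have "(%k. real n * prob (A k)) ----> real n * 0" by (intro tendsto_mult tendsto_const lim)
 hence "\<forall>\<^sub>F k in sequentially. real n * prob (A k) < e / 2" using order_tendstoD(2)[of _ "real n * 0" sequentially "e / 2"] e by simp
 then obtain K where "!!k. k >= K ==> real n * prob (A k) < e / 2" by (auto simp: eventually_sequentially)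
 hence "norm (measure ?Q (A k) - 0) < e" if "k >= K" for k using bound[of k n] n that by (smt (verit) field_sum_of_halves measure_nonneg real_norm_def)
 thus "EX no. ALL k>=no. norm (measure ?Q (A k) - 0) < e" by blast
 qed
qed

lemma kappa_pos: "valid_params p ==> 0 < kappa p"
 by (auto simp: valid_params_def kappa_def)

lemma continuous_indefinite_integral:
 fixes f :: "real => real"
 assumes f: "SI {0..T} f" and T: "0 <= T"
 shows "Con {0..T} (%t. LI {0..t} (%s. f s))"
proof -
 have i: "f integrable_on {0..T}" using set_borel_integral_eq_integral(1)[OF f] .
 have "Con {0..T} (%t. integral {0..t} f)" by (rule indefinite_integral_continuous_1[OF i])
 moreover have "integral {0..t} f = LI {0..t} (%s. f s)" if "t : {0..T}" for t
 proof -
 have "SI {0..t} f" by (rule set_integrable_subset[OF f]) (use that in auto)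
 thus ?thesis by (simp add: set_borel_integral_eq_integral(2))
 qed
 ultimately show ?thesis by (rule continuous_on_cong[THEN iffD1, OF refl, rotated])
qed

lemma set_integrable_of_sq:
 fixes f :: "real => real"
 assumes m: "f : Bm (RB T)" and sq: "NL T (%s. en ((f s)^2)) < \<infinity>"
 shows "SI {0..T} f"
proof -
 have m': "(%s. Ind {0..T} s *\<^sub>R f s) : Bm lborel"
 using m by (simp add: borel_measurable_restrict_space_iff)
 have "NI lborel (%s. en (norm (Ind {0..T} s *\<^sub>R f s))) <= NI lborel (%s. en ((f s)^2) * Ind {0..T} s + Ind {0..T} s)"
 proof (rule nn_integral_mono)
 fix s
 have "abs (f s) <= (f s)^2 + 1"
 proof (cases "abs (f s) <= 1")
 case True thus ?thesis by (simp add: add_increasing)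
 next
 case False
 hence "abs (f s) * 1 <= abs (f s) * abs (f s)" by (intro mult_left_mono) auto
 thus ?thesis by (simp add: power2_eq_square)
 qed
 hence "en (abs (f s)) <= en ((f s)^2) + 1" by (simp flip: ennreal_1 ennreal_plus add: ennreal_leI)
 thus "en (norm (Ind {0..T} s *\<^sub>R f s)) <= en ((f s)^2) * Ind {0..T} s + Ind {0..T} s"
 by (auto simp: indicator_def)
 qed
 also have "... = NL T (%s. en ((f s)^2)) + emeasure lborel {0..T}"
 proof (subst nn_integral_add)
 have "(%s. en ((Ind {0..T} s *\<^sub>R f s)^2)) : Bm lborel" using m' by measurable
 also have "(%s. en ((Ind {0..T} s *\<^sub>R f s)^2)) = (%s. en ((f s)^2) * Ind {0..T} s)" by (auto simp: indicator_def)
 finally show "(%s. en ((f s)^2) * Ind {0..T} s) : Bm lborel" .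
 qed auto
 also have "... < \<infinity>" using sq by (simp add: emeasure_lborel_Icc_eq)
 finally show ?thesis unfolding set_integrable_def using m' by (intro integrableI_bounded) auto
qed

lemma section_M:
 fixes f :: "real => 'b => real"
 assumes "(%(s, w). f s w) : Bm (RB T >< N)"
 shows "(%w. LI {0..T} (%s. f s w)) : Bm N"
proof -
 interpret sigma_finite_measure "restrict_space lborel {0..T}" by (rule sigma_finite_restrict_lborel) simp
 have "(%(s, w). f s w) : Bm (restrict_space lborel {0..T} >< N)"
 using assms measurable_cong_sets[OF sets_pair_measure_cong[OF sets_restrict_space_cong[OF sets_lborel] refl] refl] by blast
 hence "(%(w, s). f s w) : Bm (N >< restrict_space lborel {0..T})"
 by (subst measurable_pair_swap_iff) (simp add: case_prod_beta')
 hence "(%w. \<integral>s. f s w \<partial>restrict_space lborel {0..T}) : Bm N"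
 using borel_measurable_lebesgue_integral[of "%w s. f s w" N] by simp
 thus ?thesis by (simp add: set_lebesgue_integral_def integral_restrict_space)
qed

text \<open>From \<open>abs f <= f^2 / a + a\<close>; the parameter \<open>a\<close> balances the
  squared error against the length of the interval.\<close>

lemma abs_integral_le_sq:
 fixes f :: "real => real"
 assumes f: "SI {0..t} f" and a: "0 < a" and t: "0 <= t" and b: "NL t (%s. en ((f s)^2)) <= en b" "0 <= b"
 shows "abs (LI {0..t} (%s. f s)) <= b / a + a * t"
proof -
 have m: "(%s. Ind {0..t} s *\<^sub>R f s) : Bm lborel"
 using f unfolding set_integrable_def by (rule borel_measurable_integrable)
 have "en (abs (LI {0..t} (%s. f s))) <= NI lborel (%s. en (norm (Ind {0..t} s *\<^sub>R f s)))"
 unfolding set_lebesgue_integral_def using integral_norm_bound_ennreal[OF f[unfolded set_integrable_def]] by simp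
 also have "... <= NI lborel (%s. en (1 / a) * (en ((f s)^2) * Ind {0..t} s) + en a * Ind {0..t} s)"
 proof (rule nn_integral_mono)
 fix s
 have "abs (f s) <= 1 / a * (f s)^2 + a"
 proof (cases "abs (f s) <= a")
 case True thus ?thesis using a by (simp add: add_increasing)
 next
 case False
 hence "abs (f s) * a <= abs (f s) * abs (f s)" by (intro mult_left_mono) auto
 hence "abs (f s) <= (f s)^2 / a" using a by (simp add: pos_le_divide_eq power2_eq_square)
 thus ?thesis using a by simp
 qed
 hence "en (abs (f s)) <= en (1 / a * (f s)^2 + a)" by (rule ennreal_leI)
 also have "... = en (1 / a * (f s)^2) + en a" using a by (intro ennreal_plus) auto
 also have "en (1 / a * (f s)^2) = en (1 / a) * en ((f s)^2)" using a by (intro ennreal_mult) auto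
 finally show "en (norm (Ind {0..t} s *\<^sub>R f s)) <= en (1 / a) * (en ((f s)^2) * Ind {0..t} s) + en a * Ind {0..t} s"
 by (auto simp: indicator_def)
 qed
 also have "... = en (1 / a) * NL t (%s. en ((f s)^2)) + en a * emeasure lborel {0..t}"
 proof -
 have "(%s. en ((Ind {0..t} s *\<^sub>R f s)^2)) : Bm lborel" using m by measurable
 also have "(%s. en ((Ind {0..t} s *\<^sub>R f s)^2)) = (%s. en ((f s)^2) * Ind {0..t} s)" by (auto simp: indicator_def)
 finally have mm: "(%s. en ((f s)^2) * Ind {0..t} s) : Bm lborel" .
 show ?thesis
 by (subst nn_integral_add, intro borel_measurable_times_ennreal borel_measurable_const mm, simp)
 (simp add: nn_integral_cmult[OF mm] nn_integral_cmult_indicator)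
 qed
 also have "... <= en (1 / a) * en b + en a * en t"
 using t by (intro add_mono mult_left_mono b(1)) (auto simp: emeasure_lborel_Icc_eq)
 also have "... = en (b / a + a * t)"
 proof -
 have "en (1 / a) * en b = en (b / a)" using a b by (simp add: ennreal_mult'[symmetric])
 moreover have "en a * en t = en (a * t)" using a t by (simp add: ennreal_mult')
 ultimately show ?thesis using a b t by (simp flip: ennreal_plus)
 qed
 finally show ?thesis using a b t by (subst (asm) ennreal_le_iff) auto
qed

section \<open>Ito integrals under the change of measure\<close>

context bm
begin

lemma set_integrable_progressive:
 assumes "prog F v" "0 <= T" "w : space M" "NL T (%s. en ((v s w)^2)) < \<infinity>"
 shows "SI {0..T} (%s. v s w)"
 using section_measurable[OF progressive_joint[OF assms(1,2)] assms(3)] assms(4) by (rule set_integrable_of_sq)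

text \<open>The same elementary processes serve under the density. Integrating them against
  \<open>B t + k * t\<close> adds \<open>k\<close> times a time integral, and a small squared error
  makes these time integrals converge as well.\<close>

lemma approx_girsanov:
 assumes ito: "ito_integral M F B v I" and T: "0 <= T" and k: "0 < k"
 shows "EX E. approx (density M (%w. en (emart (- k) T w))) F (%t w. B t w + k * t) T E v
 (%t w. I t w + k * LI {0..t} (%s. v s w))"
proof -
 let ?Q = "density M (%w. en (emart (- k) T w))"
 let ?B = "%t w. B t w + k * t"
 let ?J = "%t w. I t w + k * LI {0..t} (%s. v s w)"
 note ito = ito[unfolded ito_integral_def]
 have v: "prog F v" using ito by blast
 have vfin: "AE w in M. ALL T>=0. NL T (%s. en ((v s w)^2)) < \<infinity>" using ito by blast
 have Im: "I t : Bm M" if "0 <= t" for t using ito that by blast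
 have Ic: "AE w in M. Con {0..} (%t. I t w)" using ito by blast
 obtain E where E: "ALL k. is_elementary F (E k)" "ALL T>=0. ALL ee>0. (%k. \<P>(w in M. en ee < NL T (%s. en ((EP (E k) s w - v s w)^2)))) ----> 0"
 "ALL t>=0. ALL ee>0. (%k. \<P>(w in M. ee < abs (EI B (E k) t w - I t w))) ----> 0"
 using ito by (elim conjE exE) (rule that)
 have el: "is_elementary F (E k)" for k using E(1) by blast
 have vl: "(%k. \<P>(w in M. en ee < NL T (%s. en ((EP (E k) s w - v s w)^2)))) ----> 0" if "0 <= T" "0 < ee" for T ee using E(2) that by blast
 have Il: "(%k. \<P>(w in M. ee < abs (EI B (E k) t w - I t w))) ----> 0" if "0 <= t" "0 < ee" for t ee using E(3) that by blast
 have gQ: "gauss_incr ?Q F ?B {0..T}" using T by (intro gauss_incr_girsanov) simp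
 interpret Q: gauss_incr ?Q F ?B "{0..T}" by (rule gQ)
 have LM: "emart (- k) T : Bm M" using T by (intro emart_M) simp
 have L1: "NI M (%w. en (emart (- k) T w)) < \<infinity>" using emart_expectation[of T "-k"] T by simp
 have AEQ: "AE w in ?Q. P w" if "AE w in M. P w" for P
 using that LM by (subst AE_density) (auto elim: eventually_mono)
 have Vjoint: "(%(s, w). EP (E j) s w) : Bm (RB u >< M)" if "0 <= u" for u j
 by (rule elementary_process_joint[OF el]) auto
 have errm: "(%w. NL u (%s. en ((EP (E j) s w - v s w)^2))) : Bm M" if u: "0 <= u" for j u
 proof (rule set_nn_integral_measurable)
 have "(%x. en (((%(s, w). EP (E j) s w) x - (%(s, w). v s w) x)^2)) : Bm (RB u >< M)"
 using Vjoint[OF u] progressive_joint[OF v u] by measurable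
 thus "(%(s, w). en ((EP (E j) s w - v s w)^2)) : Bm (RB u >< M)"
 by (simp only: case_prod_beta')
 qed
 have JM: "?J t : Bm M" if "0 <= t" for t
 using Im[OF that] section_M[OF progressive_joint[OF v that]] by measurable
 have lin: "EI ?B (E j) t w = EI B (E j) t w + k * LI {0..t} (%s. EP (E j) s w)"
 if "0 <= t" for j t w
 proof -
 obtain n t' xx where E: "E j = (n, t', xx)" by (cases "E j")
 have "EI ?B (E j) t w = EI B (E j) t w + k * EI (%t _. t) (E j) t w"
 unfolding E elementary_integral_def prod.case sum_distrib_left sum.distrib[symmetric]
 by (intro sum.cong refl) (simp add: algebra_simps)
 thus ?thesis using elementary_integral_time(1)[OF el that] by simp
 qed
 have "approx ?Q F ?B T E v ?J"
 proof (intro approx.intro approx_axioms.intro gQ T el)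
 show "(%(s, w). v s w) : Bm (RB T >< ?Q)"
 proof -
 have "sets (RB T >< ?Q) = sets (RB T >< M)"
 by (rule sets_pair_measure_cong) auto
 thus ?thesis using progressive_joint[OF v T] measurable_cong_sets by blast
 qed
 show "AE w in ?Q. NL T (%s. en ((v s w)^2)) < \<infinity>"
 using AEQ[OF vfin] T by (auto elim: eventually_mono)
 show "?J t : Bm ?Q" if "t : {0..T}" for t using JM[of t] that by simp
 show "AE w in ?Q. Con {0..T} (%t. ?J t w)"
 proof (rule AEQ)
 show "AE w in M. Con {0..T} (%t. ?J t w)"
 using vfin Ic AE_space
 proof eventually_elim
 case (elim w)
 have "SI {0..T} (%s. v s w)"
 using elim T by (intro set_integrable_progressive[OF v T]) auto
 hence "Con {0..T} (%t. LI {0..t} (%s. v s w))" by (rule continuous_indefinite_integral[OF _ T])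
 moreover have "Con {0..T} (%t. I t w)" using elim(2) by (rule continuous_on_subset) auto
 ultimately show ?case by (intro continuous_intros)
 qed
 qed
 fix ee :: real assume e: "0 < ee"
 show "(%k. Q.prob {w:space ?Q. en ee < NL T (%s. en ((EP (E k) s w - v s w)^2))}) ----> 0"
 proof (rule density_prob_tendsto_0[OF LM L1])
 show "{w:space ?Q. en ee < NL T (%s. en ((EP (E k) s w - v s w)^2))} : events" for k
 using errm[OF T, of k] by (simp only: space_density, measurable)
 show "(%k. prob {w:space ?Q. en ee < NL T (%s. en ((EP (E k) s w - v s w)^2))}) ----> 0"
 using vl[OF T e] by simp
 qed
 fix t assume "t : {0..T}"
 hence t: "0 <= t" "t <= T" by auto
 \<comment> \<open>With these values \<open>b / a\<close> and \<open>a * t\<close> are each at most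
   \<open>ee / (4 * k)\<close>, so the drift part of the error is at most
   \<open>ee / 2\<close>.\<close>
 define a where "a = ee / (4 * k * (t + 1))"
 have a: "0 < a" using e k t by (simp add: a_def)
 define b where "b = ee * a / (4 * k)"
 have b: "0 < b" using e a k by (simp add: b_def)
 let ?err = "%j w. NL t (%s. en ((EP (E j) s w - v s w)^2))"
 let ?C = "%j. {w:space M. ee / 2 < abs (EI B (E j) t w - I t w)}"
 let ?D = "%j. {w:space M. en b < ?err j w}"
 let ?S = "%j. {w:space M. ee < abs (EI ?B (E j) t w - ?J t w)}"
 have eBM: "EI B (E j) t : Bm M" for j
 by (rule elementary_integral_measurable[OF el]) (use t in simp)
 have CM: "?C j : events" for j using eBM[of j] Im[OF t(1)] by measurable
 have DM: "?D j : events" for j using errm[OF t(1), of j] by measurable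
 have eQM: "EI ?B (E j) t : Bm M" for j
 proof -
 have "(%w. EI B (E j) t w + k * LI {0..t} (%s. EP (E j) s w)) : Bm M"
 using eBM[of j] section_M[OF Vjoint[OF t(1), of j]] by measurable
 thus ?thesis unfolding lin[OF t(1), symmetric] .
 qed
 have SM: "?S j : events" for j using eQM[of j] JM[OF t(1)] by measurable
 have "(%j. prob (?S j)) ----> 0"
 proof (rule real_tendsto_sandwich[where f="%_. 0" and h="%j. prob (?C j) + prob (?D j)"])
 have "prob (?S j) <= prob (?C j) + prob (?D j)" for j
 proof -
 have "prob (?S j) <= prob (?C j Un ?D j)"
 proof (rule finite_measure_mono_AE)
 show "AE w in M. w : ?S j --> w : ?C j Un ?D j"
 using vfin AE_space
 proof eventually_elim
 case (elim w)
 show ?case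
 proof (rule impI, rule ccontr)
 assume S: "w : ?S j" and n: "w \<notin> ?C j Un ?D j"
 have vi: "SI {0..t} (%s. v s w)"
 using elim t by (intro set_integrable_progressive[OF v t(1)]) auto
 have Vi: "SI {0..t} (%s. EP (E j) s w)" by (rule elementary_integral_time(2)[OF el t(1)])
 have "?err j w <= en b" using n elim by (auto simp: not_less)
 hence "abs (LI {0..t} (%s. EP (E j) s w - v s w)) <= b / a + a * t"
 using b by (intro abs_integral_le_sq[OF set_integral_diff(1)[OF Vi vi] a t(1)]) auto
 hence "abs (LI {0..t} (%s. EP (E j) s w) - LI {0..t} (%s. v s w)) <= b / a + a * t"
 by (simp add: set_integral_diff(2)[OF Vi vi])
 also have "... <= ee / (4 * k) + ee / (4 * k)"
 proof (rule add_mono)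
 show "b / a <= ee / (4 * k)" using a by (simp add: b_def)
 have "a * t <= a * (t + 1)" using a by simp
 also have "... = ee / (4 * k)" unfolding a_def using t k by simp
 finally show "a * t <= ee / (4 * k)" .
 qed
 finally have "k * abs (LI {0..t} (%s. EP (E j) s w) - LI {0..t} (%s. v s w)) <= k * (ee / (4 * k) + ee / (4 * k))"
 using k by (intro mult_left_mono) auto
 also have "... = ee / 2" using k by (simp add: field_simps)
 finally have 1: "abs (k * (LI {0..t} (%s. EP (E j) s w) - LI {0..t} (%s. v s w))) <= ee / 2"
 using k by (simp add: abs_mult)
 have 2: "abs (EI B (E j) t w - I t w) <= ee / 2" using n elim by (auto simp: not_less)
 have "EI ?B (E j) t w - ?J t w = (EI B (E j) t w - I t w) +
 k * (LI {0..t} (%s. EP (E j) s w) - LI {0..t} (%s. v s w))"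
 unfolding lin[OF t(1)] by (simp add: algebra_simps)
 hence "abs (EI ?B (E j) t w - ?J t w) <= ee" using 1 2 by linarith
 thus False using S by simp
 qed
 qed
 qed (intro sets.Un CM DM)
 also have "... <= prob (?C j) + prob (?D j)" by (rule measure_Un_le[OF CM DM])
 finally show ?thesis .
 qed
 thus "\<forall>\<^sub>F j in sequentially. prob (?S j) <= prob (?C j) + prob (?D j)" by simp
 have "(%j. prob (?C j) + prob (?D j)) ----> 0 + 0"
 using e b t by (intro tendsto_add Il vl) auto
 thus "(%j. prob (?C j) + prob (?D j)) ----> 0" by simp
 qed auto
 from density_prob_tendsto_0[OF LM L1 SM this]
 show "(%k. Q.prob {w:space ?Q. ee < abs (EI ?B (E k) t w - ?J t w)}) ----> 0" by simp
 qed
 thus ?thesis by blast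
qed

text \<open>All elementary approximants vanish at time 0.\<close>

lemma ito_integral_0:
 assumes "ito_integral M F B v I" shows "AE w in M. I 0 w = 0"
proof -
 note ito = assms[unfolded ito_integral_def]
 have Im [measurable]: "I 0 : Bm M" using ito by blast
 obtain E where E: "ALL k. is_elementary F (E k)" "ALL T>=0. ALL ee>0. (%k. \<P>(w in M. en ee < NL T (%s. en ((EP (E k) s w - v s w)^2)))) ----> 0"
 "ALL t>=0. ALL ee>0. (%k. \<P>(w in M. ee < abs (EI B (E k) t w - I t w))) ----> 0"
 using ito by (elim conjE exE) (rule that)
 have el: "is_elementary F (E k)" for k using E(1) by blast
 have Il: "(%k. \<P>(w in M. ee < abs (EI B (E k) t w - I t w))) ----> 0" if "0 <= t" "0 < ee" for t ee using E(3) that by blast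
 have E0: "EI B (E k) 0 w = 0" for k w
 proof -
 obtain n t xx where E: "E k = (n, t, xx)" by (cases "E k")
 have "0 <= t i & t i <= t (Suc i)" if "i < n" for i using elementary_mono[OF el[of k, unfolded E], of i "Suc i"] that by simp
 hence "min 0 (t i) = 0 & min 0 (t (Suc i)) = 0" if "i < n" for i using min_absorb1 order_trans that by metis
 thus ?thesis by (simp add: E elementary_integral_def)
 qed
 have "AE w in M. ~  inverse (real (Suc n)) < abs (I 0 w)" for n
 proof -
 have "(%k. \<P>(w in M. inverse (real (Suc n)) < abs (I 0 w))) ----> 0" using Il[of 0 "inverse (real (Suc n))"] by (simp add: E0)
 hence "\<P>(w in M. inverse (real (Suc n)) < abs (I 0 w)) = 0" using LIMSEQ_unique tendsto_const by blast
 hence "{w:space M. inverse (real (Suc n)) < abs (I 0 w)} : null_sets M" by (simp add: null_sets_def emeasure_eq_measure)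
 thus ?thesis by (rule AE_I') auto
 qed
 hence "AE w in M. ALL n. ~  inverse (real (Suc n)) < abs (I 0 w)" unfolding AE_all_countable by blast
 thus ?thesis
 proof eventually_elim
 case (elim w)
 show ?case
 proof (rule ccontr)
 assume "I 0 w ~= 0"
 thus False using reals_Archimedean[of "abs (I 0 w)"] elim by auto
 qed
 qed
qed

end

lemma (in prob_space) set_nn_integral_Fubini:
 fixes f :: "real => 'a => ennreal"
 assumes f: "(%(s, j). f s j) : Bm (RB T >< M)"
 shows "NI M (%j. NL T (%s. f s j)) = NL T (%s. NI M (%j. f s j))"
proof -
 let ?R = "restrict_space lborel {0..T}"
 interpret R: sigma_finite_measure ?R by (rule sigma_finite_restrict_lborel) simp
 interpret P: pair_sigma_finite ?R M ..
 have "(%(s, j). f s j) : Bm (?R >< M)"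
 using f measurable_cong_sets[OF sets_pair_measure_cong[OF sets_restrict_space_cong[OF sets_lborel] refl] refl] by blast
 hence "NI M (%j. NI ?R (%s. f s j)) = NI ?R (%s. NI M (%j. f s j))"
 using P.Fubini[of "%(s, j). f s j"] by simp
 thus ?thesis by (simp add: set_nn_integral_restrict)
qed

section \<open>Budget inequality for the wealth equation\<close>

context bm
begin

text \<open>Locality holds almost surely for countably many pairs of times only; continuity extends
  constancy from the rationals to the closed interval.\<close>

lemma constant_after:
 fixes J :: "real => real"
 assumes J: "Con {0..T} J" and s: "0 <= sx" "sx <= T"
 and c: "!!q q'. q : Rats ==> q' : Rats ==> sx < q ==> q <= q' ==> q' < T ==> J q' = (J q :: real)" and t: "sx <= t" "t <= T"
 shows "J t = J sx"
proof (cases "sx = T")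
 case True
 hence "t = sx" using t by linarith
 thus ?thesis by simp
next
 case False
 hence lt: "sx < T" using s by simp
 let ?S = "{sx<..<T} Int Rats"
 obtain q0 where q0: "q0 : Rats" "sx < q0" "q0 < T" using Rats_dense_in_real[OF lt] by blast
 have cl: "closure ?S = {sx..T}"
 using closure_open_Int_superset[of "{sx<..<T}" "Rats"] lt by (simp add: Rats_closure_real)
 have S: "J q = J q0" if "q : ?S" for q
 using c[of q q0] c[of q0 q] q0 that by (cases "q <= q0") auto
 have "Con (closure ?S) J" unfolding cl using J s by (auto intro: continuous_on_subset)
 hence "J u = J q0" if "u : {sx..T}" for u
 using continuous_constant_on_closure[of ?S J "J q0" u] S that cl by simp
 thus ?thesis using t lt by simp
qed

text \<open>Fubini reduces to a fixed time \<open>t\<close>, where the martingale property exchanges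
  the density at \<open>t\<close> for the one at \<open>T\<close>.\<close>

lemma emart_time:
 assumes f: "prog F f" and T: "0 <= T"
 shows "NI M (%j. NL T (%t. en (f t j) * en (emart c t j))) =
 NI M (%j. NL T (%t. en (f t j)) * en (emart c T j))" (is "?l = ?r")
 and "(%j. NL T (%t. en (f t j) * en (emart c t j))) : Bm M"
proof -
 let ?R = "RB T >< M"
 have LM: "emart c T : Bm M" using T by (intro emart_M) simp
 have fj: "(%(t, j). en (f t j)) : Bm ?R"
 using measurable_compose[OF progressive_joint[OF f T] measurable_ennreal] by (simp add: case_prod_beta')
 have j1: "(%(t, j). en (f t j) * en (emart c T j)) : Bm ?R"
 using borel_measurable_times_ennreal[OF fj measurable_compose[OF measurable_snd measurable_compose[OF LM measurable_ennreal]]] by (simp add: case_prod_beta')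
 have j2: "(%(t, j). en (f t j) * en (emart c t j)) : Bm ?R"
 using borel_measurable_times_ennreal[OF fj measurable_compose[OF progressive_joint[OF emart_progressive T] measurable_ennreal]] by (simp add: case_prod_beta')
 have "?r = NI M (%j. NL T (%t. en (f t j) * en (emart c T j)))"
 proof (rule nn_integral_cong)
 fix j assume w: "j : space M"
 have "(%t. en (f t j) * Ind {0..T} t) : Bm lborel"
 using measurable_compose[OF measurable_Pair2'[OF w] fj] by (simp add: borel_measurable_restrict_space_iff_ennreal)
 thus "NL T (%t. en (f t j)) * en (emart c T j) = NL T (%t. en (f t j) * en (emart c T j))"
 by (subst nn_integral_multc[symmetric]) (simp_all only: mult_ac)
 qed
 also have "... = NL T (%t. NI M (%j. en (f t j) * en (emart c T j)))" by (rule set_nn_integral_Fubini[OF j1])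
 also have "... = NL T (%t. NI M (%j. en (f t j) * en (emart c t j)))"
 using progressive_adapted[OF f]
 by (intro nn_integral_cong) (auto simp: indicator_def intro!: emart_nn_integral measurable_compose[OF _ measurable_ennreal])
 also have "... = ?l" by (rule set_nn_integral_Fubini[OF j2, symmetric])
 finally show "?l = ?r" ..
 show "(%j. NL T (%t. en (f t j) * en (emart c t j))) : Bm M"
 by (rule set_nn_integral_measurable[OF j2])
qed

text \<open>\<open>h\<close> is capitalised income net of subsistence, so under the density
  \<open>W + h\<close> has drift \<open>r * (W + h) - c\<close> with \<open>c\<close> the spending
  above subsistence. By \<open>damped_ode\<close>, discounted wealth plus spending is the transform
  of \<open>J\<close>; it is nonnegative, and \<open>budget\<close> bounds its mean. Optional
  stopping finally moves the density from \<open>T\<close> to \<open>ta\<close>.\<close>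

lemma wealth_budget:
 assumes p: "valid_params p" and tau: "Stop F ta"
 and a: "prog F a" and x: "prog F x" and s: "prog F s"
 and sde: "wealth_sde M F B p Y et (%_. 0) w ta a x s W"
 and feas: "AE j in M. ALL t>=0. en t < ta j --> x_min p < x t j & s_min p < s t j & 0 < W t j + h"
 and h: "mu_R p * h = Y - x_min p - s_min p / et * price p" and z: "0 <= w + h" and T: "0 <= T" and eta: "0 < et"
 defines "c \<equiv> %t j. x t j - x_min p + (s t j - s_min p) / et * price p"
 and "r \<equiv> mu_R p" and "k \<equiv> kappa p"
 shows "NI M (%j. NL T (%t. en (of_bool (en t < ta j) * (exp (- r * t) * c t j)) * en (emart (- k) t j))) +
 NI M (%j. en (exp (- r * er (ta j)) * (W (er (ta j)) j + h)) * on ta T j *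
 en (emart (- k) (er (ta j)) j)) <= en (w + h)"
proof -
 have k: "0 < k" using kappa_pos[OF p] by (simp add: k_def)
 have r: "0 < r" and sg: "0 < sigma_S p" and pr: "0 < price p" using p by (auto simp: valid_params_def r_def)
 define b where "b t j = active (%_. 0) ta t j * wealth_drift p Y et (a t j) (x t j) (s t j) (W t j)" for t j
 define v where "v t j = active (%_. 0) ta t j * (a t j * sigma_S p * W t j)" for t j
 note sde = sde[unfolded wealth_sde_def Let_def, folded b_def v_def]
 have W: "prog F W" and bi: "AE j in M. ALL t>=0. SI {0..t} (%u. b u j)" using sde by auto
 obtain I where ito: "ito_integral M F B v I" and Weq: "AE j in M. ALL t>=0. 0 <= en t & en t <= ta j -->
 W t j = w + LI {0..t} (%u. b u j) + I t j" using sde by blast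
 have v: "prog F v" and vfin: "AE j in M. ALL T>=0. NL T (%s. en ((v s j)^2)) < \<infinity>"
 using ito by (auto simp: ito_integral_def)
 define J where "J t j = I t j + k * LI {0..t} (%s. v s j)" for t j
 let ?L = "emart (- k) T"
 let ?Q = "density M (%j. en (?L j))"
 have LM: "?L : Bm M" using T by (intro emart_M) simp
 have AEQ: "AE j in ?Q. P j" if "AE j in M. P j" for P
 using that LM by (subst AE_density) (auto elim: eventually_mono)
 obtain E where "approx ?Q F (%t j. B t j + k * t) T E v (%t j. I t j + k * LI {0..t} (%s. v s j))"
 using approx_girsanov[OF ito T k] by blast
 then interpret A: approx ?Q F "%t j. B t j + k * t" T E v J unfolding J_def[abs_def] .
 have act: "active (%_. 0) ta t j = of_bool (en t < ta j)" if "0 <= t" for t j using that by (simp add: active_def)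
 \<comment> \<open>Rational times keep the union of exceptional sets countable;
   \<open>constant_after\<close> fills the gaps.\<close>
 have loc: "AE j in ?Q. ALL q:Rats Int {0..T}. ALL q':Rats Int {0..T}. q <= q' --> ta j <= en q --> J q' j = J q j"
 proof -
 have cnt: "countable (Rats Int {0..T})" using countable_rat by (auto intro: countable_Int1)
 have "AE j in ?Q. q <= q' --> ta j <= en q --> J q' j = J q j" if q: "q : Rats Int {0..T}" "q' : Rats Int {0..T}" for q q'
 proof (cases "q <= q'")
 case True
 let ?A = "{j : space M. ta j <= en q}"
 have "?A : sets (F q)" using pred_le[OF tau, of q q] q by (simp add: pred_def)
 moreover have "AE j in ?Q. j : ?A --> (ALL s:{q<..q'}. v s j = 0)"
 proof (intro AE_I2 impI ballI)
 fix j s assume w: "j : ?A" and s: "s : {q<..q'}"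
 have "en q <= en s" using s by (intro ennreal_leI) simp
 hence "~  en s < ta j" using w by (auto simp: not_less intro: order_trans)
 thus "v s j = 0" using s q by (simp add: v_def act)
 qed
 ultimately have "AE j in ?Q. j : ?A --> J q' j = J q j" using q True by (intro A.locality) auto
 thus ?thesis using AE_space by eventually_elim auto
 qed simp
 thus ?thesis using cnt by (simp add: AE_ball_countable)
 qed
 define sx where "sx = stop_at ta T"
 have sr: "0 <= sx j" "sx j <= T" for j using stop_at_range[OF T] by (auto simp: sx_def)
 have s_le: "en t <= ta j" if "t <= sx j" "0 <= t" for t j
 proof (cases "ta j <= en T")
 case True
 then obtain u where u: "ta j = en u" "0 <= u" by (cases "ta j") (auto simp: top_unique)
 thus ?thesis using that True T by (simp add: sx_def stop_at_eq ennreal_leI)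
 next
 case False
 have "en t <= en T" using that sr(2)[of j] by (intro ennreal_leI) simp
 thus ?thesis using False by simp
 qed
 have s_less: "en t < ta j" if "t < sx j" "0 <= t" for t j
 proof -
 have "en t < en (sx j)" using that by (simp add: ennreal_less_iff)
 also have "... <= ta j" using s_le[of "sx j" j] sr by simp
 finally show ?thesis .
 qed
 have s_eq: "ta j = en (sx j)" if "ta j <= en T" for j
 using that T by (cases "ta j") (auto simp: sx_def stop_at_eq top_unique)
 have s_after: "~  en t < ta j" if "sx j < t" "t <= T" for t j
 proof -
 have "ta j <= en T" using that T by (auto simp: sx_def stop_at_eq split: if_splits)
 hence "ta j = en (sx j)" by (rule s_eq)
 thus ?thesis using that sr[of j] by (simp add: ennreal_less_iff not_less)
 qed
 define U where "U j = NL T (%t. en (of_bool (en t < ta j) * (exp (- r * t) * c t j)))" for j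
 define X where "X j = of_bool (ta j <= en T) * (exp (- r * sx j) * (W (sx j) j + h))" for j
 have c_prog: "prog F c"
 unfolding c_def using x s by (intro progressive_comp2[where f="%x s. x - x_min p + (s - s_min p) / et * price p"]) auto
 have f_prog: "prog F (%t j. of_bool (en t < ta j) * (exp (- r * t) * c t j))"
 by (intro progressive_mult progressive_pre[OF tau] progressive_comp_time[OF c_prog, where f="%t y. exp (- r * t) * y"]) auto
 have f_joint: "(%(t, j). en (of_bool (en t < ta j) * (exp (- r * t) * c t j))) : Bm (RB T >< M)"
 using measurable_compose[OF progressive_joint[OF f_prog T] measurable_ennreal] by (simp add: case_prod_beta')
 have UM: "U : Bm M" unfolding U_def by (rule set_nn_integral_measurable[OF f_joint])
 have XM: "X : Bm M"
 proof -
 have "(%j. W (sx j) j) : Bm M" unfolding sx_def using T by (intro F_M[OF _ progressive_stopped[OF W tau T]]) simp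
 moreover have "sx : Bm M" unfolding sx_def using T by (intro F_M[OF _ stop_at_measurable[OF tau T]]) simp
 moreover have "Measurable.pred M (%j. ta j <= en T)" by (rule pred_le_M[OF tau T])
 ultimately show ?thesis unfolding X_def by measurable
 qed
 have path: "AE j in ?Q. U j < \<infinity> & 0 <= X j & X j + er (U j) <= damped r (w + h) (%t. J t j) T &
 (ALL t:{0..T}. 0 <= damped r (w + h) (%t. J t j) t)"
 using loc AEQ[OF Weq] AEQ[OF bi] AEQ[OF vfin] AEQ[OF feas] A.J_continuous AEQ[OF ito_integral_0[OF ito]] AE_space
 proof eventually_elim
 case (elim j)
 note el_loc = elim(1) and el_W = elim(2) and el_b = elim(3) and el_v = elim(4) and el_f = elim(5) and el_J = elim(6) and el_I = elim(7)
 have wM: "j : space M" using elim(8) by simp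
 let ?s = "sx j"
 let ?z = "w + h"
 let ?D = "damped r ?z (%t. J t j)"
 define Z where "Z t = W t j + h" for t
 \<comment> \<open>Read off from the drift, so that the integral equation holds by construction up
   to \<open>sx\<close>; it agrees with \<open>c\<close> where the drift is active.\<close>
 define c' where "c' t = r * Z t - (b t j - k * v t j)" for t
 have c': "c' t = c t j" if "0 <= t" "en t < ta j" for t
 proof -
 have ks: "k * sigma_S p = mu_S p - mu_R p" using sg by (simp add: k_def kappa_def)
 have "k * v t j = a t j * (k * sigma_S p) * W t j" using that by (simp add: v_def act)
 hence kv: "k * v t j = a t j * (mu_S p - mu_R p) * W t j" by (simp add: ks)
 have "r * h = Y - x_min p - s_min p / et * price p" using h by (simp add: r_def)
 thus ?thesis using that kv
 by (simp add: c'_def Z_def b_def act wealth_drift_def c_def r_def[symmetric] algebra_simps diff_divide_distrib)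
 qed
 have bi': "SI {0..u} (%t. b t j)" if "0 <= u" for u using el_b that by blast
 have vi': "SI {0..u} (%t. v t j)" if "0 <= u" for u
 using set_integrable_progressive[OF v that wM] el_v that by blast
 have gi: "SI {0..u} (%t. b t j - k * v t j)" if "0 <= u" for u
 using bi'[OF that] vi'[OF that] by (intro set_integral_diff(1) set_integrable_mult_right) auto
 have Zeq0: "Z t = ?z + LI {0..t} (%u. b u j - k * v u j) + J t j" if "0 <= t" "t <= ?s" for t
 proof -
 have "W t j = w + LI {0..t} (%u. b u j) + I t j" using el_W s_le[OF that(2,1)] that by simp
 moreover have "LI {0..t} (%u. b u j - k * v u j) = LI {0..t} (%u. b u j) - k * LI {0..t} (%u. v u j)"
 using bi'[OF that(1)] vi'[OF that(1)] by (subst set_integral_diff(2)) (auto intro: set_integrable_mult_right)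
 ultimately show ?thesis by (simp add: Z_def J_def)
 qed
 have Zeq: "Z t = ?z + LI {0..t} (%u. r * Z u - c' u) + J t j" if "0 <= t" "t <= ?s" for t
 using Zeq0[OF that] by (simp add: c'_def)
 have Jc: "Con {0..u} (%t. J t j)" if "u <= T" for u using el_J that by (auto intro: continuous_on_subset)
 have Zc: "Con {0..u} Z" if u: "0 <= u" "u <= ?s" for u
 proof -
 have "Con {0..u} (%t. ?z + LI {0..t} (%u. b u j - k * v u j) + J t j)"
 using u sr(2)[of j] by (intro continuous_intros continuous_indefinite_integral gi Jc) auto
 moreover have "?z + LI {0..t} (%u. b u j - k * v u j) + J t j = Z t" if "t : {0..u}" for t using Zeq0[of t] that u by simp
 ultimately show ?thesis by (rule continuous_on_cong[THEN iffD1, OF refl, rotated])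
 qed
 have c'i: "SI {0..u} c'" if u: "0 <= u" "u <= ?s" for u
 unfolding c'_def[abs_def] using u by (intro set_integral_diff(1) gi set_integrable_continuous_Icc continuous_intros Zc)
 have Deq: "?D u = exp (- r * u) * Z u + LI {0..u} (%s. exp (- r * s) * c' s)" if u: "0 <= u" "u <= ?s" for u
 using u sr(2)[of j] Zeq by (intro damped_ode Zc Jc c'i) auto
 have c_pos: "0 < c t j" if "0 <= t" "en t < ta j" for t
 using el_f that eta pr by (auto simp: c_def intro!: add_pos_pos divide_pos_pos mult_pos_pos)
 \<comment> \<open>Feasibility is known strictly before \<open>ta\<close>. At \<open>ta\<close>
   itself nonnegativity follows by continuity from the left, and at time 0 from the initial
   value.\<close>
 have Z_nonneg: "0 <= Z u" if u: "0 <= u" "u <= ?s" for u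
 proof (cases "en u < ta j")
 case True thus ?thesis using el_f u by (force simp: Z_def)
 next
 case False
 show ?thesis
 proof (cases "u = 0")
 case True
 have "Z 0 = ?z + LI {0..0} (%u. b u j - k * v u j) + J 0 j" using Zeq0[of 0] u by simp
 moreover have "LI {0..0} (%u. f u) = 0" for f :: "real => real"
 proof -
 have "LI {0..0} (%u. f u) = (\<integral>u. Ind {0} u *\<^sub>R f u \<partial>lborel)" by (simp add: set_lebesgue_integral_def)
 also have "... = 0" using AE_lborel_singleton[of 0] by (intro integral_eq_zero_AE) (auto elim!: eventually_mono)
 finally show ?thesis .
 qed
 ultimately show ?thesis using True el_I z by (simp add: J_def)
 next
 case False
 hence u0: "0 < u" using u by simp
 have "0 <= Z u"
 proof (rule continuous_ge_on_closure[of "{0<..<u}" Z u 0])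
 show "Con (closure {0<..<u}) Z" using Zc[OF u] u0 by simp
 show "u : closure {0<..<u}" using u0 by simp
 fix t assume "t : {0<..<u}"
 hence t: "0 <= t" "t < ?s" using u by auto
 show "0 <= Z t" using s_less[OF t(2,1)] el_f t by (force simp: Z_def)
 qed
 thus ?thesis .
 qed
 qed
 have ec_nonneg: "AE s in lborel. 0 <= Ind {0..u} s *\<^sub>R (exp (- r * s) * c' s)" if u: "0 <= u" "u <= ?s" for u
 using AE_lborel_singleton[of u]
 proof eventually_elim
 case (elim t)
 show ?case
 proof (cases "t : {0..u}")
 case True
 hence "t < ?s" "0 <= t" using elim u by auto
 hence "en t < ta j" by (intro s_less)
 thus ?thesis using c_pos[of t] c'[of t] \<open>0 <= t\<close> by simp
 qed simp
 qed
 have D_nonneg: "0 <= ?D u" if u: "0 <= u" "u <= ?s" for u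
 proof -
 have "0 <= LI {0..u} (%s. exp (- r * s) * c' s)"
 unfolding set_lebesgue_integral_def by (rule integral_nonneg_AE[OF ec_nonneg[OF u]])
 thus ?thesis unfolding Deq[OF u] using Z_nonneg[OF u] by simp
 qed
 have Jafter: "J t j = J ?s j" if "?s <= t" "t <= T" for t
 proof (rule constant_after[OF el_J sr _ that])
 fix q q' assume q: "q : Rats" "q' : Rats" "?s < q" "q <= q'" "q' < T"
 have "ta j <= en T" using q T by (auto simp: sx_def stop_at_eq split: if_splits)
 hence "ta j = en ?s" by (rule s_eq)
 hence "ta j <= en q" using q by (simp add: ennreal_leI)
 thus "J q' j = J q j" using el_loc q sr(1)[of j] by simp
 qed
 \<comment> \<open>Past \<open>ta\<close> the integrator is constant, hence so is its
   transform.\<close>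
 have D_after: "?D u = ?D ?s" if u: "?s <= u" "u <= T" for u
 proof -
 have "?D u = damped r ?z (%t. J (min t ?s) j) u"
 proof (rule damped_cong)
 show "J t j = J (min t ?s) j" if "t : {0..u}" for t using Jafter[of t] that u by (cases "t <= ?s") auto
 show "0 <= u" using u sr(1)[of j] by simp
 qed
 also have "... = ?D ?s" by (rule damped_stop[OF Jc[OF u(2)] sr(1) u(1)])
 finally show ?thesis .
 qed
 have Uint: "U j = en (LI {0..?s} (%s. exp (- r * s) * c' s))"
 proof -
 have "U j = NI lborel (%s. en (Ind {0..?s} s *\<^sub>R (exp (- r * s) * c' s)))"
 unfolding U_def
 proof (rule nn_integral_cong_AE)
 show "AE t in lborel. en (of_bool (en t < ta j) * (exp (- r * t) * c t j)) * Ind {0..T} t = en (Ind {0..?s} t *\<^sub>R (exp (- r * t) * c' t))"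
 using AE_lborel_singleton[of ?s]
 proof eventually_elim
 case (elim t)
 consider "t < 0" | "0 <= t" "t < ?s" | "?s < t" "t <= T" | "T < t" using elim by linarith
 thus ?case
 proof cases
 case 2
 thus ?thesis using s_less[OF 2(2,1)] c'[OF 2(1)] sr(2)[of j] by simp
 next
 case 3
 thus ?thesis using s_after[OF 3] by simp
 qed (use sr[of j] in auto)
 qed
 qed
 also have "... = en (LI {0..?s} (%s. exp (- r * s) * c' s))"
 unfolding set_lebesgue_integral_def
 proof (rule nn_integral_eq_integral[OF _ ec_nonneg])
 have "SI {0..?s} (%s. exp (- r * s) * c' s)"
 proof -
 have "SI {0..?s} (%s. exp (- r * s) * (r * Z s))"
 using sr[of j] by (intro set_integrable_continuous_Icc continuous_intros Zc) auto
 moreover have "integrable lborel (%s. (exp (- r * s) * Ind {0..?s} s) * (Ind {0..?s} s *\<^sub>R (b s j - k * v s j)))"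
 proof (rule Bochner_Integration.integrable_bound[OF gi[OF sr(1), unfolded set_integrable_def]])
 show "(%s. (exp (- r * s) * Ind {0..?s} s) * (Ind {0..?s} s *\<^sub>R (b s j - k * v s j))) : Bm lborel"
 using borel_measurable_integrable[OF gi[OF sr(1), unfolded set_integrable_def]] by measurable
 show "AE s in lborel. norm ((exp (- r * s) * Ind {0..?s} s) * (Ind {0..?s} s *\<^sub>R (b s j - k * v s j))) <= norm (Ind {0..?s} s *\<^sub>R (b s j - k * v s j))"
 using r by (intro AE_I2) (auto simp: indicator_def abs_mult mult_left_le_one_le)
 qed
 hence "SI {0..?s} (%s. exp (- r * s) * (b s j - k * v s j))"
 unfolding set_integrable_def by (rule Bochner_Integration.integrable_cong[THEN iffD1, rotated 2]) (auto simp: indicator_def)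
 ultimately show ?thesis unfolding c'_def[abs_def] right_diff_distrib[of _ "r * _"] by (rule set_integral_diff(1))
 qed
 thus "integrable lborel (%s. Ind {0..?s} s *\<^sub>R (exp (- r * s) * c' s))" by (simp add: set_integrable_def)
 qed (use sr in auto)
 finally show ?thesis .
 qed
 have int0: "0 <= LI {0..?s} (%s. exp (- r * s) * c' s)"
 unfolding set_lebesgue_integral_def by (rule integral_nonneg_AE[OF ec_nonneg[OF sr(1) order_refl]])
 have X0: "0 <= X j" unfolding X_def using Z_nonneg[OF sr(1) order_refl] by (simp add: Z_def)
 have "X j <= exp (- r * ?s) * Z ?s" unfolding X_def using Z_nonneg[OF sr(1) order_refl] by (simp add: Z_def)
 hence "X j + er (U j) <= ?D ?s" unfolding Deq[OF sr(1) order_refl] Uint using int0 by simp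
 hence le: "X j + er (U j) <= ?D T" using D_after[OF sr(2) order_refl] by simp
 have "0 <= ?D t" if "t : {0..T}" for t
 proof (cases "t <= ?s")
 case True thus ?thesis using D_nonneg that by simp
 next
 case False
 thus ?thesis using D_after[of t] D_nonneg[OF sr(1) order_refl] that by simp
 qed
 thus ?case using le X0 Uint by simp
 qed
 have "NI ?Q (%j. en (X j + er (U j))) <= en (w + h)"
 proof (rule A.budget[of r])
 show "(%j. X j + er (U j)) : Bm ?Q" using XM UM by measurable
 show "AE j in ?Q. 0 <= X j + er (U j)" using path by (auto elim: eventually_mono)
 show "AE j in ?Q. X j + er (U j) <= damped r (w + h) (%t. J t j) T" using path by (auto elim: eventually_mono)
 show "AE j in ?Q. ALL t:{0..T}. 0 <= damped r (w + h) (%t. J t j) t" using path by (auto elim: eventually_mono)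
 qed (use r in simp)
 moreover have "NI ?Q (%j. en (X j + er (U j))) = NI ?Q (%j. en (X j) + U j)"
 proof (rule nn_integral_cong_AE)
 show "AE j in ?Q. en (X j + er (U j)) = en (X j) + U j"
 using path
 proof eventually_elim
 case (elim j)
 hence "en (X j + er (U j)) = en (X j) + en (er (U j))" by (intro ennreal_plus) auto
 thus ?case using elim by (simp add: ennreal_enn2real less_top)
 qed
 qed
 moreover have "... = NI M (%j. en (?L j) * (en (X j) + U j))"
 using LM XM UM by (intro nn_integral_density) auto
 moreover have "... = NI M (%j. en (X j) * en (?L j)) + NI M (%j. U j * en (?L j))"
 using LM XM UM by (subst nn_integral_add[symmetric]) (auto simp: distrib_left distrib_right mult.commute intro!: nn_integral_cong)
 moreover have "NI M (%j. en (X j) * en (?L j)) = NI M (%j. en (exp (- r * er (ta j)) * (W (er (ta j)) j + h)) * on ta T j *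
 en (emart (- k) (er (ta j)) j))"
 proof -
 let ?R = "%j. en (exp (- r * er (ta j)) * (W (er (ta j)) j + h))"
 have XR: "en (X j) = ?R j * on ta T j" for j
 using T by (auto simp: X_def sx_def stop_at_eq indicator_def)
 have "prog F (%t j. exp (- r * t) * (W t j + h))"
 by (intro progressive_comp_time[OF W, where f="%t y. exp (- r * t) * (y + h)"]) auto
 from pre_F_process[OF tau this] have "pre_F ta ?R" .
 from emart_optional_stopping[OF tau T this, of "-k"] show ?thesis unfolding XR .
 qed
 moreover have "NI M (%j. U j * en (?L j)) = NI M (%j. NL T (%t. en (of_bool (en t < ta j) * (exp (- r * t) * c t j)) * en (emart (- k) t j)))"
 proof -
 show ?thesis unfolding U_def by (rule emart_time(1)[OF f_prog T, symmetric])
 qed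
 ultimately show ?thesis by (simp add: add.commute)
qed

end

section \<open>Explicit solution of the dual problem\<close>

text \<open>Unit cost of the Cobb-Douglas aggregate of the two goods at prices 1 and
  \<open>price p / et\<close>.\<close>

definition cost :: "params => real => real" where
 "cost p et = (price p / et) powr beta p / ((1 - beta p) powr (1 - beta p) * beta p powr beta p)"

definition Gam :: "params => real => real" where
 "Gam p et = cost p et powr gam_hat p * phi p"

text \<open>Exponent of the convex conjugate of power utility, equal to
  \<open>- gam_hat p\<close>.\<close>

definition eps :: "params => real" where "eps p = (gam p - 1) / gam p"

lemma Gamma_post_Gam: "Gp p = Gam p (eff_post p)" by (simp add: Gamma_post_def Gam_def cost_def)
lemma Phi_pre_Gam: "Pp p = Gam p (eff_pre p)" by (simp add: Phi_pre_def Gam_def cost_def)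

section \<open>Conjugate utility and the post-investment value\<close>

locale valid =
 fixes p :: params
 assumes valid: "valid_params p"
begin

lemma par: "0 < mu_R p" "mu_R p < mu_S p" "0 < sigma_S p" "0 < price p" "0 < eff_pre p" "eff_pre p < eff_post p" "0 < eff_post p"
 "0 < beta p" "beta p < 1" "1 < gam p" "0 < dh p"
 using valid by (auto simp: valid_params_def delta_hat_def)

lemma kappa0: "0 < kappa p" by (rule kappa_pos[OF valid])

lemma eps_bounds: "0 < eps p" "eps p < 1" using par by (auto simp: eps_def)

lemma eps_gam: "gam p * eps p = gam p - 1" "1 - eps p = 1 / gam p" using par by (auto simp: eps_def field_simps)

lemma gam_hat_eps: "gam_hat p = - eps p" using par by (simp add: gam_hat_def eps_def minus_divide_left)

text \<open>The negative of the quadratic that defines \<open>a0\<close>. It is also the rate at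
  which \<open>exp (- dh p * t) * zeta t powr e\<close> decays in mean, with \<open>zeta\<close> the
  normalised state price introduced below.\<close>

definition phq :: "real => real" where
 "phq e = dh p - e * (dh p - mu_R p - (kappa p)^2 / 2) - (kappa p)^2 * e^2 / 2"

lemma phq_eps: "phq (eps p) = phi p"
proof -
 have g: "gam p ~= 0" using par by simp
 show ?thesis unfolding phq_def phi_def eps_def using g by (simp add: field_simps power2_eq_square)
qed

lemma phq_1: "phq 1 = mu_R p" by (simp add: phq_def)

lemma phi_pos: "0 < phi p"
proof -
 have "(kappa p)^2 * 1 <= (kappa p)^2 * gam p" using par by (intro mult_left_mono) auto
 moreover have "0 < gam p * (2 * dh p + 2 * (gam p - 1) * mu_R p)" using par by (intro mult_pos_pos add_pos_pos) auto
 ultimately have "0 < gam p * ((kappa p)^2 + 2 * dh p + 2 * (gam p - 1) * mu_R p) - (kappa p)^2"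
 by (simp add: algebra_simps)
 thus ?thesis using par by (simp add: phi_def)
qed

lemma cost_pos: "0 < et ==> 0 < cost p et" using par by (simp add: cost_def)

lemma Gam_pos: "0 < et ==> 0 < Gam p et" using cost_pos[of et] phi_pos by (simp add: Gam_def)

lemma phi_Gam: "0 < et ==> phi p / Gam p et = cost p et powr eps p"
 using cost_pos[of et] phi_pos by (simp add: Gam_def gam_hat_eps powr_minus divide_simps)

text \<open>Connects the efficiency ratio in \<open>Lambda\<close> with the conjugate constants of
  the two regimes.\<close>

lemma Gam_ratio: "Pp p / Gp p = (eff_post p / eff_pre p) powr (beta p * gam_hat p)"
proof -
 have c: "cost p (eff_pre p) = (eff_post p / eff_pre p) powr beta p * cost p (eff_post p)"
 proof -
 have "price p / eff_pre p = (eff_post p / eff_pre p) * (price p / eff_post p)" using par by simp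
 hence "(price p / eff_pre p) powr beta p = (eff_post p / eff_pre p) powr beta p * (price p / eff_post p) powr beta p"
 by (simp only: powr_mult)
 thus ?thesis by (simp add: cost_def)
 qed
 have "Pp p = (eff_post p / eff_pre p) powr (beta p * gam_hat p) * Gp p"
 unfolding Gamma_post_Gam Phi_pre_Gam Gam_def c using par cost_pos[of "eff_post p"] by (simp add: powr_mult powr_powr)
 thus ?thesis using Gam_pos[of "eff_post p"] par by (simp add: Gamma_post_Gam)
qed

lemma ratio_less: "(eff_post p / eff_pre p) powr (beta p * gam_hat p) < 1"
proof -
 have "beta p * gam_hat p < 0" using par eps_bounds by (simp add: gam_hat_eps)
 moreover have "1 < eff_post p / eff_pre p" using par by simp
 ultimately show ?thesis using powr_less_mono[of "beta p * gam_hat p" 0 "eff_post p / eff_pre p"] par by simp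
qed

lemma Phi_less: "0 < Pp p" "Pp p < Gp p" "0 < Gp p"
proof -
 show 1: "0 < Pp p" "0 < Gp p" using Gam_pos par by (auto simp: Gamma_post_Gam Phi_pre_Gam)
 show "Pp p < Gp p" using ratio_less 1 unfolding Gam_ratio[symmetric] by (simp add: divide_less_eq)
qed

lemma a0: "0 < a0 p" "phq (- a0 p) = 0"
proof -
 have "is_negative_root p (THE r. is_negative_root p r)" by (rule theI'[OF ex1_negative_root[OF valid]])
 hence r: "is_negative_root p (- a0 p)" by (simp add: a0_def)
 thus "0 < a0 p" by (simp add: is_negative_root_def)
 from r show "phq (- a0 p) = 0" by (simp add: is_negative_root_def phq_def power2_eq_square algebra_simps) (simp add: field_simps)
qed

lemma denom_pos: "0 < a0 p * gam p + gam p - 1" proof -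
 have "0 < a0 p * gam p" using a0 par by simp
 thus ?thesis using par by simp
qed

lemma Lambda_neg: "Lambda p < 0"
proof -
 have "(eff_post p / eff_pre p) powr (beta p * gam_hat p) - 1 < 0" using ratio_less by simp
 hence "(1 + a0 p) * (gam p - 1) / ((eff_post p / eff_pre p) powr (beta p * gam_hat p) - 1) < 0"
 using a0 par by (intro divide_pos_neg mult_pos_pos) auto
 hence "(1 + a0 p) * (gam p - 1) / ((eff_post p / eff_pre p) powr (beta p * gam_hat p) - 1) - a0 p < 0" using a0 by simp
 thus ?thesis unfolding Lambda_def using denom_pos by (intro mult_pos_neg) auto
qed

text \<open>Fenchel-Young inequality for power utility, from the weighted mean inequality with
  weights \<open>1 / gam p\<close> and \<open>eps p\<close>.\<close>

lemma young1:
 assumes v: "0 < v" and y: "0 < y"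
 shows "y powr eps p / eps p <= v powr (1 - gam p) / (gam p - 1) + y * v"
proof -
 have "(v powr (1 - gam p)) powr (1 / gam p) * (y * v) powr eps p <= (1 / gam p) * v powr (1 - gam p) + eps p * (y * v)"
 using v y par eps_bounds eps_gam(2) by (intro Youngs_inequality_0) auto
 also have "(v powr (1 - gam p)) powr (1 / gam p) * (y * v) powr eps p = y powr eps p"
 proof -
 have "(1 - gam p) * (1 / gam p) + eps p = 0" using par by (simp add: eps_def field_simps)
 hence "v powr ((1 - gam p) * (1 / gam p)) * v powr eps p = 1" using v by (simp add: powr_add[symmetric])
 thus ?thesis using v y by (simp add: powr_powr powr_mult mult.left_commute)
 qed
 finally have "y powr eps p / eps p <= ((1 / gam p) * v powr (1 - gam p) + eps p * (y * v)) / eps p"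
 using eps_bounds by (intro divide_right_mono) auto
 also have "... = v powr (1 - gam p) / (gam p * eps p) + y * v"
 using eps_bounds by (simp add: add_divide_distrib)
 finally show ?thesis unfolding eps_gam(1) .
qed

lemma young1_eq:
 assumes y: "0 < y" and v: "v = y powr (- 1 / gam p)"
 shows "v powr (1 - gam p) = y powr eps p" "y * v = y powr eps p"
proof -
 have "- 1 / gam p * (1 - gam p) = eps p" using par by (simp add: eps_def field_simps)
 thus "v powr (1 - gam p) = y powr eps p" unfolding v by (simp add: powr_powr)
 have "1 + (- 1 / gam p) = eps p" using par by (simp add: eps_def field_simps)
 hence "y powr 1 * y powr (- 1 / gam p) = y powr eps p" by (simp only: powr_add[symmetric])
 thus "y * v = y powr eps p" unfolding v using y by simp
qed

lemma utility_nonpos: "utility p x s <= 0"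
 unfolding utility_def using par by (intro divide_nonneg_neg) auto

text \<open>Two convexity steps. The weighted mean inequality bounds the aggregate by expenditure
  over \<open>cost p et\<close>; then \<open>young1\<close> is applied at the price
  \<open>y * cost p et\<close>. The factor \<open>phi p / Gam p et\<close> is the power
  \<open>eps p\<close> of the unit cost.\<close>

lemma utility_dual:
 assumes x: "x_min p < x" and s: "s_min p < s" and eta: "0 < et" and y: "0 < y"
 shows "utility p x s <= - (phi p / Gam p et) * (y powr eps p / eps p) + y * (x - x_min p + (s - s_min p) / et * price p)"
proof -
 let ?X = "x - x_min p" and ?S = "s - s_min p"
 let ?c = "?X + ?S / et * price p"
 let ?N = "cost p et"
 let ?C = "?X powr (1 - beta p) * ?S powr beta p"
 have X: "0 < ?X" "0 < ?S" using x s by auto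
 have N: "0 < ?N" by (rule cost_pos[OF eta])
 have C: "0 < ?C" using X by simp
 have c: "0 < ?c" using X eta par by (intro add_pos_pos mult_pos_pos divide_pos_pos) auto
 have "(?X / (1 - beta p)) powr (1 - beta p) * (?S / et * price p / beta p) powr beta p <=
 (1 - beta p) * (?X / (1 - beta p)) + beta p * (?S / et * price p / beta p)"
 using X eta par by (intro Youngs_inequality_0) auto
 also have "... = ?c" using par by simp
 also have "(?X / (1 - beta p)) powr (1 - beta p) * (?S / et * price p / beta p) powr beta p = ?N * ?C"
 proof -
 have "(?S / et * price p / beta p) powr beta p = ?S powr beta p * (price p / et) powr beta p / beta p powr beta p"
 proof -
 have "?S / et * price p / beta p = ?S * (price p / et) / beta p" by simp
 also have "... powr beta p = ?S powr beta p * (price p / et) powr beta p / beta p powr beta p"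
 using X eta par by (simp only: powr_divide powr_mult)
 finally show ?thesis .
 qed
 thus ?thesis unfolding cost_def powr_divide[of ?X] by (simp add: mult_ac)
 qed
 finally have NC: "?N * ?C <= ?c" .
 define v where "v = ?c / ?N"
 have v: "0 < v" "?C <= v" using N c NC by (auto simp: v_def field_simps)
 have "v powr (1 - gam p) <= ?C powr (1 - gam p)" using v C par by (intro powr_mono2') auto
 hence "?C powr (1 - gam p) / (1 - gam p) <= v powr (1 - gam p) / (1 - gam p)"
 using par by (intro divide_right_mono_neg) auto
 hence U: "utility p x s <= - (v powr (1 - gam p) / (gam p - 1))"
 unfolding utility_def by (simp add: minus_divide_right)
 have "(y * ?N) powr eps p / eps p <= v powr (1 - gam p) / (gam p - 1) + (y * ?N) * v"
 by (rule young1) (use v y N in auto)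
 also have "(y * ?N) * v = y * ?c" using N by (simp add: v_def)
 also have "(y * ?N) powr eps p = (phi p / Gam p et) * y powr eps p"
 unfolding phi_Gam[OF eta] using y N by (simp add: powr_mult)
 finally show ?thesis using U by simp
qed

text \<open>Spending the fractions \<open>1 - beta p\<close> and \<open>beta p\<close> on the two
  goods is the equality case of the mean inequality.\<close>

lemma utility_opt:
 assumes eta: "0 < et" and c: "0 < c"
 shows "utility p (x_min p + (1 - beta p) * c) (s_min p + beta p * (c / (price p / et))) = - ((c / cost p et) powr (1 - gam p) / (gam p - 1))"
proof -
 have "((1 - beta p) * c) powr (1 - beta p) * (beta p * (c / (price p / et))) powr beta p = c / cost p et"
 proof -
 have "(beta p * (c / (price p / et))) powr beta p = beta p powr beta p * (c powr beta p / (price p / et) powr beta p)"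
 using par eta c by (simp only: powr_mult powr_divide)
 moreover have "((1 - beta p) * c) powr (1 - beta p) = (1 - beta p) powr (1 - beta p) * c powr (1 - beta p)"
 using par c by (simp only: powr_mult)
 moreover have "c powr (1 - beta p) * c powr beta p = c" using c by (simp add: powr_add[symmetric])
 ultimately show ?thesis by (simp add: cost_def mult_ac)
 qed
 thus ?thesis unfolding utility_def by (simp add: minus_divide_right)
qed

text \<open>Candidate for the post-investment value in terms of total wealth.\<close>

definition gval :: "real => real" where
 "gval z = - ((Gp p * z) powr (1 - gam p) / ((gam p - 1) * Gp p))"

lemma gval_dual:
 assumes z: "0 < z" and y: "0 < y"
 shows "gval z <= - (y powr eps p / (eps p * Gp p)) + y * z"
proof -
 note G = Phi_less(3)
 have "y powr eps p / eps p <= (Gp p * z) powr (1 - gam p) / (gam p - 1) + y * (Gp p * z)"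
 by (rule young1) (use z y G in auto)
 hence "y powr eps p / eps p / Gp p <= ((Gp p * z) powr (1 - gam p) / (gam p - 1) + y * (Gp p * z)) / Gp p"
 using G by (intro divide_right_mono) auto
 thus ?thesis using G by (simp add: gval_def add_divide_distrib)
qed

text \<open>\<open>y\<close> is the derivative of \<open>gval\<close> at \<open>z\<close>, which is
  the equality case of \<open>gval_dual\<close>.\<close>

lemma gval_eq:
 assumes z: "0 < z" and y: "y = (Gp p * z) powr (- gam p)"
 shows "0 < y" "gval z = - (y powr eps p / (eps p * Gp p)) + y * z" "gval z = - (y powr eps p / ((gam p - 1) * Gp p))"
proof -
 note G = Phi_less(3)
 have Gz: "0 < Gp p * z" using G z by simp
 show y0: "0 < y" unfolding y using G z by simp
 have v: "Gp p * z = y powr (- 1 / gam p)"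
 proof -
 have "- gam p * (- 1 / gam p) = 1" using par by simp
 thus ?thesis unfolding y powr_powr using Gz by (simp only: powr_one less_imp_le)
 qed
 note e = young1_eq[OF y0 v]
 show 1: "gval z = - (y powr eps p / ((gam p - 1) * Gp p))" unfolding gval_def e(1) ..
 have "y * z = y powr eps p / Gp p" using e(2) G by (simp add: field_simps)
 moreover have "1 / (gam p - 1) = 1 / eps p - 1" using par by (simp add: eps_def field_simps)
 hence "y powr eps p / ((gam p - 1) * Gp p) = y powr eps p / Gp p * (1 / eps p - 1)"
 by (metis mult.commute times_divide_eq_right times_divide_times_eq mult.right_neutral)
 moreover have "a / G * (1 / e - 1) = a / (e * G) - a / G" for a G e :: real by (simp add: algebra_simps)
 ultimately show "gval z = - (y powr eps p / (eps p * Gp p)) + y * z"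
 unfolding 1 by simp
qed

lemma gval_neg: "0 < z ==> gval z < 0" unfolding gval_def using par Phi_less by simp

end

section \<open>Smooth fit for the waiting problem\<close>

locale valid_neg = valid +
 assumes theta_neg: "theta p < 0"
begin

text \<open>Gap between the conjugate constants, the coefficient of the utility forgone by consuming
  at the old efficiency.\<close>

definition D :: real where "D = 1 / Pp p - 1 / Gp p"

abbreviation "zs \<equiv> zhat_star p"

lemma D_pos: "0 < D" unfolding D_def using Phi_less by (simp add: frac_less2)

lemma D_eq: "D = (Gp p - Pp p) / (Gp p * Pp p)"
proof -
 have "1 / Pp p - 1 / Gp p = (1 * Gp p - 1 * Pp p) / (Pp p * Gp p)"
 by (rule diff_frac_eq) (use Phi_less in auto)
 thus ?thesis unfolding D_def by (simp add: mult.commute)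
qed

text \<open>The positive number whose power \<open>gam p\<close> is the threshold; the smooth-fit
  relations are rational in it and in one power of \<open>zs\<close>.\<close>

definition X where "X = (a0 p * gam p + gam p - 1) * D / ((a0 p + 1) * (gam p - 1) * - theta p)"

lemma X_pos: "0 < X" unfolding X_def using denom_pos D_pos a0 par theta_neg by (intro divide_pos_pos mult_pos_pos) auto

lemma zs_X: "zs = X powr gam p"
proof -
 have "- ((a0 p * gam p + gam p - 1) * (Gp p - Pp p)) / ((a0 p + 1) * (gam p - 1) * Gp p * theta p * Pp p) = X"
 proof -
 have e: "- (d * g) / (u * v * G * t * P) = d * (g / (G * P)) / (u * v * - t)" for d g u v G t P :: real by simp
 show ?thesis unfolding X_def D_eq by (rule e)
 qed
 thus ?thesis by (simp add: zhat_star_def)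
qed

lemma zs_pos: "0 < zs" unfolding zs_X using X_pos by simp

lemma zs_powr: "zs powr eps p = X powr (gam p - 1)" "zs = X * zs powr eps p"
proof -
 show 1: "zs powr eps p = X powr (gam p - 1)" unfolding zs_X powr_powr eps_gam(1) ..
 have "X powr 1 * X powr (gam p - 1) = X powr gam p" by (simp only: powr_add[symmetric]) simp
 thus "zs = X * zs powr eps p" unfolding 1 using X_pos by (simp add: zs_X)
qed

lemma theta_zs: "theta p * zs = - (a0 p * gam p + gam p - 1) * D / ((a0 p + 1) * (gam p - 1)) * zs powr eps p"
proof -
 have "theta p * X = - (a0 p * gam p + gam p - 1) * D / ((a0 p + 1) * (gam p - 1))"
 proof -
 have e: "t * (d * D / (u * - t)) = - d * D / u" if "t ~= 0" for t d u :: real using that by simp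
 show ?thesis unfolding X_def by (rule e) (use theta_neg in simp)
 qed
 thus ?thesis using zs_powr(2) by (metis mult.assoc)
qed

text \<open>Brings the given closed form into a shape in which smooth fit is linear in
  \<open>D * zs powr eps p\<close> and \<open>theta p * zs\<close>.\<close>

lemma A0_eq: "A0 p = D * zs powr eps p / ((1 + a0 p) * (gam p - 1))"
proof -
 let ?d = "a0 p * gam p + gam p - 1"
 let ?w = "(a0 p + 1) * (gam p - 1)"
 have w: "0 < ?w" using a0 par by simp
 note pos = Phi_less denom_pos
 have g: "gam p - 1 ~= 0" "gam p - 1 > 0" using par by auto
 have GP: "0 < Gp p - Pp p" using Phi_less by simp
 let ?Q = "?w * Gp p * Pp p"
 have Q: "0 < ?Q" using w Phi_less by simp
 have "A0 p = (?d * (Gp p - Pp p) powr (gam p / (gam p - 1)) * ?Q powr (gam p / (1 - gam p)) / - theta p) powr (gam p - 1)"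
 proof -
 have e: "- x / t = x / - t" for x t :: real by simp
 show ?thesis unfolding A0_def e ..
 qed
 also have "... = ?d powr (gam p - 1) * ((Gp p - Pp p) powr (gam p / (gam p - 1))) powr (gam p - 1) * (?Q powr (gam p / (1 - gam p))) powr (gam p - 1) / (- theta p) powr (gam p - 1)"
 by (simp only: powr_mult powr_divide)
 also have "((Gp p - Pp p) powr (gam p / (gam p - 1))) powr (gam p - 1) = (Gp p - Pp p) powr gam p"
 using g by (simp add: powr_powr)
 also have "(?Q powr (gam p / (1 - gam p))) powr (gam p - 1) = ?Q powr (- gam p)"
 proof -
 have "gam p / (1 - gam p) * (gam p - 1) = - gam p" using g by (simp add: field_simps)
 thus ?thesis by (simp add: powr_powr)
 qed
 also have "?d powr (gam p - 1) * (Gp p - Pp p) powr gam p * ?Q powr (- gam p) / (- theta p) powr (gam p - 1) =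
 ?d powr (gam p - 1) * (D / ?w) powr gam p / (- theta p) powr (gam p - 1)"
 proof -
 have "D / ?w = (Gp p - Pp p) / ?Q" unfolding D_eq by simp
 hence "(D / ?w) powr gam p = (Gp p - Pp p) powr gam p * ?Q powr (- gam p)"
 by (simp only: powr_divide powr_minus) (simp only: divide_inverse)
 thus ?thesis by simp
 qed
 also have "... = (D / ?w) * (?d * (D / ?w) / - theta p) powr (gam p - 1)"
 proof -
 have Dw: "0 < D / ?w" using D_pos w by simp
 have "(D / ?w) powr gam p = (D / ?w) powr (1 + (gam p - 1))" by simp
 also have "... = (D / ?w) powr 1 * (D / ?w) powr (gam p - 1)" by (rule powr_add)
 finally have 1: "(D / ?w) powr gam p = (D / ?w) * (D / ?w) powr (gam p - 1)" using D_pos w by simp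
 have "(?d * (D / ?w) / - theta p) powr (gam p - 1) = ?d powr (gam p - 1) * (D / ?w) powr (gam p - 1) / (- theta p) powr (gam p - 1)"
 using Dw denom_pos theta_neg by (simp only: powr_mult powr_divide)
 thus ?thesis unfolding 1 by simp
 qed
 also have "?d * (D / ?w) / - theta p = X" unfolding X_def by simp
 finally show ?thesis unfolding zs_powr(1)[symmetric] by (simp add: add.commute)
qed

lemma A0_pos: "0 < A0 p" unfolding A0_eq using D_pos zs_pos a0 par by simp

text \<open>Value matching and smooth pasting at \<open>zs\<close>: for the upper branch of
  \<open>kfun\<close>, the value and \<open>zs\<close> times the slope vanish there.\<close>

lemma smooth_fit: "A0 p = D * zs powr eps p / eps p + theta p * zs" "- a0 p * A0 p = D * zs powr eps p + theta p * zs"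
proof -
 define b where "b = D * zs powr eps p"
 have A: "A0 p = b / ((1 + a0 p) * (gam p - 1))" by (simp add: A0_eq b_def)
 have t: "theta p * zs = - (a0 p * gam p + gam p - 1) * b / ((1 + a0 p) * (gam p - 1))" unfolding theta_zs b_def by (simp add: add.commute)
 have n: "1 + a0 p ~= 0" "gam p - 1 ~= 0" "gam p ~= 0" using a0 par by auto
 have e: "b / eps p = b * gam p / (gam p - 1)" by (simp add: eps_def)
 have f: "b / (u * g) = b * (g + 1) / g + - ((u - 1) * (g + 1) + g) * b / (u * g)"
 "- (u - 1) * (b / (u * g)) = b + - ((u - 1) * (g + 1) + g) * b / (u * g)" if "u ~= 0" "g ~= 0" for u g :: real
 using that by (simp_all add: divide_simps) (simp_all add: algebra_simps)
 have h: "- (a0 p * gam p + gam p - 1) = - ((1 + a0 p - 1) * (gam p - 1 + 1) + (gam p - 1))" by simp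
 show "A0 p = D * zs powr eps p / eps p + theta p * zs" unfolding b_def[symmetric] A t e h using f(1)[OF n(1,2)] by simp
 show "- a0 p * A0 p = D * zs powr eps p + theta p * zs" unfolding b_def[symmetric] A t h using f(2)[OF n(1,2)] by simp
qed

text \<open>Value of being allowed to wait when the state price is \<open>y\<close>: the forgone
  efficiency, the deferred cost, and a multiple of the power \<open>- a0 p\<close>, whose decay rate
  is 0. It vanishes where immediate investment is optimal.\<close>

definition kfun :: "real => real" where
 "kfun y = (if y <= zs then 0 else - (D * y powr eps p / eps p) - theta p * y + A0 p * (y / zs) powr (- a0 p))"

lemma f_hat_kfun: "0 < y ==> f_hat p y = - (y powr eps p / (eps p * Gp p)) + theta p * y + kfun y"
 unfolding f_hat_def kfun_def u_hat_def gam_hat_eps D_def using Phi_less eps_bounds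
 by (simp add: divide_simps) (simp add: algebra_simps)

lemma w_star_z: "z_pre p (w_star p) = Lambda p * theta p" by (simp add: z_pre_def w_star_def)

text \<open>Matches the two descriptions of the threshold: adding \<open>theta p\<close> gives the
  post-investment total wealth whose marginal value is \<open>zs\<close>.\<close>

lemma z_star: "Lambda p * theta p = zs powr (- 1 / gam p) / Gp p - theta p"
proof -
 let ?d = "a0 p * gam p + gam p - 1"
 let ?w = "(1 + a0 p) * (gam p - 1)"
 have n: "?d ~= 0" "Gp p ~= 0" "Pp p ~= 0" "Gp p - Pp p ~= 0" "theta p ~= 0" "?w ~= 0"
 using denom_pos Phi_less theta_neg a0 par by auto
 have "zs powr (- 1 / gam p) = X powr (- 1)" unfolding zs_X powr_powr using par by simp
 also have "... = inverse X" using X_pos by (simp add: powr_minus)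
 also have "... = - theta p * ?w * (Gp p * Pp p) / (?d * (Gp p - Pp p))"
 proof -
 have e: "inverse (d * (g / (G * P)) / (w * - t)) = - t * w * (G * P) / (d * g)" for d g G P w t :: real by simp
 show ?thesis unfolding X_def D_eq e by (simp only: add.commute[of 1])
 qed
 finally have z: "zs powr (- 1 / gam p) / Gp p = - theta p * ?w * Pp p / (?d * (Gp p - Pp p))"
 proof -
 have e: "t * w * (G * P) / D / G = t * w * P / D" if "G ~= 0" for t w G P D :: real using that by simp
 show ?thesis if "zs powr (- 1 / gam p) = - theta p * ?w * (Gp p * Pp p) / (?d * (Gp p - Pp p))"
 unfolding that by (rule e[OF n(2)])
 qed
 have "Lambda p * theta p = theta p / ?d * (?w / (Pp p / Gp p - 1) - a0 p)"
 unfolding Lambda_def Gam_ratio by simp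
 also have "... = theta p / ?d * (- ?d - ?w * Pp p / (Gp p - Pp p))"
 proof -
 have e: "?w / (P / G - 1) - a = - ?d - ?w * P / (G - P)" if "G ~= 0" "G - P ~= 0" "?w + a = ?d" for P G a :: real
 proof -
 have "P / G - 1 = - ((G - P) / G)" using that by (simp add: diff_divide_distrib)
 hence "?w / (P / G - 1) = - (?w * (G / (G - P)))" by simp
 moreover have "G / (G - P) = 1 + P / (G - P)" using that by (simp add: field_simps)
 ultimately have "?w / (P / G - 1) = - (?w * (1 + P / (G - P)))" by simp
 moreover have "w * (1 + P / g) = w + w * P / g" for w g :: real by (simp add: distrib_left)
 ultimately have "?w / (P / G - 1) = - (?w + ?w * P / (G - P))" by simp
 thus ?thesis using that(3) by linarith
 qed
 have "?w + a0 p = ?d" by (simp add: algebra_simps)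
 thus ?thesis using e[OF n(2,4), of "a0 p"] by presburger
 qed
 also have "... = - theta p - theta p * ?w * Pp p / (?d * (Gp p - Pp p))"
 proof -
 have e: "t / d * (- d - w * P / g) = - t - t * w * P / (d * g)" if "d ~= 0" for t d w P g :: real
 using that by (simp add: right_diff_distrib)
 show ?thesis by (rule e[OF n(1)])
 qed
 finally show ?thesis unfolding z by simp
qed

end

section \<open>Hitting times and Dynkin's formula\<close>

definition hit :: "(real => 'a => real) => real => 'a => ennreal" where
 "hit X c v = (INF t\<in>{t. 0 <= t & c <= X t v}. en t)"

lemma hit_before: "0 <= t ==> ennreal t < hit X c v ==> X t v < c"
 unfolding hit_def by (metis (mono_tags, lifting) INF_lower leD mem_Collect_eq not_le)

lemma hit_attained:
 assumes c: "Con {0..} (%t. X t v)" and f: "hit X c v < \<infinity>"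
 obtains t where "0 <= t" "hit X c v = en t" "c <= X t v"
proof -
 let ?S = "{t. 0 <= t & c <= X t v}"
 have ne: "?S ~= {}" using f unfolding hit_def by (metis (no_types, lifting) INF_empty infinity_ennreal_def less_irrefl top.extremum_strict)
 have b: "bdd_below ?S" by (rule bdd_belowI[of _ 0]) auto
 have "closed ?S"
 proof -
 have "?S = {0..} Int (%t. X t v) -` {c..}" by auto
 thus ?thesis using continuous_closed_preimage[OF c closed_atLeast closed_atLeast] by simp
 qed
 hence I: "Inf ?S : ?S" by (rule closed_contains_Inf[OF ne b])
 have "hit X c v = en (Inf ?S)"
 proof (rule antisym)
 show "hit X c v <= en (Inf ?S)" unfolding hit_def using I by (rule INF_lower)
 show "en (Inf ?S) <= hit X c v" unfolding hit_def using b by (intro INF_greatest ennreal_leI cInf_lower) auto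
 qed
 thus thesis using that I by auto
qed

text \<open>Started at or below the level, a continuous path cannot pass it without taking its
  value.\<close>

lemma hit_level:
 assumes c: "Con {0..} (%t. X t v)" and X0: "X 0 v <= c" and t: "hit X c v = en t" "0 <= t"
 shows "X t v = c"
proof (rule antisym)
 obtain u where u: "0 <= u" "hit X c v = en u" "c <= X u v" using hit_attained[of X v c, OF c] t by auto
 hence "u = t" using t by simp
 thus "c <= X t v" using u by simp
 show "X t v <= c"
 proof (rule ccontr)
 assume "~  X t v <= c"
 then obtain s where s: "0 <= s" "s <= t" "X s v = c"
 using IVT'[of "%t. X t v" 0 c t] X0 t continuous_on_subset[OF c, of "{0..t}"] by auto
 hence "s < t" using \<open>~  X t v <= c\<close> by (cases "s = t") auto
 thus False using hit_before[of s X c v] s t by (simp add: ennreal_less_iff)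
 qed
qed

context bm
begin

text \<open>The event must be decided by the values up to \<open>t\<close>, because the filtration
  need not be right-continuous. Compactness turns reaching the level into coming arbitrarily close
  to it at countably many times.\<close>

lemma hit_stopping:
 assumes a: "!!t. 0 <= t ==> X t : Bm (F t)" and c: "!!v. v : space M ==> Con {0..} (%t. X t v)"
 shows "Stop F (hit X c)"
 unfolding ext_stopping_time_def
proof (intro allI impI)
 fix t :: real assume t: "0 <= t"
 \<comment> \<open>The times \<open>t * q\<close> with rational \<open>q\<close> in
   \<open>[0,1]\<close> include the endpoint \<open>t\<close> even if \<open>t\<close> is
   irrational.\<close>
 have "hit X c v <= en t \<longleftrightarrow> (ALL n::nat. EX q:{0..1} Int Rats. c - 1 / real (Suc n) < X (t * q) v)" (is "?l \<longleftrightarrow> ?r") if v: "v : space M" for v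
 proof -
 let ?Y = "%q. X (t * q) v"
 have cY: "Con {0..1} ?Y"
 by (rule continuous_on_compose2[OF c[OF v]]) (use t in \<open>auto intro!: continuous_intros\<close>)
 have "?l \<longleftrightarrow> (EX q:{0..1}. c <= ?Y q)"
 proof
 assume l: ?l
 hence "hit X c v < \<infinity>" using le_less_trans[OF l ennreal_less_top] by simp
 from hit_attained[OF c[OF v] this] obtain s where s: "0 <= s" "hit X c v = en s" "c <= X s v" .
 hence "s <= t" using l t by simp
 show "EX q:{0..1}. c <= ?Y q"
 proof (cases "t = 0")
 case True thus ?thesis using s \<open>s <= t\<close> by auto
 next
 case False thus ?thesis using s \<open>s <= t\<close> t by (intro bexI[of _ "s / t"]) auto
 qed
 next
 assume "EX q:{0..1}. c <= ?Y q"
 then obtain q where q: "q : {0..1}" "c <= ?Y q" by blast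
 hence "hit X c v <= en (t * q)" unfolding hit_def using t by (intro INF_lower) auto
 also have "... <= en t" using q t by (intro ennreal_leI) (auto simp: mult_left_le)
 finally show ?l .
 qed
 also have "... \<longleftrightarrow> ?r"
 proof
 assume "EX q:{0..1}. c <= ?Y q"
 then obtain q0 where q0: "q0 : {0..1}" "c <= ?Y q0" by blast
 show ?r
 proof
 fix n :: nat
 obtain d where d: "0 < d" "!!q. q : {0..1} ==> dist q q0 < d ==> dist (?Y q) (?Y q0) < 1 / real (Suc n)"
 using cY q0 unfolding continuous_on_iff by (metis zero_less_divide_1_iff of_nat_0_less_iff zero_less_Suc)
 have "q0 : closure ({0..1} Int Rats)" using dense_rationals_Icc[of 1] q0 by auto
 then obtain q where q: "q : {0..1} Int Rats" "dist q q0 < d" using d(1) closure_approachable by metis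
 thus "EX q:{0..1} Int Rats. c - 1 / real (Suc n) < ?Y q"
 using d(2)[of q] q0 by (intro bexI[of _ q]) (auto simp: dist_real_def)
 qed
 next
 assume r: ?r
 obtain q where q: "q : {0..1}" "!!q'. q' : {0..1} ==> ?Y q' <= ?Y q"
 using continuous_attains_sup[OF compact_Icc _ cY] by fastforce
 have "c <= ?Y q"
 proof (rule ccontr)
 assume "~  c <= ?Y q"
 then obtain n :: nat where "1 / real (Suc n) < c - ?Y q"
 by (metis diff_gt_0_iff_gt inverse_eq_divide not_le reals_Archimedean)
 moreover obtain q' where "q' : {0..1} Int Rats" "c - 1 / real (Suc n) < ?Y q'" using r by blast
 ultimately show False using q(2)[of q'] by auto
 qed
 thus "EX q:{0..1}. c <= ?Y q" using q by blast
 qed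
 finally show ?thesis .
 qed
 moreover have "Measurable.pred (F t) (%v. ALL n::nat. EX q:{0..1} Int Rats. c - 1 / real (Suc n) < X (t * q) v)"
 proof (rule pred_intros_countable(1))
 fix n :: nat
 have "{v : space (F t). c - 1 / real (Suc n) < X (t * q) v} : sets (F t)" if q: "q : {0..1} Int Rats" for q
 proof -
 have [measurable]: "X (t * q) : Bm (F t)"
 using t q by (intro F_mono[OF _ a]) (auto simp: mult_left_le)
 show ?thesis by measurable
 qed
 hence "(UN q:{0..1} Int Rats. {v : space (F t). c - 1 / real (Suc n) < X (t * q) v}) : sets (F t)"
 by (intro sets.countable_UN' countable_Int2[OF countable_rat]) auto
 also have "(UN q:{0..1} Int Rats. {v : space (F t). c - 1 / real (Suc n) < X (t * q) v}) = {v : space (F t). EX q:{0..1} Int Rats. c - 1 / real (Suc n) < X (t * q) v}" by blast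
 finally show "Measurable.pred (F t) (%v. EX q:{0..1} Int Rats. c - 1 / real (Suc n) < X (t * q) v)" by (simp add: pred_def)
 qed
 ultimately show "Measurable.pred (F t) (%v. hit X c v <= en t)" by (subst measurable_cong) auto
qed

lemma min_stopping:
 "Stop F ta ==> Stop F sx ==> Stop F (%v. min (ta v) (sx v))"
 unfolding ext_stopping_time_def min_le_iff_disj by (simp add: pred_intros_logic)

lemma const_stopping: "Stop F (%v. C)"
 unfolding ext_stopping_time_def by simp

lemma stopped_exp_integral:
 assumes f: "0 <= f" and T: "0 <= T"
 shows "en (exp (- f * stop_at ta T v)) + en f * NL T (%t. en (of_bool (en t < ta v) * exp (- f * t))) = 1"
proof -
 let ?s = "stop_at ta T v"
 have s: "0 <= ?s" "?s <= T" using stop_at_range[OF T, of ta v] by auto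
 have "NL T (%t. en (of_bool (en t < ta v) * exp (- f * t))) = NL ?s (%t. en (exp (- f * t)))"
 proof (rule nn_integral_cong_AE)
 show "AE t in lborel. en (of_bool (en t < ta v) * exp (- f * t)) * Ind {0..T} t = en (exp (- f * t)) * Ind {0..?s} t"
 using AE_lborel_singleton[of ?s]
 proof eventually_elim
 case (elim t)
 have "0 <= t ==> t <= T ==> ennreal t < ta v \<longleftrightarrow> t < ?s | (t = ?s)" using elim T
 by (cases "ta v") (auto simp: stop_at_eq ennreal_less_iff top_unique split: if_splits)
 thus ?case using elim s by (auto simp: indicator_def)
 qed
 qed
 also have "en f * ... = NL ?s (%t. en (f * exp (- f * t)))"
 using f by (subst nn_integral_cmult[symmetric]) (auto simp: ennreal_mult' mult.assoc)
 also have "... = en (- exp (- f * ?s) - - exp (- f * 0))"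
 using s f by (intro nn_integral_FTC_Icc) (auto intro!: derivative_eq_intros)
 finally show ?thesis using f s by (simp flip: ennreal_plus)
qed

text \<open>Dynkin's formula for \<open>exp (- f * t) * emart c t\<close> at the stopping time cut
  off at \<open>T\<close>. All martingale factors are moved to time \<open>T\<close>, after which
  the identity holds path by path.\<close>

lemma gbm_identity:
 assumes ta: "Stop F ta" and T: "0 <= T" and f: "0 <= f"
 shows "NI M (%v. en (exp (- f * stop_at ta T v)) * en (emart c (stop_at ta T v) v)) +
 en f * NI M (%v. NL T (%t. en (of_bool (en t < ta v) * exp (- f * t)) * en (emart c t v))) = 1" (is "?l = 1")
proof -
 let ?s = "%v. min (ta v) (en T)"
 let ?f = "%t v. of_bool (en t < ta v) * exp (- f * t)"
 have s: "Stop F ?s" by (rule min_stopping[OF ta const_stopping])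
 have fp: "prog F ?f"
 using progressive_comp_time[OF progressive_pre[OF ta], of "%t x. x * exp (- f * t)"] by simp
 have ep: "prog F (%t v. exp (- f * t))"
 using progressive_comp_time[OF progressive_pre[OF ta], of "%t x. exp (- f * t)"] by simp
 let ?I = "%v. NL T (%t. en (?f t v))"
 have [measurable]: "?I : Bm M" "emart c T : Bm M" "stop_at ta T : Bm M"
 using measurable_compose[OF progressive_joint[OF fp T] measurable_ennreal] T F_M[OF _ stop_at_measurable[OF ta T]]
 by (auto intro!: set_nn_integral_measurable emart_M simp: case_prod_beta')
 have i: "Ind {v. ?s v <= en T} v = (1::ennreal)" for v by simp
 have "NI M (%v. en (exp (- f * stop_at ta T v)) * en (emart c (stop_at ta T v) v)) =
 NI M (%v. en (exp (- f * stop_at ta T v)) * en (emart c T v))"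
 using emart_optional_stopping[OF s T pre_F_process[OF s ep], of c] unfolding i stop_at_def by simp
 moreover have "en f * NI M (%v. NL T (%t. en (?f t v) * en (emart c t v))) =
 NI M (%v. en f * (?I v * en (emart c T v)))"
 unfolding emart_time(1)[OF fp T] by (rule nn_integral_cmult[symmetric]) measurable
 ultimately have "?l = NI M (%v. en (exp (- f * stop_at ta T v)) * en (emart c T v)) + NI M (%v. en f * (?I v * en (emart c T v)))" by (simp only:)
 also have "... = NI M (%v. (en (exp (- f * stop_at ta T v)) + en f * ?I v) * en (emart c T v))"
 by (subst nn_integral_add[symmetric]) (measurable, simp add: distrib_right mult.assoc)
 also have "... = 1" unfolding stopped_exp_integral[OF f T] using emart_expectation[of T c] T by simp
 finally show ?thesis .
qed

end

section \<open>Upper bounds\<close>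

text \<open>Up to the factor \<open>1 + a0 p\<close>, this is the gap between the concave quadratic
  \<open>phq\<close> and its chord through \<open>- a0 p\<close> and 1, where its values are 0 and
  \<open>mu_R p\<close>.\<close>

lemma (in valid) phq_concave:
 "phq e * (1 + a0 p) - mu_R p * (e + a0 p) = (kappa p)^2 / 2 * ((1 + a0 p) * (e + a0 p) * (1 - e))"
proof -
 have "phq e * (1 + a0 p) - phq 1 * (e + a0 p) - phq (- a0 p) * (1 - e) = (kappa p)^2 / 2 * ((1 + a0 p) * (e + a0 p) * (1 - e))"
 unfolding phq_def by (simp add: field_simps power2_eq_square)
 thus ?thesis using a0(2) phq_1 by simp
qed

context valid_neg
begin

text \<open>The upper branch of \<open>kfun\<close> continued to all positive arguments.\<close>

definition gfun :: "real => real" where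
 "gfun y = - (D * y powr eps p / eps p) - theta p * y + A0 p * (y / zs) powr (- a0 p)"

lemma kfun_gfun: "kfun y = (if y <= zs then 0 else gfun y)" by (simp add: kfun_def gfun_def)

lemma gfun_zs: "gfun zs = 0"
 using smooth_fit(1) zs_pos by (simp add: gfun_def)

lemma tangent_fit: "- theta p * zs = D * zs powr eps p + a0 p * A0 p"
 "A0 p * (1 + a0 p) = D * zs powr eps p * (1 / eps p - 1)"
proof -
 show "- theta p * zs = D * zs powr eps p + a0 p * A0 p" using smooth_fit(2) by simp
 have "A0 p * (1 + a0 p) = A0 p + a0 p * A0 p" by (simp add: algebra_simps)
 thus "A0 p * (1 + a0 p) = D * zs powr eps p * (1 / eps p - 1)" using smooth_fit by (simp add: right_diff_distrib)
qed

text \<open>In the variable \<open>s = y / zs\<close>, the power \<open>eps p\<close> lies below its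
  tangent at 1 and the power \<open>- a0 p\<close> above its own; by \<open>tangent_fit\<close> the
  tangents cancel exactly.\<close>

lemma gfun_nonneg:
 assumes y: "0 < y" shows "0 <= gfun y"
proof -
 define s where "s = y / zs"
 have s: "0 < s" "y = zs * s" using y zs_pos by (auto simp: s_def)
 define b where "b = D * zs powr eps p"
 have b: "0 < b" using D_pos zs_pos by (simp add: b_def)
 have "s powr eps p * 1 powr (1 - eps p) <= eps p * s + (1 - eps p) * 1"
 using s eps_bounds by (intro Youngs_inequality_0) auto
 hence 1: "b * s powr eps p / eps p <= b * (eps p * s + (1 - eps p)) / eps p"
 using b eps_bounds by (intro divide_right_mono mult_left_mono) auto
 have "(s powr - a0 p) powr (1 / (1 + a0 p)) * s powr (a0 p / (1 + a0 p)) <= 1 / (1 + a0 p) * s powr - a0 p + a0 p / (1 + a0 p) * s"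
 using s a0 by (intro Youngs_inequality_0) (auto simp: add_divide_distrib[symmetric])
 also have "(s powr - a0 p) powr (1 / (1 + a0 p)) * s powr (a0 p / (1 + a0 p)) = 1"
 using s by (simp add: powr_powr powr_add[symmetric])
 also have "1 / (1 + a0 p) * s powr - a0 p + a0 p / (1 + a0 p) * s = (s powr - a0 p + a0 p * s) / (1 + a0 p)" by (simp add: add_divide_distrib)
 finally have "1 + a0 p <= s powr - a0 p + a0 p * s" using a0 by (simp add: le_divide_eq)
 hence 2: "A0 p * (1 + a0 p) <= A0 p * s powr - a0 p + A0 p * a0 p * s"
 using A0_pos by (metis distrib_left mult.assoc mult_le_cancel_left_pos)
 have "b * (eps p * s + (1 - eps p)) / eps p = b * s + b * (1 / eps p - 1)" using eps_bounds by (simp add: field_simps)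
 moreover have "gfun y = - (b * s powr eps p / eps p) + (b + a0 p * A0 p) * s + A0 p * s powr - a0 p"
 proof -
 have "y powr eps p = zs powr eps p * s powr eps p" unfolding s(2) by (rule powr_mult)
 moreover have "- theta p * y = (b + a0 p * A0 p) * s" using tangent_fit(1) unfolding s(2) b_def by (simp add: mult.assoc[symmetric])
 moreover have "y / zs = s" by (simp add: s_def)
 ultimately show ?thesis unfolding gfun_def b_def by (simp add: mult.assoc)
 qed
 ultimately show ?thesis using 1 2 tangent_fit(2) by (simp add: b_def[symmetric] algebra_simps)
qed

text \<open>Below the threshold, deferring the cost earns no more than the efficiency it forgoes. At
  \<open>zs\<close> this is the concavity of \<open>phq\<close>; for smaller \<open>y\<close> the
  left side shrinks by the factor \<open>s\<close>, the right side only by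
  \<open>s powr eps p\<close>.\<close>

lemma waiting_cost:
 assumes y: "0 < y" "y <= zs"
 shows "- theta p * y * mu_R p <= D * y powr eps p / eps p * phi p"
proof -
 have e: "0 < eps p" "eps p < 1" using eps_bounds by auto
 have "(kappa p)^2 / 2 * ((1 + a0 p) * (eps p + a0 p) * (1 - eps p)) >= 0" using a0 e by simp
 hence "mu_R p * (eps p + a0 p) <= phi p * (1 + a0 p)" using phq_concave[of "eps p"] phq_eps by simp
 hence 1: "mu_R p * ((eps p + a0 p) / (1 + a0 p)) <= phi p" using a0 by (simp add: field_simps)
 have b: "0 < D * zs powr eps p" using D_pos zs_pos by simp
 have "- theta p * zs = D * zs powr eps p / eps p * ((eps p + a0 p) / (1 + a0 p))"
 proof -
 have "A0 p = D * zs powr eps p * (1 / eps p - 1) / (1 + a0 p)" using tangent_fit(2) a0 by (simp add: field_simps)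
 moreover have "b + a * (b * (1 / e - 1) / (1 + a)) = b / e * ((e + a) / (1 + a))" if "0 < a" "0 < e" for a b e :: real
 using that by (simp add: divide_simps) (simp add: algebra_simps)
 ultimately show ?thesis using tangent_fit(1) a0 e by simp
 qed
 hence "- theta p * zs * mu_R p = D * zs powr eps p / eps p * (mu_R p * ((eps p + a0 p) / (1 + a0 p)))" by simp
 also have "... <= D * zs powr eps p / eps p * phi p" using 1 b e by (intro mult_left_mono) auto
 finally have z: "- theta p * zs * mu_R p <= D * zs powr eps p / eps p * phi p" .
 define s where "s = y / zs"
 have s: "0 < s" "s <= 1" "y = zs * s" using y zs_pos by (auto simp: s_def)
 have "- theta p * y * mu_R p = (- theta p * zs * mu_R p) * s" using s by simp
 also have "... <= (D * zs powr eps p / eps p * phi p) * s" using z s by (intro mult_right_mono) auto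
 also have "... <= (D * zs powr eps p / eps p * phi p) * s powr eps p"
 using powr_mono'[of "eps p" 1 s] s b e phi_pos by (intro mult_left_mono) auto
 also have "... = D * y powr eps p / eps p * phi p" unfolding s(3) powr_mult by simp
 finally show ?thesis .
qed

end

context bm
begin

lemma path_measurable:
 assumes f: "prog F f" and T: "0 <= T" and v: "v : space M"
 shows "(%t. en (f t v) * Ind {0..T} t) : Bm lborel"
 using measurable_compose[OF section_measurable[OF progressive_joint[OF f T] v] measurable_ennreal]
 by (simp add: borel_measurable_restrict_space_iff_ennreal)

lemma set_integral_M:
 assumes f: "prog F f" and T: "0 <= T"
 shows "(%v. NL T (%t. en (f t v))) : Bm M"
 using measurable_compose[OF progressive_joint[OF f T] measurable_ennreal]
 by (intro set_nn_integral_measurable) (simp add: case_prod_beta')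

lemma set_integral_cmult:
 assumes f: "prog F f" and T: "0 <= T" and c: "0 <= c"
 shows "en c * NI M (%v. NL T (%t. en (f t v))) = NI M (%v. NL T (%t. en (c * f t v)))"
 unfolding nn_integral_cmult[OF set_integral_M[OF f T], symmetric]
proof (rule nn_integral_cong)
 fix v assume v: "v : space M"
 show "en c * NL T (%t. en (f t v)) = NL T (%t. en (c * f t v))"
 unfolding nn_integral_cmult[OF path_measurable[OF f T v], symmetric] ennreal_mult'[OF c] by (simp only: mult.assoc)
qed

end

section \<open>The state price and its powers\<close>

locale market = bm M F B + valid p for M :: "'a measure" and F B p
begin

definition ex :: "real => real => 'a => real" where
 "ex e t v = exp (- phq e * t) * emart (- e * kappa p) t v"

text \<open>\<open>exp (- dh p * t) * zeta t\<close> is the state price density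
  \<open>exp (- mu_R p * t) * emart (- kappa p) t\<close>. With the utility discount taken out,
  \<open>y * zeta t\<close> is the marginal value of wealth along an optimal path.\<close>

definition zeta :: "real => 'a => real" where
 "zeta t v = exp ((dh p - mu_R p - (kappa p)^2 / 2) * t - kappa p * (B t v - B 0 v))"

lemma zeta_pos: "0 < zeta t v" by (simp add: zeta_def)
lemma zeta_0: "zeta 0 v = 1" by (simp add: zeta_def)
lemma ex_pos: "0 < ex e t v" by (simp add: ex_def emart_pos)

lemma ex_zeta: "ex e t v = exp (- dh p * t) * zeta t v powr e"
 unfolding ex_def zeta_def emart_def phq_def exp_powr_real exp_add[symmetric]
 by (rule arg_cong[where f=exp]) (simp add: field_simps power2_eq_square)

lemma zeta_continuous: "v : space M ==> Con {0..} (%t. zeta t v)"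
 unfolding zeta_def by (intro continuous_intros continuous)

lemma zeta_progressive: "prog F zeta"
proof (rule progressive_continuous[OF _ zeta_continuous])
 fix t :: real assume t: "0 <= t"
 hence [measurable]: "B t : Bm (F t)" "B 0 : Bm (F t)" using bt_adapted by auto
 show "zeta t : Bm (F t)" unfolding zeta_def by measurable
qed

lemma ex_progressive: "prog F (ex e)"
 unfolding ex_zeta by (rule progressive_comp_time[OF zeta_progressive]) measurable

definition II :: "real => ('a => ennreal) => real => ennreal" where
 "II e ta T = NI M (%v. NL T (%t. en (of_bool (en t < ta v) * ex e t v)))"

definition ii :: "real => ('a => ennreal) => real => real" where "ii e ta T = er (II e ta T)"

definition nn :: "real => ('a => ennreal) => real => real" where
 "nn e ta T = (LINT v|M. ex e (stop_at ta T v) v)"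

lemma of_bool_ex: "en (of_bool b * ex e t v) = en (of_bool b * exp (- phq e * t)) * en (emart (- e * kappa p) t v)"
 unfolding ex_def by (subst ennreal_mult'[symmetric]) (auto simp: mult.assoc)

context
 fixes ta :: "'a => ennreal" and T :: real
 assumes ta: "Stop F ta" and T: "0 <= T"
begin

lemma ex_stopped_M: "(%v. ex e (stop_at ta T v) v) : Bm M"
 using F_M[OF _ progressive_stopped[OF ex_progressive ta T]] T by simp

lemma pre_ex_progressive: "prog F (%t v. of_bool (en t < ta v) * ex e t v)"
 by (intro progressive_mult progressive_pre ta ex_progressive)

lemma nn_II: "0 <= phq e ==> NI M (%v. en (ex e (stop_at ta T v) v)) + en (phq e) * II e ta T = 1"
 using gbm_identity[OF ta T, of "phq e" "- e * kappa p"] unfolding II_def of_bool_ex by (simp add: ex_def ennreal_mult')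

lemma ex_stopped_integrable: "0 <= phq e ==> integrable M (%v. ex e (stop_at ta T v) v)"
proof (rule integrableI_nonneg[OF ex_stopped_M])
 assume "0 <= phq e"
 hence "NI M (%v. en (ex e (stop_at ta T v) v)) <= 1" using nn_II[of e] by (metis le_iff_add)
 thus "NI M (%v. en (ex e (stop_at ta T v) v)) < \<infinity>" using le_less_trans by fastforce
qed (auto simp: ex_pos less_imp_le)

lemma nn_eq: "0 <= phq e ==> NI M (%v. en (ex e (stop_at ta T v) v)) = en (nn e ta T)"
 unfolding nn_def by (rule nn_integral_eq_integral[OF ex_stopped_integrable]) (auto simp: ex_pos less_imp_le)

lemma nn_nonneg: "0 <= nn e ta T" unfolding nn_def by (intro Bochner_Integration.integral_nonneg) (auto simp: ex_pos less_imp_le)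

text \<open>At a zero of \<open>phq\<close> the discounted power is a martingale.\<close>

lemma nn_0: "phq e = 0 ==> nn e ta T = 1"
 using nn_II[of e] nn_eq[of e] nn_nonneg[of e] by simp

lemma ii: "0 < phq e ==> nn e ta T = 1 - phq e * ii e ta T" "0 < phq e ==> II e ta T = en (ii e ta T)" "0 <= ii e ta T"
proof -
 assume e: "0 < phq e"
 have 1: "en (nn e ta T) + en (phq e) * II e ta T = 1" using nn_II[of e] nn_eq[of e] e by simp
 hence "II e ta T ~= \<top>" using e by (auto simp: ennreal_mult_eq_top_iff ennreal_top_mult ennreal_mult_top)
 thus 2: "II e ta T = en (ii e ta T)" unfolding ii_def by (simp add: less_top)
 have "en (nn e ta T + phq e * ii e ta T) = en 1"
 using 1 e nn_nonneg[of e] unfolding 2 by (simp add: ennreal_mult' ii_def ennreal_plus)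
 hence "nn e ta T + phq e * ii e ta T = 1"
 using e nn_nonneg[of e] by (subst (asm) ennreal_inj) (auto simp: ii_def)
 thus "nn e ta T = 1 - phq e * ii e ta T" by simp
qed (simp add: ii_def)

lemma nn_le_1: "0 < phq e ==> nn e ta T <= 1" using ii by simp

end

end

section \<open>Optimal stopping bound for the gain from waiting\<close>

locale market_neg = market M F B p + valid_neg p for M :: "'a measure" and F B p
begin

context
 fixes y T :: real
 assumes y: "0 < y" and T: "0 <= T"
begin

text \<open>The discounted value \<open>gfun (y * zeta t)\<close>, expanded into powers so that its
  mean at a stopping time can be computed term by term.\<close>

definition G :: "real => 'a => real" where
 "G t v = - (D * y powr eps p / eps p * ex (eps p) t v) - theta p * y * ex 1 t v + A0 p * (y / zs) powr (- a0 p) * ex (- a0 p) t v"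

lemma G_gfun: "G t v = exp (- dh p * t) * gfun (y * zeta t v)"
proof -
 have "y * zeta t v / zs = y / zs * zeta t v" by simp
 hence "(y * zeta t v / zs) powr (- a0 p) = (y / zs) powr (- a0 p) * zeta t v powr (- a0 p)" by (simp only: powr_mult)
 thus ?thesis unfolding G_def gfun_def ex_zeta powr_mult using zeta_pos[of t v] by (simp add: algebra_simps)
qed

lemma G_nonneg: "0 <= G t v"
 unfolding G_gfun using gfun_nonneg[of "y * zeta t v"] y zeta_pos[of t v] by simp

lemma phq_nonneg: "0 <= phq (eps p)" "0 <= phq 1" "0 <= phq (- a0 p)" "0 < phq (eps p)" "0 < phq 1"
 using phi_pos par a0 by (auto simp: phq_eps phq_1)

lemma G_integral:
 assumes ta: "Stop F ta"
 shows "integrable M (%v. G (stop_at ta T v) v)"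
 "(LINT v|M. G (stop_at ta T v) v) = gfun y - (- theta p * y * mu_R p * ii 1 ta T - D * y powr eps p / eps p * phi p * ii (eps p) ta T)"
proof -
 note i = ex_stopped_integrable[OF ta T phq_nonneg(1)] ex_stopped_integrable[OF ta T phq_nonneg(2)] ex_stopped_integrable[OF ta T phq_nonneg(3)]
 show "integrable M (%v. G (stop_at ta T v) v)" unfolding G_def using i by simp
 have "(LINT v|M. G (stop_at ta T v) v) = - (D * y powr eps p / eps p * nn (eps p) ta T) - theta p * y * nn 1 ta T + A0 p * (y / zs) powr (- a0 p) * nn (- a0 p) ta T"
 unfolding G_def nn_def using i by simp
 thus "(LINT v|M. G (stop_at ta T v) v) = gfun y - (- theta p * y * mu_R p * ii 1 ta T - D * y powr eps p / eps p * phi p * ii (eps p) ta T)"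
 unfolding nn_0[OF ta T a0(2)] ii(1)[OF ta T phq_nonneg(4)] ii(1)[OF ta T phq_nonneg(5)] phq_eps phq_1 gfun_def
 by (simp add: algebra_simps)
qed

text \<open>The left side is \<open>gfun y\<close> minus the mean of \<open>G\<close> at the
  stopping time. Above the threshold, nonnegativity of \<open>G\<close> is enough. Below it,
  stopping no later than the first visit to \<open>zs\<close> does not increase that mean, because
  \<open>G\<close> is 0 at the visit; up to then waiting loses at every moment by
  \<open>waiting_cost\<close>.\<close>

lemma waiting:
 assumes ta: "Stop F ta"
 shows "- theta p * y * mu_R p * ii 1 ta T - D * y powr eps p / eps p * phi p * ii (eps p) ta T <= kfun y"
proof (cases "zs < y")
 case True
 have "0 <= (LINT v|M. G (stop_at ta T v) v)" by (intro Bochner_Integration.integral_nonneg) (simp add: G_nonneg)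
 thus ?thesis using True unfolding G_integral(2)[OF ta] kfun_gfun by simp
next
 case False
 hence y': "y <= zs" by simp
 define sx where "sx = hit (%t v. y * zeta t v) zs"
 have cy: "Con {0..} (%t. y * zeta t v)" if "v : space M" for v using that by (intro continuous_intros zeta_continuous)
 have sx: "Stop F sx"
 unfolding sx_def
 proof (rule hit_stopping[OF _ cy])
 fix t :: real assume "0 <= t"
 hence [measurable]: "zeta t : Bm (F t)" using progressive_adapted[OF zeta_progressive] by blast
 show "(%v. y * zeta t v) : Bm (F t)" by measurable
 qed
 define rh where "rh v = min (ta v) (sx v)" for v
 have rh: "Stop F rh" unfolding rh_def by (rule min_stopping[OF ta sx])
 have "(LINT v|M. G (stop_at rh T v) v) <= (LINT v|M. G (stop_at ta T v) v)"
 proof (intro integral_mono G_integral(1) ta rh)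
 fix v assume v: "v : space M"
 show "G (stop_at rh T v) v <= G (stop_at ta T v) v"
 proof (cases "stop_at rh T v = stop_at ta T v")
 case False
 hence lt: "sx v < ta v" "sx v <= en T" by (auto simp: rh_def stop_at_def min_def split: if_splits)
 have "sx v < \<top>" using lt(1) top_greatest[of "ta v"] by (rule less_le_trans)
 hence "sx v = en (er (sx v))" by simp
 then obtain t where t: "sx v = en t" "0 <= t" using enn2real_nonneg by blast
 have "y * zeta t v = zs" by (rule hit_level[of "%t v. y * zeta t v", OF cy[OF v] _ t(1)[unfolded sx_def] t(2)]) (simp add: zeta_0 y')
 moreover have "stop_at rh T v = t" using lt t by (simp add: stop_at_def rh_def min_def not_less[symmetric])
 ultimately show ?thesis using G_nonneg by (simp add: G_gfun gfun_zs)
 qed simp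
 qed
 moreover have "- theta p * y * mu_R p * ii 1 rh T <= D * y powr eps p / eps p * phi p * ii (eps p) rh T"
 proof -
 let ?a = "- theta p * y * mu_R p" and ?b = "D * y powr eps p / eps p * phi p"
 have "0 <= - theta p" using theta_neg by simp
 note ab = mult_nonneg_nonneg[OF mult_nonneg_nonneg[OF this less_imp_le[OF y]] less_imp_le[OF par(1)]]
 mult_nonneg_nonneg[OF divide_nonneg_nonneg[OF mult_nonneg_nonneg[OF less_imp_le[OF D_pos] powr_ge_zero[of y "eps p"]] less_imp_le[OF eps_bounds(1)]] less_imp_le[OF phi_pos]]
 have pt: "?a * ex 1 t v <= ?b * ex (eps p) t v" if t: "0 <= t" "en t < rh v" for t v
 proof -
 have "y * zeta t v < zs" using hit_before[OF t(1), of "%t v. y * zeta t v" zs v] t(2) by (simp add: rh_def sx_def)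
 hence "- theta p * (y * zeta t v) * mu_R p <= D * (y * zeta t v) powr eps p / eps p * phi p"
 using y zeta_pos by (intro waiting_cost) auto
 hence "exp (- dh p * t) * (- theta p * (y * zeta t v) * mu_R p) <= exp (- dh p * t) * (D * (y * zeta t v) powr eps p / eps p * phi p)"
 by (rule mult_left_mono) simp
 thus ?thesis unfolding ex_zeta powr_mult using zeta_pos[of t v] by (simp add: mult_ac)
 qed
 have eq: "en c * II e rh T = NI M (%v. NL T (%t. en (c * (of_bool (en t < rh v) * ex e t v))))" if c: "0 <= c" for c e
 unfolding II_def by (rule set_integral_cmult[OF pre_ex_progressive[OF rh T] T c])
 have "en ?a * II 1 rh T <= en ?b * II (eps p) rh T"
 unfolding eq[OF ab(1)] eq[OF ab(2)]
 proof (intro nn_integral_mono)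
 fix v t
 show "en (?a * (of_bool (en t < rh v) * ex 1 t v)) * Ind {0..T} t <= en (?b * (of_bool (en t < rh v) * ex (eps p) t v)) * Ind {0..T} t"
 using pt[of t v] by (cases "t : {0..T}"; cases "en t < rh v") (simp_all add: ennreal_leI)
 qed
 hence "en (?a * ii 1 rh T) <= en (?b * ii (eps p) rh T)"
 unfolding ii(2)[OF rh T phq_nonneg(4)] ii(2)[OF rh T phq_nonneg(5)] by (simp only: ennreal_mult'[OF ab(1)] ennreal_mult'[OF ab(2)])
 thus ?thesis using mult_nonneg_nonneg[OF ab(2) ii(3)[OF rh T]] by (subst (asm) ennreal_le_iff) auto
 qed
 ultimately show ?thesis using False unfolding G_integral(2)[OF ta] G_integral(2)[OF rh] kfun_gfun by simp
qed

end

end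

section \<open>Payoffs as negatives of nonnegative costs\<close>

lemma ereal_integral_neg:
 assumes "!!x. f x <= 0"
 shows "ereal_integral N f = - enn2ereal (NI N (%x. e2ennreal (- f x)))"
 using assms by (simp add: ereal_integral_def e2ennreal_neg zero_ennreal.rep_eq)

context valid
begin

definition JJ :: "(real => 'b => real) => (real => 'b => real) => ('b => ennreal) => ('b => ennreal) => 'b => ennreal" where
 "JJ x s sx ta v = NI lborel (%t. en (active sx ta t v * (du p x s t v)))"

lemma discounted_JJ: "discounted_utility p x s sx ta v = - enn2ereal (JJ x s sx ta v)"
 unfolding discounted_utility_def JJ_def
 by (subst ereal_integral_neg) (auto simp: active_def mult_nonneg_nonpos utility_nonpos e2ennreal_ereal)

lemma JJ_ge:
 "NL T (%t. en (of_bool (en t < ta v) * (du p x s t v))) <= JJ x s (%_. 0) ta v"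
 unfolding JJ_def by (intro nn_integral_mono) (auto simp: active_def indicator_def)

lemma post_payoff_JJ: "post_payoff M p x s = - enn2ereal (NI M (%v. JJ x s (%_. 0) (%_. \<infinity>) v))"
 unfolding post_payoff_def by (subst ereal_integral_neg) (auto simp: discounted_JJ)

lemma value_G_nonpos: "value_G M F B p w <= 0"
 unfolding value_G_def by (intro SUP_least) (auto simp: post_payoff_JJ)

lemma payoff_JJ: "payoff M F B p x s ta W = - enn2ereal (NI M (%v. JJ x s (%_. 0) ta v +
 (if ta v = \<infinity> then 0 else en (exp (- dh p * er (ta v))) * e2ennreal (- value_G M F B p (W (er (ta v)) v)))))"
proof -
 have G: "ereal e * value_G M F B p w = - enn2ereal (en e * e2ennreal (- value_G M F B p w))" if "0 <= e" for e w
 proof -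
 have "value_G M F B p w = - enn2ereal (e2ennreal (- value_G M F B p w))"
 using value_G_nonpos[of M F B w] by (simp add: enn2ereal_e2ennreal)
 thus ?thesis using that by (metis ereal_mult_minus_right times_ennreal.rep_eq enn2ereal_ennreal)
 qed
 have "discounted_utility p x s (%_. 0) ta v + (if ta v = \<infinity> then 0 else ereal (exp (- dh p * er (ta v))) * value_G M F B p (W (er (ta v)) v)) =
 - enn2ereal (JJ x s (%_. 0) ta v + (if ta v = \<infinity> then 0 else en (exp (- dh p * er (ta v))) * e2ennreal (- value_G M F B p (W (er (ta v)) v))))" for v
 proof -
 have add: "- enn2ereal a + - enn2ereal b = - enn2ereal (a + b)" for a b
 using enn2ereal_nonneg[of a] enn2ereal_nonneg[of b] unfolding plus_ennreal.rep_eq by (cases "enn2ereal a"; cases "enn2ereal b") auto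
 show ?thesis unfolding discounted_JJ by (cases "ta v = \<infinity>") (simp_all add: G add)
 qed
 thus ?thesis unfolding payoff_def by (subst ereal_integral_neg) auto
qed

end

section \<open>Weak duality\<close>

context market
begin

context
 fixes ta :: "'a => ennreal" and a x s W :: "real => 'a => real" and Y et w h y T :: real
 assumes ta: "Stop F ta" and a: "prog F a" and x: "prog F x" and s: "prog F s"
 and sde: "wealth_sde M F B p Y et (%_. 0) w ta a x s W"
 and feas: "AE v in M. ALL t>=0. en t < ta v --> x_min p < x t v & s_min p < s t v & 0 < W t v + h"
 and h: "mu_R p * h = Y - x_min p - s_min p / et * price p" and z: "0 <= w + h" and T: "0 <= T" and eta: "0 < et"
 and y: "0 < y"
begin

abbreviation "RR v \<equiv> en (exp (- mu_R p * er (ta v)) * (W (er (ta v)) v + h)) * on ta T v *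
 en (emart (- kappa p) (er (ta v)) v)"

abbreviation "fP t v \<equiv> of_bool (en t < ta v) * (du p x s t v)"

lemma fP_progressive: "prog F fP"
proof -
 have "(%(x, y). utility p x y) : Bm (borel >< borel)" unfolding utility_def by measurable
 from progressive_comp2[OF x s this] have u: "prog F (%t v. utility p (x t v) (s t v))" .
 have "prog F (%t v. du p x s t v)"
 by (rule progressive_comp_time[OF u, of "%t x. exp (- dh p * t) * - x"]) measurable
 from progressive_mult[OF progressive_pre[OF ta] this] show ?thesis .
qed

text \<open>Pointwise conjugacy with multiplier \<open>y * zeta t\<close>, integrated and combined
  with the budget inequality. The priced wealth stays on the left, to be matched later with the
  reward at \<open>ta\<close>.\<close>

lemma budget_dual:
 "en (phi p / Gam p et * (y powr eps p / eps p)) * II (eps p) ta T + en y * NI M (%v. RR v) <=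
 NI M (%v. NL T (%t. en (fP t v))) + en (y * (w + h))"
proof -
 define c where "c t v = x t v - x_min p + (s t v - s_min p) / et * price p" for t v
 let ?C = "phi p / Gam p et * (y powr eps p / eps p)"
 let ?fQ = "%t v. of_bool (en t < ta v) * (ex 1 t v * c t v)"
 have C: "0 <= ?C" using phi_pos Gam_pos[OF eta] eps_bounds by simp
 have cp: "prog F c"
 unfolding c_def by (rule progressive_comp2[OF x s, of "%x s. x - x_min p + (s - s_min p) / et * price p"]) measurable
 have Qp: "prog F ?fQ" by (intro progressive_mult progressive_pre ta ex_progressive cp)
 have "NI M (%v. NL T (%t. en (of_bool (en t < ta v) * (exp (- mu_R p * t) * c t v)) * en (emart (- kappa p) t v))) + NI M (%v. RR v) <= en (w + h)"
 unfolding c_def by (rule wealth_budget[OF valid ta a x s sde feas h z T eta])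
 also have "(%v. NL T (%t. en (of_bool (en t < ta v) * (exp (- mu_R p * t) * c t v)) * en (emart (- kappa p) t v))) = (%v. NL T (%t. en (?fQ t v)))"
 proof -
 have "?fQ t v = (of_bool (en t < ta v) * (exp (- mu_R p * t) * c t v)) * emart (- kappa p) t v" for t v
 by (simp add: ex_def phq_1 mult_ac)
 hence "en (?fQ t v) = en (of_bool (en t < ta v) * (exp (- mu_R p * t) * c t v)) * en (emart (- kappa p) t v)" for t v
 by (simp only: ennreal_mult'' emart_pos less_imp_le)
 thus ?thesis by presburger
 qed
 finally have bud: "NI M (%v. NL T (%t. en (?fQ t v))) + NI M (%v. RR v) <= en (w + h)" .
 have "en ?C * II (eps p) ta T = NI M (%v. NL T (%t. en (?C * (of_bool (en t < ta v) * ex (eps p) t v))))"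
 unfolding II_def by (rule set_integral_cmult[OF pre_ex_progressive[OF ta T] T C])
 also have "... <= NI M (%v. NL T (%t. en (fP t v)) + NL T (%t. en (y * ?fQ t v)))"
 proof (rule nn_integral_mono_AE)
 have yQ: "prog F (%t v. y * ?fQ t v)" by (rule progressive_comp[OF Qp, of "%x. y * x"]) measurable
 show "AE v in M. NL T (%t. en (?C * (of_bool (en t < ta v) * ex (eps p) t v))) <=
 NL T (%t. en (fP t v)) + NL T (%t. en (y * ?fQ t v))"
 using feas AE_space
 proof eventually_elim
 case (elim v)
 have pt: "?C * ex (eps p) t v <= du p x s t v + y * (ex 1 t v * c t v)" "0 <= c t v"
 if t: "0 <= t" "en t < ta v" for t
 proof -
 have xs: "x_min p < x t v" "s_min p < s t v" using elim(1) t by auto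
 thus "0 <= c t v" unfolding c_def using eta par by (intro add_nonneg_nonneg mult_nonneg_nonneg divide_nonneg_nonneg) auto
 have "utility p (x t v) (s t v) <= - (phi p / Gam p et) * ((y * zeta t v) powr eps p / eps p) + (y * zeta t v) * c t v"
 unfolding c_def using y zeta_pos by (intro utility_dual[OF xs eta]) simp
 hence "(phi p / Gam p et) * ((y * zeta t v) powr eps p / eps p) <= - utility p (x t v) (s t v) + (y * zeta t v) * c t v" by simp
 hence "exp (- dh p * t) * ((phi p / Gam p et) * ((y * zeta t v) powr eps p / eps p)) <= exp (- dh p * t) * (- utility p (x t v) (s t v) + (y * zeta t v) * c t v)"
 by (rule mult_left_mono) simp
 thus "?C * ex (eps p) t v <= du p x s t v + y * (ex 1 t v * c t v)"
 unfolding ex_zeta powr_mult distrib_left using zeta_pos[of t v] by (simp add: mult_ac)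
 qed
 have "NL T (%t. en (?C * (of_bool (en t < ta v) * ex (eps p) t v))) <=
 NI lborel (%t. en (fP t v) * Ind {0..T} t + en (y * ?fQ t v) * Ind {0..T} t)"
 proof (rule nn_integral_mono)
 fix t
 show "en (?C * (of_bool (en t < ta v) * ex (eps p) t v)) * Ind {0..T} t <= en (fP t v) * Ind {0..T} t + en (y * ?fQ t v) * Ind {0..T} t"
 proof (cases "0 <= t & t <= T & en t < ta v")
 case True
 have "0 <= du p x s t v" using utility_nonpos[of "x t v" "s t v"] by (intro mult_nonneg_nonneg) auto
 moreover have "0 <= y * (ex 1 t v * c t v)" using pt(2)[of t] True y ex_pos[of 1 t v] by simp
 ultimately show ?thesis using True pt(1)[of t] by (simp add: ennreal_leI flip: ennreal_plus)
 qed (auto simp: indicator_def)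
 qed
 also have "... = NL T (%t. en (fP t v)) + NL T (%t. en (y * ?fQ t v))"
 using elim(2) by (intro nn_integral_add path_measurable fP_progressive yQ T)
 finally show ?case .
 qed
 qed
 also have "... = NI M (%v. NL T (%t. en (fP t v))) + NI M (%v. NL T (%t. en (y * ?fQ t v)))"
 by (intro nn_integral_add set_integral_M fP_progressive T progressive_comp[OF Qp, of "%x. y * x"]) measurable
 also have "NI M (%v. NL T (%t. en (y * ?fQ t v))) = en y * NI M (%v. NL T (%t. en (?fQ t v)))"
 using y by (intro set_integral_cmult[symmetric] Qp T) simp
 finally have "en ?C * II (eps p) ta T + en y * NI M (%v. RR v) <= NI M (%v. NL T (%t. en (fP t v))) +
 en y * (NI M (%v. NL T (%t. en (?fQ t v))) + NI M (%v. RR v))"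
 unfolding distrib_left add.assoc[symmetric] by (rule add_right_mono)
 also have "... <= NI M (%v. NL T (%t. en (fP t v))) + en y * en (w + h)"
 using bud by (intro add_left_mono mult_left_mono) auto
 finally show ?thesis using y by (simp add: ennreal_mult')
qed

text \<open>Finiteness permits cancelling this term in \<open>ennreal\<close>.\<close>

lemma RR_finite: "NI M (%v. RR v) < \<infinity>"
proof -
 have "NI M (%v. RR v) <= en (w + h)"
 using wealth_budget[OF valid ta a x s sde feas h z T eta] by (rule order_trans[rotated]) simp
 thus ?thesis by (rule le_less_trans) simp
qed

end

end

context market
begin

definition NT :: "real => ('a => ennreal) => real => ennreal" where
 "NT e ta T = NI M (%v. en (ex e (er (ta v)) v) * on ta T v)"

lemma at_stopping_M:
 assumes ta: "Stop F ta" and T: "0 <= T" and X: "prog F X"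
 shows "(%v. en (X (er (ta v)) v) * on ta T v) : Bm M"
 using pre_F_process[OF ta X] T unfolding pre_F_def by (intro F_M[of T]) auto

text \<open>The difference to \<open>nn\<close> comes from paths with \<open>ta > T\<close>; there
  the value at \<open>T\<close> contributes at most its unrestricted mean
  \<open>exp (- phq e * T)\<close>.\<close>

lemma NT:
 assumes ta: "Stop F ta" and T: "0 <= T" and e: "0 <= phq e"
 shows "en (nn e ta T - exp (- phq e * T)) <= NT e ta T" "NT e ta T <= en (nn e ta T)"
proof -
 have s: "en (ex e (stop_at ta T v) v) = en (ex e (er (ta v)) v) * on ta T v + en (ex e T v) * Ind {v. ~  ta v <= en T} v" for v
 using T by (simp add: stop_at_eq indicator_def)
 have m: "(%v. en (ex e T v) * Ind {v. ~  ta v <= en T} v) : Bm M"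
 proof -
 have [measurable]: "ex e T : Bm M" using progressive_M[OF ex_progressive T] .
 have [measurable]: "Measurable.pred M (%v. ta v <= en T)" using pred_le_M[OF ta T] .
 show ?thesis by measurable
 qed
 have "en (nn e ta T) = NT e ta T + NI M (%v. en (ex e T v) * Ind {v. ~  ta v <= en T} v)"
 unfolding nn_eq[OF ta T e, symmetric] NT_def s by (rule nn_integral_add[OF at_stopping_M[OF ta T ex_progressive] m])
 moreover have "NI M (%v. en (ex e T v) * Ind {v. ~  ta v <= en T} v) <= en (exp (- phq e * T))"
 proof -
 have "NI M (%v. en (ex e T v) * Ind {v. ~  ta v <= en T} v) <= NI M (%v. en (exp (- phq e * T)) * en (emart (- e * kappa p) T v))"
 unfolding ex_def by (intro nn_integral_mono) (auto simp: indicator_def ennreal_mult')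
 also have "... = en (exp (- phq e * T))"
 using T emart_M[of T "- e * kappa p"] emart_expectation[of T "- e * kappa p"] by (subst nn_integral_cmult) auto
 finally show ?thesis .
 qed
 ultimately have "en (nn e ta T) <= NT e ta T + en (exp (- phq e * T))" by (simp add: add_left_mono)
 hence "en (nn e ta T) - en (exp (- phq e * T)) <= NT e ta T" by (simp add: ennreal_minus_le_iff add.commute)
 thus "en (nn e ta T - exp (- phq e * T)) <= NT e ta T" by (simp add: ennreal_minus)
 show "NT e ta T <= en (nn e ta T)" using \<open>en (nn e ta T) = _\<close> by simp
qed

lemma exp_decay: "0 < c ==> (%n. exp (- c * real n)) ----> 0"
proof -
 assume c: "0 < c"
 have "(%n. exp (- c) ^ n) ----> 0" using c by (intro LIMSEQ_power_zero) simp
 thus ?thesis by (simp add: exp_of_nat_mult[symmetric] mult.commute)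
qed

lemma neg_enn2ereal_le: "(!!L. l = en L ==> 0 <= L ==> - L <= c) ==> - enn2ereal l <= ereal c"
 by (cases l) auto

text \<open>Weak duality with an infinite stopping time: \<open>phi p\<close> times the truncated
  time integral tends to 1 as the horizon grows.\<close>

lemma post_payoff_le:
 assumes adm: "admissible_post M F B p (%_. 0) w a x s W" and z: "0 < z_post p w" and y: "0 < y"
 shows "post_payoff M p x s <= ereal (- (y powr eps p / (eps p * Gp p)) + y * z_post p w)"
 unfolding post_payoff_JJ
proof (rule neg_enn2ereal_le)
 fix L assume L: "NI M (%v. JJ x s (%_. 0) (%_. \<infinity>) v) = en L" "0 <= L"
 note a = adm[unfolded admissible_post_def z_post_def]
 let ?K = "y powr eps p / (eps p * Gp p)"
 have e: "0 < phq (eps p)" using phi_pos by (simp add: phq_eps)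
 have "?K * (1 - exp (- phi p * real n)) <= L + y * z_post p w" for n
 proof -
 note st = const_stopping[of "\<infinity>"]
 have hp: "mu_R p * H_post p = income_post p - x_min p - s_min p / eff_post p * price p" using par by (simp add: H_post_def)
 have feas: "AE v in M. ALL t>=0. en t < \<infinity> --> x_min p < x t v & s_min p < s t v & 0 < W t v + H_post p"
 and px: "prog F a" "prog F x" "prog F s"
 and sde: "wealth_sde M F B p (income_post p) (eff_post p) (%_. 0) w (%_. \<infinity>) a x s W" using a by auto
 have zw: "0 <= w + H_post p" using z by (simp add: z_post_def)
 have "en (phi p / Gam p (eff_post p) * (y powr eps p / eps p)) * II (eps p) (%_. \<infinity>) (real n) <=
 NI M (%v. NL (real n) (%t. en (of_bool (en t < \<infinity>) * (du p x s t v)))) + en (y * (w + H_post p))"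
 by (rule order_trans[OF _ budget_dual[OF st px sde feas hp zw of_nat_0_le_iff par(7) y]]) simp
 also have "... <= en L + en (y * (w + H_post p))"
 unfolding L(1)[symmetric] by (intro add_right_mono nn_integral_mono JJ_ge)
 also have "... = en (L + y * z_post p w)" using L z y by (simp add: z_post_def flip: ennreal_plus)
 finally have up: "en (phi p / Gam p (eff_post p) * (y powr eps p / eps p)) * II (eps p) (%_. \<infinity>) (real n) <= en (L + y * z_post p w)" .
 have h1: "phi p * ?K * ii (eps p) (%_. \<infinity>) (real n) <= L + y * z_post p w"
 proof -
 let ?C = "phi p / Gam p (eff_post p) * (y powr eps p / eps p)" and ?i = "ii (eps p) (%_. \<infinity>) (real n)"
 have "0 <= ?C" using phi_pos Gam_pos[OF par(7)] eps_bounds by simp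
 hence "en (?C * ?i) <= en (L + y * z_post p w)"
 using up unfolding ii(2)[OF st of_nat_0_le_iff e] by (simp only: ennreal_mult')
 hence "?C * ?i <= L + y * z_post p w" using L(2) z y by (subst (asm) ennreal_le_iff) auto
 thus ?thesis by (simp add: Gamma_post_Gam mult_ac)
 qed
 moreover have h2: "phi p * ii (eps p) (%_. \<infinity>) (real n) = 1 - nn (eps p) (%_. \<infinity>) (real n)"
 using ii(1)[OF st of_nat_0_le_iff e, of n] by (simp add: phq_eps)
 moreover have "nn (eps p) (%_. \<infinity>) (real n) <= exp (- phi p * real n)"
 proof -
 have "NT (eps p) (%_. \<infinity>) (real n) = 0" by (simp add: NT_def top_unique)
 thus ?thesis using NT(1)[OF st of_nat_0_le_iff less_imp_le[OF e], of n] by (simp add: phq_eps ennreal_eq_0_iff)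
 qed
 hence h3: "?K * (1 - exp (- phi p * real n)) <= ?K * (1 - nn (eps p) (%_. \<infinity>) (real n))"
 using Phi_less eps_bounds by (intro mult_left_mono) auto
 moreover have h4: "phi p * ?K * ii (eps p) (%_. \<infinity>) (real n) = ?K * (phi p * ii (eps p) (%_. \<infinity>) (real n))" by (simp only: mult_ac)
 ultimately show ?thesis using order_trans[OF h3 h1[unfolded h4 h2]] by simp
 qed
 moreover have "(%n. ?K * (1 - exp (- phi p * real n))) ----> ?K * (1 - 0)"
 by (intro tendsto_intros exp_decay phi_pos)
 ultimately have "?K * (1 - 0) <= L + y * z_post p w" by (intro LIMSEQ_le_const2) auto
 thus "- L <= - ?K + y * z_post p w" by simp
qed

text \<open>The best multiplier is the marginal value \<open>gval\<close> assigns to total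
  wealth.\<close>

lemma value_G_le: "0 < z_post p w ==> value_G M F B p w <= ereal (gval (z_post p w))"
proof -
 assume z: "0 < z_post p w"
 define y where "y = (Gp p * z_post p w) powr (- gam p)"
 note g = gval_eq[OF z y_def]
 show ?thesis unfolding value_G_def g(2) using post_payoff_le[OF _ z g(1)] by (intro SUP_least) auto
qed

text \<open>Finite-horizon weak duality for both signs of \<open>theta p\<close>:
  \<open>budget_dual\<close> handles the time before \<open>ta\<close>, \<open>gval_dual\<close> the
  reward at \<open>ta\<close>. To keep all terms nonnegative, the positive part of
  \<open>theta p\<close> goes to the right and the negative part to the left. Expressing everything
  through \<open>ii\<close> isolates the gain from waiting.\<close>

lemma payoff_le:
 assumes adm: "admissible M F B p w a x s ta W" and z: "0 <= z_pre p w" and y: "0 < y"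
 and L: "NI M (%v. JJ x s (%_. 0) ta v +
 (if ta v = \<infinity> then 0 else en (exp (- dh p * er (ta v))) * e2ennreal (- value_G M F B p (W (er (ta v)) v)))) = en L" "0 <= L"
 and T: "0 <= T"
 shows "y powr eps p / (eps p * Gp p) * (1 - exp (- phi p * T)) + y * max 0 (- theta p) * (1 - exp (- mu_R p * T)) -
 (y * max 0 (- theta p) * mu_R p * ii 1 ta T - (1 / Pp p - 1 / Gp p) * y powr eps p / eps p * phi p * ii (eps p) ta T)
 <= L + y * (z_pre p w + max 0 (theta p))"
proof -
 have ta: "Stop F ta" and px: "prog F a" "prog F x" "prog F s"
 and feas: "AE v in M. ALL t>=0. en t < ta v --> x_min p < x t v & s_min p < s t v & 0 < W t v + H_pre p"
 and zp: "AE v in M. ta v < \<infinity> --> 0 < z_post p (W (er (ta v)) v)"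
 and sde: "wealth_sde M F B p (income p) (eff_pre p) (%_. 0) w ta a x s W"
 using adm by (auto simp: admissible_def z_pre_def)
 have W: "prog F W" using sde by (auto simp: wealth_sde_def Let_def)
 have hp: "mu_R p * H_pre p = income p - x_min p - s_min p / eff_pre p * price p" using par by (simp add: H_pre_def)
 have zw: "0 <= w + H_pre p" using z by (simp add: z_pre_def)
 let ?K = "y powr eps p / (eps p * Gp p)"
 let ?P = "NI M (%v. NL T (%t. en (of_bool (en t < ta v) * (du p x s t v))))"
 let ?R = "%v. en (exp (- mu_R p * er (ta v)) * (W (er (ta v)) v + H_pre p)) * on ta T v * en (emart (- kappa p) (er (ta v)) v)"
 let ?g = "%v. en (exp (- dh p * er (ta v)) * - gval (W (er (ta v)) v + H_post p)) * on ta T v"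
 let ?m = "max 0 (- theta p)" and ?q = "max 0 (theta p)"
 have K: "0 < ?K" using y eps_bounds Phi_less by simp
 have m: "0 <= y * ?m" "0 <= y * ?q" using y by auto
 note bud = budget_dual[OF ta px sde feas hp zw T par(5) y]
 have gm: "?g : Bm M"
 by (rule at_stopping_M[OF ta T progressive_comp_time[OF W, of "%t x. exp (- dh p * t) * - gval (x + H_post p)"]]) (simp add: gval_def)
 have Rm: "?R : Bm M"
 proof -
 have "prog F (%t v. exp (- mu_R p * t) * (W t v + H_pre p))"
 by (rule progressive_comp_time[OF W, of "%t x. exp (- mu_R p * t) * (x + H_pre p)"]) measurable
 from borel_measurable_times_ennreal[OF at_stopping_M[OF ta T this] at_stopping_M[OF ta T emart_progressive[of "- kappa p"]]]
 show ?thesis by (rule measurable_cong[THEN iffD1, rotated]) (simp add: indicator_def)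
 qed
 note NTm = at_stopping_M[OF ta T ex_progressive]
 have "en ?K * NT (eps p) ta T + en (y * ?m) * NT 1 ta T <= NI M (%v. ?g v) + en y * NI M (%v. ?R v) + en (y * ?q) * NT 1 ta T"
 proof -
 let ?i = "%v. on ta T v :: ennreal" and ?X = "%e v. en (ex e (er (ta v)) v)"
 have "NI M (%v. en ?K * (?X (eps p) v * ?i v) + en (y * ?m) * (?X 1 v * ?i v)) <= NI M (%v. ?g v + en y * ?R v + en (y * ?q) * (?X 1 v * ?i v))"
 proof (rule nn_integral_mono_AE)
 show "AE v in M. en ?K * (?X (eps p) v * ?i v) + en (y * ?m) * (?X 1 v * ?i v) <= ?g v + en y * ?R v + en (y * ?q) * (?X 1 v * ?i v)"
 using zp
 proof eventually_elim
 case (elim v)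
 show ?case
 proof (cases "ta v <= en T")
 case True
 define t where "t = er (ta v)"
 define Z where "Z = W t v + H_pre p"
 have th: "W t v + H_post p = Z + theta p" by (simp add: Z_def theta_def)
 have "ta v < \<infinity>" using le_less_trans[OF True ennreal_less_top] by simp
 hence zt: "0 < Z + theta p" using elim by (simp add: z_post_def t_def[symmetric] th)
 have "(y * zeta t v) powr eps p / (eps p * Gp p) <= - gval (Z + theta p) + (y * zeta t v) * (Z + theta p)"
 using gval_dual[OF zt, of "y * zeta t v"] y zeta_pos by simp
 hence "exp (- dh p * t) * ((y * zeta t v) powr eps p / (eps p * Gp p)) <= exp (- dh p * t) * (- gval (Z + theta p) + (y * zeta t v) * (Z + theta p))"
 by (rule mult_left_mono) simp
 hence 1: "?K * ex (eps p) t v <= exp (- dh p * t) * - gval (Z + theta p) + y * ex 1 t v * (Z + theta p)"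
 unfolding ex_zeta powr_mult distrib_left using zeta_pos[of t v] by (simp add: mult_ac)
 \<comment> \<open>When \<open>theta p\<close> is positive, only \<open>Z + theta p\<close> is known
   to be positive at \<open>ta\<close>; \<open>max 0 Z\<close> reproduces the truncation that
   \<open>en\<close> performs inside \<open>?R\<close>.\<close>
 have "y * ex 1 t v * (Z + theta p) <= y * ex 1 t v * (max 0 Z + (?q - ?m))"
 using y ex_pos[of 1 t v] by (intro mult_left_mono) auto
 with 1 have "?K * ex (eps p) t v + y * ?m * ex 1 t v <= exp (- dh p * t) * - gval (Z + theta p) + y * (ex 1 t v * max 0 Z) + y * ?q * ex 1 t v"
 by (simp add: algebra_simps)
 hence "en (?K * ex (eps p) t v + y * ?m * ex 1 t v) <= en (exp (- dh p * t) * - gval (Z + theta p) + y * (ex 1 t v * max 0 Z) + y * ?q * ex 1 t v)"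
 by (rule ennreal_leI)
 also have "... = en (exp (- dh p * t) * - gval (Z + theta p)) + en y * (en (ex 1 t v * max 0 Z)) + en (y * ?q) * en (ex 1 t v)"
 proof -
 have "en (A + y * E + q * X) = en A + en y * en E + en q * en X" if "0 <= A" "0 <= E" "0 <= q" "0 <= X" for A E q X
 using that y by (simp add: ennreal_plus ennreal_mult')
 moreover have "0 <= exp (- dh p * t) * - gval (Z + theta p)" using gval_neg[OF zt] by (intro mult_nonneg_nonneg) auto
 ultimately show ?thesis using m ex_pos[of 1 t v] by (simp only: mult_nonneg_nonneg less_imp_le max.cobounded1)
 qed
 also have "en (?K * ex (eps p) t v + y * ?m * ex 1 t v) = en ?K * en (ex (eps p) t v) + en (y * ?m) * en (ex 1 t v)"
 proof -
 have "en (k * E + q * X) = en k * en E + en q * en X" if "0 <= k" "0 <= E" "0 <= q" "0 <= X" for k E q X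
 using that by (simp add: ennreal_plus ennreal_mult')
 thus ?thesis using K m ex_pos[of 1 t v] ex_pos[of "eps p" t v] by (simp only: less_imp_le)
 qed
 also have "en (ex 1 t v * max 0 Z) = en (exp (- mu_R p * t) * Z) * en (emart (- kappa p) t v)"
 proof -
 have "ex 1 t v * max 0 Z = exp (- mu_R p * t) * max 0 Z * emart (- kappa p) t v" by (simp add: ex_def phq_1)
 moreover have "en (exp (- mu_R p * t) * max 0 Z) = en (exp (- mu_R p * t) * Z)"
 by (cases "0 <= Z") (simp_all add: ennreal_neg mult_nonneg_nonpos)
 ultimately show ?thesis using emart_pos[of "- kappa p" t v] by (metis ennreal_mult'' less_imp_le)
 qed
 finally show ?thesis using True by (simp add: t_def[symmetric] th Z_def[symmetric])
 qed simp
 qed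
 qed
 also have "... = NI M (%v. ?g v) + en y * NI M (%v. ?R v) + en (y * ?q) * NT 1 ta T"
 unfolding NT_def using gm Rm NTm[of 1] by (subst nn_integral_add nn_integral_cmult; measurable)+
 also have "NI M (%v. en ?K * (?X (eps p) v * ?i v) + en (y * ?m) * (?X 1 v * ?i v)) = en ?K * NT (eps p) ta T + en (y * ?m) * NT 1 ta T"
 unfolding NT_def using NTm by (subst nn_integral_add nn_integral_cmult; measurable)+
 finally show ?thesis .
 qed
 note term_le = this
 have LL: "?P + NI M (%v. ?g v) <= en L"
 proof -
 have "?P + NI M (%v. ?g v) = NI M (%v. NL T (%t. en (of_bool (en t < ta v) * (du p x s t v))) + ?g v)"
 by (rule nn_integral_add[OF set_integral_M[OF fP_progressive[OF ta px sde feas hp zw T par(5) y] T] gm, symmetric])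
 also have "... <= en L" unfolding L(1)[symmetric]
 proof (rule nn_integral_mono_AE)
 show "AE v in M. NL T (%t. en (of_bool (en t < ta v) * (du p x s t v))) + ?g v <=
 JJ x s (%_. 0) ta v + (if ta v = \<infinity> then 0 else en (exp (- dh p * er (ta v))) * e2ennreal (- value_G M F B p (W (er (ta v)) v)))"
 using zp
 proof eventually_elim
 case (elim v)
 have "?g v <= (if ta v = \<infinity> then 0 else en (exp (- dh p * er (ta v))) * e2ennreal (- value_G M F B p (W (er (ta v)) v)))"
 proof (cases "ta v <= en T")
 case True
 hence f: "ta v < \<infinity>" using le_less_trans[OF True ennreal_less_top] by simp
 let ?w = "W (er (ta v)) v"
 have "value_G M F B p ?w <= ereal (gval (z_post p ?w))" using elim f by (intro value_G_le) auto
 hence "ereal (- gval (z_post p ?w)) <= - value_G M F B p ?w" unfolding uminus_ereal.simps(1)[symmetric] ereal_minus_le_minus .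
 hence "en (- gval (z_post p ?w)) <= e2ennreal (- value_G M F B p ?w)" by (metis e2ennreal_ereal e2ennreal_mono)
 hence "en (exp (- dh p * er (ta v))) * en (- gval (z_post p ?w)) <= en (exp (- dh p * er (ta v))) * e2ennreal (- value_G M F B p ?w)"
 by (rule mult_left_mono) simp
 thus ?thesis using True f by (simp add: ennreal_mult'[symmetric] z_post_def)
 qed (auto simp: top_unique)
 thus ?case by (intro add_mono JJ_ge)
 qed
 qed
 finally show ?thesis .
 qed
 let ?C = "phi p / Gam p (eff_pre p) * (y powr eps p / eps p)"
 let ?RI = "NI M (%v. ?R v)"
 have p1: "0 < phq 1" "0 < phq (eps p)" using par phi_pos by (auto simp: phq_1 phq_eps)
 have "en y * ?RI + (en ?C * II (eps p) ta T + en ?K * NT (eps p) ta T + en (y * ?m) * NT 1 ta T) =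
 (en ?C * II (eps p) ta T + en y * ?RI) + (en ?K * NT (eps p) ta T + en (y * ?m) * NT 1 ta T)" by (simp only: add_ac)
 also have "... <= (?P + en (y * (w + H_pre p))) + (NI M (%v. ?g v) + en y * ?RI + en (y * ?q) * NT 1 ta T)"
 by (rule add_mono[OF bud term_le])
 also have "... = en y * ?RI + ((?P + NI M (%v. ?g v)) + (en (y * (w + H_pre p)) + en (y * ?q) * NT 1 ta T))" by (simp only: add_ac)
 \<comment> \<open>The common summand \<open>en y * ?RI\<close> is finite by
   \<open>RR_finite\<close> and cancels.\<close>
 finally have "en ?C * II (eps p) ta T + en ?K * NT (eps p) ta T + en (y * ?m) * NT 1 ta T <=
 (?P + NI M (%v. ?g v)) + (en (y * (w + H_pre p)) + en (y * ?q) * NT 1 ta T)"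
 using RR_finite[OF ta px sde feas hp zw T par(5) y] unfolding ennreal_add_left_cancel_le by (auto simp: ennreal_mult_eq_top_iff)
 also have "... <= en L + (en (y * (w + H_pre p)) + en (y * ?q) * en 1)"
 using order_trans[OF NT(2)[OF ta T less_imp_le[OF p1(1)]] ennreal_leI[OF nn_le_1[OF ta T p1(1)]]]
 by (intro add_mono LL mult_left_mono) auto
 also have "... = en (L + y * (z_pre p w + ?q))"
 proof -
 have "en L + (en A + en B * en 1) = en (L + (A + B))" if "0 <= A" "0 <= B" for A B
 using that L(2) by (simp add: ennreal_plus)
 moreover have "y * (z_pre p w + ?q) = y * (w + H_pre p) + y * ?q" by (simp add: z_pre_def distrib_left)
 ultimately show ?thesis using mult_nonneg_nonneg[OF less_imp_le[OF y] zw] m by simp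
 qed
 finally have up: "en ?C * II (eps p) ta T + en ?K * NT (eps p) ta T + en (y * ?m) * NT 1 ta T <= en (L + y * (z_pre p w + ?q))" .
 let ?ne = "max 0 (nn (eps p) ta T - exp (- phi p * T))" and ?n1 = "max 0 (nn 1 ta T - exp (- mu_R p * T))"
 have C: "0 <= ?C * ii (eps p) ta T" using phi_pos Gam_pos[OF par(5)] eps_bounds ii(3)[OF ta T, of "eps p"] by simp
 have "en (?C * ii (eps p) ta T + ?K * ?ne + y * ?m * ?n1) = en (?C * ii (eps p) ta T) + en (?K * ?ne) + en (y * ?m * ?n1)"
 proof -
 have "en (A + k * E + q * X) = en A + en (k * E) + en (q * X)" if "0 <= A" "0 <= k" "0 <= E" "0 <= q" "0 <= X" for A k E q X
 using that by (simp add: ennreal_plus)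
 thus ?thesis using C K m by (simp only: less_imp_le max.cobounded1)
 qed
 also have "... = en ?C * II (eps p) ta T + en ?K * en ?ne + en (y * ?m) * en ?n1"
 unfolding ii(2)[OF ta T p1(2)] using K m ii(3)[OF ta T, of "eps p"] by (simp only: ennreal_mult' ennreal_mult'' less_imp_le)
 also have "... <= en ?C * II (eps p) ta T + en ?K * NT (eps p) ta T + en (y * ?m) * NT 1 ta T"
 using NT(1)[OF ta T less_imp_le[OF p1(1)]] NT(1)[OF ta T less_imp_le[OF p1(2)]]
 by (intro add_mono mult_left_mono) (auto simp: phq_1 phq_eps max_def ennreal_neg)
 also note up
 finally have "?C * ii (eps p) ta T + ?K * ?ne + y * ?m * ?n1 <= L + y * (z_pre p w + ?q)"
 using L(2) y z by (subst (asm) ennreal_le_iff) auto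
 moreover have "?K * (nn (eps p) ta T - exp (- phi p * T)) <= ?K * ?ne" using K by (intro mult_left_mono) auto
 moreover have "y * ?m * (nn 1 ta T - exp (- mu_R p * T)) <= y * ?m * ?n1" using m by (intro mult_left_mono) auto
 ultimately have f: "?C * ii (eps p) ta T + ?K * (nn (eps p) ta T - exp (- phi p * T)) + y * ?m * (nn 1 ta T - exp (- mu_R p * T)) <= L + y * (z_pre p w + ?q)" by linarith
 have CK: "?C = phi p * (y powr eps p / eps p) * (1 / Pp p)" "?K = (y powr eps p / eps p) * (1 / Gp p)" by (simp_all add: Phi_pre_Gam)
 have D: "(1 / Pp p - 1 / Gp p) * y powr eps p / eps p * phi p * ii (eps p) ta T =
 phi p * (y powr eps p / eps p) * (1 / Pp p) * ii (eps p) ta T - phi p * (y powr eps p / eps p) * (1 / Gp p) * ii (eps p) ta T"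
 proof -
 have e: "(A - B) * m * f * i = f * m * A * i - f * m * B * i" for A B m f i :: real by (simp add: algebra_simps)
 show ?thesis using e[of "1 / Pp p" "1 / Gp p" "y powr eps p / eps p" "phi p" "ii (eps p) ta T"] by (simp only: times_divide_eq_right)
 qed
 show ?thesis using f unfolding D CK ii(1)[OF ta T p1(1)] ii(1)[OF ta T p1(2)] phq_1 phq_eps by (simp only: algebra_simps)
qed

end

context market
begin

lemma wealth_start:
 assumes "wealth_sde M F B p Y et (%_. 0) w ta a x s W"
 shows "AE v in M. W 0 v = w"
proof -
 obtain b H I where I: "ito_integral M F B H I" and W: "AE v in M. ALL t>=0. 0 <= en t & en t <= ta v --> W t v = w + LI {0..t} (%u. b u v) + I t v"
 using assms unfolding wealth_sde_def Let_def by (elim conjE exE) (rule that, assumption+)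
 show ?thesis using W ito_integral_0[OF I]
 proof eventually_elim
 case (elim v)
 have "AE u in lborel. Ind {0..0::real} u *\<^sub>R b u v = 0" using AE_lborel_singleton[of "0::real"] by eventually_elim simp
 hence "LI {0..0} (%u. b u v) = 0" unfolding set_lebesgue_integral_def by (rule integral_eq_zero_AE)
 thus ?case using elim(1)[rule_format, of 0] elim(2) by simp
 qed
qed

lemma payoff_le_value:
 assumes th: "0 <= theta p" and adm: "admissible M F B p w a x s ta W" and z: "0 < z_post p w"
 shows "payoff M F B p x s ta W <= ereal (gval (z_post p w))"
proof (cases "0 <= z_pre p w")
 case True
 define y where "y = (Gp p * z_post p w) powr (- gam p)"
 note g = gval_eq[OF z y_def]
 show ?thesis unfolding payoff_JJ
 proof (rule neg_enn2ereal_le, goal_cases)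
 case (1 L)
 let ?K = "y powr eps p / (eps p * Gp p)"
 have ta: "Stop F ta" using adm by (simp add: admissible_def)
 have "?K * (1 - exp (- phi p * real n)) <= L + y * z_post p w" for n
 proof -
 have "0 <= (1 / Pp p - 1 / Gp p) * y powr eps p / eps p * phi p * ii (eps p) ta (real n)"
 using Phi_less phi_pos eps_bounds ii(3)[OF ta of_nat_0_le_iff, of "eps p" n]
 by (intro mult_nonneg_nonneg divide_nonneg_nonneg) (auto simp: frac_le)
 thus ?thesis using payoff_le[OF adm True g(1) 1 of_nat_0_le_iff, of n] th
 by (simp add: z_post_def z_pre_def theta_def)
 qed
 moreover have "(%n. ?K * (1 - exp (- phi p * real n))) ----> ?K * (1 - 0)"
 by (intro tendsto_intros exp_decay phi_pos)
 ultimately have "?K * (1 - 0) <= L + y * z_post p w" by (intro LIMSEQ_le_const2) auto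
 thus "- L <= gval (z_post p w)" unfolding g(2) by simp
 qed
next
 case False
 have s: "AE v in M. W 0 v = w" using adm unfolding admissible_def by (elim conjE) (rule wealth_start)
 have f: "AE v in M. ALL t>=0. en t < ta v --> x_min p < x t v & s_min p < s t v & 0 < z_pre p (W t v)"
 using adm by (simp add: admissible_def)
 have "AE v in M. ta v = 0"
 using f s
 proof eventually_elim
 case (elim v)
 hence "~  0 < ta v" using False by (metis ennreal_0 order_refl less_imp_le)
 thus ?case by simp
 qed
 have "e2ennreal (- value_G M F B p w) = NI M (%v. e2ennreal (- value_G M F B p w))" by (simp add: emeasure_space_1)
 also have "... <= NI M (%v. JJ x s (%_. 0) ta v +
 (if ta v = \<infinity> then 0 else en (exp (- dh p * er (ta v))) * e2ennreal (- value_G M F B p (W (er (ta v)) v))))"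
 proof (rule nn_integral_mono_AE)
 show "AE v in M. e2ennreal (- value_G M F B p w) <= JJ x s (%_. 0) ta v +
 (if ta v = \<infinity> then 0 else en (exp (- dh p * er (ta v))) * e2ennreal (- value_G M F B p (W (er (ta v)) v)))"
 using s \<open>AE v in M. ta v = 0\<close> by eventually_elim simp
 qed
 finally have "payoff M F B p x s ta W <= - enn2ereal (e2ennreal (- value_G M F B p w))"
 unfolding payoff_JJ by (simp add: less_eq_ennreal.rep_eq)
 also have "... = value_G M F B p w" using value_G_nonpos[of M F B w] by (simp add: enn2ereal_e2ennreal)
 finally show ?thesis using value_G_le[OF z] by (rule order_trans)
qed

end

text \<open>\<open>waiting\<close> bounds the gain from deferral by \<open>kfun y\<close> uniformly
  in the horizon, which then tends to infinity.\<close>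

lemma (in market_neg) payoff_le_dual:
 assumes adm: "admissible M F B p w a x s ta W" and z0: "0 <= z_pre p w" and y: "0 < y"
 shows "payoff M F B p x s ta W <= ereal (f_hat p y + y * z_pre p w)"
 unfolding payoff_JJ
proof (rule neg_enn2ereal_le, goal_cases)
 case (1 L)
 let ?K = "y powr eps p / (eps p * Gp p)"
 have ta: "Stop F ta" using adm by (simp add: admissible_def)
 have "?K * (1 - exp (- phi p * real n)) + y * - theta p * (1 - exp (- mu_R p * real n)) <= L + y * z_pre p w + kfun y" for n
 proof -
 have "y * - theta p * mu_R p * ii 1 ta (real n) - (1 / Pp p - 1 / Gp p) * y powr eps p / eps p * phi p * ii (eps p) ta (real n) <= kfun y"
 using waiting[OF y of_nat_0_le_iff ta, of n] unfolding D_def by (simp add: mult.commute[of y])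
 thus ?thesis using payoff_le[OF adm z0 y 1 of_nat_0_le_iff, of n] theta_neg by simp
 qed
 moreover have "(%n. ?K * (1 - exp (- phi p * real n)) + y * - theta p * (1 - exp (- mu_R p * real n))) ----> ?K * (1 - 0) + y * - theta p * (1 - 0)"
 by (intro tendsto_intros exp_decay phi_pos par)
 ultimately have "?K * (1 - 0) + y * - theta p * (1 - 0) <= L + y * z_pre p w + kfun y" by (intro LIMSEQ_le_const2) auto
 thus "- L <= f_hat p y + y * z_pre p w" unfolding f_hat_kfun[OF y] by (simp add: algebra_simps)
qed

section \<open>Ito integrals of exponential martingales\<close>

text \<open>Dyadic times. At stage \<open>k\<close> the first \<open>k * 2 ^ k\<close> cells are
  used, so the mesh tends to 0 while the grid exhausts the half-line.\<close>

definition dy :: "nat => nat => real" where "dy k i = real i / 2 ^ k"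

lemma dy: "dy k i <= dy k (Suc i)" "0 <= dy k i" "dy k 0 = 0" "dy k (Suc i) - dy k i = 1 / 2 ^ k" "dy k (k * 2 ^ k) = real k"
 by (simp_all add: dy_def add_divide_distrib divide_right_mono)

lemma dy_mono: "i <= j ==> dy k i <= dy k j" by (simp add: dy_def divide_right_mono)

lemma dy_left:
 assumes s: "0 < s" "s <= real k"
 obtains i where "i < k * 2 ^ k" "dy k i < s" "s <= dy k (Suc i)"
proof -
 define n where "n = nat \<lceil>s * 2 ^ k\<rceil>"
 have n: "s * 2 ^ k <= real n" "real n < s * 2 ^ k + 1" "0 < n" using s by (auto simp: n_def of_nat_nat) linarith+
 have "n <= k * 2 ^ k"
 proof -
 have "s * 2 ^ k <= real (k * 2 ^ k)" using s by simp
 thus ?thesis unfolding n_def by (simp add: nat_le_iff ceiling_le_iff)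
 qed
 with n show thesis by (intro that[of "n - 1"]) (auto simp: dy_def field_simps of_nat_diff)
qed

context bm
begin

definition conv0 :: "(nat => 'a => real) => bool" where
 "conv0 X \<longleftrightarrow> (ALL k. X k : Bm M) & (ALL ee>0. (%k. measure M {v:space M. ee < abs (X k v)}) ----> 0)"

lemma prob_tendsto_AE:
 assumes A: "!!k. A k : sets M" and e: "AE v in M. eventually (%k. v \<notin> A k) sequentially"
 shows "(%k. prob (A k)) ----> 0"
proof -
 have "(%k. LINT v|M. Ind (A k) v :: real) ----> (LINT v|M. 0)"
 proof (rule integral_dominated_convergence[where w="%_. 1"])
 show "AE v in M. (%k. Ind (A k) v :: real) ----> 0"
 using e by eventually_elim (auto intro!: tendsto_eventually elim: eventually_mono)
 qed (use A in \<open>auto simp: indicator_def\<close>)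
 thus ?thesis using A by (simp add: sets.Int_space_eq2)
qed

lemma conv0_AE:
 assumes m: "!!k. X k : Bm M" and l: "AE v in M. (%k. X k v) ----> 0"
 shows "conv0 X"
 unfolding conv0_def
proof (intro conjI allI impI m prob_tendsto_AE)
 fix ee :: real and k assume e: "0 < ee"
 show "{v:space M. ee < abs (X k v)} : sets M" using m[of k] by measurable
next
 fix ee :: real assume e: "0 < ee"
 show "AE v in M. eventually (%k. v \<notin> {v:space M. ee < abs (X k v)}) sequentially"
 using l
 proof eventually_elim
 case (elim v)
 hence "eventually (%k. abs (X k v) < ee) sequentially" using e by (auto simp: tendsto_iff dist_real_def)
 thus ?case by eventually_elim auto
 qed
qed

lemma conv0_add:
 assumes X: "conv0 X" and Y: "conv0 Y"
 shows "conv0 (%k v. X k v + Y k v)"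
 unfolding conv0_def
proof (intro conjI allI impI)
 have m: "X k : Bm M" "Y k : Bm M" for k using X Y by (auto simp: conv0_def)
 thus "(%v. X k v + Y k v) : Bm M" for k by measurable
 fix ee :: real assume e: "0 < ee"
 let ?P = "%Z k. {v:space M. ee / 2 < abs (Z k v)}"
 have Pm: "?P X k : sets M" "?P Y k : sets M" for k using m[of k] by measurable
 show "(%k. \<P>(v in M. ee < abs (X k v + Y k v))) ----> 0"
 proof (rule tendsto_sandwich[OF _ _ tendsto_const])
 show "\<forall>\<^sub>F k in sequentially. \<P>(v in M. ee < abs (X k v + Y k v)) <= prob (?P X k) + prob (?P Y k)"
 proof (rule always_eventually, rule allI)
 fix k
 have "\<P>(v in M. ee < abs (X k v + Y k v)) <= prob (?P X k Un ?P Y k)"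
 using Pm by (intro finite_measure_mono) auto
 also have "... <= prob (?P X k) + prob (?P Y k)" by (rule measure_Un_le[OF Pm])
 finally show "\<P>(v in M. ee < abs (X k v + Y k v)) <= prob (?P X k) + prob (?P Y k)" .
 qed
 have "(%k. prob (?P X k) + prob (?P Y k)) ----> 0 + 0"
 using X Y half_gt_zero[OF e] unfolding conv0_def by (intro tendsto_add) blast+
 thus "(%k. prob (?P X k) + prob (?P Y k)) ----> 0" by simp
 qed simp
qed

lemma conv0_cmult:
 assumes X: "conv0 X" shows "conv0 (%k v. c * X k v)"
 unfolding conv0_def
proof (intro conjI allI impI)
 have [measurable]: "X k : Bm M" for k using X by (simp add: conv0_def)
 show "(%v. c * X k v) : Bm M" for k by measurable
 fix ee :: real assume e: "0 < ee"
 show "(%k. \<P>(v in M. ee < abs (c * X k v))) ----> 0"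
 proof (cases "c = 0")
 case False
 hence "{v:space M. ee < abs (c * X k v)} = {v:space M. ee / abs c < abs (X k v)}" for k
 by (auto simp: abs_mult field_simps)
 thus ?thesis using X e False by (auto simp: conv0_def)
 qed (use e in simp)
qed

lemma conv0_L2:
 assumes m: "!!k. X k : Bm M" and b: "eventually (%k. NI M (%v. en ((X k v)^2)) <= en (c k)) sequentially" and c: "c ----> 0"
 shows "conv0 X"
 unfolding conv0_def
proof (intro conjI allI impI m)
 fix ee :: real assume e: "0 < ee"
 have ev: "eventually (%k. \<P>(v in M. ee < abs (X k v)) <= abs (c k) / ee^2) sequentially"
 using b
 proof eventually_elim
 case (elim k)
 have [measurable]: "X k : Bm M" by (rule m)
 have "emeasure M {v:space M. ee < abs (X k v)} = NI M (%v. Ind {v:space M. ee < abs (X k v)} v)" by simp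
 also have "... <= NI M (%v. en (1 / ee^2) * en ((X k v)^2))"
 proof (rule nn_integral_mono)
 fix v
 show "Ind {v:space M. ee < abs (X k v)} v <= en (1 / ee^2) * en ((X k v)^2)"
 proof (cases "ee < abs (X k v)")
 case True
 hence "ee^2 <= (X k v)^2" using e by (metis abs_of_pos less_imp_le power2_le_iff_abs_le abs_ge_zero power2_abs power_mono)
 hence "1 <= 1 / ee^2 * (X k v)^2" using e by simp
 hence "en 1 <= en (1 / ee^2 * (X k v)^2)" by (rule ennreal_leI)
 hence "1 <= en (1 / ee^2) * en ((X k v)^2)" by (subst ennreal_mult'[symmetric]) auto
 thus ?thesis by (auto simp: indicator_def)
 qed simp
 qed
 also have "... = en (1 / ee^2) * NI M (%v. en ((X k v)^2))" by (rule nn_integral_cmult) measurable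
 also have "... <= en (1 / ee^2) * en (abs (c k))"
 using elim by (intro mult_left_mono) (auto intro: order_trans ennreal_leI)
 also have "... = en (abs (c k) / ee^2)" by (simp add: ennreal_mult'[symmetric])
 finally show ?case by (simp add: emeasure_eq_measure)
 qed
 have "(%k. abs (c k) / ee^2) ----> 0" using tendsto_divide[OF tendsto_rabs[OF c] tendsto_const[of "ee^2"]] e by simp
 from tendsto_sandwich[of "%_. 0", OF _ ev tendsto_const this]
 show "(%k. \<P>(v in M. ee < abs (X k v))) ----> 0" by simp
qed

text \<open>Left-point Riemann sum for the Ito integral of \<open>H\<close> up to time
  \<open>t\<close>.\<close>

definition LS :: "(real => 'a => real) => nat => real => 'a => real" where
 "LS H k t v = (SUM i<k * 2 ^ k. H (dy k i) v * (B (min t (dy k (Suc i))) v - B (min t (dy k i)) v))"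

text \<open>Elementary integrands must be bounded; on a locally bounded path the cut at level
  \<open>k\<close> is eventually inactive.\<close>

definition trunc :: "real => real => real" where "trunc k x = max (- k) (min k x)"

text \<open>Local boundedness and almost everywhere continuity of the paths make the truncated
  left-point processes converge in the squared distance, by dominated convergence. The separate
  \<open>H'\<close> lets the prescribed integrand differ from the explicit one on a null set of
  times, such as the zeros of wealth.\<close>

lemma ito_from_riemann:
 assumes H': "prog F H'" and H: "prog F H" and eq: "AE v in M. AE s in lborel. 0 <= s --> H' s v = H s v"
 and bd: "AE v in M. ALL T>=0. EX C. ALL s:{0..T}. abs (H s v) <= C"
 and cont: "AE v in M. AE s in lborel. 0 < s --> isCont (%s. H s v) s"
 and I: "!!t. 0 <= t ==> I t : Bm M" "AE v in M. Con {0..} (%t. I t v)"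
 and lim: "!!t. 0 <= t ==> conv0 (%k v. LS H k t v - I t v)"
 shows "ito_integral M F B H' I"
proof -
 define E where "E k = (k * 2 ^ k, dy k, %i v. trunc (real k) (H (dy k i) v))" for k :: nat
 have el: "is_elementary F (E k)" for k
 unfolding is_elementary_def E_def prod.case
 proof (intro conjI allI impI dy)
 fix i
 have "H (dy k i) : Bm (F (dy k i))" by (rule progressive_adapted[OF H dy(2)])
 thus "(%v. trunc (real k) (H (dy k i) v)) : Bm (F (dy k i))" unfolding trunc_def by measurable
 show "EX C. ALL v:space (F (dy k i)). abs (trunc (real k) (H (dy k i) v)) <= C" by (rule exI[of _ "real k"]) (auto simp: trunc_def)
 qed
 have Hm [measurable]: "H (dy k i) : Bm M" for k i by (rule progressive_M[OF H dy(2)])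
 show ?thesis unfolding ito_integral_def
 proof (intro conjI H' I exI[of _ E] allI impI el)
 show "AE v in M. ALL T>=0. NL T (%s. en ((H' s v)^2)) < \<infinity>"
 using bd eq
 proof eventually_elim
 case (elim v)
 show ?case
 proof (intro allI impI)
 fix T :: real assume T: "0 <= T"
 then obtain C where C: "!!s. s : {0..T} ==> abs (H s v) <= C" using elim(1) by blast
 have "NL T (%s. en ((H' s v)^2)) <= NI lborel (%s. en (C^2) * Ind {0..T} s)"
 proof (rule nn_integral_mono_AE)
 show "AE s in lborel. en ((H' s v)^2) * Ind {0..T} s <= en (C^2) * Ind {0..T} s"
 using elim(2)
 proof eventually_elim
 case (elim s)
 thus ?case using C[of s] by (auto simp: indicator_def power2_le_iff_abs_le intro!: ennreal_leI abs_le_square_iff[THEN iffD1])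
 qed
 qed
 also have "... < \<infinity>" using T by (simp add: nn_integral_cmult ennreal_mult_less_top)
 finally show "NL T (%s. en ((H' s v)^2)) < \<infinity>" .
 qed
 qed
 next
 fix T ee :: real assume T: "0 <= T" and e: "0 < ee"
 let ?Y = "%k v. NL T (%s. en ((EP (E k) s v - H' s v)^2))"
 have jm: "(%(s, v). en ((EP (E k) s v - H' s v)^2)) : Bm (RB T >< M)" for k
 proof -
 have "(%(s, v). EP (E k) s v) : Bm (RB T >< M)"
 proof -
 have [measurable]: "fst : Bm (RB T >< M)"
 by (rule measurable_compose[OF measurable_fst]) (simp add: measurable_restrict_space1)
 have "(%x. SUM i<k * 2 ^ k. trunc (real k) (H (dy k i) (snd x)) * Ind {dy k i<..dy k (Suc i)} (fst x)) : Bm (RB T >< M)"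
 unfolding trunc_def by measurable
 thus ?thesis by (simp add: E_def elementary_process_def case_prod_beta')
 qed
 from borel_measurable_diff[OF this progressive_joint[OF H' T]] show ?thesis by (simp add: case_prod_beta')
 qed
 show "(%k. \<P>(v in M. en ee < ?Y k v)) ----> 0"
 proof (rule prob_tendsto_AE)
 show "{v:space M. en ee < ?Y k v} : sets M" for k
 using set_nn_integral_measurable[OF jm] by measurable
 show "AE v in M. \<forall>\<^sub>F k in sequentially. v \<notin> {v:space M. en ee < ?Y k v}"
 using bd eq cont AE_space
 proof eventually_elim
 case (elim v)
 obtain C where C: "!!s. s : {0..T} ==> abs (H s v) <= C" using elim(1) T by blast
 have C0: "0 <= C" using C[of 0] T by auto
 have val: "EP (E k) s v = trunc (real k) (H (dy k i) v)" if "i < k * 2 ^ k" "dy k i < s" "s <= dy k (Suc i)" for k i s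
 proof -
 have "EP (E k) s v = (SUM j<k * 2 ^ k. if j = i then trunc (real k) (H (dy k i) v) else 0)"
 unfolding E_def elementary_process_def prod.case
 proof (rule sum.cong[OF refl])
 fix j
 have "Ind {dy k j<..dy k (Suc j)} s = (of_bool (j = i) :: real)"
 using that dy_mono[of "Suc j" i k] dy_mono[of "Suc i" j k] by (cases j i rule: linorder_cases) (auto simp: indicator_def)
 thus "trunc (real k) (H (dy k j) v) * Ind {dy k j<..dy k (Suc j)} s = (if j = i then trunc (real k) (H (dy k i) v) else 0)" by simp
 qed
 thus ?thesis using that by simp
 qed
 \<comment> \<open>From stage \<open>n0\<close> on the grid covers \<open>[0,T]\<close>.\<close>
 obtain n0 :: nat where n0: "T <= real n0" using real_arch_simple by blast
 have "(%k. ?Y k v) ----> NL T (%s. 0)"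
 proof (rule LIMSEQ_offset[where k=n0])
 show "(%k. ?Y (k + n0) v) ----> NL T (%s. 0)"
 proof (rule nn_integral_dominated_convergence[where w="%s. en ((2 * C)^2) * Ind {0..T} s"])
 show "(%s. en ((EP (E (k + n0)) s v - H' s v)^2) * Ind {0..T} s) : Bm lborel" for k
 using iffD1[OF borel_measurable_restrict_space_iff_ennreal section_measurable[OF jm elim(4)]] by (simp only: measurable_lborel2) simp
 show "NI lborel (%s. en ((2 * C)^2) * Ind {0..T} s) < \<infinity>" using T by (simp add: nn_integral_cmult ennreal_mult_less_top)
 show "AE s in lborel. en ((EP (E (k + n0)) s v - H' s v)^2) * Ind {0..T} s <= en ((2 * C)^2) * Ind {0..T} s" for k
 using elim(2) AE_lborel_singleton[of 0]
 proof eventually_elim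
 case (elim s)
 show ?case
 proof (cases "s : {0..T}")
 case True
 then obtain i where i: "i < (k + n0) * 2 ^ (k + n0)" "dy (k + n0) i < s" "s <= dy (k + n0) (Suc i)"
 using dy_left[of s "k + n0"] elim n0 by force
 have "abs (H (dy (k + n0) i) v) <= C" using True i by (intro C) (auto simp: dy)
 hence "abs (EP (E (k + n0)) s v - H' s v) <= abs (2 * C)" using C[OF True] True elim unfolding val[OF i] by (auto simp: trunc_def)
 thus ?thesis by (intro mult_right_mono ennreal_leI) (auto simp: abs_le_square_iff)
 qed simp
 qed
 show "AE s in lborel. (%k. en ((EP (E (k + n0)) s v - H' s v)^2) * Ind {0..T} s) ----> 0 * Ind {0..T} s"
 using elim(2,3) AE_lborel_singleton[of 0]
 proof eventually_elim
 case (elim s)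
 show ?case
 proof (cases "s : {0..T}")
 case True
 hence s: "0 < s" "s <= T" using elim by auto
 hence c: "isCont (%s. H s v) s" "H' s v = H s v" using elim by auto
 have "(%k. EP (E (k + n0)) s v) ----> H s v"
 proof (rule LIMSEQ_I)
 fix r :: real assume r: "0 < r"
 obtain d where d: "0 < d" "!!x. dist x s < d ==> dist (H x v) (H s v) < r" using c(1) r unfolding continuous_at_eps_delta by (auto simp: dist_real_def)
 obtain n1 :: nat where n1: "1 / d < real n1" "C <= real n1" using reals_Archimedean2[of "max (1 / d) C"] by (auto simp: less_imp_le)
 show "EX n. ALL k>=n. norm (EP (E (k + n0)) s v - H s v) < r"
 proof (intro exI[of _ n1] allI impI)
 fix k assume k: "n1 <= k"
 obtain i where i: "i < (k + n0) * 2 ^ (k + n0)" "dy (k + n0) i < s" "s <= dy (k + n0) (Suc i)"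
 using dy_left[of s "k + n0"] s n0 by force
 have "real (k + n0) < 2 ^ (k + n0)" using of_nat_less_two_power by blast
 hence "1 / d < 2 ^ (k + n0)" using n1 k by simp
 hence "1 / 2 ^ (k + n0) < d" using d(1) by (simp add: field_simps)
 hence "dist (dy (k + n0) i) s < d" using i dy(4)[of "k + n0" i] by (simp add: dist_real_def)
 from d(2)[OF this] have "abs (H (dy (k + n0) i) v - H s v) < r" by (simp add: dist_real_def)
 moreover have "abs (H (dy (k + n0) i) v) <= C" using s i by (intro C) (auto simp: dy)
 ultimately show "norm (EP (E (k + n0)) s v - H s v) < r" unfolding val[OF i] using n1 k by (simp add: trunc_def)
 qed
 qed
 hence "(%k. en ((EP (E (k + n0)) s v - H' s v)^2)) ----> en ((H s v - H' s v)^2)"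
 by (intro tendsto_intros)
 thus ?thesis using True c by simp
 qed simp
 qed
 qed (use T in auto)
 qed
 hence "(%k. ?Y k v) ----> 0" by simp
 hence "eventually (%k. ?Y k v < en ee) sequentially" using e by (intro order_tendstoD) auto
 thus ?case by eventually_elim (auto simp: not_less)
 qed
 qed
 next
 fix t ee :: real assume t: "0 <= t" and e: "0 < ee"
 have EM: "EI B (E k) t : Bm M" "LS H k t : Bm M" for k
 proof -
 have [measurable]: "B (min t (dy k i)) : Bm M" for i using t dy(2) by (intro bt_measurable) simp
 show "EI B (E k) t : Bm M" "LS H k t : Bm M"
 unfolding E_def elementary_integral_def prod.case LS_def trunc_def by measurable
 qed
 have "conv0 (%k v. EI B (E k) t v - LS H k t v)"
 proof (rule conv0_AE)
 show "(%v. EI B (E k) t v - LS H k t v) : Bm M" for k using EM by measurable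
 show "AE v in M. (%k. EI B (E k) t v - LS H k t v) ----> 0"
 using bd
 proof eventually_elim
 case (elim v)
 then obtain C where C: "!!s. s : {0..t} ==> abs (H s v) <= C" using t by blast
 have "eventually (%k. C <= real k) sequentially" using filterlim_at_top[THEN iffD1, OF filterlim_real_sequentially] by blast
 hence "eventually (%k. EI B (E k) t v - LS H k t v = 0) sequentially"
 proof eventually_elim
 case (elim k)
 have "trunc (real k) (H (dy k i) v) * (B (min t (dy k (Suc i))) v - B (min t (dy k i)) v) = H (dy k i) v * (B (min t (dy k (Suc i))) v - B (min t (dy k i)) v)" for i
 proof (cases "dy k i <= t")
 case True
 hence "abs (H (dy k i) v) <= C" by (intro C) (simp add: dy)
 thus ?thesis using elim by (simp add: trunc_def)
 next
 case False
 hence "min t (dy k (Suc i)) = t" "min t (dy k i) = t" using dy(1)[of k i] by auto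
 thus ?thesis by simp
 qed
 hence "EI B (E k) t v = LS H k t v"
 unfolding E_def elementary_integral_def prod.case LS_def by (intro sum.cong refl)
 thus ?case by simp
 qed
 thus ?case by (rule tendsto_eventually)
 qed
 qed
 from conv0_add[OF this lim[OF t]]
 show "(%k. \<P>(v in M. ee < abs (EI B (E k) t v - I t v))) ----> 0"
 using e by (simp add: conv0_def)
 qed
qed

end

section \<open>Pathwise estimates for Riemann sums\<close>

lemma indefinite_mvt:
 fixes E :: "real => real"
 assumes E: "Con {0..t} E" and xy: "0 <= x" "x < y" "y <= t"
 obtains xx where "x < xx" "xx < y" "LI {0..y} (%s. E s) - LI {0..x} (%s. E s) = E xx * (y - x)"
proof -
 let ?J = "%x. integral {0..x} E"
 have eq: "LI {0..u} (%s. E s) = ?J u" if "u <= t" for u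
 using that by (intro set_borel_integral_eq_integral(2) set_integrable_continuous_Icc continuous_on_subset[OF E]) auto
 have c: "Con {0..t} ?J" by (intro indefinite_integral_continuous_1 integrable_continuous_real E)
 obtain xx where "x < xx" "xx < y" "?J y - ?J x = (%h. E xx * h) (y - x)"
 proof (rule mvt[OF xy(2), of ?J "%u h. E u * h"])
 show "Con {x..y} ?J" using continuous_on_subset[OF c] xy by auto
 show "(?J has_derivative (*) (E u)) (at u)" if "x < u" "u < y" for u
 using integral_has_real_derivative[OF E, of u] that xy by (simp add: has_field_derivative_def at_within_Icc_at)
 qed blast
 thus thesis using that[of xx] eq[of x] eq[of y] xy by simp
qed

text \<open>Up to a constant, \<open>V\<close> is the integral of \<open>exp (c * x)\<close> against
  \<open>m\<close>, defined by parts. Since \<open>exp (c * x) * m y\<close> equals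
  \<open>E y * exp (- c * (y - x))\<close>, only smooth factors are expanded, and continuity of
  \<open>m\<close> makes the error small relative to the length of the cell.\<close>

lemma gbm_step:
 fixes m :: "real => real" and c t :: real
 assumes m: "Con {0..t} m" and e: "0 < e"
 defines "E \<equiv> %x. exp (c * x) * m x"
 defines "V \<equiv> %x. E x - c * LI {0..x} (%s. E s)"
 obtains d where "0 < d" "!!x y. 0 <= x ==> x <= y ==> y <= t ==> y - x <= d ==>
 abs (exp (c * x) * (m y - m x) - (V y - V x)) <= e * (y - x) & abs (V y - V x) <= e"
proof -
 have Ec: "Con {0..t} E" unfolding E_def by (intro continuous_intros m)
 have Vc: "Con {0..t} V"
 proof (cases "0 <= t")
 case True
 thus ?thesis unfolding V_def
 by (intro continuous_intros Ec continuous_indefinite_integral set_integrable_continuous_Icc)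
 qed simp
 obtain C where C: "!!x. x : {0..t} ==> abs (E x) <= C"
 using compact_imp_bounded[OF compact_continuous_image[OF Ec compact_Icc]] unfolding bounded_iff by force
 define C' where "C' = max C 1"
 \<comment> \<open>Two errors, each at most \<open>C' * r\<close>, are multiplied by
   \<open>abs c\<close>; together they stay below \<open>e\<close>.\<close>
 define r where "r = e / (2 * (abs c + 1) * C')"
 have C': "1 <= C'" "!!x. x : {0..t} ==> abs (E x) <= C'" using C by (fastforce simp: C'_def)+
 have r: "0 < r" using e C' by (auto simp: r_def intro!: divide_pos_pos mult_pos_pos)
 have unif: "EX d>0. ALL x:{0..t}. ALL y:{0..t}. dist y x < d --> dist (f y) (f x) < q" if "Con {0..t} f" "0 < q" for f :: "real => real" and q
 using compact_uniformly_continuous[OF that(1) compact_Icc] that(2) unfolding uniformly_continuous_on_def by blast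
 obtain d1 where d1: "0 < d1" "!!x y. x : {0..t} ==> y : {0..t} ==> dist y x < d1 ==> dist (E y) (E x) < r" using unif[OF Ec r] by blast
 obtain d2 where d2: "0 < d2" "!!x y. x : {0..t} ==> y : {0..t} ==> dist y x < d2 ==> dist (V y) (V x) < e" using unif[OF Vc e] by blast
 have "isCont (%x. exp (- c * x)) 0" by (intro continuous_intros)
 then obtain d3 where d3: "0 < d3" "!!x. dist x 0 < d3 ==> dist (exp (- c * x)) 1 < r" using r unfolding continuous_at_eps_delta by (auto simp: dist_real_def)
 define d where "d = min d1 (min d2 d3) / 2"
 have d: "0 < d" "d < d1" "d < d2" "d < d3" using d1 d2 d3 by (auto simp: d_def min_def)
 show thesis
 proof (rule that[OF d(1)], rule conjI)
 fix x y assume xy: "0 <= x" "x <= y" "y <= t" "y - x <= d"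
 show "abs (V y - V x) <= e" using d2(2)[of x y] xy d by (simp add: dist_real_def)
 show "abs (exp (c * x) * (m y - m x) - (V y - V x)) <= e * (y - x)"
 proof (cases "x = y")
 case False
 hence lt: "x < y" using xy by simp
 obtain xx where xi: "x < xx" "xx < y" "LI {0..y} (%s. E s) - LI {0..x} (%s. E s) = E xx * (y - x)"
 by (rule indefinite_mvt[OF Ec xy(1) lt xy(3)])
 obtain et where eta: "0 < et" "et < y - x" "exp (- c * (y - x)) - exp (- c * 0) = (y - x - 0) * (- c * exp (- c * et))"
 proof -
 have "((%u. exp (- c * u)) has_real_derivative - c * exp (- c * u)) (at u)" for u by (auto intro!: derivative_eq_intros)
 thus thesis using MVT2[of 0 "y - x" "%u. exp (- c * u)" "%u. - c * exp (- c * u)"] lt that by force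
 qed
 have ex: "exp (c * x) * m y = E y * exp (- c * (y - x))" unfolding E_def
 by (simp add: exp_add[symmetric] right_diff_distrib mult.commute[of _ "m y"])
 have "exp (c * x) * (m y - m x) - (V y - V x) = E y * (exp (- c * (y - x)) - 1) + c * (E xx * (y - x))"
 proof -
 have "V y - V x = E y - E x - c * (E xx * (y - x))" unfolding V_def xi(3)[symmetric] by (simp add: right_diff_distrib)
 moreover have "exp (c * x) * m x = E x" by (simp add: E_def)
 ultimately show ?thesis using ex by (simp add: right_diff_distrib)
 qed
 also have "exp (- c * (y - x)) - 1 = (y - x) * (- c * exp (- c * et))" using eta(3) by simp
 also have "E y * ((y - x) * (- c * exp (- c * et))) + c * (E xx * (y - x)) = (y - x) * (c * ((E xx - E y) - E y * (exp (- c * et) - 1)))"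
 proof -
 have "a * (d * (- c * X)) + c * (b * d) = d * (c * ((b - a) - a * (X - 1)))" for a b d X :: real by (simp add: algebra_simps)
 thus ?thesis .
 qed
 finally have eq: "abs (exp (c * x) * (m y - m x) - (V y - V x)) = (y - x) * (abs c * abs ((E xx - E y) - E y * (exp (- c * et) - 1)))"
 using lt by (simp add: abs_mult)
 have "abs (E xx - E y) <= r" using d1(2)[of y xx] xi xy d by (simp add: dist_real_def)
 moreover have "abs (E y * (exp (- c * et) - 1)) <= C' * r"
 unfolding abs_mult using C'(2)[of y] d3(2)[of et] eta xy d C'(1) by (intro mult_mono) (auto simp: dist_real_def)
 moreover have "r <= C' * r" using C'(1) r by simp
 ultimately have "abs ((E xx - E y) - E y * (exp (- c * et) - 1)) <= 2 * (C' * r)" by linarith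
 hence "abs c * abs ((E xx - E y) - E y * (exp (- c * et) - 1)) <= (abs c + 1) * (2 * (C' * r))" by (intro mult_mono) auto
 also have "... = e"
 proof -
 have a: "a * (2 * (C' * (e / (2 * a * C')))) = e" if "0 < a" for a using that C'(1) by simp
 show ?thesis unfolding r_def by (rule a) simp
 qed
 finally have "(y - x) * (abs c * abs ((E xx - E y) - E y * (exp (- c * et) - 1))) <= (y - x) * e" using lt by (intro mult_left_mono) auto
 thus ?thesis unfolding eq by (simp add: mult.commute)
 qed simp
 qed
qed

text \<open>Only cells starting at or after \<open>s\<close> count. The extra \<open>e\<close> pays
  for the partial cell between \<open>s\<close> and the first of them; the remaining errors add up
  to at most \<open>e * u n\<close>.\<close>

lemma riemann_path:
 fixes u :: "nat => real"
 assumes u: "!!i. u i <= u (Suc i)" "0 <= u 0" and a: "!!i. i < n ==> abs (a i - (V (u (Suc i)) - V (u i))) <= e * (u (Suc i) - u i)"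
 and V: "!!i x. i < n ==> u i <= x ==> x <= u (Suc i) ==> abs (V (u (Suc i)) - V x) <= e" and s: "u 0 <= s" and e: "0 <= (e::real)"
 shows "(u n < s --> (SUM i<n. of_bool (s <= u i) * a i) = 0) & (s <= u n --> abs ((SUM i<n. of_bool (s <= u i) * a i) - (V (u n) - V s)) <= e + e * u n)"
 using a V
proof (induction n)
 case 0
 have "0 <= e * u 0" using e u(2) by simp
 thus ?case using s e by auto
next
 case (Suc n)
 let ?S = "SUM i<n. of_bool (s <= u i) * a i"
 have IH: "u n < s ==> ?S = 0" "s <= u n ==> abs (?S - (V (u n) - V s)) <= e + e * u n" using Suc by auto
 have p: "0 <= e * u (Suc n)"
 proof -
 have "0 <= u (Suc n)" using u(2) lift_Suc_mono_le[of u 0 "Suc n", OF u(1)] by simp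
 thus ?thesis using e by simp
 qed
 show ?case
 proof (cases "s <= u n")
 case True
 thus ?thesis using IH(2)[OF True] Suc.prems(1)[of n] u(1)[of n] by (simp add: algebra_simps)
 next
 case False
 hence "?S = 0" using IH(1) by simp
 thus ?thesis using False Suc.prems(2)[of n s] p by (auto simp: abs_le_iff)
 qed
qed

text \<open>Relative increment of an exponential martingale over time \<open>d\<close> minus its
  linear part, as a function of the Brownian increment.\<close>

definition psi :: "real => real => real => real" where "psi b d x = exp (b * x - b^2 * d / 2) - 1 - b * x"

text \<open>The linearisation error is centred, and its second moment is of order
  \<open>d^2\<close>, small compared with the length of a cell.\<close>

lemma psi_moments:
 assumes d: "0 < d"
 shows "has_bochner_integral lborel (%x. nd d x * psi b d x) 0"
 "has_bochner_integral lborel (%x. nd d x * (psi b d x)^2) (exp (b^2 * d) - 1 - b^2 * d)"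
proof -
 let ?N = "%m. normal_density m (sqrt d)"
 have s: "0 < sqrt d" "(sqrt d)^2 = d" using d by auto
 have 0: "has_bochner_integral lborel (?N m) 1" for m using normal_moment_even[OF s(1), of m 0] by simp
 have 1: "has_bochner_integral lborel (%x. ?N m x * x) m" for m
 proof -
 have "has_bochner_integral lborel (%x. ?N m x * (x - m) + m * ?N m x) (0 + m * 1)"
 using normal_moment_odd[OF s(1), of m 0] by (intro has_bochner_integral_add has_bochner_integral_mult_right 0) simp
 thus ?thesis by (simp add: algebra_simps)
 qed
 have 2: "has_bochner_integral lborel (%x. ?N 0 x * x^2) d" using normal_moment_even[OF s(1), of 0 1] s by (simp add: fact_numeral)
 have e: "?N 0 x * exp (b * x - b^2 * d / 2) = ?N (b * d) x" "?N 0 x * (exp (b * x - b^2 * d / 2))^2 = exp (b^2 * d) * ?N (2 * b * d) x" for x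
 proof -
 have "?N 0 x * exp (b * x - b^2 * d / 2) = exp (b * x) * ?N 0 x * exp (- (b^2 * d / 2))" unfolding diff_conv_add_uminus exp_add by (simp only: mult_ac)
 thus "?N 0 x * exp (b * x - b^2 * d / 2) = ?N (b * d) x" unfolding normal_density_exp[OF d] by (simp add: exp_minus field_simps)
 have "(exp (b * x - b^2 * d / 2))^2 = exp ((2 * b) * x) * exp (- (b^2 * d))"
 by (simp add: power2_eq_square exp_add[symmetric] algebra_simps)
 hence "?N 0 x * (exp (b * x - b^2 * d / 2))^2 = exp ((2 * b) * x) * ?N 0 x * exp (- (b^2 * d))" by (simp only: mult_ac)
 also have "... = (exp ((2 * b)^2 * d / 2) * exp (- (b^2 * d))) * ?N (2 * b * d) x" unfolding normal_density_exp[OF d] by (simp only: mult_ac)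
 also have "exp ((2 * b)^2 * d / 2) * exp (- (b^2 * d)) = exp (b^2 * d)" by (simp add: exp_add[symmetric] power2_eq_square)
 finally show "?N 0 x * (exp (b * x - b^2 * d / 2))^2 = exp (b^2 * d) * ?N (2 * b * d) x" .
 qed
 have "has_bochner_integral lborel (%x. ?N (b * d) x - ?N 0 x - b * (?N 0 x * x)) (1 - 1 - b * 0)"
 by (intro has_bochner_integral_diff has_bochner_integral_mult_right 0 1)
 moreover have "?N (b * d) x - ?N 0 x - b * (?N 0 x * x) = ?N 0 x * psi b d x" for x unfolding psi_def e(1)[symmetric] by (simp add: algebra_simps)
 ultimately show "has_bochner_integral lborel (%x. ?N 0 x * psi b d x) 0" by simp
 have "has_bochner_integral lborel (%x. exp (b^2 * d) * ?N (2 * b * d) x - 2 * ?N (b * d) x - 2 * b * (?N (b * d) x * x) + ?N 0 x + 2 * b * (?N 0 x * x) + b^2 * (?N 0 x * x^2))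
 (exp (b^2 * d) * 1 - 2 * 1 - 2 * b * (b * d) + 1 + 2 * b * 0 + b^2 * d)"
 by (intro has_bochner_integral_add has_bochner_integral_diff has_bochner_integral_mult_right 0 1 2)
 moreover have "exp (b^2 * d) * ?N (2 * b * d) x - 2 * ?N (b * d) x - 2 * b * (?N (b * d) x * x) + ?N 0 x + 2 * b * (?N 0 x * x) + b^2 * (?N 0 x * x^2) = ?N 0 x * (psi b d x)^2" for x
 unfolding psi_def e[symmetric] by (simp add: power2_eq_square algebra_simps)
 ultimately show "has_bochner_integral lborel (%x. ?N 0 x * (psi b d x)^2) (exp (b^2 * d) - 1 - b^2 * d)"
 by (simp add: power2_eq_square mult.assoc)
qed

context bm
begin

text \<open>Errors of different cells are orthogonal because each is centred given the past, so only
  their second moments add up.\<close>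

lemma emart_error:
 assumes u: "!!i. u i <= u (Suc i)" "0 <= u 0" "!!i. b^2 * (u (Suc i) - u i) <= 1"
 and h: "!!i. h i : Bm (F (u i))" "!!i v. abs (h i v) <= C"
 shows "NI M (%v. en ((SUM i<n. h i v * psi b (u (Suc i) - u i) (B (u (Suc i)) v - B (u i) v))^2)) <=
 en (SUM i<n. C^2 * (b^2 * (u (Suc i) - u i))^2)"
proof (induction n)
 case (Suc n)
 let ?D = "%n v. SUM i<n. h i v * psi b (u (Suc i) - u i) (B (u (Suc i)) v - B (u i) v)"
 let ?d = "u (Suc n) - u n"
 have mono: "u i <= u j" if "i <= j" for i j using lift_Suc_mono_le[of u i j, OF u(1) that] .
 have u0: "0 <= u i" for i using u(2) mono[of 0 i] by simp
 have Dm: "?D n : Bm (F (u n))"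
 proof (rule borel_measurable_sum)
 fix i assume i: "i : {..<n}"
 have [measurable]: "h i : Bm (F (u n))" "B (u (Suc i)) : Bm (F (u n))" "B (u i) : Bm (F (u n))"
 using i u0 by (auto intro!: F_mono[OF mono h(1)] bt_adapted mono)
 show "(%v. h i v * psi b (u (Suc i) - u i) (B (u (Suc i)) v - B (u i) v)) : Bm (F (u n))" unfolding psi_def by measurable
 qed
 show ?case
 proof (cases "u n = u (Suc n)")
 case True
 thus ?thesis using Suc by (simp add: psi_def)
 next
 case False
 hence lt: "u n < u (Suc n)" using u(1)[of n] by simp
 have bd: "b^2 * ?d <= 1" "0 <= b^2 * ?d" using u by auto
 have q: "exp (b^2 * ?d) - 1 - b^2 * ?d <= (b^2 * ?d)^2" using exp_bound[OF bd(2,1)] by simp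
 have "NI M (%v. en ((?D (Suc n) v)^2)) = NI M (%v. en ((?D n v)^2 + (h n v)^2 * (exp (b^2 * ?d) - 1 - b^2 * ?d)))"
 unfolding sum.lessThan_Suc
 using increment_square_gen[OF _ _ lt Dm h(1)[of n], of "psi b ?d"] psi_moments[of ?d b] lt u0 by (simp add: psi_def[abs_def])
 also have "... <= NI M (%v. en ((?D n v)^2) + en (C^2 * (b^2 * ?d)^2))"
 proof (rule nn_integral_mono)
 fix v
 have "(h n v)^2 <= C^2" using h(2)[of n v] by (simp add: abs_le_square_iff[symmetric])
 hence "(h n v)^2 * (exp (b^2 * ?d) - 1 - b^2 * ?d) <= C^2 * (b^2 * ?d)^2"
 proof (rule mult_mono[OF _ q])
 show "0 <= exp (b^2 * ?d) - 1 - b^2 * ?d" using exp_ge_add_one_self[of "b^2 * ?d"] by linarith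
 qed auto
 hence "en ((?D n v)^2 + (h n v)^2 * (exp (b^2 * ?d) - 1 - b^2 * ?d)) <= en ((?D n v)^2 + C^2 * (b^2 * ?d)^2)" by (intro ennreal_leI) simp
 thus "en ((?D n v)^2 + (h n v)^2 * (exp (b^2 * ?d) - 1 - b^2 * ?d)) <= en ((?D n v)^2) + en (C^2 * (b^2 * ?d)^2)" by simp
 qed
 also have "... = NI M (%v. en ((?D n v)^2)) + en (C^2 * (b^2 * ?d)^2)"
 using F_M[OF _ Dm] u0 by (subst nn_integral_add) (auto simp: emeasure_space_1)
 also have "... <= en (SUM i<n. C^2 * (b^2 * (u (Suc i) - u i))^2) + en (C^2 * (b^2 * ?d)^2)"
 using Suc by (intro add_right_mono)
 also have "... = en (SUM i<Suc n. C^2 * (b^2 * (u (Suc i) - u i))^2)" by (simp add: sum_nonneg)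
 finally show ?thesis .
 qed
qed simp

end

section \<open>Integrals switched on at a stopping time\<close>

context bm
begin

text \<open>Every power of the state price has this form, see \<open>zeta_EE\<close>.
  \<open>VV\<close> is its martingale part; \<open>HH\<close> is the integrand switched on at
  \<open>sx\<close> and \<open>IT\<close> its integral, both carrying the factor \<open>K\<close>
  frozen at \<open>sx\<close>.\<close>

definition EE :: "real => real => real => 'a => real" where "EE b c t v = exp (c * t) * emart b t v"
definition VV :: "real => real => real => 'a => real" where "VV b c t v = EE b c t v - c * LI {0..t} (%s. EE b c s v)"
definition GG :: "('a => ennreal) => (real => 'a => real) => real => 'a => real" where
 "GG sx K t v = of_bool (sx v <= en t) * K (stop_at sx t v) v"
definition HH :: "('a => ennreal) => (real => 'a => real) => real => real => real => 'a => real" where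
 "HH sx K b c t v = b * (GG sx K t v * EE b c t v)"
definition IT :: "('a => ennreal) => (real => 'a => real) => real => real => real => 'a => real" where
 "IT sx K b c t v = K (stop_at sx t v) v * (VV b c t v - VV b c (stop_at sx t v) v)"

lemma EE_continuous: "v : space M ==> Con {0..} (%t. EE b c t v)"
 unfolding EE_def by (intro continuous_intros emart_continuous)

lemma EE_progressive: "prog F (EE b c)"
 using progressive_comp_time[OF emart_progressive, of "%t x. exp (c * t) * x"] by (simp add: EE_def[abs_def])

lemma continuous_Ici:
 fixes f :: "real => real"
 assumes "!!T. 0 <= T ==> Con {0..T} f" shows "Con {0..} f"
 unfolding continuous_on_eq_continuous_within
proof
 fix x :: real assume x: "x : {0..}"
 hence "continuous (at x within {0..x + 1}) f" using assms[of "x + 1"] by (auto simp: continuous_on_eq_continuous_within)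
 moreover have "at x within {0..} = at x within {0..x + 1}"
 by (rule at_within_nhd[of x "{x - 1<..<x + 1}"]) auto
 ultimately show "continuous (at x within {0..}) f" by simp
qed

lemma VV_continuous: "v : space M ==> Con {0..} (%t. VV b c t v)"
 unfolding VV_def
 by (intro continuous_Ici continuous_intros continuous_indefinite_integral set_integrable_continuous_Icc continuous_on_subset[OF EE_continuous]) auto

lemma VV_progressive: "prog F (VV b c)"
proof (rule progressive_continuous[OF _ VV_continuous])
 fix t :: real assume t: "0 <= t"
 have [measurable]: "(%v. LI {0..t} (%s. EE b c s v)) : Bm (F t)"
 using EE_progressive[of b c] t unfolding progressive_def by (intro section_M) auto
 have [measurable]: "EE b c t : Bm (F t)" using progressive_adapted[OF EE_progressive t] .
 show "VV b c t : Bm (F t)" unfolding VV_def by measurable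
qed

lemma stop_at_continuous: "Con {0..} (%t. stop_at sx t v)"
proof (rule continuous_on_cong[THEN iffD2, OF refl])
 show "stop_at sx t v = (if sx v = \<top> then t else min (er (sx v)) t)" if "t : {0..}" for t
 using that by (cases "sx v") (auto simp: stop_at_eq top_unique)
 show "Con {0..} (%t. if sx v = \<top> then t else min (er (sx v)) t)"
 by (cases "sx v = \<top>") (auto intro!: continuous_intros)
qed

lemma GG_eq: "0 <= t ==> GG sx K t v = (if sx v = \<top> then 0 else of_bool (er (sx v) <= t) * K (er (sx v)) v)"
 by (cases "sx v") (auto simp: GG_def stop_at_eq top_unique)

lemma IT_eq: "0 <= t ==> IT sx K b c t v = GG sx K t v * (VV b c t v - VV b c (er (sx v)) v)"
 by (auto simp: GG_def IT_def stop_at_eq)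

lemma stopped_continuous: "Con {0..} f ==> Con {0..} (%t. f (stop_at sx t v) :: real)"
 by (rule continuous_on_compose2[OF _ stop_at_continuous]) (use stop_at_range in fastforce)+

lemma stopped_progressive:
 assumes "Stop F sx" "prog F K" "!!v. v : space M ==> Con {0..} (%t. K t v)"
 shows "prog F (%t v. K (stop_at sx t v) v)"
 by (rule progressive_continuous[OF progressive_stopped[OF assms(2,1)] stopped_continuous[OF assms(3)]])

context
 fixes sx :: "'a => ennreal" and K :: "real => 'a => real" and b c :: real
 assumes sx: "Stop F sx" and K: "prog F K" and Kc: "!!v. v : space M ==> Con {0..} (%t. K t v)"
begin

lemma GG_progressive: "prog F (GG sx K)"
 unfolding GG_def[abs_def]
 by (intro progressive_mult progressive_stopping[OF sx] stopped_progressive[OF sx K Kc])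

lemma HH_progressive: "prog F (HH sx K b c)"
 using progressive_comp[OF progressive_mult[OF GG_progressive EE_progressive], of "%x. b * x"] by (simp add: HH_def[abs_def])

lemma GE_bound:
 assumes v: "v : space M" and T: "0 <= T"
 shows "EX C>=0. ALL s:{0..T}. abs (GG sx K s v * EE b c s v) <= C"
proof -
 have "bounded ((%s. EE b c s v) ` {0..T})"
 by (intro compact_imp_bounded compact_continuous_image continuous_on_subset[OF EE_continuous[OF v]]) auto
 then obtain C where C: "!!s. s : {0..T} ==> abs (EE b c s v) <= C" unfolding bounded_iff by force
 have "abs (GG sx K s v * EE b c s v) <= abs (K (er (sx v)) v) * C" if "s : {0..T}" for s
 unfolding abs_mult using C[OF that] that by (intro mult_mono) (auto simp: GG_eq)
 thus ?thesis using C[of 0] T by (intro exI[of _ "abs (K (er (sx v)) v) * C"]) auto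
qed

lemma HH_bound: "v : space M ==> ALL T>=0. EX C. ALL s:{0..T}. abs (HH sx K b c s v) <= C"
proof (intro allI impI)
 fix T :: real assume "v : space M" "0 <= T"
 then obtain C where C: "0 <= C" "!!s. s : {0..T} ==> abs (GG sx K s v * EE b c s v) <= C" using GE_bound by blast
 thus "EX C. ALL s:{0..T}. abs (HH sx K b c s v) <= C"
 unfolding HH_def by (intro exI[of _ "abs b * C"]) (auto simp: abs_mult[of b] intro!: mult_left_mono)
qed

text \<open>The switch at \<open>sx\<close> is the only possible discontinuity at positive
  times.\<close>

lemma HH_cont: "v : space M ==> AE s in lborel. 0 < s --> isCont (%s. HH sx K b c s v) s"
 using AE_lborel_singleton[of "er (sx v)"]
proof eventually_elim
 case (elim s)
 show ?case
 proof
 assume s: "0 < s"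
 let ?r = "er (sx v)"
 let ?k = "if sx v = \<top> | s < ?r then 0 else K ?r v"
 have ev: "eventually (%t. HH sx K b c t v = b * (?k * EE b c t v)) (nhds s)"
 proof -
 let ?S = "if s < ?r then {0<..<?r} else {max 0 ?r<..}"
 have "open ?S" "s : ?S" using s elim by auto
 from eventually_nhds_in_open[OF this] show ?thesis
 proof eventually_elim
 case (elim t)
 hence "0 < t" using le_less_trans[OF enn2real_nonneg, of "sx v" t] by (auto split: if_splits)
 thus ?case using elim by (auto simp: HH_def GG_eq split: if_splits)
 qed
 qed
 have "isCont (%t. EE b c t v) s"
 using continuous_on_interior[OF EE_continuous[OF elim(1)], of s] s by simp
 hence "isCont (%t. b * (?k * EE b c t v)) s" by (intro continuous_intros)
 thus "isCont (%s. HH sx K b c s v) s" using isCont_cong[OF ev] by simp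
 qed
qed

lemma IT_continuous: "v : space M ==> Con {0..} (%t. IT sx K b c t v)"
 unfolding IT_def by (intro continuous_intros stopped_continuous Kc VV_continuous)

lemma IT_measurable: "0 <= t ==> IT sx K b c t : Bm M"
proof -
 assume t: "0 <= t"
 note [measurable] = F_M[of t, OF _ progressive_stopped[OF K sx t], simplified, OF t] F_M[of t, OF _ progressive_stopped[OF VV_progressive[of b c] sx t], simplified, OF t] progressive_M[OF VV_progressive[of b c] t]
 show ?thesis unfolding IT_def using t by measurable
qed

text \<open>Adding the remainder \<open>R\<close> turns the Riemann sum into \<open>P\<close>, built
  from true increments of the exponential martingale, which converges path by path to
  \<open>IT\<close> by \<open>gbm_step\<close> and \<open>riemann_path\<close>. The remainder tends
  to 0 in second moment.\<close>

lemma gbm_ito: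
 assumes t: "0 <= t"
 shows "conv0 (%k v. LS (HH sx K b c) k t v - IT sx K b c t v)"
proof -
 define u where "u k i = min t (dy k i)" for k i
 have u: "u k i <= u k (Suc i)" "0 <= u k i" "u k 0 = 0" "u k i <= t" "u k (Suc i) - u k i <= 1 / 2 ^ k" for k i
 using dy(1,2,4)[of k i] t by (auto simp: u_def min_def dy(3))
 have ue: "u k (k * 2 ^ k) = t" if "t <= real k" for k using that by (simp add: u_def dy(5))
 let ?X = "%s v. GG sx K s v * EE b c s v"
 \<comment> \<open>Cutting the weights at level \<open>k\<close> makes \<open>R\<close> square
   integrable; on each path the cut is eventually inactive.\<close>
 define h where "h k i v = (if abs (?X (u k i) v) <= real k then ?X (u k i) v else 0)" for k i v
 let ?d = "%k i. u k (Suc i) - u k i" and ?dB = "%k i v. B (u k (Suc i)) v - B (u k i) v"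
 define R where "R k v = (SUM i<k * 2 ^ k. h k i v * psi b (?d k i) (?dB k i v))" for k v
 define P where "P k v = (SUM i<k * 2 ^ k. GG sx K (u k i) v * (exp (c * u k i) * (emart b (u k (Suc i)) v - emart b (u k i) v)))" for k v
 have hm: "h k i : Bm (F (u k i))" for k i
 proof -
 have [measurable]: "?X (u k i) : Bm (F (u k i))"
 using progressive_adapted[OF progressive_mult[OF GG_progressive EE_progressive] u(2)] .
 show ?thesis unfolding h_def by measurable
 qed
 have BM': "B (u k i) : Bm M" for k i using u(2) by (intro bt_measurable) simp
 have Rm: "R k : Bm M" for k
 proof -
 have [measurable]: "h k i : Bm M" for i by (rule F_M[OF _ hm]) (simp add: u)
 note [measurable] = BM'
 show ?thesis unfolding R_def psi_def using u(2) by measurable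
 qed
 have Lm: "LS (HH sx K b c) k t : Bm M" for k
 proof -
 note [measurable] = BM'[unfolded u_def] progressive_M[OF HH_progressive dy(2)]
 show ?thesis unfolding LS_def by measurable
 qed
 \<comment> \<open>The mesh \<open>1 / 2 ^ k\<close> outweighs the square of the cut-off level
   \<open>k\<close>.\<close>
 have "conv0 R"
 proof (rule conv0_L2[OF Rm, where c="%k. (real k)^2 * b ^ 4 * t / 2 ^ k"])
 have "eventually (%k. b^2 <= real k) sequentially" using filterlim_at_top[THEN iffD1, OF filterlim_real_sequentially] by blast
 thus "eventually (%k. NI M (%v. en ((R k v)^2)) <= en ((real k)^2 * b ^ 4 * t / 2 ^ k)) sequentially"
 proof eventually_elim
 case (elim k)
 have "real k <= 2 ^ k" using of_nat_less_two_power less_imp_le by blast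
 from order_trans[OF elim this] have bk: "b^2 * (1 / 2 ^ k) <= 1" by simp
 have bu: "b^2 * ?d k i <= 1" for i using order_trans[OF mult_left_mono[OF u(5)[of k i], of "b^2"] bk] by simp
 have "NI M (%v. en ((R k v)^2)) <= en (SUM i<k * 2 ^ k. (real k)^2 * (b^2 * ?d k i)^2)"
 unfolding R_def by (intro emart_error u bu hm) (auto simp: h_def)
 also have "... <= en ((real k)^2 * b ^ 4 * t / 2 ^ k)"
 proof (rule ennreal_leI)
 have "(SUM i<k * 2 ^ k. (real k)^2 * (b^2 * ?d k i)^2) <= (SUM i<k * 2 ^ k. ((real k)^2 * b ^ 4 / 2 ^ k) * ?d k i)"
 proof (rule sum_mono)
 fix i
 have "?d k i * ?d k i <= 1 / 2 ^ k * ?d k i" using u(1,5)[of k i] by (intro mult_right_mono) auto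
 hence "(real k)^2 * b ^ 4 * (?d k i * ?d k i) <= (real k)^2 * b ^ 4 * (1 / 2 ^ k * ?d k i)" by (intro mult_left_mono) auto
 thus "(real k)^2 * (b^2 * ?d k i)^2 <= ((real k)^2 * b ^ 4 / 2 ^ k) * ?d k i" by (simp add: power2_eq_square power4_eq_xxxx mult_ac)
 qed
 also have "... = ((real k)^2 * b ^ 4 / 2 ^ k) * (u k (k * 2 ^ k) - u k 0)" unfolding sum_distrib_left[symmetric] sum_lessThan_telescope ..
 also have "... <= ((real k)^2 * b ^ 4 / 2 ^ k) * t" using u(3)[of k] u(4)[of k "k * 2 ^ k"] by (intro mult_left_mono) auto
 finally show "(SUM i<k * 2 ^ k. (real k)^2 * (b^2 * ?d k i)^2) <= (real k)^2 * b ^ 4 * t / 2 ^ k" by simp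
 qed
 finally show ?case .
 qed
 have "(%k. b ^ 4 * t * ((real k)^2 / 2 ^ k)) ----> b ^ 4 * t * 0"
 by (intro tendsto_intros) real_asymp
 thus "(%k. (real k)^2 * b ^ 4 * t / 2 ^ k) ----> 0" by (simp add: mult_ac)
 qed
 hence R: "conv0 (%k v. - 1 * R k v)" by (rule conv0_cmult)
 have "conv0 (%k v. LS (HH sx K b c) k t v + R k v - IT sx K b c t v)"
 proof (rule conv0_AE)
 show "(%v. LS (HH sx K b c) k t v + R k v - IT sx K b c t v) : Bm M" for k
 using Lm Rm IT_measurable[OF t] by measurable
 show "AE v in M. (%k. LS (HH sx K b c) k t v + R k v - IT sx K b c t v) ----> 0"
 using AE_space
 proof eventually_elim
 case (elim v)
 obtain C where C: "0 <= C" "!!s. s : {0..t} ==> abs (?X s v) <= C" using GE_bound[OF elim t] by blast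
 have "eventually (%k. C <= real k) sequentially" using filterlim_at_top[THEN iffD1, OF filterlim_real_sequentially] by blast
 hence LP: "eventually (%k. LS (HH sx K b c) k t v + R k v = P k v) sequentially"
 proof eventually_elim
 case (elim k)
 have hX: "h k i v = ?X (u k i) v" for i using C(2)[of "u k i"] u(2,4)[of k i] elim by (auto simp: h_def)
 have "HH sx K b c (dy k i) v * ?dB k i v + h k i v * psi b (?d k i) (?dB k i v) = GG sx K (u k i) v * (exp (c * u k i) * (emart b (u k (Suc i)) v - emart b (u k i) v))" for i
 proof (cases "dy k i <= t")
 case True
 hence ui: "u k i = dy k i" by (simp add: u_def)
 have "emart b (u k (Suc i)) v = emart b (u k i) v * (psi b (?d k i) (?dB k i v) + 1 + b * ?dB k i v)"
 unfolding emart_step[of b "u k (Suc i)" v "u k i"] psi_def by simp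
 thus ?thesis unfolding hX HH_def ui[symmetric] EE_def by (simp only:) (simp add: algebra_simps)
 next
 case False
 hence "u k i = t" "u k (Suc i) = t" using dy(1)[of k i] by (auto simp: u_def)
 thus ?thesis by (simp add: psi_def)
 qed
 thus ?case unfolding LS_def R_def P_def sum.distrib[symmetric] u_def by simp
 qed
 have "(%k. P k v - IT sx K b c t v) ----> 0"
 proof (cases "sx v <= en t")
 case False
 have "GG sx K s v = 0" if "s <= t" for s
 proof -
 have "~  sx v <= en s" using False ennreal_leI[OF that] order_trans by blast
 thus ?thesis by (simp add: GG_def)
 qed
 hence "P k v = 0" "IT sx K b c t v = 0" for k using u(4) t by (auto simp: P_def IT_eq)
 thus ?thesis by simp
 next
 case True
 define r where "r = er (sx v)"
 have r: "sx v = en r" "0 <= r" "r <= t" using True t by (cases "sx v"; auto simp: r_def top_unique)+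
 let ?K = "K r v"
 have G: "GG sx K s v = of_bool (r <= s) * ?K" if "0 <= s" for s using that r by (simp add: GG_eq)
 show ?thesis
 proof (rule LIMSEQ_I)
 fix q :: real assume q: "0 < q"
 \<comment> \<open>Calibrated so that the factor \<open>abs ?K + 1\<close> times
   \<open>e + e * t\<close> is \<open>q / 2\<close>.\<close>
 define e where "e = q / (2 * (abs (?K) + 1) * (1 + t))"
 have e: "0 < e" using q t by (auto simp: e_def intro!: divide_pos_pos mult_pos_pos)
 have mc: "Con {0..t} (%s. emart b s v)" by (rule continuous_on_subset[OF emart_continuous[OF elim]]) auto
 obtain d where d: "0 < d" "!!x y. 0 <= x ==> x <= y ==> y <= t ==> y - x <= d ==>
 abs (exp (c * x) * (emart b y v - emart b x v) - (VV b c y v - VV b c x v)) <= e * (y - x) & abs (VV b c y v - VV b c x v) <= e"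
 by (rule gbm_step[OF mc e, of c]) (use that in \<open>auto simp: VV_def EE_def\<close>)
 obtain n :: nat where n: "max (1 / d) t < real n" using reals_Archimedean2 by blast
 show "EX n. ALL k>=n. norm (P k v - IT sx K b c t v - 0) < q"
 proof (intro exI[of _ n] allI impI)
 fix k assume k: "n <= k"
 have "real k <= 2 ^ k" using of_nat_less_two_power less_imp_le by blast
 moreover have "1 / d < real k" using n k by simp
 ultimately have "1 / d < 2 ^ k" by linarith
 hence dk: "1 / 2 ^ k < d" using d(1) by (simp add: field_simps)
 hence ud: "?d k i <= d" for i using u(5)[of k i] by simp
 let ?a = "%i. exp (c * u k i) * (emart b (u k (Suc i)) v - emart b (u k i) v)"
 have uk: "u k (k * 2 ^ k) = t" using n k by (intro ue) simp
 have rp: "abs ((SUM i<k * 2 ^ k. of_bool (r <= u k i) * ?a i) - (VV b c (u k (k * 2 ^ k)) v - VV b c r v)) <= e + e * u k (k * 2 ^ k)"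
 proof (rule riemann_path[THEN conjunct2, rule_format])
 show "u k i <= u k (Suc i)" "0 <= u k 0" "u k 0 <= r" "0 <= e" "r <= u k (k * 2 ^ k)" for i using u(1) r e by (simp_all add: u(3) uk)
 show "abs (?a i - (VV b c (u k (Suc i)) v - VV b c (u k i) v)) <= e * ?d k i" for i using d(2)[OF u(2,1,4) ud] by blast
 show "abs (VV b c (u k (Suc i)) v - VV b c x v) <= e" if "u k i <= x" "x <= u k (Suc i)" for i x
 using d(2)[of x "u k (Suc i)"] that u(2)[of k i] u(4)[of k "Suc i"] ud[of i] by simp
 qed
 have "P k v = ?K * (SUM i<k * 2 ^ k. of_bool (r <= u k i) * ?a i)" unfolding P_def sum_distrib_left
 using G u(2) by (intro sum.cong) auto
 moreover have "IT sx K b c t v = ?K * (VV b c t v - VV b c r v)" using G[OF t] r t by (simp add: IT_eq)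
 ultimately have "norm (P k v - IT sx K b c t v - 0) = abs (?K) * abs ((SUM i<k * 2 ^ k. of_bool (r <= u k i) * ?a i) - (VV b c t v - VV b c r v))"
 by (simp add: abs_mult[symmetric] right_diff_distrib)
 also have "... <= (abs (?K) + 1) * (e + e * t)" using rp unfolding uk by (intro mult_mono) auto
 also have "... = q / 2"
 proof -
 have a: "a * (q / (2 * a * s) * s) = q / 2" if "0 < a" "0 < s" for a s using that by simp
 have "e + e * t = q / (2 * (abs (?K) + 1) * (1 + t)) * (1 + t)" unfolding e_def[symmetric] by (simp add: distrib_left)
 thus ?thesis by (simp only:) (rule a, use t in auto)
 qed
 finally show "norm (P k v - IT sx K b c t v - 0) < q" using q by simp
 qed
 qed
 qed
 moreover have "eventually (%k. P k v - IT sx K b c t v = LS (HH sx K b c) k t v + R k v - IT sx K b c t v) sequentially"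
 using LP by eventually_elim simp
 ultimately show ?case by (rule Lim_transform_eventually)
 qed
 qed
 from conv0_add[OF this R] show ?thesis by simp
qed

end

end

section \<open>Linear combinations and the wealth equation\<close>

context bm
begin

text \<open>Implies \<open>ito_integral\<close> and is evidently closed under linear combinations,
  because the Riemann sums are linear in the integrand.\<close>

definition LSI :: "(real => 'a => real) => (real => 'a => real) => bool" where
 "LSI H I \<longleftrightarrow> prog F H & (ALL v:space M. (ALL T>=0. EX C. ALL s:{0..T}. abs (H s v) <= C) &
 (AE s in lborel. 0 < s --> isCont (%s. H s v) s) & Con {0..} (%t. I t v)) &
 (ALL t>=0. I t : Bm M & conv0 (%k v. LS H k t v - I t v))"

lemma LSI_HH:
 assumes "Stop F sx" "prog F K" "!!v. v : space M ==> Con {0..} (%t. K t v)"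
 shows "LSI (HH sx K b c) (IT sx K b c)"
 unfolding LSI_def
 using HH_progressive[OF assms] HH_bound[OF assms] HH_cont[OF assms] IT_continuous[OF assms] IT_measurable[OF assms] gbm_ito[OF assms] by blast

lemma LSI_lin:
 assumes "LSI H I" "LSI H' I'"
 shows "LSI (%t v. H t v + m * H' t v) (%t v. I t v + m * I' t v)"
 unfolding LSI_def
proof (intro conjI ballI allI impI)
 note a = assms[unfolded LSI_def]
 show "prog F (%t v. H t v + m * H' t v)"
 using progressive_comp2[of F H H' "%x y. x + m * y"] a by simp
 fix v assume v: "v : space M"
 show "Con {0..} (%t. I t v + m * I' t v)" using a v by (intro continuous_intros) auto
 have "AE s in lborel. 0 < s --> isCont (%s. H s v) s" "AE s in lborel. 0 < s --> isCont (%s. H' s v) s" using a v by auto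
 thus "AE s in lborel. 0 < s --> isCont (%s. H s v + m * H' s v) s" by eventually_elim (auto intro!: continuous_intros)
 fix T :: real assume T: "0 <= T"
 obtain C C' where "!!s. s : {0..T} ==> abs (H s v) <= C" "!!s. s : {0..T} ==> abs (H' s v) <= C'" using a v T by meson
 hence "abs (H s v + m * H' s v) <= C + abs m * C'" if "s : {0..T}" for s
 using that by (intro order_trans[OF abs_triangle_ineq] add_mono) (auto simp: abs_mult intro!: mult_left_mono)
 thus "EX C. ALL s:{0..T}. abs (H s v + m * H' s v) <= C" by blast
next
 note a = assms[unfolded LSI_def]
 fix t :: real assume t: "0 <= t"
 have [measurable]: "I t : Bm M" "I' t : Bm M" using a t by auto
 show "(%v. I t v + m * I' t v) : Bm M" by measurable
 have "LS (%t v. H t v + m * H' t v) k t v = LS H k t v + m * LS H' k t v" for k v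
 unfolding LS_def sum_distrib_left sum.distrib[symmetric] by (simp add: algebra_simps)
 hence e: "LS (%t v. H t v + m * H' t v) k t v - (I t v + m * I' t v) = (LS H k t v - I t v) + m * (LS H' k t v - I' t v)" for k v
 by (simp add: algebra_simps)
 show "conv0 (%k v. LS (%t v. H t v + m * H' t v) k t v - (I t v + m * I' t v))"
 unfolding e using a t by (intro conv0_add conv0_cmult) auto
qed

lemma LSI_ito:
 assumes L: "LSI H I" and H': "prog F H'" and eq: "AE v in M. AE s in lborel. 0 <= s --> H' s v = H s v"
 shows "ito_integral M F B H' I"
proof (rule ito_from_riemann[OF H' _ eq])
 note a = L[unfolded LSI_def]
 show "prog F H" using a by blast
 show "AE v in M. ALL T>=0. EX C. ALL s:{0..T}. abs (H s v) <= C" "AE v in M. AE s in lborel. 0 < s --> isCont (%s. H s v) s"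
 "AE v in M. Con {0..} (%t. I t v)" using a by (auto intro!: AE_I2)
 show "I t : Bm M" "conv0 (%k v. LS H k t v - I t v)" if "0 <= t" for t using a that by auto
qed

lemma active_progressive:
 assumes "Stop F sx" "Stop F ta" and X: "prog F X"
 shows "prog F (%t v. active sx ta t v * X t v)"
proof -
 have "prog F (%t v. of_bool (sx v <= en t) * of_bool (en t < ta v) * X t v)"
 by (intro progressive_mult progressive_stopping progressive_pre assms)
 thus ?thesis by (rule progressive_cong[THEN iffD1, rotated 2]) (auto simp: active_def)
qed

text \<open>Integrand and drift are identified with \<open>H\<close> and \<open>D\<close> for almost
  every time only: at zeros of \<open>W\<close> the fraction \<open>a\<close> is a quotient by 0,
  and \<open>a * W\<close> loses its intended value.\<close>

lemma sde_intro:
 assumes st: "Stop F sx" "Stop F ta"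
 and pr: "prog F a" "prog F x" "prog F s" "prog F W" and L: "LSI H I"
 and H: "AE v in M. AE u in lborel. 0 <= u --> active sx ta u v * (a u v * sigma_S p * W u v) = H u v"
 and b: "AE v in M. AE u in lborel. 0 <= u --> active sx ta u v * wealth_drift p Y et (a u v) (x u v) (s u v) (W u v) = D u v"
 and D: "AE v in M. ALL t>=0. SI {0..t} (%u. D u v)"
 and eq: "AE v in M. ALL t>=0. sx v <= en t & en t <= ta v --> W t v = w + LI {0..t} (%u. D u v) + I t v"
 shows "wealth_sde M F B p Y et sx w ta a x s W"
proof -
 let ?b = "%t v. active sx ta t v * wealth_drift p Y et (a t v) (x t v) (s t v) (W t v)"
 have vp: "prog F (%t v. active sx ta t v * (a t v * sigma_S p * W t v))"
 using progressive_mult[OF progressive_mult[OF pr(1) progressive_const[of F "sigma_S p"]] pr(4)] by (intro active_progressive st) simp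
 have "prog F (%t v. wealth_drift p Y et (a t v) (x t v) (s t v) (W t v))"
 proof -
 have "prog F (%t v. a t v * W t v)" "prog F (%t v. x t v + s t v / et * price p)"
 using progressive_mult[OF pr(1,4)] progressive_comp2[OF pr(2,3), of "%x s. x + s / et * price p"] by auto
 from progressive_add[OF progressive_comp2[OF this, of "%x y. x * (mu_S p - mu_R p) - y"] progressive_comp[OF pr(4), of "%x. mu_R p * x + Y"]]
 have "prog F (%t v. (a t v * W t v) * (mu_S p - mu_R p) - (x t v + s t v / et * price p) + (mu_R p * W t v + Y))" by simp
 thus ?thesis unfolding wealth_drift_def by (simp add: algebra_simps)
 qed
 hence bp: "prog F ?b" by (intro active_progressive st)
 have AEb: "AE v in M. ALL t>=0. SI {0..t} (%u. ?b u v) & LI {0..t} (%u. ?b u v) = LI {0..t} (%u. D u v)"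
 using b D AE_space
 proof eventually_elim
 case (elim v)
 show ?case
 proof (intro allI impI)
 fix t :: real assume t: "0 <= t"
 have m: "(%u. indicat_real {0..t} u *\<^sub>R ?b u v) : Bm lborel"
 using section_measurable[OF progressive_joint[OF bp t] elim(3)] by (simp add: borel_measurable_restrict_space_iff mult.commute)
 have m': "(%u. indicat_real {0..t} u *\<^sub>R D u v) : Bm lborel"
 using elim(2) t unfolding set_integrable_def by auto
 have ae: "AE u in lborel. indicat_real {0..t} u *\<^sub>R ?b u v = indicat_real {0..t} u *\<^sub>R D u v"
 using elim(1) by eventually_elim (auto simp: indicator_def)
 show "SI {0..t} (%u. ?b u v) & LI {0..t} (%u. ?b u v) = LI {0..t} (%u. D u v)"
 using integrable_cong_AE[OF m m' ae] integral_cong_AE[OF m m' ae] elim(2) t unfolding set_integrable_def set_lebesgue_integral_def by blast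
 qed
 qed
 have "AE v in M. ALL t>=0. sx v <= en t & en t <= ta v --> W t v = w + LI {0..t} (%u. ?b u v) + I t v"
 using AEb eq by eventually_elim simp
 moreover have "AE v in M. ALL t>=0. SI {0..t} (%u. ?b u v)" using AEb by eventually_elim simp
 moreover note LSI_ito[OF L vp H]
 ultimately show ?thesis unfolding wealth_sde_def Let_def using pr(4) by blast
qed

lemma AE_lborel_from_0:
 assumes "!!n::nat. AE u in lborel. u : {0..real n} --> P u"
 shows "AE u in lborel. 0 <= u --> P u"
proof -
 have "AE u in lborel. ALL n::nat. u : {0..real n} --> P u" unfolding AE_all_countable using assms by blast
 thus ?thesis
 proof eventually_elim
 case (elim u)
 thus ?case using real_arch_simple[of u] by auto
 qed
qed

text \<open>Fubini: an inequality that holds almost surely at each fixed time holds almost surely at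
  almost every time.\<close>

lemma AE_progressive_null:
 assumes f: "prog F f" and z: "!!t. 0 <= t ==> AE v in M. f t v <= 0"
 shows "AE v in M. AE u in lborel. 0 <= u --> f u v <= 0"
proof -
 have "AE v in M. ALL n::nat. AE u in lborel. u : {0..real n} --> f u v <= 0"
 unfolding AE_all_countable
 proof
 fix n :: nat
 have j: "(%(t, v). en (f t v)) : Bm (RB (real n) >< M)"
 using measurable_compose[OF progressive_joint[OF f of_nat_0_le_iff] measurable_ennreal] by (simp add: case_prod_beta')
 have "NI M (%v. NL (real n) (%t. en (f t v))) = NL (real n) (%t. NI M (%v. en (f t v)))"
 by (rule set_nn_integral_Fubini[OF j])
 also have "... = NI (lborel :: real measure) (%t. 0)"
 proof (rule nn_integral_cong)
 fix t :: real
 have "NI M (%v. en (f t v)) = NI M (%v. 0)" if "0 <= t"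
 using z[OF that] by (intro nn_integral_cong_AE) (auto simp: ennreal_neg)
 thus "NI M (%v. en (f t v)) * Ind {0..real n} t = 0" by (auto simp: indicator_def)
 qed
 finally have "AE v in M. NL (real n) (%t. en (f t v)) = 0"
 using set_integral_M[OF f, of "real n"] by (simp add: nn_integral_0_iff_AE)
 thus "AE v in M. AE u in lborel. u : {0..real n} --> f u v <= 0"
 using AE_space
 proof eventually_elim
 case (elim v)
 hence "AE u in lborel. en (f u v) * Ind {0..real n} u = 0"
 using path_measurable[OF f of_nat_0_le_iff elim(2), of n] by (simp add: nn_integral_0_iff_AE)
 thus ?case by eventually_elim (auto simp: indicator_def ennreal_eq_0_iff)
 qed
 qed
 thus ?thesis by eventually_elim (rule AE_lborel_from_0, blast)
qed

lemma Ici_SUP: "en x * Ind {0..} t = (SUP n. en x * Ind {0..real n} t)"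
proof (rule antisym)
 obtain n :: nat where n: "t <= real n" using real_arch_simple by blast
 have "en x * Ind {0..} t = en x * Ind {0..real n} t" using n by (auto simp: indicator_def)
 thus "en x * Ind {0..} t <= (SUP n. en x * Ind {0..real n} t)" by (auto intro: SUP_upper2)
qed (auto intro!: SUP_least simp: indicator_def)

context
 fixes f :: "real => 'a => real" assumes f: "prog F f"
begin

lemma path_measurable_Ici: "v : space M ==> (%t. en (f t v) * Ind {0..} t) : Bm lborel"
 unfolding Ici_SUP using path_measurable[OF f of_nat_0_le_iff] by (intro borel_measurable_SUP) auto

lemma integral_Ici: "v : space M ==> NS lborel {0..} (%t. en (f t v)) = (SUP n. NL (real n) (%t. en (f t v)))"
 unfolding Ici_SUP using path_measurable[OF f of_nat_0_le_iff]
 by (intro nn_integral_monotone_convergence_SUP) (auto simp: incseq_def le_fun_def indicator_def)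

lemma integral_Ici_M: "(%v. NS lborel {0..} (%t. en (f t v))) : Bm M"
 using set_integral_M[OF f of_nat_0_le_iff] by (subst measurable_cong[OF integral_Ici]) (auto intro!: borel_measurable_SUP)

lemma time_SUP: "NI M (%v. NS lborel {0..} (%t. en (f t v))) = (SUP n. NL (real n) (%t. NI M (%v. en (f t v))))"
proof -
 have j: "(%(t, v). en (f t v)) : Bm (RB (real n) >< M)" for n
 using measurable_compose[OF progressive_joint[OF f of_nat_0_le_iff] measurable_ennreal] by (simp add: case_prod_beta')
 have "NI M (%v. NS lborel {0..} (%t. en (f t v))) = NI M (%v. (SUP n. NL (real n) (%t. en (f t v))))"
 by (rule nn_integral_cong[OF integral_Ici])
 also have "... = (SUP n. NI M (%v. NL (real n) (%t. en (f t v))))"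
 using set_integral_M[OF f of_nat_0_le_iff]
 by (intro nn_integral_monotone_convergence_SUP) (auto simp: incseq_def le_fun_def indicator_def intro!: nn_integral_mono)
 finally show ?thesis by (simp only: set_nn_integral_Fubini[OF j])
qed

end

lemma time_swap:
 assumes f: "prog F f" and g: "prog F g"
 and eq: "!!t. 0 <= t ==> NI M (%v. en (f t v)) = NI M (%v. en (g t v))"
 shows "NI M (%v. NS lborel {0..} (%t. en (f t v))) = NI M (%v. NS lborel {0..} (%t. en (g t v)))"
proof -
 have "NL (real n) (%t. NI M (%v. en (f t v))) = NL (real n) (%t. NI M (%v. en (g t v)))" for n :: nat
 using eq by (intro nn_integral_cong) (auto simp: indicator_def)
 thus ?thesis unfolding time_SUP[OF f] time_SUP[OF g] by simp
qed

end

context bm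
begin

context
 fixes sx :: "'a => ennreal" and K :: "real => 'a => real" and b c t :: real and v :: 'a
 assumes v: "v : space M" and t: "0 <= t"
begin

text \<open>Drift and Ito part add up to the increment of \<open>EE\<close> since \<open>sx\<close>;
  this is the integration by parts built into \<open>VV\<close>, cut at the switching time.\<close>

lemma GE_total:
 shows "SI {0..t} (%u. c * (GG sx K u v * EE b c u v))"
 and "LI {0..t} (%u. c * (GG sx K u v * EE b c u v)) + IT sx K b c t v = GG sx K t v * (EE b c t v - EE b c (er (sx v)) v)"
proof -
 let ?r = "er (sx v)"
 have si: "SI {a..d} (%u. EE b c u v)" if "0 <= a" for a d
 using that by (intro set_integrable_continuous_Icc continuous_on_subset[OF EE_continuous[OF v]]) auto
 have "SI {0..t} (%u. c * (GG sx K u v * EE b c u v)) &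
 LI {0..t} (%u. c * (GG sx K u v * EE b c u v)) = c * (GG sx K t v * (LI {0..t} (%u. EE b c u v) - LI {0..?r} (%u. EE b c u v)))"
 proof (cases "sx v <= en t")
 case False
 have "GG sx K u v = 0" if "u <= t" for u
 proof -
 have "~  sx v <= en u" using False ennreal_leI[OF that] order_trans by blast
 thus ?thesis by (simp add: GG_def)
 qed
 hence "(%u. indicat_real {0..t} u *\<^sub>R (c * (GG sx K u v * EE b c u v))) = (%_. 0)" "GG sx K t v = 0" by (auto simp: indicator_def)
 thus ?thesis unfolding set_integrable_def set_lebesgue_integral_def by (simp only:) simp
 next
 case True
 hence r: "0 <= ?r" "?r <= t" "sx v ~= \<top>" using t by (auto simp: enn2real_leI top_unique)
 have e: "indicat_real {0..t} u *\<^sub>R (c * (GG sx K u v * EE b c u v)) = (c * K ?r v) * (indicat_real {?r..t} u *\<^sub>R EE b c u v)" for u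
 using r order_trans[OF r(1), of u] by (auto simp: indicator_def GG_eq)
 have "LI {0..t} (%u. EE b c u v) = LI {0..?r} (%u. EE b c u v) + LI {?r..t} (%u. EE b c u v)"
 using r by (simp add: set_borel_integral_eq_integral(2)[OF si] Henstock_Kurzweil_Integration.integral_combine[OF r(1,2) set_borel_integral_eq_integral(1)[OF si]])
 thus ?thesis unfolding set_integrable_def set_lebesgue_integral_def e
 using si[OF r(1), of t] r t unfolding set_integrable_def by (simp add: GG_eq)
 qed
 note this
 thus "SI {0..t} (%u. c * (GG sx K u v * EE b c u v))"
 "LI {0..t} (%u. c * (GG sx K u v * EE b c u v)) + IT sx K b c t v = GG sx K t v * (EE b c t v - EE b c ?r v)"
 unfolding IT_eq[OF t] VV_def by (auto simp: algebra_simps)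
qed

end

end

section \<open>Growth of powers of the state price\<close>

context market
begin

text \<open>A wealth component proportional to \<open>zeta powr e\<close> has volatility rate
  \<open>- e * kappa p\<close>. If it pays for consumption at rate \<open>phq (e + 1)\<close>, its
  drift is exactly the growth rate \<open>dh p - phq e\<close>, so the explicit wealth is
  self-financing.\<close>

lemma phq_shift: "mu_R p - (kappa p)^2 * e - phq (e + 1) = dh p - phq e"
 unfolding phq_def by (simp add: power2_eq_square algebra_simps)

lemma zeta_EE: "zeta t v powr e = EE (- e * kappa p) (dh p - phq e) t v"
proof -
 have "ex e t v = exp (- dh p * t) * EE (- e * kappa p) (dh p - phq e) t v"
 unfolding ex_def EE_def mult.assoc[symmetric] exp_add[symmetric] by (simp add: algebra_simps)
 thus ?thesis unfolding ex_zeta by simp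
qed

lemma zeta_powr_progressive: "prog F (%t v. c * zeta t v powr e)"
 using progressive_comp[OF zeta_progressive, of "%x. c * x powr e"] by simp

lemma zeta_powr_continuous: "v : space M ==> Con {0..} (%t. c * zeta t v powr e)"
 using less_imp_neq[OF zeta_pos] by (intro continuous_on_mult_left continuous_on_powr' zeta_continuous continuous_on_const) (auto simp: zeta_pos less_imp_le)

text \<open>At a fixed time \<open>t\<close> after \<open>sx\<close>, a rational \<open>q\<close> in
  between makes the level known at \<open>q\<close>, while the increment from \<open>q\<close> to
  \<open>t\<close> has a density and misses the required value almost surely. Fubini turns fixed
  times into almost every time.\<close>

lemma level_null:
 assumes sx: "Stop F sx" and X: "prog F X" and Xc: "!!v. v : space M ==> Con {0..} (%t. X t v)"
 shows "AE v in M. AE u in lborel. 0 <= u --> sx v <= en u --> zeta u v ~= X (er (sx v)) v"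
proof -
 let ?f = "%u v. of_bool (sx v <= en u) * (of_bool (zeta u v = X (stop_at sx u v) v) * of_bool (stop_at sx u v < u)) :: real"
 have fp: "prog F ?f"
 proof (intro progressive_mult progressive_stopping[OF sx])
 show "prog F (%u v. of_bool (zeta u v = X (stop_at sx u v) v))"
 using progressive_comp2[OF zeta_progressive stopped_progressive[OF sx X Xc], of "%x y. of_bool (x = y)"] by simp
 have "prog F (stop_at sx)" by (intro progressive_continuous stop_at_measurable[OF sx] stop_at_continuous)
 from progressive_comp_time[OF this, of "%u x. of_bool (x < u)"] show "prog F (%u v. of_bool (stop_at sx u v < u))" by simp
 qed
 have z: "AE v in M. ?f t v <= 0" if t: "0 <= t" for t
 proof -
 have q: "AE v in M. ~  (sx v <= en q & zeta t v = X (stop_at sx q v) v)" if q: "0 <= q" "q < t" for q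
 proof -
 \<comment> \<open>The value that \<open>B t - B q\<close> would need for \<open>zeta t\<close> to
   equal the level.\<close>
 define g where "g v = ((dh p - mu_R p - (kappa p)^2 / 2) * t - kappa p * (B q v - B 0 v) - ln (X (stop_at sx q v) v)) / kappa p" for v
 have [measurable]: "B q : Bm (F q)" "B 0 : Bm (F q)" "(%v. X (stop_at sx q v) v) : Bm (F q)"
 using q bt_adapted progressive_stopped[OF X sx] by auto
 have gm [measurable]: "g : Bm (F q)" unfolding g_def by measurable
 have "NI M (%v. en (of_bool (B t v - B q v = g v))) = NI M (%v. NI lborel (%x. en (of_bool (x = g v)) * en (nd (t - q) x)))"
 using freeze[of q t "%(v, x). en (of_bool (x = g v))"] q by simp
 also have "... = NI M (%v. 0)"
 proof (rule nn_integral_cong)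
 fix v
 have "AE x in lborel. en (of_bool (x = g v)) * en (nd (t - q) x) = 0"
 using AE_lborel_singleton[of "g v"] by eventually_elim simp
 thus "NI lborel (%x. en (of_bool (x = g v)) * en (nd (t - q) x)) = 0"
 by (subst nn_integral_0_iff_AE) auto
 qed
 finally have i0: "NI M (%v. en (of_bool (B t v - B q v = g v))) = 0" by simp
 have "AE v in M. en (of_bool (B t v - B q v = g v)) = 0"
 proof -
 have [measurable]: "B t : Bm M" "B q : Bm M" "g : Bm M" using q bt_measurable F_M[OF _ gm] by auto
 show ?thesis using i0 by (subst (asm) nn_integral_0_iff_AE) auto
 qed
 thus ?thesis
 proof eventually_elim
 case (elim v)
 show ?case
 proof
 assume "sx v <= en q & zeta t v = X (stop_at sx q v) v"
 hence "ln (X (stop_at sx q v) v) = (dh p - mu_R p - (kappa p)^2 / 2) * t - kappa p * (B t v - B 0 v)" unfolding zeta_def by (metis ln_exp)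
 hence "B t v - B q v = g v" unfolding g_def using kappa0 by (simp add: field_simps)
 thus False using elim by simp
 qed
 qed
 qed
 have "AE v in M. ALL q:{q : Rats. 0 <= q & q < t}. ~  (sx v <= en q & zeta t v = X (stop_at sx q v) v)"
 using q by (intro AE_ball_countable') (auto intro: countable_subset[OF _ countable_rat])
 thus ?thesis
 proof eventually_elim
 case (elim v)
 show ?case
 proof (rule ccontr)
 assume "~  ?f t v <= 0"
 hence h: "sx v <= en t" "zeta t v = X (stop_at sx t v) v" "stop_at sx t v < t"
 by (cases "sx v <= en t"; cases "zeta t v = X (stop_at sx t v) v"; cases "stop_at sx t v < t"; simp)+
 let ?r = "er (sx v)"
 have r: "?r < t" "sx v = en ?r" using h t by (cases "sx v"; auto simp: stop_at_eq top_unique)+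
 obtain q where q: "q : Rats" "?r < q" "q < t" using Rats_dense_in_real[OF r(1)] by blast
 have q0: "0 <= q" using q(2) enn2real_nonneg[of "sx v"] by linarith
 have "sx v <= en q" using q(2) by (subst r(2)) (rule ennreal_leI, simp)
 moreover have "stop_at sx q v = stop_at sx t v" using calculation h(1) q0 t by (simp add: stop_at_eq)
 ultimately show False using elim h(2) q q0 by auto
 qed
 qed
 qed
 have "AE v in M. AE u in lborel. 0 <= u --> ?f u v <= 0" by (rule AE_progressive_null[OF fp z])
 thus ?thesis
 proof eventually_elim
 case (elim v)
 thus ?case using AE_lborel_singleton[of "er (sx v)"]
 proof eventually_elim
 case (elim u)
 show ?case
 proof (intro impI notI)
 assume u: "0 <= u" "sx v <= en u" "zeta u v = X (er (sx v)) v"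
 hence "er (sx v) < u" using elim(2) enn2real_leI[OF u(1) u(2)] by simp
 thus False using elim(1) u by (simp add: stop_at_eq)
 qed
 qed
 qed
qed

text \<open>At each time the martingale factor may be replaced by its value at \<open>sx\<close>,
  since the weight is known there. What remains is an exponential integral with rate
  \<open>phq e\<close>.\<close>

lemma tail:
 assumes sx: "Stop F sx" and R: "prog F R" and Rc: "!!v. v : space M ==> Con {0..} (%t. R t v)"
 and R0: "!!t v. 0 <= R t v" and e: "0 < phq e"
 shows "NI M (%v. NS lborel {0..} (%t. en (of_bool (sx v <= en t) * (R (stop_at sx t v) v * ex e t v)))) =
 NI M (%v. (if sx v = \<top> then 0 else en (R (er (sx v)) v * ex e (er (sx v)) v / phq e)))"
proof -
 let ?f = "%t v. of_bool (sx v <= en t) * (R (stop_at sx t v) v * ex e t v)"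
 let ?E = "%t v. emart (- e * kappa p) t v"
 let ?g = "%t v. of_bool (sx v <= en t) * (R (stop_at sx t v) v * ?E (stop_at sx t v) v * exp (- phq e * t))"
 have Rp: "prog F (%t v. R (stop_at sx t v) v)" by (rule stopped_progressive[OF sx R Rc])
 have fp: "prog F ?f" by (intro progressive_mult progressive_stopping[OF sx] Rp ex_progressive)
 have gp: "prog F ?g"
 using progressive_comp_time[OF progressive_mult[OF Rp stopped_progressive[OF sx emart_progressive emart_continuous]], of "%t x. x * exp (- phq e * t)"]
 by (intro progressive_mult[OF progressive_stopping[OF sx]]) simp
 have eq: "NI M (%v. en (?f t v)) = NI M (%v. en (?g t v))" if t: "0 <= t" for t
 proof -
 let ?R = "%v. en ((%s v. R s v * exp (- phq e * t)) (er (sx v)) v)"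
 have pre: "pre_F sx ?R"
 by (rule pre_F_process[OF sx]) (use progressive_comp[OF R, of "%x. x * exp (- phq e * t)"] in simp)
 have "en (?f t v) = ?R v * on sx t v * en (?E t v)"
 "en (?g t v) = ?R v * on sx t v * en (?E (er (sx v)) v)" for v
 using t by (auto simp: indicator_def ex_def stop_at_eq ennreal_mult''[OF less_imp_le[OF emart_pos], symmetric] ennreal_mult'[OF less_imp_le[OF emart_pos], symmetric] mult_ac)
 thus ?thesis using emart_optional_stopping[OF sx t pre, of "- e * kappa p"] by simp
 qed
 have "NS lborel {0..} (%t. en (?g t v)) = (if sx v = \<top> then 0 else en (R (er (sx v)) v * ex e (er (sx v)) v / phq e))" for v
 proof (cases "sx v = \<top>")
 case True
 thus ?thesis by (simp add: top_unique)
 next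
 case False
 define r where "r = er (sx v)"
 have r: "sx v = en r" "0 <= r" using False by (auto simp: r_def less_top)
 let ?c = "R r v * ?E r v"
 have c: "0 <= ?c" using R0[of r v] emart_pos[of "- e * kappa p" r v] by simp
 have "NS lborel {0..} (%t. en (?g t v)) = NI lborel (%t. en (?c * exp (- phq e * t)) * Ind {r..} t)"
 using r by (intro nn_integral_cong) (auto simp: indicator_def stop_at_eq r_def[symmetric])
 also have "... = en (0 - - (?c * exp (- phq e * r) / phq e))"
 proof (rule nn_integral_FTC_atLeast[where F="%t. - (?c * exp (- phq e * t) / phq e)"])
 show "((%t. - (?c * exp (- phq e * t) / phq e)) has_real_derivative ?c * exp (- phq e * t)) (at t)" for t
 using e by (auto intro!: derivative_eq_intros)
 show "0 <= ?c * exp (- phq e * t)" for t using c by simp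
 have "((%t. - (?c * exp (- (phq e * t)) / phq e)) \<longlongrightarrow> - (?c * 0 / phq e)) at_top"
 by (intro tendsto_intros filterlim_compose[OF exp_at_bot] filterlim_compose[OF filterlim_uminus_at_bot_at_top] filterlim_tendsto_pos_mult_at_top[OF tendsto_const e filterlim_ident]) (use e in auto)
 thus "((%t. - (?c * exp (- phq e * t) / phq e)) \<longlongrightarrow> 0) at_top" by simp
 qed simp
 finally show ?thesis using False by (simp add: r_def[symmetric] ex_def mult_ac)
 qed
 thus ?thesis using time_swap[OF fp gp eq] by simp
qed

end

section \<open>Optimal strategies\<close>

context market
begin

text \<open>From \<open>sx\<close> on, total wealth is \<open>z\<close> times the power
  \<open>- 1 / gam p\<close> of the state price relative to its value at \<open>sx\<close>;
  \<open>KP\<close> collects what is frozen at \<open>sx\<close>.\<close>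

definition KP :: "real => real => 'a => real" where "KP z t v = z * zeta t v powr (1 / gam p)"
definition ZZ :: "('a => ennreal) => real => real => 'a => real" where
 "ZZ sx z t v = KP z (stop_at sx t v) v * zeta t v powr (- 1 / gam p)"
definition VP :: "('a => ennreal) => real => real => 'a => real" where "VP sx z t v = ZZ sx z t v - H_post p"

lemma KP: "prog F (KP z)" "v : space M ==> Con {0..} (%t. KP z t v)"
 unfolding KP_def[abs_def] by (rule zeta_powr_progressive, rule zeta_powr_continuous)

lemma neg_inv_gam: "- 1 / gam p + 1 = eps p" using par by (simp add: eps_def field_simps)

text \<open>Wealth can be 0 only when \<open>zeta\<close> is at one level determined at
  \<open>sx\<close>, which \<open>level_null\<close> excludes for almost all times.\<close>

lemma AE_not_level:
 assumes sx: "Stop F sx" and z: "0 < z"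
 shows "AE v in M. AE u in lborel. 0 <= u --> sx v <= en u --> VP sx z u v ~= 0"
proof -
 have "AE v in M. AE u in lborel. 0 <= u --> sx v <= en u --> zeta u v ~= (H_post p / z) powr (- gam p) * zeta (er (sx v)) v powr 1"
 by (rule level_null[OF sx zeta_powr_progressive zeta_powr_continuous])
 thus ?thesis
 proof eventually_elim
 case (elim v)
 thus ?case
 proof eventually_elim
 case (elim u)
 show ?case
 proof (intro impI notI)
 assume u: "0 <= u" "sx v <= en u" "VP sx z u v = 0"
 define r where "r = er (sx v)"
 have g: "gam p ~= 0" using par by simp
 have "z * zeta r v powr (1 / gam p) * zeta u v powr (- 1 / gam p) = H_post p"
 using u by (simp add: VP_def ZZ_def KP_def stop_at_eq r_def)
 from this[symmetric] have "(H_post p / z) powr (- gam p) = (zeta r v powr (1 / gam p) * zeta u v powr (- 1 / gam p)) powr (- gam p)" using z by simp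
 also have "... = zeta r v powr (- 1) * zeta u v" using zeta_pos[of u v] g by (simp add: powr_mult powr_powr)
 finally have "(H_post p / z) powr (- gam p) * zeta r v powr 1 = zeta u v" using zeta_pos[of r v] by (simp add: powr_minus)
 thus False using elim u by (simp add: r_def)
 qed
 qed
 qed
qed

context
 fixes sx :: "'a => ennreal" and z :: real and a x s :: "real => 'a => real"
 assumes sx: "Stop F sx" and z: "0 < z"
 and axs: "!!t v. v : space M ==> 0 <= t ==> sx v <= en t ==> a t v = a_post p (VP sx z t v) & x t v = x_post p (VP sx z t v) & s t v = s_post p (VP sx z t v)"
begin

lemma VP_progressive: "prog F (VP sx z)"
proof -
 have "prog F (ZZ sx z)"
 unfolding ZZ_def[abs_def] using zeta_powr_progressive[of 1 "- 1 / gam p"] by (intro progressive_mult stopped_progressive[OF sx KP]) simp_all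
 from progressive_comp[OF this, of "%x. x - H_post p"] show ?thesis by (simp add: VP_def[abs_def])
qed

lemma ZZ_pos: "0 < ZZ sx z t v" unfolding ZZ_def KP_def using z less_imp_neq[OF zeta_pos] by (metis mult_pos_pos powr_gt_zero)

text \<open>Total wealth is a single power of the state price with a factor frozen at
  \<open>sx\<close>, so one integral of type \<open>IT\<close> represents it.\<close>

lemma post_sde:
 assumes pr: "prog F a" "prog F x" "prog F s"
 shows "wealth_sde M F B p (income_post p) (eff_post p) sx (z - H_post p) (%_. \<infinity>) a x s (VP sx z)"
proof -
 define e where "e = - 1 / gam p"
 define b where "b = - e * kappa p"
 define c where "c = dh p - phq e"
 have GE: "GG sx (KP z) u v * EE b c u v = ZZ sx z u v" if "sx v <= en u" for u v
 unfolding GG_def ZZ_def b_def c_def zeta_EE[symmetric] using that by (simp add: e_def)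
 \<comment> \<open>By \<open>phq_shift\<close>, consuming at rate \<open>phi p\<close> leaves
   exactly the growth rate of the power \<open>- 1 / gam p\<close>.\<close>
 have cc: "mu_R p + kappa p * b - phi p = c"
 using phq_shift[of e] neg_inv_gam unfolding c_def b_def e_def[symmetric] by (simp add: phq_eps power2_eq_square mult_ac)
 have sg: "sigma_S p ~= 0" "gam p ~= 0" using par by auto
 have aW: "a u v * sigma_S p * VP sx z u v = b * ZZ sx z u v" if "v : space M" "0 <= u" "sx v <= en u" "VP sx z u v ~= 0" for u v
 using axs[OF that(1-3)] that(4) sg by (simp add: a_post_def z_post_def VP_def b_def e_def)
 note ae = AE_not_level[OF sx z]
 show ?thesis
 proof (rule sde_intro[OF sx const_stopping pr VP_progressive LSI_HH[OF sx KP, of z b c]])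
 show "AE v in M. AE u in lborel. 0 <= u --> active sx (%_. \<infinity>) u v * (a u v * sigma_S p * VP sx z u v) = HH sx (KP z) b c u v"
 using ae AE_space
 proof eventually_elim
 case (elim v)
 from elim(1) show ?case
 proof eventually_elim
 case (elim u)
 thus ?case using aW[of v u] \<open>v : space M\<close> GE[of v u] by (cases "sx v <= en u") (auto simp: active_def HH_def GG_def)
 qed
 qed
 show "AE v in M. AE u in lborel. 0 <= u --> active sx (%_. \<infinity>) u v * wealth_drift p (income_post p) (eff_post p) (a u v) (x u v) (s u v) (VP sx z u v) = c * (GG sx (KP z) u v * EE b c u v)"
 using ae AE_space
 proof eventually_elim
 case (elim v)
 from elim(1) show ?case
 proof eventually_elim
 case (elim u)
 show ?case
 proof (cases "sx v <= en u & 0 <= u")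
 case True
 let ?Z = "ZZ sx z u v" and ?W = "VP sx z u v"
 note c1 = axs[OF \<open>v : space M\<close>, of u]
 have aw: "a u v * sigma_S p * ?W = b * ?Z" using True elim \<open>v : space M\<close> by (intro aW) auto
 have k: "(mu_S p - mu_R p) * (a u v * ?W) = kappa p * (a u v * sigma_S p * ?W)" using sg by (simp add: kappa_def)
 have z1: "z_post p ?W = ?Z" by (simp add: z_post_def VP_def)
 have "x u v + s u v / eff_post p * price p = x_min p + s_min p / eff_post p * price p + phi p * ?Z"
 using True c1 par unfolding x_post_def s_post_def z1 by (simp add: add_divide_distrib distrib_right) (simp add: algebra_simps)
 moreover have "mu_R p * ?W = mu_R p * ?Z - (income_post p - x_min p - s_min p / eff_post p * price p)"
 using par by (simp add: VP_def H_post_def right_diff_distrib)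
 moreover have "wealth_drift p (income_post p) (eff_post p) (a u v) (x u v) (s u v) ?W = mu_R p * ?W + (mu_S p - mu_R p) * (a u v * ?W) + income_post p - (x u v + s u v / eff_post p * price p)"
 unfolding wealth_drift_def by (simp add: algebra_simps)
 ultimately have "wealth_drift p (income_post p) (eff_post p) (a u v) (x u v) (s u v) ?W = (mu_R p + kappa p * b - phi p) * ?Z"
 unfolding k aw by (simp add: algebra_simps)
 thus ?thesis unfolding cc using True GE[of v u] by (simp add: active_def)
 qed (auto simp: active_def GG_def)
 qed
 qed
 show "AE v in M. ALL t>=0. SI {0..t} (%u. c * (GG sx (KP z) u v * EE b c u v))"
 using GE_total(1) by (auto intro: AE_I2)
 show "AE v in M. ALL t>=0. sx v <= en t & en t <= \<infinity> --> VP sx z t v = z - H_post p + LI {0..t} (%u. c * (GG sx (KP z) u v * EE b c u v)) + IT sx (KP z) b c t v"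
 proof (rule AE_I2, intro allI impI)
 fix v and t :: real assume v: "v : space M" and t: "0 <= t" "sx v <= en t & en t <= \<infinity>"
 let ?r = "er (sx v)"
 have G: "GG sx (KP z) t v = KP z ?r v" using t by (simp add: GG_def stop_at_eq)
 have "KP z ?r v * EE b c ?r v = z" unfolding KP_def b_def c_def zeta_EE[symmetric] e_def using zeta_pos[of ?r v] by (simp add: powr_add[symmetric])
 moreover have "KP z ?r v * EE b c t v = ZZ sx z t v" using GE[of v t] G t by simp
 ultimately show "VP sx z t v = z - H_post p + LI {0..t} (%u. c * (GG sx (KP z) u v * EE b c u v)) + IT sx (KP z) b c t v"
 using GE_total(2)[OF v t(1), of c sx "KP z" b] G by (simp add: VP_def right_diff_distrib)
 qed
 qed
qed

text \<open>Along the candidate, disutility is the power \<open>eps p\<close> of the state price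
  relative to its value at \<open>sx\<close>. The constants combine to \<open>gval z\<close> because
  \<open>phi p / Gp p\<close> is a power of the unit cost.\<close>

lemma post_utility:
 assumes "v : space M" "0 <= t" "sx v <= en t"
 shows "du p x s t v = phi p * - gval z * (zeta (stop_at sx t v) v powr (- eps p) * ex (eps p) t v)"
proof -
 let ?Z = "ZZ sx z t v" and ?q = "stop_at sx t v" and ?N = "cost p (eff_post p)"
 have z1: "z_post p (VP sx z t v) = ?Z" by (simp add: z_post_def VP_def)
 have N: "0 < ?N" using cost_pos par by simp
 have "utility p (x t v) (s t v) = utility p (x_min p + (1 - beta p) * (phi p * ?Z)) (s_min p + beta p * (phi p * ?Z / (price p / eff_post p)))"
 using axs[OF assms] unfolding x_post_def s_post_def z1 by (simp add: mult.assoc)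
 also have "... = - ((phi p * ?Z / ?N) powr (1 - gam p) / (gam p - 1))"
 by (rule utility_opt) (use par phi_pos ZZ_pos in auto)
 finally have U: "- utility p (x t v) (s t v) = (phi p * ?Z / ?N) powr (1 - gam p) / (gam p - 1)" by simp
 have G: "phi p / ?N = Gp p * ?N powr (- (1 - eps p))"
 proof -
 have "?N powr (- eps p) * ?N powr (- (1 - eps p)) = ?N powr (- 1)" unfolding powr_add[symmetric] by simp
 hence "?N powr (- eps p) * ?N powr (- (1 - eps p)) = inverse ?N" using N by (simp only: powr_minus) simp
 thus ?thesis unfolding Gamma_post_Gam Gam_def gam_hat_eps divide_inverse by (simp only: mult_ac)
 qed
 have "phi p * ?Z / ?N = ?N powr (- (1 - eps p)) * (Gp p * ?Z)" using G by (metis mult.commute mult.left_commute times_divide_eq_left)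
 hence "(phi p * ?Z / ?N) powr (1 - gam p) = ?N powr (- (1 - eps p) * (1 - gam p)) * (Gp p * ?Z) powr (1 - gam p)" by (simp add: powr_mult powr_powr)
 also have "- (1 - eps p) * (1 - gam p) = eps p" using eps_gam(2) par by (simp add: eps_def field_simps)
 also have "?N powr eps p = phi p / Gp p" using phi_Gam par by (simp add: Gamma_post_Gam)
 finally have 1: "- utility p (x t v) (s t v) = phi p * ((Gp p * ?Z) powr (1 - gam p) / ((gam p - 1) * Gp p))" unfolding U by simp
 have "?Z powr (1 - gam p) = z powr (1 - gam p) * zeta ?q v powr (1 / gam p * (1 - gam p)) * zeta t v powr (- 1 / gam p * (1 - gam p))"
 unfolding ZZ_def KP_def by (simp only: powr_mult powr_powr)
 also have "1 / gam p * (1 - gam p) = - eps p" using par by (simp add: eps_def minus_divide_left)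
 also have "- 1 / gam p * (1 - gam p) = eps p" using par by (simp add: eps_def field_simps)
 finally have "(Gp p * ?Z) powr (1 - gam p) = (Gp p * z) powr (1 - gam p) * (zeta ?q v powr (- eps p) * zeta t v powr eps p)" by (simp add: powr_mult)
 thus ?thesis unfolding 1 gval_def ex_zeta by simp
qed

text \<open>By \<open>tail\<close>, consuming from \<open>sx\<close> on is worth the same as a
  single reward \<open>gval z\<close> received at \<open>sx\<close>.\<close>

lemma post_cost:
 "NI M (%v. JJ x s sx (%_. \<infinity>) v) = NI M (%v. (if sx v = \<top> then 0 else en (exp (- dh p * er (sx v)) * - gval z)))"
proof -
 let ?R = "%t v. (phi p * - gval z) * zeta t v powr (- eps p)"
 have g: "0 <= phi p * - gval z" using phi_pos gval_neg[OF z] by (intro mult_nonneg_nonneg) auto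
 have e: "0 < phq (eps p)" by (simp add: phq_eps phi_pos)
 have "NI M (%v. JJ x s sx (%_. \<infinity>) v) = NI M (%v. NS lborel {0..} (%t. en (of_bool (sx v <= en t) * (?R (stop_at sx t v) v * ex (eps p) t v))))"
 proof (intro nn_integral_cong, unfold JJ_def, intro nn_integral_cong)
 fix v t assume "v : space M"
 thus "en (active sx (%_. \<infinity>) t v * (du p x s t v)) =
 en (of_bool (sx v <= en t) * (?R (stop_at sx t v) v * ex (eps p) t v)) * Ind {0..} t"
 using post_utility[of v t] by (cases "0 <= t & sx v <= en t") (auto simp: active_def mult.assoc)
 qed
 also have "... = NI M (%v. (if sx v = \<top> then 0 else en (?R (er (sx v)) v * ex (eps p) (er (sx v)) v / phq (eps p))))"
 by (rule tail[OF sx zeta_powr_progressive zeta_powr_continuous mult_nonneg_nonneg[OF g powr_ge_zero] e])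
 also have "... = NI M (%v. (if sx v = \<top> then 0 else en (exp (- dh p * er (sx v)) * - gval z)))"
 proof -
 have "?R t v * ex (eps p) t v / phq (eps p) = exp (- dh p * t) * - gval z" for t v
 unfolding ex_zeta phq_eps using phi_pos zeta_pos[of t v] by (simp add: powr_minus)
 thus ?thesis by presburger
 qed
 finally show ?thesis .
qed

lemma post_admissible:
 assumes pr: "prog F a" "prog F x" "prog F s"
 shows "admissible_post M F B p sx (z - H_post p) a x s (VP sx z)"
proof -
 have "x_min p < x t v & s_min p < s t v & 0 < z_post p (VP sx z t v)" if "v : space M" "0 <= t" "sx v <= en t" for t v
 proof -
 have "z_post p (VP sx z t v) = ZZ sx z t v" by (simp add: z_post_def VP_def)
 thus ?thesis using axs[OF that] ZZ_pos[of t v] par phi_pos by (simp add: x_post_def s_post_def)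
 qed
 thus ?thesis unfolding admissible_post_def using pr post_sde[OF pr] by (auto intro!: AE_I2)
qed

end

lemma post_measurable: "a_post p : Bm borel" "x_post p : Bm borel" "s_post p : Bm borel"
 unfolding a_post_def[abs_def] x_post_def[abs_def] s_post_def[abs_def] z_post_def[abs_def] by measurable

lemma immediate_investment:
 assumes z: "0 < z_post p w"
 obtains a x s W where
 "ALL t>=0. ALL v:space M. a t v = a_post p (W t v) & x t v = x_post p (W t v) & s t v = s_post p (W t v)"
 "admissible_post M F B p (%_. 0) w a x s W" "post_payoff M p x s = ereal (gval (z_post p w))"
 "prog F a" "prog F x" "prog F s" "prog F W" "!!v. W 0 v = w"
proof -
 let ?W = "VP (%_. 0) (z_post p w)"
 note st = const_stopping[of 0]
 have Wp: "prog F ?W" by (rule VP_progressive[OF st z]) auto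
 note pr = progressive_comp[OF Wp post_measurable(1)] progressive_comp[OF Wp post_measurable(2)] progressive_comp[OF Wp post_measurable(3)]
 note P = st z conjI[OF refl conjI[OF refl refl]]
 have "post_payoff M p (%t v. x_post p (?W t v)) (%t v. s_post p (?W t v)) = ereal (gval (z_post p w))"
 unfolding post_payoff_JJ post_cost[OF P] using gval_neg[OF z] by (simp add: emeasure_space_1)
 moreover have "admissible_post M F B p (%_. 0) w (%t v. a_post p (?W t v)) (%t v. x_post p (?W t v)) (%t v. s_post p (?W t v)) ?W"
 using post_admissible[OF P pr] by (simp add: z_post_def)
 moreover have "?W 0 v = w" for v by (simp add: VP_def ZZ_def KP_def stop_at_eq zeta_0 z_post_def)
 ultimately show thesis using that[of "%t v. a_post p (?W t v)" ?W "%t v. x_post p (?W t v)" "%t v. s_post p (?W t v)"] pr Wp by blast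
qed

lemma value_G_eq: "0 < z_post p w ==> value_G M F B p w = ereal (gval (z_post p w))"
proof (rule antisym)
 assume z: "0 < z_post p w"
 show "value_G M F B p w <= ereal (gval (z_post p w))" by (rule value_G_le[OF z])
 obtain a x s W where "admissible_post M F B p (%_. 0) w a x s W" "post_payoff M p x s = ereal (gval (z_post p w))"
 by (rule immediate_investment[OF z])
 thus "ereal (gval (z_post p w)) <= value_G M F B p w"
 unfolding value_G_def by (intro SUP_upper2[of "(a, x, s, W)"]) auto
qed

end

text \<open>Each difference quotient at \<open>x\<close> lies between \<open>g x\<close> and
  \<open>g y\<close>, and \<open>g\<close> is continuous at \<open>x\<close>.\<close>

lemma deriv_from_supergradient:
 fixes f g :: "real => real"
 assumes S: "open S" "x : S" and g: "isCont g x" and b: "!!y z. y : S ==> z : S ==> f z <= f y + g y * (z - y)"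
 shows "(f has_real_derivative g x) (at x)"
 unfolding has_field_derivative_iff
proof (rule tendsto_sandwich)
 have gl: "(g \<longlongrightarrow> g x) (at x)" using g by (simp add: isCont_def)
 have q: "abs ((f y - f x) / (y - x) - g x) <= abs (g y - g x)" if "y : S" "y ~= x" for y
 proof -
 have 1: "f y - f x <= g x * (y - x)" "g y * (y - x) <= f y - f x" using b[OF S(2) that(1)] b[OF that(1) S(2)] by (simp_all add: algebra_simps)
 show ?thesis
 proof (cases "x < y")
 case True
 hence "(f y - f x) / (y - x) <= g x" "g y <= (f y - f x) / (y - x)" using 1 by (simp_all add: divide_le_eq le_divide_eq)
 thus ?thesis by linarith
 next
 case False
 hence "g x <= (f y - f x) / (y - x)" "(f y - f x) / (y - x) <= g y" using 1 that by (simp_all add: neg_divide_le_eq neg_le_divide_eq)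
 thus ?thesis by linarith
 qed
 qed
 have ev: "eventually (%y. y : S & y ~= x) (at x)" using S by (auto simp: eventually_at_filter intro: eventually_mono[OF eventually_nhds_in_open[OF S]])
 show "eventually (%y. g x - abs (g y - g x) <= (f y - f x) / (y - x)) (at x)" "eventually (%y. (f y - f x) / (y - x) <= g x + abs (g y - g x)) (at x)"
 using ev by (eventually_elim, use q in \<open>force simp: abs_le_iff\<close>)+
 show "((%y. g x - abs (g y - g x)) \<longlongrightarrow> g x) (at x)" "((%y. g x + abs (g y - g x)) \<longlongrightarrow> g x) (at x)"
 using tendsto_diff[OF tendsto_const[of "g x"] tendsto_rabs[OF tendsto_diff[OF gl tendsto_const[of "g x"]]]]
 tendsto_add[OF tendsto_const[of "g x"] tendsto_rabs[OF tendsto_diff[OF gl tendsto_const[of "g x"]]]] by simp_all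
qed

section \<open>Inverse of the marginal value\<close>

context valid_neg
begin

text \<open>\<open>C2\<close> makes \<open>zf\<close> minus the derivative of the upper branch of
  \<open>f_hat\<close>. Hence \<open>zf y\<close> is the total wealth with marginal value
  \<open>y\<close>, and \<open>yv\<close> recovers the marginal value from wealth.\<close>

definition C2 :: real where "C2 = a0 p * A0 p * zs powr a0 p"
definition zf :: "real => real" where "zf y = 1 / Pp p * y powr (- 1 / gam p) + C2 * y powr (- a0 p - 1)"
definition zf' :: "real => real" where
 "zf' y = 1 / Pp p * (- 1 / gam p * y powr (- 1 / gam p - 1)) + C2 * ((- a0 p - 1) * y powr (- a0 p - 1 - 1))"
definition yv :: "real => real" where "yv z = (SOME y. 0 < y & zf y = z)"

lemma C2_pos: "0 < C2" unfolding C2_def using a0 A0_pos zs_pos by simp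

lemma zf_pos: "0 < y ==> 0 < zf y" unfolding zf_def using C2_pos Phi_less by (intro add_pos_pos) auto

lemma zf_less: assumes "0 < x" "x < y" shows "zf y < zf x"
proof -
 have "y powr (- 1 / gam p) < x powr (- 1 / gam p)" "y powr (- a0 p - 1) < x powr (- a0 p - 1)"
 using assms par a0 by (auto intro!: powr_less_mono2_neg)
 thus ?thesis unfolding zf_def using C2_pos Phi_less by (intro add_strict_mono mult_strict_left_mono) auto
qed

lemma zf_less_iff: "0 < x ==> 0 < y ==> zf y < zf x \<longleftrightarrow> x < y" using zf_less[of x y] zf_less[of y x] by (cases x y rule: linorder_cases) auto

lemma yv_zf: "0 < y ==> yv (zf y) = y"
 unfolding yv_def by (rule some_equality) (metis zf_less less_irrefl linorder_neqE_linordered_idom)+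

lemma zf_deriv: "0 < y ==> (zf has_real_derivative zf' y) (at y)"
 unfolding zf_def[abs_def] zf'_def using Phi_less(1) by (auto intro!: derivative_eq_intros)

lemma zf'_neg: "0 < y ==> zf' y < 0"
proof -
 assume y: "0 < y"
 have "1 / Pp p * (- 1 / gam p * y powr (- 1 / gam p - 1)) < 0" using y par Phi_less by (intro mult_pos_neg mult_neg_pos) auto
 moreover have "C2 * ((- a0 p - 1) * y powr (- a0 p - 1 - 1)) < 0" using y a0 C2_pos by (intro mult_pos_neg mult_neg_pos) auto
 ultimately show ?thesis unfolding zf'_def by simp
qed

lemma zf'_times: "0 < y ==> y * zf' y = - 1 / gam p * (1 / Pp p * y powr (- 1 / gam p)) + (- a0 p - 1) * (C2 * y powr (- a0 p - 1))"
proof -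
 assume y: "0 < y"
 have e: "y powr (e - 1) * y = y powr e" for e using y by (simp add: powr_diff)
 have "y * zf' y = 1 / Pp p * (- 1 / gam p * (y powr (- 1 / gam p - 1) * y)) + C2 * ((- a0 p - 1) * (y powr (- a0 p - 1 - 1) * y))"
 unfolding zf'_def by (simp only: distrib_left mult_ac)
 thus ?thesis unfolding e by (simp only: mult_ac)
qed

text \<open>Smooth fit again: at \<open>zs\<close> both branches of \<open>f_hat\<close> have the
  same slope, and minus this slope is the threshold of total wealth.\<close>

lemma zf_zs: "zf zs = z_pre p (w_star p)"
proof -
 have "C2 * zs powr (- a0 p - 1) = a0 p * A0 p / zs"
 unfolding C2_def using zs_pos by (simp add: powr_diff powr_minus field_simps)
 moreover have "a0 p * A0 p = - (D * zs powr eps p) - theta p * zs" using smooth_fit(2) by simp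
 moreover have "zs powr eps p / zs = zs powr (- 1 / gam p)"
 proof -
 have "zs powr (- 1 / gam p + 1) = zs powr (- 1 / gam p) * zs" unfolding powr_add using zs_pos by simp
 moreover have "- 1 / gam p + 1 = eps p" using par by (simp add: eps_def field_simps)
 ultimately show ?thesis using zs_pos by simp
 qed
 ultimately have "C2 * zs powr (- a0 p - 1) = - (D * zs powr (- 1 / gam p)) - theta p" using zs_pos
 by (simp add: diff_divide_distrib) (simp only: times_divide_eq_right[symmetric])
 hence "zf zs = zs powr (- 1 / gam p) / Gp p - theta p" unfolding zf_def D_def by (simp add: algebra_simps)
 thus ?thesis unfolding w_star_z z_star .
qed

lemma yv:
 assumes z: "0 < z" "z < z_pre p (w_star p)" shows "zs < yv z" "zf (yv z) = z"
proof -
 have "((%y. 1 / Pp p * y powr (- 1 / gam p) + C2 * y powr (- a0 p - 1)) \<longlongrightarrow> 1 / Pp p * 0 + C2 * 0) at_top"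
 using par a0 by (intro tendsto_intros tendsto_neg_powr filterlim_ident) auto
 hence "eventually (%y. zf y < z) at_top" using z by (intro order_tendstoD(2)) (auto simp: zf_def)
 from eventually_conj[OF this eventually_gt_at_top[of zs]] obtain b where b: "zf b < z" "zs < b"
 by (auto dest: eventually_happens'[rotated])
 have "EX y>=zs. y <= b & zf y = z"
 using b z zf_zs zs_pos by (intro IVT2) (auto intro!: DERIV_isCont[OF zf_deriv])
 then obtain y where y: "zs <= y" "zf y = z" by blast
 have "zs ~= y" using y z zf_zs by auto
 hence "zs < y" "0 < y" using y zs_pos by auto
 moreover have "yv z = y" using yv_zf[OF \<open>0 < y\<close>] y by simp
 ultimately show "zs < yv z" "zf (yv z) = z" using y by auto
qed

lemma yv_deriv:
 assumes z: "0 < z" "z < z_pre p (w_star p)" shows "isCont yv z" "(yv has_real_derivative inverse (zf' (yv z))) (at z)"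
proof -
 let ?y = "yv z"
 have y: "0 < ?y" "zf ?y = z" using yv[OF z] zs_pos by auto
 have "isCont yv (zf ?y)"
 proof (rule isCont_inverse_function2[of "?y / 2" ?y "?y + 1"])
 show "yv (zf x) = x" "isCont zf x" if "?y / 2 <= x" for x using that y(1) yv_zf[of x] DERIV_isCont[OF zf_deriv[of x]] by simp_all
 qed (use y(1) in simp_all)
 thus c: "isCont yv z" using y by simp
 show "(yv has_real_derivative inverse (zf' ?y)) (at z)"
 using zf_deriv[OF y(1)] zf'_neg[OF y(1)] z yv c by (intro DERIV_inverse_function[of zf _ _ _ 0 "z_pre p (w_star p)"]) auto
qed

text \<open>Puts the dual objective at its stationary point into the shape of a cost: total
  disutility of never investing, minus the saving weighted by \<open>(y / zs) powr (- a0 p)\<close>,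
  the anticipated mean discount factor at the threshold.\<close>

lemma dual_value:
 assumes y: "zs < y"
 shows "f_hat p y + y * zf y = - (y powr eps p / ((gam p - 1) * Pp p) - D * zs powr eps p * (y / zs) powr (- a0 p) / (gam p - 1))"
proof -
 have y0: "0 < y" using y zs_pos by simp
 have n: "Pp p ~= 0" "eps p ~= 0" "gam p - 1 ~= 0" "1 + a0 p ~= 0" using Phi_less eps_bounds par a0 by auto
 have f: "f_hat p y = - (y powr eps p / (eps p * Pp p)) + A0 p * (y / zs) powr (- a0 p)"
 using y unfolding f_hat_def u_hat_def gam_hat_eps by (simp add: divide_inverse)
 have "y * y powr (- 1 / gam p) = y powr eps p"
 using young1_eq(2)[OF y0 refl] .
 moreover have "y * (C2 * y powr (- a0 p - 1)) = a0 p * A0 p * (y / zs) powr (- a0 p)"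
 unfolding C2_def using y0 zs_pos by (simp add: powr_diff powr_divide powr_minus field_simps)
 ultimately have yz: "y * zf y = y powr eps p / Pp p + a0 p * A0 p * (y / zs) powr (- a0 p)"
 unfolding zf_def by (simp add: distrib_left mult.left_commute[of y])
 have "1 / (eps p * Pp p) = 1 / Pp p + 1 / ((gam p - 1) * Pp p)"
 using n par by (simp add: eps_def field_simps)
 hence 1: "y powr eps p / (eps p * Pp p) = y powr eps p / Pp p + y powr eps p / ((gam p - 1) * Pp p)"
 by (metis distrib_left mult.right_neutral times_divide_eq_right)
 have "(1 + a0 p) * A0 p = D * zs powr eps p / (gam p - 1)" unfolding A0_eq using n by simp
 hence "A0 p * L + a0 p * A0 p * L = D * zs powr eps p * L / (gam p - 1)" for L by (metis distrib_right mult.commute mult_1 times_divide_eq_left)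
 thus ?thesis unfolding f yz 1 by simp
qed

end

context valid
begin

text \<open>\<open>c\<close> is the expenditure above subsistence with marginal utility
  \<open>y\<close>; \<open>b0\<close> and \<open>b1\<close> split it in the optimal fractions of
  \<open>utility_opt\<close>.\<close>

lemma pre_controls:
 fixes y :: real
 assumes y: "0 < y"
 defines "c \<equiv> phi p / Pp p * y powr (- 1 / gam p)"
 shows "b0 p y (price p / eff_pre p * y) = x_min p + (1 - beta p) * c"
 "b1 p y (price p / eff_pre p * y) = s_min p + beta p * (c / (price p / eff_pre p))"
 "0 < c" "- utility p (x_min p + (1 - beta p) * c) (s_min p + beta p * (c / (price p / eff_pre p))) = phi p / Pp p * (y powr eps p / (gam p - 1))"
proof -
 let ?N = "cost p (eff_pre p)"
 have N: "0 < ?N" using cost_pos par by simp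
 show c: "0 < c" unfolding c_def using phi_pos Phi_less y by simp
 have cy: "c = (y * ?N) powr eps p / y"
 proof -
 have "y * y powr (- 1 / gam p) = y powr eps p" using young1_eq(2)[OF y refl] .
 hence "y powr (- 1 / gam p) = y powr eps p / y" using y by (metis less_irrefl nonzero_mult_div_cancel_left)
 thus ?thesis unfolding c_def Phi_pre_Gam phi_Gam[OF par(5)] powr_mult by simp
 qed
 have q: "q p y (price p / eff_pre p * y) = y * ?N"
 proof -
 have "q p y (price p / eff_pre p * y) = (y powr (1 - beta p) * y powr beta p) * ?N"
 unfolding q_def cost_def powr_divide powr_mult by (simp add: mult_ac)
 also have "y powr (1 - beta p) * y powr beta p = y" using y by (simp add: powr_add[symmetric])
 finally show ?thesis .
 qed
 show "b0 p y (price p / eff_pre p * y) = x_min p + (1 - beta p) * c" unfolding b0_def q gam_hat_eps cy by simp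
 show "b1 p y (price p / eff_pre p * y) = s_min p + beta p * (c / (price p / eff_pre p))" unfolding b1_def q gam_hat_eps cy using par by (simp add: mult_ac)
 have "c / ?N = (y * ?N) powr (- 1 / gam p)"
 proof -
 have "y * ?N * (y * ?N) powr (- 1 / gam p) = (y * ?N) powr eps p" using young1_eq(2)[of "y * ?N", OF _ refl] y N by simp
 thus ?thesis unfolding cy using y N by (simp add: field_simps)
 qed
 from young1_eq(1)[OF _ this] have "(c / ?N) powr (1 - gam p) = phi p / Pp p * y powr eps p"
 using y N by (simp add: powr_mult Phi_pre_Gam phi_Gam par)
 thus "- utility p (x_min p + (1 - beta p) * c) (s_min p + beta p * (c / (price p / eff_pre p))) = phi p / Pp p * (y powr eps p / (gam p - 1))"
 unfolding utility_opt[OF par(5) c] by simp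
qed

end

lemma (in market_neg) value_F_le: "0 <= z_pre p w ==> 0 < y ==> value_F M F B p w <= ereal (f_hat p y + y * z_pre p w)"
 unfolding value_F_def by (intro SUP_least) (auto intro: payoff_le_dual)

context valid_neg
begin

lemma z_star_pos: "0 < z_post p (w_star p)" "Gp p * z_post p (w_star p) = zs powr (- 1 / gam p)"
proof -
 have "z_post p (w_star p) = z_pre p (w_star p) + theta p" by (simp add: z_pre_def z_post_def theta_def)
 hence e: "z_post p (w_star p) = zs powr (- 1 / gam p) / Gp p" unfolding w_star_z z_star by simp
 thus "0 < z_post p (w_star p)" "Gp p * z_post p (w_star p) = zs powr (- 1 / gam p)" using zs_pos Phi_less by auto
qed

end

section \<open>The waiting strategy\<close>

locale waiting_market = market_neg M F B p for M :: "'a measure" and F B p +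
 fixes y :: real
 assumes y: "zs < y"
begin

lemma y0: "0 < y" using y zs_pos by simp

text \<open>Wealth is reconstructed from the state price: the marginal value
  \<open>y * zeta t\<close> prescribes total wealth \<open>zf (y * zeta t)\<close>.\<close>

definition W :: "real => 'a => real" where "W t v = zf (y * zeta t v) - H_pre p"
definition T :: "'a => ennreal" where "T = hit W (w_star p)"
definition V :: "real => 'a => real" where "V = VP T (z_post p (w_star p))"

text \<open>The two powers of the state price in \<open>zf\<close>. By \<open>phq_shift\<close> the
  first finances consumption at rate \<open>phi p\<close>; the second has
  \<open>phq (e2 + 1) = 0\<close>, finances none, and carries the option to invest.\<close>

definition e1 :: real where "e1 = - 1 / gam p"
definition e2 :: real where "e2 = - a0 p - 1"
definition k1 :: real where "k1 = 1 / Pp p * y powr e1"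
definition k2 :: real where "k2 = C2 * y powr e2"

lemma zf_zeta: "zf (y * zeta t v) = k1 * zeta t v powr e1 + k2 * zeta t v powr e2"
 unfolding zf_def k1_def k2_def e1_def e2_def powr_mult by simp

lemma Y_pos: "0 < y * zeta t v" using y0 zeta_pos by simp

lemma W_continuous: "v : space M ==> Con {0..} (%t. W t v)"
 unfolding W_def zf_zeta by (intro continuous_on_diff continuous_on_add zeta_powr_continuous continuous_on_const)

lemma W_progressive: "prog F W"
 using progressive_diff[OF progressive_add[OF zeta_powr_progressive[of k1 e1] zeta_powr_progressive[of k2 e2]] progressive_const[of F "H_pre p"]]
 unfolding W_def[abs_def] zf_zeta .

lemma T: "Stop F T"
 unfolding T_def by (rule hit_stopping[OF progressive_adapted[OF W_progressive] W_continuous])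

lemma W_range: "0 <= t ==> ennreal t < T v ==> W t v < w_star p" unfolding T_def by (rule hit_before)

lemma zW: "z_pre p (W t v) = zf (y * zeta t v)" by (simp add: z_pre_def W_def)

lemma Y_above: "0 <= t ==> ennreal t < T v ==> zs < y * zeta t v"
proof -
 assume "0 <= t" "en t < T v"
 from W_range[OF this] have "zf (y * zeta t v) < zf zs" unfolding zW[symmetric] zf_zs by (simp add: z_pre_def)
 thus ?thesis using zf_less_iff[OF zs_pos Y_pos] by blast
qed

lemma W_0: "W 0 v = zf y - H_pre p" by (simp add: W_def zeta_0)

lemma at_T: "v : space M ==> T v ~= \<top> ==> W (er (T v)) v = w_star p & y * zeta (er (T v)) v = zs"
proof -
 assume v: "v : space M" "T v ~= \<top>"
 hence t: "hit W (w_star p) v = en (er (T v))" unfolding T_def by (simp add: less_top)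
 have "zf y < zf zs" by (rule zf_less[OF zs_pos y])
 hence "W 0 v <= w_star p" unfolding W_0 zf_zs by (simp add: z_pre_def)
 from hit_level[OF W_continuous[OF v(1)] this t enn2real_nonneg] have w: "W (er (T v)) v = w_star p" .
 hence "zf (y * zeta (er (T v)) v) = zf zs" unfolding zW[symmetric] zf_zs by simp
 thus ?thesis using w yv_zf[OF Y_pos] yv_zf[OF zs_pos] by metis
qed

lemma gval_star: "- gval (z_post p (w_star p)) = zs powr eps p / ((gam p - 1) * Gp p)"
 unfolding gval_def z_star_pos(2) young1_eq(1)[OF zs_pos refl] by simp

text \<open>As \<open>zf\<close> is injective, zero wealth corresponds to at most one level of the
  state price.\<close>

lemma not_level: "AE v in M. AE u in lborel. 0 <= u --> W u v ~= 0"
proof -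
 have "AE v in M. AE u in lborel. 0 <= u --> 0 <= en u --> zeta u v ~= (%_ _. yv (H_pre p) / y) (er 0) v"
 by (rule level_null[OF const_stopping progressive_const continuous_on_const])
 thus ?thesis
 proof eventually_elim
 case (elim v)
 thus ?case
 proof eventually_elim
 case (elim u)
 show ?case
 proof (intro impI notI)
 assume u: "0 <= u" "W u v = 0"
 hence "yv (H_pre p) = y * zeta u v" using yv_zf[OF Y_pos, of u v] by (simp add: W_def)
 thus False using elim u y0 by simp
 qed
 qed
 qed
qed

context
 fixes a x s :: "real => 'a => real"
 assumes axs: "!!t v. v : space M ==> 0 <= t ==> ennreal t < T v ==>
 a t v = - (kappa p / sigma_S p) * (y * zeta t v / (W t v * inverse (zf' (y * zeta t v)))) &
 x t v = x_min p + (1 - beta p) * (phi p / Pp p * (y * zeta t v) powr e1) &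
 s t v = s_min p + beta p * (phi p / Pp p * (y * zeta t v) powr e1 / (price p / eff_pre p))"
 and pr: "prog F a" "prog F x" "prog F s"
begin

text \<open>An integral up to \<open>T\<close> is represented as the one started at 0 minus the one
  switched on at \<open>T\<close>.\<close>

abbreviation "H0 k e \<equiv> HH (%_. 0) (%_ _. k) (- e * kappa p) (dh p - phq e)"
abbreviation "HT k e \<equiv> HH T (%_ _. k) (- e * kappa p) (dh p - phq e)"
abbreviation "D0 k e u v \<equiv> (dh p - phq e) * (GG (%_. 0) (%_ _. k) u v * EE (- e * kappa p) (dh p - phq e) u v)"
abbreviation "DT k e u v \<equiv> (dh p - phq e) * (GG T (%_ _. k) u v * EE (- e * kappa p) (dh p - phq e) u v)"

lemma HD: "H0 k e u v - HT k e u v = of_bool (en u < T v) * (- e * kappa p * (k * zeta u v powr e))"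
 "D0 k e u v - DT k e u v = of_bool (en u < T v) * ((dh p - phq e) * (k * zeta u v powr e))"
 unfolding HH_def GG_def zeta_EE by (auto simp: not_less[symmetric])

text \<open>Total wealth is a sum of two powers of the state price, each represented by a difference
  of two explicit integrals; \<open>phq_shift\<close> matches the drift for both.\<close>

lemma pre_sde: "wealth_sde M F B p (income p) (eff_pre p) (%_. 0) (zf y - H_pre p) T a x s W"
proof -
 let ?c = "%t v. phi p / Pp p * (y * zeta t v) powr e1"
 have sg: "sigma_S p ~= 0" using par by simp
 have aW: "a u v * sigma_S p * W u v = - e1 * kappa p * (k1 * zeta u v powr e1) + - e2 * kappa p * (k2 * zeta u v powr e2)"
 if "v : space M" "0 <= u" "en u < T v" "W u v ~= 0" for u v
 proof -
 let ?Y = "y * zeta u v"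
 have "zf' ?Y ~= 0" using zf'_neg[OF Y_pos] by (metis less_irrefl)
 moreover have "- (k / g) * (Y / (w * inverse d)) * g * w = - k * (Y * d)" if "w ~= 0" "g ~= 0" for k g Y w d :: real
 proof -
 have "- (k / g) * (Y / (w * inverse d)) * g * w = - k * (Y * d) * (inverse g * g) * (inverse w * w)" by (simp add: divide_inverse mult_ac)
 thus ?thesis using that by simp
 qed
 ultimately have "a u v * sigma_S p * W u v = - kappa p * (?Y * zf' ?Y)" using axs[OF that(1-3)] that(4) sg by metis
 thus ?thesis unfolding zf'_times[OF Y_pos] e1_def[symmetric] e2_def[symmetric] powr_mult k1_def k2_def by (simp add: algebra_simps)
 qed
 have L: "LSI (%t v. (H0 k1 e1 t v + - 1 * HT k1 e1 t v) + 1 * (H0 k2 e2 t v + - 1 * HT k2 e2 t v))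
 (%t v. (IT (%_. 0) (%_ _. k1) (- e1 * kappa p) (dh p - phq e1) t v + - 1 * IT T (%_ _. k1) (- e1 * kappa p) (dh p - phq e1) t v)
 + 1 * (IT (%_. 0) (%_ _. k2) (- e2 * kappa p) (dh p - phq e2) t v + - 1 * IT T (%_ _. k2) (- e2 * kappa p) (dh p - phq e2) t v))"
 by (intro LSI_lin LSI_HH T const_stopping progressive_const continuous_on_const)
 show ?thesis
 proof (rule sde_intro[OF const_stopping T pr W_progressive L, where D="%u v. (D0 k1 e1 u v - DT k1 e1 u v) + (D0 k2 e2 u v - DT k2 e2 u v)"])
 show "AE v in M. AE u in lborel. 0 <= u --> active (%_. 0) T u v * (a u v * sigma_S p * W u v) =
 (H0 k1 e1 u v + - 1 * HT k1 e1 u v) + 1 * (H0 k2 e2 u v + - 1 * HT k2 e2 u v)"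
 using not_level AE_space
 proof eventually_elim
 case (elim v)
 from elim(1) show ?case
 proof eventually_elim
 case (elim u)
 show ?case using elim aW[of v u] \<open>v : space M\<close> HD(1)[of k1 e1 u v] HD(1)[of k2 e2 u v] by (cases "en u < T v") (auto simp: active_def)
 qed
 qed
 show "AE v in M. AE u in lborel. 0 <= u --> active (%_. 0) T u v * wealth_drift p (income p) (eff_pre p) (a u v) (x u v) (s u v) (W u v) =
 (D0 k1 e1 u v - DT k1 e1 u v) + (D0 k2 e2 u v - DT k2 e2 u v)"
 using not_level AE_space
 proof eventually_elim
 case (elim v)
 from elim(1) show ?case
 proof eventually_elim
 case (elim u)
 show ?case
 proof (cases "en u < T v & 0 <= u")
 case True
 let ?W = "W u v" and ?p = "k1 * zeta u v powr e1" and ?q = "k2 * zeta u v powr e2"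
 have aw: "a u v * sigma_S p * ?W = - e1 * kappa p * ?p + - e2 * kappa p * ?q" using True elim \<open>v : space M\<close> by (intro aW) auto
 have k: "(mu_S p - mu_R p) * (a u v * ?W) = kappa p * (a u v * sigma_S p * ?W)" using sg by (simp add: kappa_def)
 have "x u v + s u v / eff_pre p * price p = x_min p + s_min p / eff_pre p * price p + ?c u v"
 proof -
 have "xm + (1 - b) * c + (sm + b * (c / (P / e))) / e * P = xm + sm / e * P + c" if "e ~= 0" "P ~= 0" for xm b c sm P e :: real
 proof -
 have "(sm + b * (c / (P / e))) / e * P = sm / e * P + b * c" using that by (simp add: field_simps)
 thus ?thesis by (simp add: left_diff_distrib)
 qed
 moreover have "eff_pre p ~= 0" "price p ~= 0" using par by auto
 ultimately show ?thesis using True axs[OF \<open>v : space M\<close>, of u] by metis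
 qed
 moreover have "?c u v = phi p * ?p" unfolding k1_def powr_mult by simp
 moreover have "mu_R p * ?W = mu_R p * (?p + ?q) - (income p - x_min p - s_min p / eff_pre p * price p)"
 unfolding W_def zf_zeta using par by (simp add: H_pre_def right_diff_distrib)
 moreover have "wealth_drift p (income p) (eff_pre p) (a u v) (x u v) (s u v) ?W = mu_R p * ?W + (mu_S p - mu_R p) * (a u v * ?W) + income p - (x u v + s u v / eff_pre p * price p)"
 unfolding wealth_drift_def by (simp add: algebra_simps)
 ultimately have "wealth_drift p (income p) (eff_pre p) (a u v) (x u v) (s u v) ?W = (mu_R p - (kappa p)^2 * e1 - phi p) * ?p + (mu_R p - (kappa p)^2 * e2 - 0) * ?q"
 unfolding k aw by (simp add: algebra_simps power2_eq_square)
 also have "phi p = phq (e1 + 1)" using neg_inv_gam by (simp add: e1_def phq_eps)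
 also have "0 = phq (e2 + 1)" using a0 by (simp add: e2_def)
 finally have "wealth_drift p (income p) (eff_pre p) (a u v) (x u v) (s u v) ?W = (dh p - phq e1) * ?p + (dh p - phq e2) * ?q"
 unfolding phq_shift .
 thus ?thesis unfolding HD using True by (simp add: active_def)
 next
 case False
 thus ?thesis unfolding HD by (auto simp: active_def)
 qed
 qed
 qed
 show "AE v in M. ALL t>=0. SI {0..t} (%u. (D0 k1 e1 u v - DT k1 e1 u v) + (D0 k2 e2 u v - DT k2 e2 u v))"
 by (rule AE_I2, intro allI impI set_integral_add set_integral_diff GE_total(1))
 show "AE v in M. ALL t>=0. 0 <= en t & en t <= T v --> W t v = zf y - H_pre p + LI {0..t} (%u. (D0 k1 e1 u v - DT k1 e1 u v) + (D0 k2 e2 u v - DT k2 e2 u v)) +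
 ((IT (%_. 0) (%_ _. k1) (- e1 * kappa p) (dh p - phq e1) t v + - 1 * IT T (%_ _. k1) (- e1 * kappa p) (dh p - phq e1) t v)
 + 1 * (IT (%_. 0) (%_ _. k2) (- e2 * kappa p) (dh p - phq e2) t v + - 1 * IT T (%_ _. k2) (- e2 * kappa p) (dh p - phq e2) t v))"
 proof (rule AE_I2, intro allI impI)
 fix v and t :: real assume v: "v : space M" and t: "0 <= t" "0 <= en t & en t <= T v"
 have G0: "GG (%_. 0) (%_ _. k) t v = k" for k by (simp add: GG_def)
 \<comment> \<open>Up to and including \<open>T\<close>, the part switched on at \<open>T\<close>
   contributes nothing.\<close>
 have GT: "GG T (%_ _. k) t v * (f t v - f (er (T v)) v) = 0" for k and f :: "real => 'a => real"
 proof (cases "T v <= en t")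
 case True
 hence "T v = en t" using t by (auto intro: antisym)
 hence "er (T v) = t" using t by simp
 thus ?thesis by simp
 qed (simp add: GG_def)
 have z0: "LI {0..t} (%u. D0 k e u v) + IT (%_. 0) (%_ _. k) (- e * kappa p) (dh p - phq e) t v = k * (zeta t v powr e - 1)" for k e
 unfolding GE_total(2)[OF v t(1)] unfolding G0 zeta_EE[symmetric] by (simp add: zeta_0)
 have zT: "LI {0..t} (%u. DT k e u v) + IT T (%_ _. k) (- e * kappa p) (dh p - phq e) t v = 0" for k e
 unfolding GE_total(2)[OF v t(1)] by (rule GT)
 have i: "SI {0..t} (%u. D0 k e u v)" "SI {0..t} (%u. DT k e u v)" for k e by (rule GE_total(1)[OF v t(1)])+
 have e: "Wt = z + X + (i1 + - 1 * j1 + 1 * (i2 + - 1 * j2))"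
 if "Wt = z + P + Q" "X = a1 - b1 + (a2 - b2)" "a1 + i1 = P" "a2 + i2 = Q" "b1 + j1 = 0" "b2 + j2 = 0" for Wt z X P Q a1 a2 b1 b2 i1 i2 j1 j2 :: real
 using that by (algebra | auto simp: add_eq_0_iff algebra_simps)
 have "zf y = k1 + k2" by (simp add: zf_def k1_def k2_def e1_def e2_def)
 hence "W t v = zf y - H_pre p + k1 * (zeta t v powr e1 - 1) + k2 * (zeta t v powr e2 - 1)" unfolding W_def zf_zeta by (simp add: algebra_simps)
 moreover have "LI {0..t} (%u. (D0 k1 e1 u v - DT k1 e1 u v) + (D0 k2 e2 u v - DT k2 e2 u v)) =
 LI {0..t} (%u. D0 k1 e1 u v) - LI {0..t} (%u. DT k1 e1 u v) + (LI {0..t} (%u. D0 k2 e2 u v) - LI {0..t} (%u. DT k2 e2 u v))"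
 unfolding set_integral_add(2)[OF set_integral_diff(1)[OF i] set_integral_diff(1)[OF i]] set_integral_diff(2)[OF i] ..
 ultimately show "W t v = zf y - H_pre p + LI {0..t} (%u. (D0 k1 e1 u v - DT k1 e1 u v) + (D0 k2 e2 u v - DT k2 e2 u v)) +
 ((IT (%_. 0) (%_ _. k1) (- e1 * kappa p) (dh p - phq e1) t v + - 1 * IT T (%_ _. k1) (- e1 * kappa p) (dh p - phq e1) t v)
 + 1 * (IT (%_. 0) (%_ _. k2) (- e2 * kappa p) (dh p - phq e2) t v + - 1 * IT T (%_ _. k2) (- e2 * kappa p) (dh p - phq e2) t v))"
 by (rule e[OF _ _ z0 z0 zT zT])
 qed
 qed
qed

lemma pre_utility: "v : space M ==> 0 <= t ==> ennreal t < T v ==>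
 du p x s t v = phi p / Pp p * (y powr eps p / (gam p - 1)) * ex (eps p) t v"
 using axs[of v t] pre_controls(4)[OF Y_pos, of t v] unfolding e1_def[symmetric] ex_zeta powr_mult by simp

end

end

context market
begin

lemma stopping_M: "Stop F ta ==> ta : Bm M"
proof (rule borel_measurableI_le)
 fix c :: ennreal assume ta: "Stop F ta"
 show "{v : space M. ta v <= c} : sets M"
 using pred_le_M[OF ta] by (cases c) (auto simp: pred_def)
qed

lemma if_progressive:
 assumes ta: "Stop F ta" and "prog F X" "prog F Y"
 shows "prog F (%t v. if en t < ta v then X t v else Y t v)"
proof -
 have "prog F (%t v. of_bool (en t < ta v) * X t v + of_bool (ta v <= en t) * Y t v)"
 by (intro progressive_add progressive_mult progressive_pre progressive_stopping assms)
 thus ?thesis by (rule progressive_cong[THEN iffD1, rotated 2]) (auto simp: not_less[symmetric])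
qed

context
 fixes x s :: "real => 'a => real" assumes x: "prog F x" and s: "prog F s"
begin

lemma jj_progressive:
 assumes "Stop F sx" "Stop F ta"
 shows "prog F (%t v. active sx ta t v * (du p x s t v))"
proof (rule active_progressive[OF assms])
 have "(%(x, y). utility p x y) : Bm (borel >< borel)" unfolding utility_def by measurable
 from progressive_comp2[OF x s this] have u: "prog F (%t v. utility p (x t v) (s t v))" .
 show "prog F (%t v. du p x s t v)"
 by (rule progressive_comp_time[OF u, of "%t x. exp (- dh p * t) * - x"]) measurable
qed

lemma JJ_Ici: "JJ x s sx ta v = NS lborel {0..} (%t. en (active sx ta t v * (du p x s t v)))"
 unfolding JJ_def by (intro nn_integral_cong) (auto simp: active_def indicator_def)

lemma JJ_M: "Stop F sx ==> Stop F ta ==> JJ x s sx ta : Bm M"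
 unfolding JJ_Ici[abs_def] by (rule integral_Ici_M[OF jj_progressive])

lemma JJ_split:
 assumes ta: "Stop F ta" and v: "v : space M"
 shows "JJ x s (%_. 0) (%_. \<infinity>) v = JJ x s (%_. 0) ta v + JJ x s ta (%_. \<infinity>) v"
proof -
 note st = const_stopping
 have "JJ x s (%_. 0) ta v + JJ x s ta (%_. \<infinity>) v = NI lborel (%t. en (active (%_. 0) ta t v * (du p x s t v)) * Ind {0..} t +
 en (active ta (%_. \<infinity>) t v * (du p x s t v)) * Ind {0..} t)"
 unfolding JJ_Ici by (rule nn_integral_add[symmetric]) (intro path_measurable_Ici jj_progressive ta st v)+
 also have "... = JJ x s (%_. 0) (%_. \<infinity>) v"
 unfolding JJ_Ici by (intro nn_integral_cong) (auto simp: active_def not_less[symmetric])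
 finally show ?thesis ..
qed

end

end

section \<open>Cost of the waiting strategy\<close>

context waiting_market
begin

text \<open>Mean discount factor at the investment time, with paths that never invest counted as
  0.\<close>

definition Lq :: ennreal where "Lq = NI M (%v. disc p T v)"
definition l :: real where "l = er Lq"

lemma disc_M: "(%v. if T v = \<top> then 0 else en (exp (- dh p * er (T v)))) : Bm M"
 using stopping_M[OF T] by measurable

lemma Lq: "Lq = en l" "0 <= l"
proof -
 have "Lq <= NI M (%v. 1)" unfolding Lq_def using par by (intro nn_integral_mono) (auto simp: mult_nonneg_nonneg)
 hence "Lq <= 1" by (simp add: emeasure_space_1)
 hence "Lq < \<top>" using le_less_trans by fastforce
 thus "Lq = en l" "0 <= l" by (auto simp: l_def)
qed

text \<open>Optional stopping of the martingale \<open>ex (- a0 p)\<close> at \<open>T\<close> cut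
  off at \<open>n\<close>. On paths with \<open>T <= n\<close> it is a fixed multiple of the
  discount factor, since the state price sits at \<open>zs\<close>; on the others the price is above
  \<open>zs\<close> and the contribution is at most the same multiple of
  \<open>exp (- dh p * n)\<close>, which vanishes in the limit.\<close>

lemma l_ge: "(y / zs) powr (- a0 p) <= l"
proof -
 let ?q = "(y / zs) powr a0 p"
 have q: "0 < ?q" using y0 zs_pos by simp
 have bd: "1 <= ?q * (l + exp (- dh p * real n))" for n
 proof -
 have "1 = NI M (%v. en (ex (- a0 p) (stop_at T (real n) v) v))"
 using nn_eq[OF T of_nat_0_le_iff, of "- a0 p" n] nn_0[OF T of_nat_0_le_iff a0(2), of n] a0(2) by simp
 also have "... <= NI M (%v. en ?q * disc p T v + en (?q * exp (- dh p * real n)))"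
 proof (rule nn_integral_mono)
 fix v assume v: "v : space M"
 have b: "ex (- a0 p) t v <= ?q * exp (- dh p * t)" if "zs <= y * zeta t v" for t
 proof -
 have "zs / y <= zeta t v" using that y0 by (simp add: field_simps)
 hence "zeta t v powr (- a0 p) <= (zs / y) powr (- a0 p)" using zs_pos y0 a0 by (intro powr_mono2') auto
 also have "(zs / y) powr (- a0 p) = ?q" unfolding powr_divide powr_minus by (simp add: divide_inverse mult.commute)
 finally show ?thesis unfolding ex_zeta by (simp add: mult.commute[of ?q])
 qed
 show "en (ex (- a0 p) (stop_at T (real n) v) v) <= en ?q * disc p T v + en (?q * exp (- dh p * real n))"
 proof (cases "T v <= en (real n)")
 case True
 hence f: "T v ~= \<top>" by (auto simp: top_unique)
 have "en (ex (- a0 p) (er (T v)) v) <= en (?q * exp (- dh p * er (T v)))"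
 using at_T[OF v f] by (intro ennreal_leI b) simp
 hence "en (ex (- a0 p) (er (T v)) v) <= en ?q * en (exp (- dh p * er (T v)))" by (simp add: ennreal_mult')
 thus ?thesis using True f by (simp add: stop_at_eq add_increasing2)
 next
 case False
 hence "en (ex (- a0 p) (real n) v) <= en (?q * exp (- dh p * real n))"
 using Y_above[of "real n" v] by (intro ennreal_leI b) (auto simp: not_le)
 thus ?thesis using False by (simp add: stop_at_eq add_increasing)
 qed
 qed
 also have "... = en ?q * Lq + en (?q * exp (- dh p * real n))"
 unfolding Lq_def using disc_M by (simp add: nn_integral_add nn_integral_cmult emeasure_space_1)
 also have "... = en (?q * l + ?q * exp (- dh p * real n))" unfolding Lq(1) using q Lq(2) by (simp add: ennreal_mult'[symmetric])
 finally have "en 1 <= en (?q * l + ?q * exp (- dh p * real n))" by simp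
 hence "1 <= ?q * l + ?q * exp (- dh p * real n)"
 by (subst (asm) ennreal_le_iff) (use q Lq(2) in \<open>auto intro!: add_nonneg_nonneg\<close>)
 thus ?thesis by (simp add: distrib_left)
 qed
 have "(%n. ?q * (l + exp (- dh p * real n))) ----> ?q * (l + 0)" by (intro tendsto_intros exp_decay par)
 hence "1 <= ?q * (l + 0)" using bd by (intro LIMSEQ_le_const) auto
 thus ?thesis using q by (simp add: powr_minus inverse_eq_divide divide_le_eq mult.commute)
qed

text \<open>The cost of waiting found in \<open>pre_cost\<close>, still in terms of the mean
  discount factor \<open>l\<close>.\<close>

definition cost_total :: real where "cost_total = y powr eps p / ((gam p - 1) * Pp p) - D * zs powr eps p * l / (gam p - 1)"

lemma cost_total_le: "f_hat p y + y * zf y <= - cost_total"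
proof -
 have "D * zs powr eps p * (y / zs) powr (- a0 p) / (gam p - 1) <= D * zs powr eps p * l / (gam p - 1)"
 using l_ge D_pos par by (intro divide_right_mono mult_left_mono) auto
 thus ?thesis unfolding dual_value[OF y] cost_total_def by simp
qed

context
 fixes x s :: "real => 'a => real"
 assumes pre: "!!v t. v : space M ==> 0 <= t ==> ennreal t < T v ==>
 du p x s t v = phi p / Pp p * (y powr eps p / (gam p - 1)) * ex (eps p) t v"
 and xs: "prog F x" "prog F s"
begin

text \<open>The integral up to \<open>T\<close> is obtained by difference. By \<open>tail\<close>,
  started at 0 and at \<open>T\<close>, the whole integral of \<open>ex (eps p)\<close> has mean
  \<open>1 / phi p\<close>, and the part after \<open>T\<close> is \<open>r / phi p\<close> times
  the mean discount factor.\<close>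

lemma pre_cost: "0 <= cost_total" "NI M (%v. JJ x s (%_. 0) T v) + en (- gval (z_post p (w_star p))) * Lq = en cost_total"
proof -
 let ?k = "phi p / Pp p * (y powr eps p / (gam p - 1))"
 let ?f = "%t v. of_bool (en t < T v) * ex (eps p) t v" and ?g = "%t v. of_bool (T v <= en t) * (1 * ex (eps p) t v)"
 have k: "0 <= ?k" using phi_pos Phi_less par by simp
 have e: "0 < phq (eps p)" by (simp add: phq_eps phi_pos)
 have fp: "prog F ?f" "prog F ?g" using ex_progressive[of "eps p"] by (auto intro!: progressive_mult progressive_pre progressive_stopping T)
 define X where "X = NI M (%v. NS lborel {0..} (%t. en (?f t v)))"
 \<comment> \<open>At \<open>T\<close> the price \<open>y * zeta\<close> equals \<open>zs\<close>,
   so \<open>r\<close> is the value of \<open>zeta powr eps p\<close> there.\<close>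
 define r where "r = (zs / y) powr eps p"
 have r: "0 < r" "r * y powr eps p = zs powr eps p" using zs_pos y0 by (auto simp: r_def powr_divide)
 have A: "NI M (%v. JJ x s (%_. 0) T v) = en ?k * X"
 proof -
 have "NI M (%v. JJ x s (%_. 0) T v) = NI M (%v. en ?k * NS lborel {0..} (%t. en (?f t v)))"
 proof (rule nn_integral_cong)
 fix v assume v: "v : space M"
 have "JJ x s (%_. 0) T v = NI lborel (%t. en ?k * (en (?f t v) * Ind {0..} t))"
 unfolding JJ_def
 proof (rule nn_integral_cong)
 fix t
 show "en (active (%_. 0) T t v * (du p x s t v)) = en ?k * (en (?f t v) * Ind {0..} t)"
 using pre[OF v, of t] ennreal_mult'[OF k] by (cases "0 <= t & en t < T v") (auto simp: active_def simp del: mult_minus_right)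
 qed
 thus "JJ x s (%_. 0) T v = en ?k * NS lborel {0..} (%t. en (?f t v))"
 unfolding nn_integral_cmult[OF path_measurable_Ici[OF fp(1) v]] .
 qed
 thus ?thesis unfolding X_def nn_integral_cmult[OF integral_Ici_M[OF fp(1)]] .
 qed
 have S: "X + en (r / phi p) * Lq = en (1 / phi p)"
 proof -
 have "NI M (%v. NS lborel {0..} (%t. en (?g t v))) = NI M (%v. en (r / phi p) * disc p T v)"
 proof -
 have "(if T v = \<top> then 0 else en (1 * ex (eps p) (er (T v)) v / phq (eps p))) = en (r / phi p) * disc p T v" if v: "v : space M" for v
 proof (cases "T v = \<top>")
 case False
 hence "zeta (er (T v)) v = zs / y" using at_T[OF v False] y0 by (simp add: field_simps)
 hence "ex (eps p) (er (T v)) v / phq (eps p) = r / phi p * exp (- dh p * er (T v))" unfolding ex_zeta phq_eps r_def by simp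
 moreover have "en (r / phi p * exp (- dh p * er (T v))) = en (r / phi p) * en (exp (- dh p * er (T v)))"
 by (rule ennreal_mult') (use r phi_pos in simp)
 ultimately show ?thesis using False by simp
 qed simp
 thus ?thesis unfolding tail[OF T progressive_const continuous_on_const zero_le_one e] by (rule nn_integral_cong)
 qed
 also have "... = en (r / phi p) * Lq" unfolding Lq_def by (rule nn_integral_cmult[OF disc_M])
 finally have "X + en (r / phi p) * Lq = NI M (%v. NS lborel {0..} (%t. en (?f t v)) + NS lborel {0..} (%t. en (?g t v)))"
 unfolding X_def by (simp only: nn_integral_add[OF integral_Ici_M[OF fp(1)] integral_Ici_M[OF fp(2)]])
 also have "... = NI M (%v. NS lborel {0..} (%t. en (of_bool (0 <= en t) * (1 * ex (eps p) t v))))"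
 proof (rule nn_integral_cong)
 fix v assume v: "v : space M"
 show "NS lborel {0..} (%t. en (?f t v)) + NS lborel {0..} (%t. en (?g t v)) = NS lborel {0..} (%t. en (of_bool (0 <= en t) * (1 * ex (eps p) t v)))"
 unfolding nn_integral_add[OF path_measurable_Ici[OF fp(1) v] path_measurable_Ici[OF fp(2) v], symmetric]
 by (intro nn_integral_cong) (auto simp: not_less[symmetric])
 qed
 also have "... = en (1 / phi p)"
 unfolding tail[OF const_stopping[of 0] progressive_const continuous_on_const zero_le_one e] by (simp add: ex_zeta zeta_0 phq_eps emeasure_space_1)
 finally show ?thesis .
 qed
 have "X ~= \<top>" using S by auto
 then obtain xi where xi: "X = en xi" "0 <= xi" by (cases X) auto
 have rl: "0 <= r / phi p * l" using r phi_pos Lq by simp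
 have "en (xi + r / phi p * l) = en (1 / phi p)"
 using S unfolding xi(1) Lq(1) ennreal_plus[OF xi(2) rl] by (subst ennreal_mult') (use r phi_pos in simp_all)
 hence "xi + r / phi p * l = 1 / phi p" using xi rl phi_pos by (subst (asm) ennreal_inj) auto
 hence xie: "phi p * xi = 1 - r * l" using phi_pos by (simp add: field_simps)
 let ?g' = "zs powr eps p / ((gam p - 1) * Gp p)"
 have g: "0 <= ?g'" using Phi_less par by simp
 have "?k * xi + ?g' * l = cost_total"
 proof -
 have "?k * xi = y powr eps p / ((gam p - 1) * Pp p) * (phi p * xi)" by (simp add: mult_ac)
 also have "... = y powr eps p / ((gam p - 1) * Pp p) - (r * y powr eps p) * l / ((gam p - 1) * Pp p)"
 unfolding xie by (simp add: right_diff_distrib)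
 also have "... + ?g' * l = cost_total" unfolding r(2) cost_total_def D_def
 proof -
 have "A - z * l / (g * P) + z / (g * G) * l = A - (1 / P - 1 / G) * z * l / g" for A z g P G :: real
 by (simp add: divide_inverse algebra_simps)
 thus "y powr eps p / ((gam p - 1) * Pp p) - zs powr eps p * l / ((gam p - 1) * Pp p) + zs powr eps p / ((gam p - 1) * Gp p) * l =
 y powr eps p / ((gam p - 1) * Pp p) - (1 / Pp p - 1 / Gp p) * zs powr eps p * l / (gam p - 1)" .
 qed
 finally show ?thesis .
 qed
 moreover have "0 <= ?k * xi" "0 <= ?g' * l" by (rule mult_nonneg_nonneg[OF k xi(2)] mult_nonneg_nonneg[OF g Lq(2)])+
 moreover have "en ?k * X + en ?g' * Lq = en (?k * xi) + en (?g' * l)" unfolding xi(1) Lq(1) by (simp only: ennreal_mult'[OF k] ennreal_mult'[OF g])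
 ultimately show "0 <= cost_total" "NI M (%v. JJ x s (%_. 0) T v) + en (- gval (z_post p (w_star p))) * Lq = en cost_total"
 unfolding A gval_star by (auto simp flip: ennreal_plus)
qed

lemma waiting_payoff: "payoff M F B p x s T W = ereal (- cost_total)"
proof -
 have "NI M (%v. JJ x s (%_. 0) T v + (if T v = \<infinity> then 0 else en (exp (- dh p * er (T v))) * e2ennreal (- value_G M F B p (W (er (T v)) v)))) =
 NI M (%v. JJ x s (%_. 0) T v + en (- gval (z_post p (w_star p))) * disc p T v)"
 using at_T value_G_eq[OF z_star_pos(1)] by (intro nn_integral_cong) (auto simp: e2ennreal_ereal mult.commute)
 also have "... = NI M (%v. JJ x s (%_. 0) T v) + en (- gval (z_post p (w_star p))) * Lq"
 unfolding Lq_def using JJ_M[OF xs const_stopping T] disc_M by (simp add: nn_integral_add nn_integral_cmult)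
 finally show ?thesis unfolding payoff_JJ pre_cost(2) using pre_cost(1) by simp
qed

text \<open>After \<open>T\<close> the post-investment controls cost exactly the reward credited at
  \<open>T\<close>, so running the controls forever has the same payoff.\<close>

lemma waiting_total:
 assumes post: "NI M (%v. JJ x s T (%_. \<infinity>) v) = NI M (%v. (if T v = \<top> then 0 else en (exp (- dh p * er (T v)) * - gval (z_post p (w_star p)))))"
 shows "ereal_integral M (discounted_utility p x s (%_. 0) (%_. \<infinity>)) = ereal (- cost_total)"
proof -
 have g: "0 <= - gval (z_post p (w_star p))" using gval_neg[OF z_star_pos(1)] by simp
 have m: "en (E * - gval (z_post p (w_star p))) = en (- gval (z_post p (w_star p))) * en E" for E by (subst ennreal_mult''[OF g]) (rule mult.commute)
 have "NI M (%v. JJ x s T (%_. \<infinity>) v) = NI M (%v. en (- gval (z_post p (w_star p))) * disc p T v)"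
 unfolding post m by (intro nn_integral_cong) auto
 also have "... = en (- gval (z_post p (w_star p))) * Lq" unfolding Lq_def by (rule nn_integral_cmult[OF disc_M])
 finally have 2: "NI M (%v. JJ x s T (%_. \<infinity>) v) = en (- gval (z_post p (w_star p))) * Lq" .
 have "NI M (%v. JJ x s (%_. 0) (%_. \<infinity>) v) = NI M (%v. JJ x s (%_. 0) T v + JJ x s T (%_. \<infinity>) v)"
 by (rule nn_integral_cong[OF JJ_split[OF xs T]])
 also have "... = en cost_total" unfolding nn_integral_add[OF JJ_M[OF xs const_stopping T] JJ_M[OF xs T const_stopping]] 2 pre_cost(2) ..
 finally show ?thesis using post_payoff_JJ[of M x s] pre_cost(1) unfolding post_payoff_def by simp
qed

end

end

section \<open>Value function and feedback controls\<close>

context market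
begin

text \<open>With \<open>ta = 0\<close> the pre-investment wealth equation constrains only time 0,
  where integrand and drift are inactive, so the post-investment controls serve both
  problems.\<close>

lemma immediate:
 assumes z: "0 < z_post p w"
 shows "EX a x s W.
 (ALL t>=0. ALL v:space M. a t v = a_post p (W t v) & x t v = x_post p (W t v) & s t v = s_post p (W t v)) &
 admissible_post M F B p (%_. 0) w a x s W & post_payoff M p x s = value_G M F B p w &
 admissible M F B p w a x s (%_. 0) W & payoff M F B p x s (%_. 0) W = value_G M F B p w"
proof -
 obtain a x s W where *:
 "ALL t>=0. ALL v:space M. a t v = a_post p (W t v) & x t v = x_post p (W t v) & s t v = s_post p (W t v)"
 "admissible_post M F B p (%_. 0) w a x s W" "post_payoff M p x s = ereal (gval (z_post p w))"
 and pr: "prog F a" "prog F x" "prog F s" "prog F W" and W0: "ALL v. W 0 v = w"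
 by (rule immediate_investment[OF z]) (rule that, assumption+, blast)
 note st = const_stopping[of 0]
 have H: "LSI (HH (%_. 0) (%_ _. 0) 0 0) (IT (%_. 0) (%_ _. 0) 0 0)" by (rule LSI_HH[OF st progressive_const continuous_on_const])
 \<comment> \<open>The zero integral arises as a difference of two equal ones.\<close>
 have L: "LSI (%_ _. 0) (%_ _. 0)" using LSI_lin[OF H H, where m="- 1"] by simp
 have "wealth_sde M F B p (income p) (eff_pre p) (%_. 0) w (%_. 0) a x s W"
 by (rule sde_intro[OF st st pr L, where D="%_ _. 0"]) (auto simp: active_def W0 set_integrable_def)
 hence adm: "admissible M F B p w a x s (%_. 0) W" unfolding admissible_def using pr st z by (simp add: W0)
 have "payoff M F B p x s (%_. 0) W = ereal (gval (z_post p w))"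
 unfolding payoff_JJ using gval_neg[OF z] by (simp add: JJ_def active_def W0 value_G_eq[OF z] e2ennreal_ereal emeasure_space_1)
 thus ?thesis using * adm value_G_eq[OF z] by metis
qed

lemma value_G_le_F: "0 < z_post p w ==> value_G M F B p w <= value_F M F B p w"
proof -
 assume "0 < z_post p w"
 then obtain a x s W where "admissible M F B p w a x s (%_. 0) W" "payoff M F B p x s (%_. 0) W = value_G M F B p w" using immediate by metis
 thus ?thesis unfolding value_F_def by (intro SUP_upper2[of "(a, x, s, %_. 0, W)"]) auto
qed

lemma value_F_nonneg_theta: "0 <= theta p ==> 0 < z_post p w ==> value_F M F B p w = value_G M F B p w"
 using value_G_le_F[of w] unfolding value_F_def by (intro antisym SUP_least) (auto simp: value_G_eq intro: payoff_le_value)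

end

context market_neg
begin

text \<open>Above the threshold the marginal value of post-investment wealth is at most
  \<open>zs\<close>, where \<open>kfun\<close> vanishes; at this multiplier the dual bound is
  \<open>gval\<close>.\<close>

lemma value_F_above:
 assumes w: "w_star p <= w" shows "value_F M F B p w = value_G M F B p w"
proof -
 have le: "z_pre p (w_star p) <= z_pre p w" "z_post p (w_star p) <= z_post p w" using w by (auto simp: z_pre_def z_post_def)
 have z: "0 < z_post p w" using le z_star_pos by simp
 have z0: "0 <= z_pre p w" using le zf_zs zf_pos[OF zs_pos] by simp
 define y where "y = (Gp p * z_post p w) powr (- gam p)"
 note g = gval_eq[OF z y_def]
 have "zs powr (- 1 / gam p) <= Gp p * z_post p w" unfolding z_star_pos(2)[symmetric] using le Phi_less by simp
 hence "y <= (zs powr (- 1 / gam p)) powr (- gam p)" unfolding y_def using zs_pos par by (intro powr_mono2') auto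
 also have "... = zs" unfolding powr_powr using zs_pos par by simp
 finally have "f_hat p y + y * z_pre p w = - (y powr eps p / (eps p * Gp p)) + y * z_post p w"
 unfolding f_hat_kfun[OF g(1)] by (simp add: kfun_def z_pre_def z_post_def theta_def algebra_simps)
 hence "value_F M F B p w <= value_G M F B p w" using value_F_le[OF z0 g(1)] unfolding value_G_eq[OF z] g(2) by simp
 thus ?thesis using value_G_le_F[OF z] by simp
qed

end

context waiting_market
begin

text \<open>One set of controls, switched at \<open>T\<close>, serves the waiting problem and the
  continuation after investment. Before \<open>T\<close> they are given through the state price; the
  feedback form follows once the derivatives of the value function are known.\<close>

lemma waiting_optimal:
 obtains a x s where
 "a = (%t v. if en t < T v then - (kappa p / sigma_S p) * (y * zeta t v / (W t v * inverse (zf' (y * zeta t v)))) else a_post p (V t v))"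
 "x = (%t v. if en t < T v then x_min p + (1 - beta p) * (phi p / Pp p * (y * zeta t v) powr e1) else x_post p (V t v))"
 "s = (%t v. if en t < T v then s_min p + beta p * (phi p / Pp p * (y * zeta t v) powr e1 / (price p / eff_pre p)) else s_post p (V t v))"
 "admissible M F B p (zf y - H_pre p) a x s T W" "payoff M F B p x s T W = ereal (- cost_total)"
 "admissible_post M F B p T (w_star p) a x s V" "ereal_integral M (discounted_utility p x s (%_. 0) (%_. \<infinity>)) = ereal (- cost_total)"
proof -
 let ?a = "%q. - (kappa p / sigma_S p) * (y * q / ((zf (y * q) - H_pre p) * inverse (zf' (y * q))))"
 let ?x = "%q. x_min p + (1 - beta p) * (phi p / Pp p * (y * q) powr e1)"
 let ?s = "%q. s_min p + beta p * (phi p / Pp p * (y * q) powr e1 / (price p / eff_pre p))"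
 define a where "a = (%t v. if en t < T v then ?a (zeta t v) else a_post p (V t v))"
 define x where "x = (%t v. if en t < T v then ?x (zeta t v) else x_post p (V t v))"
 define s where "s = (%t v. if en t < T v then ?s (zeta t v) else s_post p (V t v))"
 have m: "?a : Bm borel" "?x : Bm borel" "?s : Bm borel" unfolding zf_def zf'_def by measurable
 have Vp: "prog F V" unfolding V_def by (rule VP_progressive[OF T z_star_pos(1)]) auto
 have pr: "prog F a" "prog F x" "prog F s"
 unfolding a_def x_def s_def
 by (rule if_progressive[OF T] progressive_comp[OF zeta_progressive] progressive_comp[OF Vp] m post_measurable)+
 have pre: "a t v = - (kappa p / sigma_S p) * (y * zeta t v / (W t v * inverse (zf' (y * zeta t v)))) &
 x t v = x_min p + (1 - beta p) * (phi p / Pp p * (y * zeta t v) powr e1) &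
 s t v = s_min p + beta p * (phi p / Pp p * (y * zeta t v) powr e1 / (price p / eff_pre p))"
 if "v : space M" "0 <= t" "en t < T v" for t v using that by (simp add: a_def x_def s_def W_def)
 have post: "a t v = a_post p (VP T (z_post p (w_star p)) t v) & x t v = x_post p (VP T (z_post p (w_star p)) t v) & s t v = s_post p (VP T (z_post p (w_star p)) t v)"
 if "v : space M" "0 <= t" "T v <= en t" for t v using that by (simp add: a_def x_def s_def V_def not_less[symmetric])
 note U = pre_utility[OF pre pr]
 have "x_min p < x t v & s_min p < s t v & 0 < z_pre p (W t v)" if "v : space M" "0 <= t" "en t < T v" for t v
 proof -
 have c: "0 < phi p / Pp p * (y * zeta t v) powr e1" using pre_controls(3)[OF Y_pos] unfolding e1_def .
 have "0 < (1 - beta p) * (phi p / Pp p * (y * zeta t v) powr e1)" by (rule mult_pos_pos[OF _ c]) (use par in simp)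
 moreover have "0 < beta p * (phi p / Pp p * (y * zeta t v) powr e1 / (price p / eff_pre p))"
 by (rule mult_pos_pos[OF _ divide_pos_pos[OF c divide_pos_pos]]) (use par in simp_all)
 ultimately show ?thesis
 unfolding zW conjunct1[OF conjunct2[OF pre[OF that]]] conjunct2[OF conjunct2[OF pre[OF that]]] less_add_same_cancel1 using zf_pos[OF Y_pos] by blast
 qed
 hence "admissible M F B p (zf y - H_pre p) a x s T W"
 unfolding admissible_def using pr T pre_sde[OF pre pr] at_T z_star_pos(1) by (auto intro!: AE_I2)
 moreover have "payoff M F B p x s T W = ereal (- cost_total)" by (rule waiting_payoff[OF U pr(2,3)])
 moreover have "admissible_post M F B p T (w_star p) a x s V"
 using post_admissible[OF T z_star_pos(1) post pr] unfolding V_def by (simp add: z_post_def)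
 moreover have "ereal_integral M (discounted_utility p x s (%_. 0) (%_. \<infinity>)) = ereal (- cost_total)"
 by (rule waiting_total[OF U pr(2,3) post_cost[OF T z_star_pos(1) post]])
 ultimately show thesis by (rule that[of a x s, rotated 3]) (simp_all only: a_def x_def s_def W_def)
qed

text \<open>The payoff \<open>- cost_total\<close> is at most the value, the value at most the dual
  objective at \<open>y\<close>, and this by \<open>l_ge\<close> at most
  \<open>- cost_total\<close>; so all three coincide.\<close>

lemma value_F_waiting: "value_F M F B p (zf y - H_pre p) = ereal (f_hat p y + y * zf y)" "- cost_total = f_hat p y + y * zf y"
proof -
 let ?w = "zf y - H_pre p"
 have z: "z_pre p ?w = zf y" by (simp add: z_pre_def)
 have "0 <= zf y" using zf_pos[OF y0] by simp
 hence 1: "value_F M F B p ?w <= ereal (f_hat p y + y * zf y)" using value_F_le[of ?w y] y0 unfolding z by blast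
 obtain a x s where "admissible M F B p ?w a x s T W" "payoff M F B p x s T W = ereal (- cost_total)" by (rule waiting_optimal)
 hence 2: "ereal (- cost_total) <= value_F M F B p ?w" unfolding value_F_def by (intro SUP_upper2[of "(a, x, s, T, W)"]) auto
 from order_trans[OF 2 1] cost_total_le show c: "- cost_total = f_hat p y + y * zf y" by simp
 show "value_F M F B p ?w = ereal (f_hat p y + y * zf y)" using 1 2 unfolding c by simp
qed

end

context market_neg
begin

context
 fixes w :: real assumes w: "0 < z_pre p w" "w < w_star p"
begin

lemma w_range: "z_pre p w < z_pre p (w_star p)" using w by (simp add: z_pre_def)

lemma value_F_below: "value_F M F B p w = ereal (f_hat p (yv (z_pre p w)) + yv (z_pre p w) * z_pre p w)"
proof -
 note yv = yv[OF w(1) w_range]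
 interpret W: waiting_market M F B p "yv (z_pre p w)" by unfold_locales (rule yv(1))
 show ?thesis using W.value_F_waiting(1) unfolding yv(2) by (simp add: z_pre_def)
qed

text \<open>The bound holds for every multiplier and is attained at
  \<open>yv (z_pre p w)\<close>.\<close>

lemma value_F_INF: "value_F M F B p w = (INF y\<in>{0<..}. ereal (f_hat p y + y * z_pre p w))"
proof (rule antisym)
 show "value_F M F B p w <= (INF y\<in>{0<..}. ereal (f_hat p y + y * z_pre p w))" using w(1) by (intro INF_greatest value_F_le) auto
 show "(INF y\<in>{0<..}. ereal (f_hat p y + y * z_pre p w)) <= value_F M F B p w"
 unfolding value_F_below using yv(1)[OF w(1) w_range] zs_pos by (intro INF_lower) auto
qed

end

text \<open>The dual bound at the multiplier optimal for \<open>u\<close> is an affine majorant that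
  touches the value at \<open>u\<close>. Hence \<open>yv\<close> gives supergradients and, being
  continuous, the derivative.\<close>

lemma dF_eq:
 assumes w: "0 < z_pre p w" "w < w_star p"
 shows "dF M F B p w = yv (z_pre p w)"
proof -
 let ?S = "{- H_pre p <..< w_star p}"
 have S: "u : ?S \<longleftrightarrow> 0 < z_pre p u & u < w_star p" for u by (auto simp: z_pre_def)
 have c: "isCont (%w. yv (z_pre p w)) w"
 using isCont_o2[where f="z_pre p" and g=yv and a=w, OF _ yv_deriv(1)[OF w(1) w_range[OF w]]] unfolding z_pre_def[abs_def] by (auto intro!: continuous_intros)
 have "real_of_ereal (value_F M F B p v) <= real_of_ereal (value_F M F B p u) + yv (z_pre p u) * (v - u)" if u: "u : ?S" and v: "v : ?S" for u v
 proof -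
 note u' = u[unfolded S] and v' = v[unfolded S]
 have "0 < yv (z_pre p u)" using yv(1)[of "z_pre p u"] w_range[of u] u' zs_pos by simp
 hence "value_F M F B p v <= ereal (f_hat p (yv (z_pre p u)) + yv (z_pre p u) * z_pre p v)" using v' by (intro value_F_le) auto
 moreover have "value_F M F B p u = ereal (f_hat p (yv (z_pre p u)) + yv (z_pre p u) * z_pre p u)" "EX r. value_F M F B p v = ereal r"
 using value_F_below u' v' by blast+
 moreover have "z_pre p v = z_pre p u + (v - u)" by (simp add: z_pre_def)
 ultimately show ?thesis by (auto simp: distrib_left)
 qed
 hence "((%w. real_of_ereal (value_F M F B p w)) has_real_derivative yv (z_pre p w)) (at w)"
 using w by (intro deriv_from_supergradient[of ?S, OF _ _ c]) (auto simp: z_pre_def)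
 thus ?thesis unfolding dF_def by (rule DERIV_imp_deriv)
qed

lemma d2F_eq:
 assumes w: "0 < z_pre p w" "w < w_star p"
 shows "d2F M F B p w = inverse (zf' (yv (z_pre p w)))"
proof -
 have "((%w. yv (w + H_pre p)) has_real_derivative inverse (zf' (yv (z_pre p w)))) (at w)"
 using yv_deriv(2)[OF w(1) w_range[OF w]] unfolding z_pre_def DERIV_shift .
 hence "(dF M F B p has_real_derivative inverse (zf' (yv (z_pre p w)))) (at w)"
 by (rule has_field_derivative_transform_within_open[of _ _ _ "{- H_pre p <..< w_star p}"]) (use w dF_eq in \<open>auto simp: z_pre_def\<close>)
 thus ?thesis unfolding d2F_def by (rule DERIV_imp_deriv)
qed

text \<open>Along the candidate, \<open>dF\<close> at the current wealth is
  \<open>yv (z_pre p w) * zeta t\<close>, because \<open>yv\<close> inverts \<open>zf\<close>; this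
  converts controls given through the state price into feedback form.\<close>

lemma wait_and_invest:
 assumes w: "0 < z_pre p w" "w < w_star p"
 shows "EX a x s ta W V.
 (ALL v:space M. ta v = (INF t\<in>{t. 0 <= t & W t v >= w_star p}. en t)) &
 (ALL t>=0. ALL v:space M.
 a t v = (if en t < ta v then a_pre M F B p (W t v) else a_post p (V t v)) &
 x t v = (if en t < ta v then x_pre M F B p (W t v) else x_post p (V t v)) &
 s t v = (if en t < ta v then s_pre M F B p (W t v) else s_post p (V t v))) &
 admissible M F B p w a x s ta W & payoff M F B p x s ta W = value_F M F B p w &
 admissible_post M F B p ta (w_star p) a x s V &
 ereal_integral M (discounted_utility p x s (%_. 0) (%_. \<infinity>)) = value_F M F B p w"
proof -
 note yv = yv[OF w(1) w_range[OF w]]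
 interpret Z: waiting_market M F B p "yv (z_pre p w)" by unfold_locales (rule yv(1))
 let ?Y = "%t v. yv (z_pre p w) * zeta t v"
 have e: "zf (yv (z_pre p w)) - H_pre p = w" unfolding yv(2) by (simp add: z_pre_def)
 have val: "ereal (- Z.cost_total) = value_F M F B p w" using Z.value_F_waiting unfolding e by simp
 obtain a x s where f:
 "a = (%t v. if en t < Z.T v then - (kappa p / sigma_S p) * (?Y t v / (Z.W t v * inverse (zf' (?Y t v)))) else a_post p (Z.V t v))"
 "x = (%t v. if en t < Z.T v then x_min p + (1 - beta p) * (phi p / Pp p * (?Y t v) powr Z.e1) else x_post p (Z.V t v))"
 "s = (%t v. if en t < Z.T v then s_min p + beta p * (phi p / Pp p * (?Y t v) powr Z.e1 / (price p / eff_pre p)) else s_post p (Z.V t v))"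
 and r: "admissible M F B p w a x s Z.T Z.W" "payoff M F B p x s Z.T Z.W = value_F M F B p w"
 "admissible_post M F B p Z.T (w_star p) a x s Z.V" "ereal_integral M (discounted_utility p x s (%_. 0) (%_. \<infinity>)) = value_F M F B p w"
 by (rule Z.waiting_optimal[unfolded e val])
 have pre: "a_pre M F B p (Z.W t v) = - (kappa p / sigma_S p) * (?Y t v / (Z.W t v * inverse (zf' (?Y t v)))) &
 x_pre M F B p (Z.W t v) = x_min p + (1 - beta p) * (phi p / Pp p * (?Y t v) powr Z.e1) &
 s_pre M F B p (Z.W t v) = s_min p + beta p * (phi p / Pp p * (?Y t v) powr Z.e1 / (price p / eff_pre p))"
 if "0 <= t" "en t < Z.T v" for t v
 proof -
 have b: "0 < z_pre p (Z.W t v)" "Z.W t v < w_star p" using Z.W_range[OF that] zf_pos[OF Z.Y_pos] by (auto simp: Z.zW)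
 show ?thesis unfolding a_pre_def x_pre_def s_pre_def dF_eq[OF b] d2F_eq[OF b] Z.zW yv_zf[OF Z.Y_pos] pre_controls(1,2)[OF Z.Y_pos] Z.e1_def by simp
 qed
 have A: "a t v = (if en t < Z.T v then a_pre M F B p (Z.W t v) else a_post p (Z.V t v)) &
 x t v = (if en t < Z.T v then x_pre M F B p (Z.W t v) else x_post p (Z.V t v)) &
 s t v = (if en t < Z.T v then s_pre M F B p (Z.W t v) else s_post p (Z.V t v))" if "0 <= t" for t v
 using pre[OF that, of v] unfolding f by (cases "en t < Z.T v") (simp_all only: if_True if_False simp_thms)
 have T: "Z.T v = (INF t\<in>{t. 0 <= t & Z.W t v >= w_star p}. en t)" for v unfolding Z.T_def hit_def ..
 show ?thesis
 by (rule exI[of _ a], rule exI[of _ x], rule exI[of _ s], rule exI[of _ Z.T], rule exI[of _ Z.W], rule exI[of _ Z.V])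
 (intro conjI ballI allI impI T r conjunct1[OF A] conjunct1[OF conjunct2[OF A]] conjunct2[OF conjunct2[OF A]])
qed

end

theorem theorem2:
  fixes M :: "'a measure"
    and F :: "real \<Rightarrow> 'a measure"
    and B :: "real \<Rightarrow> 'a \<Rightarrow> real"
    and p :: params
    and w :: real
  assumes BM: "brownian_motion M F B"
    and params: "valid_params p"
    and w: "w > - H_pre p - theta p"
  shows
    "Lambda p < 0 \<and>
     (theta p \<ge> 0 \<or> w \<ge> w_star p \<longrightarrow>
        value_F M F B p w = value_G M F B p w \<and>
        (\<exists>a x s W.
           (\<forall>t\<ge>0. \<forall>\<omega>\<in>space M.
              a t \<omega> = a_post p (W t \<omega>) \<and> x t \<omega> = x_post p (W t \<omega>) \<and> s t \<omega> = s_post p (W t \<omega>)) \<and>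
           admissible_post M F B p (\<lambda>_. 0) w a x s W \<and>
           post_payoff M p x s = value_G M F B p w \<and>
           admissible M F B p w a x s (\<lambda>_. 0) W \<and>
           payoff M F B p x s (\<lambda>_. 0) W = value_F M F B p w)) \<and>
     (theta p < 0 \<and> w < w_star p \<longrightarrow>
        value_F M F B p w = (INF y\<in>{0<..}. ereal (f_hat p y + y * z_pre p w)) \<and>
        (\<exists>a x s \<tau> W V.
           (\<forall>\<omega>\<in>space M. \<tau> \<omega> = (INF t\<in>{t. 0 \<le> t \<and> W t \<omega> \<ge> w_star p}. ennreal t)) \<and>
           (\<forall>t\<ge>0. \<forall>\<omega>\<in>space M.
              a t \<omega> = (if ennreal t < \<tau> \<omega> then a_pre M F B p (W t \<omega>) else a_post p (V t \<omega>)) \<and>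
              x t \<omega> = (if ennreal t < \<tau> \<omega> then x_pre M F B p (W t \<omega>) else x_post p (V t \<omega>)) \<and>
              s t \<omega> = (if ennreal t < \<tau> \<omega> then s_pre M F B p (W t \<omega>) else s_post p (V t \<omega>))) \<and>
           admissible M F B p w a x s \<tau> W \<and>
           payoff M F B p x s \<tau> W = value_F M F B p w \<and>
           admissible_post M F B p \<tau> (w_star p) a x s V \<and>
           ereal_integral M (discounted_utility p x s (\<lambda>_. 0) (\<lambda>_. \<infinity>)) = value_F M F B p w))"
proof -
 interpret market M F B p using BM params by unfold_locales
 have z: "0 < z_post p w" using w by (simp add: z_post_def theta_def)
 have wp: "z_pre p w = z_post p w - theta p" by (simp add: z_pre_def z_post_def theta_def)
 have neg: "market_neg M F B p" if "theta p < 0" using that by unfold_locales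
 have "value_F M F B p w = value_G M F B p w" if "theta p >= 0 | w >= w_star p"
 using that value_F_nonneg_theta[OF _ z] market_neg.value_F_above[OF neg] by (cases "theta p < 0") auto
 \<comment> \<open>For negative \<open>theta p\<close>, pre-investment total wealth exceeds the
   positive post-investment one.\<close>
 moreover have "0 < z_pre p w" if "theta p < 0" using z that unfolding wp by simp
 ultimately show ?thesis
 using Lambda_neg immediate[OF z] market_neg.value_F_INF[OF neg] market_neg.wait_and_invest[OF neg] by simp
qed

end
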